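(* Let $\Sigma$ be a closed orientable surface, $p,q\in\Sigma$, $\alpha\in(0,1)$, and let $G$ be a conic metric on $\Sigma$ with exactly one cone point $p$, of cone angle $2\pi\alpha$, and $g$ a conic metric on $\Sigma$ with exactly one cone point $q$, of the same cone angle. Let $u:(\Sigma,g)\to(\Sigma,G)$ be in Form 1 with $u^{-1}(p)=q$ and $\tau(u,g,G)=0$ on $\Sigma\setminus\{q\}$. Let $L$ be the linearization of the tension field at $u$, and let $\psi\in\mathcal K:=\ker\big(L|_{r^{1+\epsilon-2\alpha}\mathcal X^{2,\gamma}_b(u)}\big)$, where $\epsilon>0$ is sufficiently small. Let $z$ be a $g$-conformal coordinate centered at $q$. If $2\pi\alpha>\pi$, then near $q$ $$\psi(z)=w+\frac{\overline a}{1-\alpha}|z|^{2(1-\alpha)}+\mathcal O\big(|z|^{2(1-\alpha)+\delta}\big)$$ for some $w,a\in\mathbb C$ and $\delta>0$. If $2\pi\alpha<\pi$, then near $q$ $$\psi(z)=\mu z+\mathcal O\big(|z|^{1+\delta}\big)$$ for some $\mu\in\mathbb C$ and $\delta>0$.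
   Context: Weighted Hölder spaces. $D(\sigma)=\{|z|<\sigma\}\subset\mathbb C$, $z=re^{i\theta}$. $\|f\|_{C^{0,\gamma}_b}=\sup|f|+\sup_{z,z'\neq0}\frac{|f(z)-f(z')|}{|\theta-\theta'|^\gamma+|r-r'|^\gamma/(r+r')^\gamma}$, $\gamma\in(0,1)$; $f\in C^{m,\gamma}_b$ iff $(r\partial_r)^i\partial_\theta^jf\in C^{0,\gamma}_b$ for $i+j\le m$; $f\in r^cC^{m,\gamma}_b$ iff $r^{-c}f\in C^{m,\gamma}_b$. Conic metric with cone point $p$ of angle $2\pi\alpha$: a $C^{2,\gamma}_{loc}$ metric on $\Sigma\setminus\{p\}$ such that in some conformal coordinate centered at $p$ it equals $c\,e^{2\lambda}|z|^{2(\alpha-1)}|dz|^2$, $c>0$, $\lambda\in r^\nu C^{2,\gamma}_b(D(\sigma))$ for some $\sigma>0$; standing assumption: $\nu>2\alpha$. Form 1: $u$ is a homeomorphism of $\Sigma$ homotopic to the identity, $u:\Sigma\setminus\{q\}\to\Sigma\setminus\{p\}$ is a $C^{2,\gamma}_{loc}$ diffeomorphism, and in conformal coordinates centered at $q$ (for $g$) and $p$ (for $G$), $u(z)=\lambda z+v(z)$ with $\lambda\in\mathbb C^*$, $v\in r^{1+\epsilon}C^{2,\gamma}_b$ for some small $\epsilon>0$. Tension field: with $g=\sigma|dz|^2$ and $G=\rho|du|^2$ in conformal coordinates, $\tau(u,g,G)=\frac4\sigma\big(u_{z\bar z}+\frac{\partial\log\rho}{\partial u}u_zu_{\bar z}\big)$,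 a section of $u^*T\Sigma$. $L\psi=\frac{d}{dt}\big|_{t=0}\tau(u_t,g,G)$ for $u_t$ with $u_0=u$, $\frac d{dt}|_{t=0}u_t=\psi$. $r^c\mathcal X^{2,\gamma}_b(u)$: sections $\psi$ of $u^*T(\Sigma\setminus\{p\})$ over $\Sigma\setminus\{q\}$ that are $C^{2,\gamma}_{loc}$ and whose coordinate expression near $q$ lies in $r^cC^{2,\gamma}_b$. Convention for $\psi(z)$: one pulls back the target metric by $u$ so that $u$ becomes the identity; that is, $u^*T\Sigma$ is identified with $T\Sigma$ over $\Sigma\setminus\{q\}$ via $du$, and $\psi(z)\in\mathbb C$ denotes the component of the resulting vector field in the coordinate $z$ (the vector field is $2\,\mathrm{Re}(\psi(z)\partial_z)$). *)

theory Defs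
  imports "HOL-Analysis.Analysis" "HOL-Library.Landau_Symbols"
begin

section \<open>Calculus on plane domains\<close>

definition pd_z :: "(complex \<Rightarrow> complex) \<Rightarrow> complex \<Rightarrow> complex" where
  "pd_z f z = (frechet_derivative f (at z) 1 - \<i> * frechet_derivative f (at z) \<i>) / 2"

definition pd_zbar :: "(complex \<Rightarrow> complex) \<Rightarrow> complex \<Rightarrow> complex" where
  "pd_zbar f z = (frechet_derivative f (at z) 1 + \<i> * frechet_derivative f (at z) \<i>) / 2"

text \<open>\<open>holder_loc k \<gamma> S f\<close>: \<open>f\<close> is of class \<open>C\<^sup>k\<^sup>,\<^sup>\<gamma>\<^sub>l\<^sub>o\<^sub>c\<close> on the open set \<open>S\<close>.\<close>

primrec holder_loc ::
  "nat \<Rightarrow> real \<Rightarrow> complex set \<Rightarrow> (complex \<Rightarrow> 'b::real_normed_vector) \<Rightarrow> bool" where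
  "holder_loc 0 \<gamma> S f \<longleftrightarrow>
     (\<forall>x\<in>S. \<exists>e>0. \<exists>C. \<forall>y\<in>ball x e \<inter> S. \<forall>z\<in>ball x e \<inter> S.
        norm (f y - f z) \<le> C * dist y z powr \<gamma>)"
| "holder_loc (Suc k) \<gamma> S f \<longleftrightarrow>
     (\<forall>z\<in>S. f differentiable (at z)) \<and>
     holder_loc k \<gamma> S (\<lambda>z. frechet_derivative f (at z) 1) \<and>
     holder_loc k \<gamma> S (\<lambda>z. frechet_derivative f (at z) \<i>)"

text \<open>Since \<open>C\<^sup>k\<^sup>+\<^sup>1 \<subseteq> C\<^sup>k\<^sup>,\<^sup>1\<^sub>l\<^sub>o\<^sub>c \<subseteq> C\<^sup>k\<close>, this is the class \<open>C\<^sup>\<infinity>\<close>.\<close>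

definition smooth_on :: "complex set \<Rightarrow> (complex \<Rightarrow> 'b::real_normed_vector) \<Rightarrow> bool" where
  "smooth_on S f \<longleftrightarrow> (\<forall>k. holder_loc k 1 S f)"


section \<open>Weighted Hoelder spaces on the punctured disc\<close>

text \<open>At \<open>z = r e\<^sup>i\<^sup>\<theta>\<close> the vector fields \<open>r \<partial>\<^sub>r\<close> and \<open>\<partial>\<^sub>\<theta>\<close> are \<open>z\<close> and \<open>i z\<close>.\<close>

definition r_dr :: "(complex \<Rightarrow> 'b::real_normed_vector) \<Rightarrow> complex \<Rightarrow> 'b" where
  "r_dr f z = frechet_derivative f (at z) z"

definition d_theta :: "(complex \<Rightarrow> 'b::real_normed_vector) \<Rightarrow> complex \<Rightarrow> 'b" where
  "d_theta f z = frechet_derivative f (at z) (\<i> * z)"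

text \<open>Finiteness of the \<open>C\<^sup>0\<^sup>,\<^sup>\<gamma>\<^sub>b\<close> norm over \<open>D(s)\<close> minus the origin. The angles range over
  all real representatives, so \<open>\<bar>\<theta> - \<theta>'\<bar>\<close> is in effect the distance on the circle, with no
  artificial cut.\<close>

definition Cb0 :: "real \<Rightarrow> real \<Rightarrow> (complex \<Rightarrow> 'b::real_normed_vector) \<Rightarrow> bool" where
  "Cb0 \<gamma> s f \<longleftrightarrow>
     (\<exists>B. \<forall>z\<in>ball 0 s - {0}. norm (f z) \<le> B) \<and>
     (\<exists>C. \<forall>r r' \<theta> \<theta>'. 0 < r \<and> r < s \<and> 0 < r' \<and> r' < s \<longrightarrow>
        norm (f (rcis r \<theta>) - f (rcis r' \<theta>'))
          \<le> C * (\<bar>\<theta> - \<theta>'\<bar> powr \<gamma> + \<bar>r - r'\<bar> powr \<gamma> / (r + r') powr \<gamma>))"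

definition Cb :: "nat \<Rightarrow> real \<Rightarrow> real \<Rightarrow> (complex \<Rightarrow> 'b::real_normed_vector) \<Rightarrow> bool" where
  "Cb m \<gamma> s f \<longleftrightarrow>
     (\<forall>i j. i + j < m \<longrightarrow>
        (\<forall>z\<in>ball 0 s - {0}. ((r_dr ^^ i) ((d_theta ^^ j) f)) differentiable (at z))) \<and>
     (\<forall>i j. i + j \<le> m \<longrightarrow> Cb0 \<gamma> s ((r_dr ^^ i) ((d_theta ^^ j) f)))"

text \<open>\<open>f \<in> r\<^sup>c C\<^sup>m\<^sup>,\<^sup>\<gamma>\<^sub>b(D(s))\<close>.\<close>

definition weighted_Cb ::
  "real \<Rightarrow> nat \<Rightarrow> real \<Rightarrow> real \<Rightarrow> (complex \<Rightarrow> 'b::real_normed_vector) \<Rightarrow> bool" where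
  "weighted_Cb c m \<gamma> s f \<longleftrightarrow> Cb m \<gamma> s (\<lambda>z. (cmod z powr (- c)) *\<^sub>R f z)"


section \<open>Surfaces, tangent vectors, metrics\<close>

text \<open>A surface is the whole of a Hausdorff type together with a smooth atlas; a chart is a
  domain together with a coordinate function.\<close>

type_synonym 'a chart = "'a set \<times> ('a \<Rightarrow> complex)"

definition is_chart :: "('a::topological_space) chart \<Rightarrow> bool" where
  "is_chart c \<longleftrightarrow> open (fst c) \<and> open (snd c ` fst c) \<and>
     homeomorphism (fst c) (snd c ` fst c) (snd c) (inv_into (fst c) (snd c))"

definition point_of :: "'a chart \<Rightarrow> complex \<Rightarrow> 'a" where
  "point_of c = inv_into (fst c) (snd c)"

text \<open>Coordinate expression of a map; meaningful on \<open>snd c ` (fst c \<inter> u -` fst d)\<close>.\<close>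

definition local_rep :: "'a chart \<Rightarrow> ('a \<Rightarrow> 'a) \<Rightarrow> 'a chart \<Rightarrow> complex \<Rightarrow> complex" where
  "local_rep c u d = (\<lambda>\<zeta>. snd d (u (point_of c \<zeta>)))"

abbreviation transition :: "'a chart \<Rightarrow> 'a chart \<Rightarrow> complex \<Rightarrow> complex" where
  "transition c d \<equiv> local_rep c (\<lambda>x. x) d"

definition smooth_atlas :: "('a::topological_space) chart set \<Rightarrow> bool" where
  "smooth_atlas A \<longleftrightarrow>
     (\<forall>c\<in>A. is_chart c) \<and> (\<Union>c\<in>A. fst c) = UNIV \<and>
     (\<forall>c\<in>A. \<forall>d\<in>A. smooth_on (snd c ` (fst c \<inter> fst d)) (transition c d))"

definition closed_surface :: "('a::t2_space) chart set \<Rightarrow> bool" where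
  "closed_surface A \<longleftrightarrow>
     smooth_atlas A \<and> compact (UNIV :: 'a set) \<and> connected (UNIV :: 'a set)"

text \<open>The Jacobian determinant of a plane map \<open>f\<close> is \<open>\<bar>f\<^sub>z\<bar>\<^sup>2 - \<bar>f\<^sub>z\<^sub>b\<^sub>a\<^sub>r\<bar>\<^sup>2\<close>.\<close>

definition orientable :: "('a::topological_space) chart set \<Rightarrow> bool" where
  "orientable A \<longleftrightarrow>
     (\<exists>B. smooth_atlas B \<and> smooth_atlas (A \<union> B) \<and>
        (\<forall>c\<in>B. \<forall>d\<in>B. \<forall>\<zeta>\<in>snd c ` (fst c \<inter> fst d).
           (cmod (pd_z (transition c d) \<zeta>))\<^sup>2 - (cmod (pd_zbar (transition c d) \<zeta>))\<^sup>2 > 0))"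

text \<open>Tangent vectors in the classical sense: a vector at \<open>x\<close> assigns to each chart around
  \<open>x\<close> its component in that chart, subject to the transformation law. All charts that are
  differentiably compatible with the atlas at \<open>x\<close> take part, because the conformal charts of
  a \<open>C\<^sup>2\<^sup>,\<^sup>\<gamma>\<^sub>l\<^sub>o\<^sub>c\<close> metric are in general not smoothly compatible with the atlas.\<close>

type_synonym 'a tvec = "'a chart \<Rightarrow> complex"

definition charts_at :: "('a::topological_space) chart set \<Rightarrow> 'a \<Rightarrow> 'a chart set" where
  "charts_at A x = {c. is_chart c \<and> x \<in> fst c \<and>
     (\<forall>a\<in>A. x \<in> fst a \<longrightarrow>
        transition a c differentiable (at (snd a x)) \<and>
        transition c a differentiable (at (snd c x)))}"

definition tangent_space :: "('a::topological_space) chart set \<Rightarrow> 'a \<Rightarrow> 'a tvec set" where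
  "tangent_space A x = {X.
     (\<forall>c\<in>charts_at A x. \<forall>d\<in>charts_at A x.
        X d = frechet_derivative (transition c d) (at (snd c x)) (X c)) \<and>
     (\<forall>c. c \<notin> charts_at A x \<longrightarrow> X c = 0)}"

text \<open>The tangent vector at \<open>x\<close> whose component in the chart \<open>c\<close> is \<open>v\<close>.\<close>

definition tangent_vec ::
  "('a::topological_space) chart set \<Rightarrow> 'a chart \<Rightarrow> 'a \<Rightarrow> complex \<Rightarrow> 'a tvec" where
  "tangent_vec A c x v = (\<lambda>d. if d \<in> charts_at A x
     then frechet_derivative (transition c d) (at (snd c x)) v else 0)"

text \<open>The differential \<open>du\<close> at \<open>x\<close>; its value does not depend on the chart chosen at \<open>x\<close>.\<close>

definition differential ::
  "('a::topological_space) chart set \<Rightarrow> ('a \<Rightarrow> 'a) \<Rightarrow> 'a \<Rightarrow> 'a tvec \<Rightarrow> 'a tvec" where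
  "differential A u x X = (\<lambda>d. if d \<in> charts_at A (u x)
     then (let c = (SOME c. c \<in> A \<and> x \<in> fst c)
           in frechet_derivative (local_rep c u d) (at (snd c x)) (X c))
     else 0)"

type_synonym 'a metric_tensor = "'a \<Rightarrow> 'a tvec \<Rightarrow> 'a tvec \<Rightarrow> real"

text \<open>A \<open>C\<^sup>2\<^sup>,\<^sup>\<gamma>\<^sub>l\<^sub>o\<^sub>c\<close> Riemannian metric on the complement of the point \<open>p\<close>.\<close>

definition metric_off ::
  "real \<Rightarrow> ('a::topological_space) chart set \<Rightarrow> 'a \<Rightarrow> 'a metric_tensor \<Rightarrow> bool" where
  "metric_off \<gamma> A p g \<longleftrightarrow> (\<forall>c\<in>A.
     (\<forall>x\<in>fst c - {p}.
        bilinear (\<lambda>v w. g x (tangent_vec A c x v) (tangent_vec A c x w)) \<and>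
        (\<forall>v w. g x (tangent_vec A c x v) (tangent_vec A c x w)
             = g x (tangent_vec A c x w) (tangent_vec A c x v)) \<and>
        (\<forall>v. v \<noteq> 0 \<longrightarrow> g x (tangent_vec A c x v) (tangent_vec A c x v) > 0)) \<and>
     (\<forall>v w. holder_loc 2 \<gamma> (snd c ` (fst c - {p}))
        (\<lambda>\<zeta>. let x = point_of c \<zeta> in g x (tangent_vec A c x v) (tangent_vec A c x w))))"

text \<open>\<open>g = \<rho> \<bar>dz\<bar>\<^sup>2\<close> on the domain of the chart \<open>c = (W, z)\<close>, apart from \<open>p\<close>. The coordinate is
  of class \<open>C\<^sup>3\<^sup>,\<^sup>\<gamma>\<^sub>l\<^sub>o\<^sub>c\<close> away from \<open>p\<close>, which is the regularity isothermal coordinates of a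
  \<open>C\<^sup>2\<^sup>,\<^sup>\<gamma>\<^sub>l\<^sub>o\<^sub>c\<close> metric have automatically. At \<open>p\<close> itself it is only required to be a
  topological coordinate, as the conformal structure of a conic metric need not be induced by
  a chart of the smooth atlas there. Both orientations of the coordinate are allowed.\<close>

definition conformal_chart ::
  "real \<Rightarrow> ('a::topological_space) chart set \<Rightarrow> 'a metric_tensor \<Rightarrow> 'a \<Rightarrow>
     'a chart \<Rightarrow> (complex \<Rightarrow> real) \<Rightarrow> bool" where
  "conformal_chart \<gamma> A g p c \<rho> \<longleftrightarrow>
     is_chart c \<and>
     (\<forall>a\<in>A. holder_loc 3 \<gamma> (snd a ` (fst a \<inter> fst c - {p})) (transition a c) \<and>
             holder_loc 3 \<gamma> (snd c ` (fst a \<inter> fst c - {p})) (transition c a)) \<and>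
     (\<forall>x\<in>fst c - {p}. \<forall>X\<in>tangent_space A x. \<forall>Y\<in>tangent_space A x.
        g x X Y = \<rho> (snd c x) * (X c \<bullet> Y c))"

definition centered_at :: "'a chart \<Rightarrow> 'a \<Rightarrow> bool" where
  "centered_at c p \<longleftrightarrow> p \<in> fst c \<and> snd c p = 0"

text \<open>Conic metric with the single cone point \<open>p\<close>, of cone angle \<open>2 \<pi> \<alpha>\<close>.\<close>

definition conic_metric ::
  "real \<Rightarrow> real \<Rightarrow> real \<Rightarrow> ('a::topological_space) chart set \<Rightarrow>
     'a metric_tensor \<Rightarrow> 'a \<Rightarrow> bool" where
  "conic_metric \<alpha> \<nu> \<gamma> A g p \<longleftrightarrow>
     metric_off \<gamma> A p g \<and>
     (\<exists>c \<rho> s k lam. conformal_chart \<gamma> A g p c \<rho> \<and> centered_at c p \<and>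
        0 < s \<and> ball 0 s \<subseteq> snd c ` fst c \<and> 0 < k \<and>
        weighted_Cb \<nu> 2 \<gamma> s (lam :: complex \<Rightarrow> real) \<and>
        (\<forall>\<zeta>\<in>ball 0 s - {0}. \<rho> \<zeta> = k * exp (2 * lam \<zeta>) * cmod \<zeta> powr (2 * (\<alpha> - 1))))"


section \<open>Maps, the tension field and its linearization\<close>

definition holder_map_off ::
  "real \<Rightarrow> ('a::topological_space) chart set \<Rightarrow> 'a \<Rightarrow> ('a \<Rightarrow> 'a) \<Rightarrow> bool" where
  "holder_map_off \<gamma> A q u \<longleftrightarrow> (\<forall>c\<in>A. \<forall>d\<in>A.
     holder_loc 2 \<gamma> (snd c ` (fst c \<inter> u -` fst d - {q})) (local_rep c u d))"

text \<open>The map \<open>u : (\<Sigma>, g) \<rightarrow> (\<Sigma>, G)\<close> is in Form 1, where \<open>q\<close> and \<open>p\<close> are the cone points of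
  \<open>g\<close> and \<open>G\<close>. The local condition is preserved, for small \<open>\<epsilon>\<close>, by holomorphic changes of
  coordinates, and by conjugating both coordinates.\<close>

definition form1 ::
  "real \<Rightarrow> ('a::topological_space) chart set \<Rightarrow> 'a metric_tensor \<Rightarrow> 'a \<Rightarrow>
     'a metric_tensor \<Rightarrow> 'a \<Rightarrow> ('a \<Rightarrow> 'a) \<Rightarrow> bool" where
  "form1 \<gamma> A g q G p u \<longleftrightarrow>
     homeomorphism UNIV UNIV u (inv u) \<and>
     homotopic_with_canon (\<lambda>_. True) UNIV UNIV u id \<and>
     bij_betw u (UNIV - {q}) (UNIV - {p}) \<and>
     holder_map_off \<gamma> A q u \<and> holder_map_off \<gamma> A p (inv u) \<and>
     (\<exists>c \<sigma> d \<rho> s l \<epsilon>.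
        conformal_chart \<gamma> A g q c \<sigma> \<and> centered_at c q \<and>
        conformal_chart \<gamma> A G p d \<rho> \<and> centered_at d p \<and>
        0 < s \<and> ball 0 s \<subseteq> snd c ` (fst c \<inter> u -` fst d) \<and> l \<noteq> 0 \<and> 0 < \<epsilon> \<and>
        weighted_Cb (1 + \<epsilon>) 2 \<gamma> s (\<lambda>\<zeta>. local_rep c u d \<zeta> - l * \<zeta>))"

text \<open>Tension field of \<open>U\<close> for \<open>g = \<sigma> \<bar>dz\<bar>\<^sup>2\<close>, \<open>G = \<rho> \<bar>du\<bar>\<^sup>2\<close>, in conformal coordinates.\<close>

definition tension ::
  "(complex \<Rightarrow> real) \<Rightarrow> (complex \<Rightarrow> real) \<Rightarrow> (complex \<Rightarrow> complex) \<Rightarrow> complex \<Rightarrow> complex" where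
  "tension \<sigma> \<rho> U \<zeta> = of_real (4 / \<sigma> \<zeta>) *
     (pd_z (pd_zbar U) \<zeta>
      + pd_z (\<lambda>w. of_real (ln (\<rho> w))) (U \<zeta>) * pd_z U \<zeta> * pd_zbar U \<zeta>)"

text \<open>Its linearization at \<open>U\<close>: the derivative at \<open>t = 0\<close> along the variation
  \<open>U\<^sub>t = U + t \<Psi>\<close>, whose initial velocity is \<open>\<Psi>\<close>. By the chain rule any other variation with
  this initial velocity gives the same value. On a surface this is applied in conformal
  coordinates; the variation is then only local, which suffices as the tension field is a
  differential operator.\<close>

definition lin_tension ::
  "(complex \<Rightarrow> real) \<Rightarrow> (complex \<Rightarrow> real) \<Rightarrow> (complex \<Rightarrow> complex) \<Rightarrow>
     (complex \<Rightarrow> complex) \<Rightarrow> complex \<Rightarrow> complex" where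
  "lin_tension \<sigma> \<rho> U \<Psi> \<zeta> =
     vector_derivative (\<lambda>t. tension \<sigma> \<rho> (\<lambda>\<xi>. U \<xi> + of_real t * \<Psi> \<xi>) \<zeta>) (at 0)"

text \<open>\<open>\<tau>(u, g, G) = 0\<close> on the complement of \<open>q\<close>.\<close>

definition tension_zero_off ::
  "real \<Rightarrow> ('a::topological_space) chart set \<Rightarrow> 'a metric_tensor \<Rightarrow> 'a \<Rightarrow>
     'a metric_tensor \<Rightarrow> 'a \<Rightarrow> ('a \<Rightarrow> 'a) \<Rightarrow> bool" where
  "tension_zero_off \<gamma> A g q G p u \<longleftrightarrow>
     (\<forall>c \<sigma> d \<rho>. conformal_chart \<gamma> A g q c \<sigma> \<and> conformal_chart \<gamma> A G p d \<rho> \<longrightarrow>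
        (\<forall>x\<in>fst c \<inter> u -` fst d - {q}. tension \<sigma> \<rho> (local_rep c u d) (snd c x) = 0))"

text \<open>The component, in the target chart \<open>d\<close>, of a section of \<open>u\<^sup>*T\<Sigma>\<close>, as a function of the
  coordinate \<open>c\<close> on the source.\<close>

definition section_rep :: "'a chart \<Rightarrow> ('a \<Rightarrow> 'a tvec) \<Rightarrow> 'a chart \<Rightarrow> complex \<Rightarrow> complex" where
  "section_rep c \<psi> d = (\<lambda>\<zeta>. \<psi> (point_of c \<zeta>) d)"

text \<open>The space \<open>r\<^sup>b X\<^sup>2\<^sup>,\<^sup>\<gamma>\<^sub>b(u)\<close>.\<close>

definition weighted_sections ::
  "real \<Rightarrow> real \<Rightarrow> ('a::topological_space) chart set \<Rightarrow> 'a metric_tensor \<Rightarrow> 'a \<Rightarrow>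
     'a metric_tensor \<Rightarrow> 'a \<Rightarrow> ('a \<Rightarrow> 'a) \<Rightarrow> ('a \<Rightarrow> 'a tvec) set" where
  "weighted_sections b \<gamma> A g q G p u = {\<psi>.
     (\<forall>x. x \<noteq> q \<longrightarrow> \<psi> x \<in> tangent_space A (u x)) \<and>
     (\<forall>c\<in>A. \<forall>d\<in>A.
        holder_loc 2 \<gamma> (snd c ` (fst c \<inter> u -` fst d - {q})) (section_rep c \<psi> d)) \<and>
     (\<exists>c \<sigma> d \<rho> s.
        conformal_chart \<gamma> A g q c \<sigma> \<and> centered_at c q \<and>
        conformal_chart \<gamma> A G p d \<rho> \<and> centered_at d p \<and>
        0 < s \<and> ball 0 s \<subseteq> snd c ` (fst c \<inter> u -` fst d) \<and>
        weighted_Cb b 2 \<gamma> s (section_rep c \<psi> d))}"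

text \<open>The kernel of the linearization \<open>L\<close> at \<open>u\<close> on \<open>r\<^sup>b X\<^sup>2\<^sup>,\<^sup>\<gamma>\<^sub>b(u)\<close>.\<close>

definition kernel_L ::
  "real \<Rightarrow> real \<Rightarrow> ('a::topological_space) chart set \<Rightarrow> 'a metric_tensor \<Rightarrow> 'a \<Rightarrow>
     'a metric_tensor \<Rightarrow> 'a \<Rightarrow> ('a \<Rightarrow> 'a) \<Rightarrow> ('a \<Rightarrow> 'a tvec) set" where
  "kernel_L b \<gamma> A g q G p u = {\<psi> \<in> weighted_sections b \<gamma> A g q G p u.
     \<forall>c \<sigma> d \<rho>. conformal_chart \<gamma> A g q c \<sigma> \<and> conformal_chart \<gamma> A G p d \<rho> \<longrightarrow>
       (\<forall>x\<in>fst c \<inter> u -` fst d - {q}.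
          lin_tension \<sigma> \<rho> (local_rep c u d) (section_rep c \<psi> d) (snd c x) = 0)}"

text \<open>The vector field on the source that \<open>du\<close> carries to the section \<open>\<psi>\<close> of \<open>u\<^sup>*T\<Sigma>\<close>; in
  other words \<open>\<psi>\<close> after pulling the target back by \<open>u\<close>, so that \<open>u\<close> becomes the identity.\<close>

definition pullback_field ::
  "('a::topological_space) chart set \<Rightarrow> ('a \<Rightarrow> 'a) \<Rightarrow> ('a \<Rightarrow> 'a tvec) \<Rightarrow> 'a \<Rightarrow> 'a tvec" where
  "pullback_field A u \<psi> x = the_inv_into (tangent_space A x) (differential A u x) (\<psi> x)"

end

theory Submission
  imports Defs "HOL-Complex_Analysis.Complex_Analysis"
begin

text \<open>In conformal coordinates \<open>U\<close> has a holomorphic Hopf differential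
  \<open>\<Phi> = \<rho>(U) U\<^sub>z cnj(U\<^sub>z\<^sub>')\<close> (with \<open>'\<close> for the conjugate variable), and its linearization \<open>H\<close>
  along the Jacobi field \<open>P\<close> is holomorphic too. The weights bound both near \<open>q\<close>, so \<open>\<Phi>\<close> and \<open>H\<close>
  have at most a simple pole. For the pulled back field \<open>X\<close> put
  \<open>Y = X + \<kappa> cnj X\<close>, \<open>\<kappa> = 2 cnj \<Phi> / (\<rho>(U) S)\<close>, \<open>S = |U\<^sub>z|\<^sup>2 + |U\<^sub>z\<^sub>'|\<^sup>2\<close>. Then
  \<open>Y\<^sub>z\<^sub>' = cnj H / (\<rho>(U) S) + b cnj X\<close>: the right hand side contains no derivative of \<open>X\<close>.
  As \<open>1/\<rho>(U)\<close> is a multiple of \<open>r\<^sup>2\<^sup>-\<^sup>2\<^sup>\<alpha>\<close> to leading order, bootstrapping the Pompeiu formula expands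
  \<open>Y\<close>, and then \<open>X\<close>, beyond the order \<open>2 - 2\<alpha>\<close> or \<open>1\<close>; the term \<open>r\<^sup>2\<^sup>-\<^sup>2\<^sup>\<alpha>\<close> comes from the residue
  of \<open>H\<close>. Two conformal coordinates centered at \<open>q\<close> differ by a holomorphic or antiholomorphic
  germ, under which the expansion keeps its form.\<close>

text \<open>A Jacobi field solves a second order system whose coefficients are singular at
  \<open>q\<close>. The two holomorphic objects replace it by first order equations, for which the
  Cauchy kernel gives sharp orders. For a non-conformal map the linearized Hopf differential still
  contains both first derivatives of the field. In cnj H they occur only as cnj(U_z) P_z' + U_z'
  cnj(P_z), which is, up to terms without derivatives of P, the conjugate derivative of cnj(U_z) P +
  U_z' cnj(P) = S Y. This is the origin of Y. Exponents: put g = 2 - 2\<alpha>. The conjugate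
  derivative of |z|^g is (1 - \<alpha>) |z|^g / cnj z, so a simple pole of H, conjugated and divided
  by \<rho>(U), integrates to a multiple of |z|^g / (1 - \<alpha>); hence the form of the
  coefficient in the statement. The two cases are g < 1 and g > 1, that is, whether |z|^g comes
  before or after the linear term. For g > 1 the weight 1 + \<epsilon> - 2\<alpha> is positive, so
  the field tends to 0 and no constant term can occur.\<close>

section \<open>Wirtinger derivatives\<close>

text \<open>The predicate carries real differentiability together with the values of both
  derivatives. \<open>pd_z\<close> and \<open>pd_zbar\<close> are built from a Frechet derivative
  that is arbitrary where none exists, so they are only read off once such a fact is
  available.\<close>

definition has_wd :: "(complex \<Rightarrow> complex) \<Rightarrow> complex \<Rightarrow> complex \<Rightarrow> complex \<Rightarrow> bool" where
  "has_wd f a b z \<longleftrightarrow> (f has_derivative (\<lambda>h. a * h + b * cnj h)) (at z)"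

lemma has_wd_frechet: "has_wd f a b z \<Longrightarrow> frechet_derivative f (at z) = (\<lambda>h. a * h + b * cnj h)"
  unfolding has_wd_def by (metis frechet_derivative_at)

lemma has_wd_differentiable: "has_wd f a b z \<Longrightarrow> f differentiable (at z)"
  unfolding has_wd_def differentiable_def by blast

lemma has_wd_pd_z: "has_wd f a b z \<Longrightarrow> pd_z f z = a"
  and has_wd_pd_zbar: "has_wd f a b z \<Longrightarrow> pd_zbar f z = b"
  by (simp_all add: pd_z_def pd_zbar_def has_wd_frechet algebra_simps)

lemma has_wd_unique:
  assumes "has_wd f a b z" "has_wd f a' b' z"
  shows "a = a' \<and> b = b'"
  using has_wd_pd_z[OF assms(1)] has_wd_pd_z[OF assms(2)] has_wd_pd_zbar[OF assms(1)]
    has_wd_pd_zbar[OF assms(2)] by simp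

lemma real_linear_complex:
  assumes "linear (L :: complex \<Rightarrow> 'b::real_normed_vector)"
  shows "L h = Re h *\<^sub>R L 1 + Im h *\<^sub>R L \<i>"
proof -
  have "h = Re h *\<^sub>R 1 + Im h *\<^sub>R \<i>" by (simp add: complex_eq_iff)
  then have "L h = L (Re h *\<^sub>R 1 + Im h *\<^sub>R \<i>)" by simp
  then show ?thesis by (simp add: linear_add[OF assms] linear_scale[OF assms])
qed

lemma frechet_pd:
  assumes "f differentiable (at z)"
  shows "frechet_derivative f (at z) h = pd_z f z * h + pd_zbar f z * cnj h"
proof -
  let ?L = "frechet_derivative f (at z)"
  have "linear ?L" using assms frechet_derivative_works linear_frechet_derivative by blast
  from real_linear_complex[OF this, of h] show ?thesis
    unfolding pd_z_def pd_zbar_def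
    by (simp add: complex_eq_iff scaleR_conv_of_real field_simps)
qed

lemma differentiable_has_wd:
  assumes "f differentiable (at z)"
  shows "has_wd f (pd_z f z) (pd_zbar f z) z"
proof -
  have "(f has_derivative frechet_derivative f (at z)) (at z)"
    using assms frechet_derivative_works by blast
  moreover have "frechet_derivative f (at z) = (\<lambda>h. pd_z f z * h + pd_zbar f z * cnj h)"
    using frechet_pd[OF assms] by blast
  ultimately show ?thesis unfolding has_wd_def by simp
qed

lemma has_wd_isCont: "has_wd f a b z \<Longrightarrow> isCont f z"
  unfolding has_wd_def by (rule has_derivative_continuous)

lemma has_wd_eqI: "has_wd f a b z \<Longrightarrow> a = a' \<Longrightarrow> b = b' \<Longrightarrow> has_wd f a' b' z"
  by simp

lemma has_wd_transform:
  assumes "has_wd f a b z" "\<forall>\<^sub>F x in nhds z. f x = g x"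
  shows "has_wd g a b z"
proof -
  have "f z = g z" using assms(2) by (rule eventually_nhds_x_imp_x)
  moreover have "\<forall>\<^sub>F x in at z. f x = g x" using assms(2) by (simp add: eventually_at_filter eventually_mono)
  ultimately show ?thesis using assms(1) unfolding has_wd_def
    by (metis (mono_tags, lifting) has_derivative_transform_eventually UNIV_I)
qed

lemma has_wd_const: "has_wd (\<lambda>_. c) 0 0 z"
  unfolding has_wd_def by simp

lemma has_wd_ident: "has_wd (\<lambda>z. z) 1 0 z"
  unfolding has_wd_def by simp

lemma has_wd_cnj: "has_wd f a b z \<Longrightarrow> has_wd (\<lambda>z. cnj (f z)) (cnj b) (cnj a) z"
  unfolding has_wd_def by (drule has_derivative_cnj) (simp add: add.commute mult.commute)

lemma has_wd_add: "has_wd f a b z \<Longrightarrow> has_wd g a' b' z \<Longrightarrow> has_wd (\<lambda>z. f z + g z) (a + a') (b + b') z"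
  unfolding has_wd_def by (drule (1) has_derivative_add) (simp add: algebra_simps)

lemma has_wd_diff: "has_wd f a b z \<Longrightarrow> has_wd g a' b' z \<Longrightarrow> has_wd (\<lambda>z. f z - g z) (a - a') (b - b') z"
  unfolding has_wd_def by (drule (1) has_derivative_diff) (simp add: algebra_simps)

lemma has_wd_mult: "has_wd f a b z \<Longrightarrow> has_wd g a' b' z \<Longrightarrow>
    has_wd (\<lambda>z. f z * g z) (a * g z + f z * a') (b * g z + f z * b') z"
  unfolding has_wd_def by (drule (1) has_derivative_mult) (simp add: algebra_simps)

lemma has_wd_compose:
  assumes "has_wd f a b (g z)" "has_wd g a' b' z"
  shows "has_wd (\<lambda>z. f (g z)) (a * a' + b * cnj b') (a * b' + b * cnj a') z"
  using has_derivative_compose[OF assms(2)[unfolded has_wd_def] assms(1)[unfolded has_wd_def]]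
  unfolding has_wd_def by (simp add: algebra_simps)

lemma has_wd_field:
  "(f has_field_derivative d) (at z) \<longleftrightarrow> has_wd f d 0 z"
  unfolding has_wd_def has_field_derivative_def by simp

lemma has_wd_holo_compose:
  assumes "(h has_field_derivative d) (at (f z))" "has_wd f a b z"
  shows "has_wd (\<lambda>z. h (f z)) (d * a) (d * b) z"
  using has_wd_compose[OF assms(1)[unfolded has_wd_field] assms(2)] by simp

lemma has_wd_inverse:
  assumes "has_wd f a b z" "f z \<noteq> 0"
  shows "has_wd (\<lambda>z. inverse (f z)) (- a / (f z)^2) (- b / (f z)^2) z"
  using has_wd_holo_compose[OF DERIV_inverse[OF assms(2)] assms(1)]
  by (rule has_wd_eqI) (auto simp: divide_simps power2_eq_square)

lemma has_wd_divide:
  assumes "has_wd f a b z" "has_wd g a' b' z" "g z \<noteq> 0"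
  shows "has_wd (\<lambda>z. f z / g z) ((a * g z - f z * a') / (g z)^2) ((b * g z - f z * b') / (g z)^2) z"
proof -
  have "has_wd (\<lambda>z. f z * inverse (g z)) (a * inverse (g z) + f z * (- a' / (g z)^2))
       (b * inverse (g z) + f z * (- b' / (g z)^2)) z"
    by (intro has_wd_mult has_wd_inverse assms)
  then show ?thesis
    unfolding divide_inverse[symmetric]
    by (rule has_wd_eqI) (use assms(3) in \<open>auto simp: divide_simps power2_eq_square\<close>)
qed

lemma has_wd_exp: "has_wd f a b z \<Longrightarrow> has_wd (\<lambda>z. exp (f z)) (exp (f z) * a) (exp (f z) * b) z"
  by (rule has_wd_holo_compose) (auto intro: DERIV_exp)

lemma has_wd_real_valued:
  assumes "has_wd f a b z" "\<forall>\<^sub>F x in nhds z. cnj (f x) = f x"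
  shows "b = cnj a"
proof -
  have "has_wd f (cnj b) (cnj a) z"
    by (rule has_wd_transform[OF has_wd_cnj[OF assms(1)] assms(2)])
  then show ?thesis using has_wd_unique assms(1) by blast
qed

section \<open>Integrals of d-bar derivatives of compactly supported functions\<close>

lemma has_wd_quotient_LIMSEQ:
  assumes "has_wd f a b z" "h \<noteq> 0"
  shows "(\<lambda>n. of_nat (Suc n) * (f (h / of_nat (Suc n) + z) - f z)) \<longlonglongrightarrow> a * h + b * cnj h"
proof -
  let ?D = "\<lambda>h. a * h + b * cnj h"
  let ?y = "\<lambda>n. h / of_nat (Suc n) + z"
  have lim: "((\<lambda>y. norm ((f y - f z) - ?D (y - z)) / norm (y - z)) \<longlongrightarrow> 0) (at z)"
    using assms(1) unfolding has_wd_def has_derivative_iff_norm by blast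
  have "(\<lambda>n. h * inverse (of_nat (Suc n)) + z) \<longlonglongrightarrow> h * 0 + z"
    by (intro tendsto_intros) (use LIMSEQ_Suc[OF lim_inverse_n] in auto)
  then have 1: "?y \<longlonglongrightarrow> z" by (simp add: divide_inverse)
  have "filterlim ?y (at z) sequentially"
    using 1 assms(2) by (auto simp: filterlim_at simp del: of_nat_Suc)
  from filterlim_compose[OF lim this]
  have 2: "(\<lambda>n. norm ((f (?y n) - f z) - ?D (?y n - z)) / norm (?y n - z)) \<longlonglongrightarrow> 0" .
  have "norm (of_nat (Suc n) * (f (?y n) - f z) - ?D h) =
      norm h * (norm ((f (?y n) - f z) - ?D (?y n - z)) / norm (?y n - z))" for n
  proof -
    have e: "of_nat (Suc n) * (f (?y n) - f z) - ?D h = of_nat (Suc n) * ((f (?y n) - f z) - ?D (?y n - z))"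
      by (simp add: field_simps del: of_nat_Suc)
    show ?thesis unfolding e using assms(2) by (simp add: norm_mult norm_divide del: of_nat_Suc)
  qed
  moreover have "(\<lambda>n. norm h * (norm ((f (?y n) - f z) - ?D (?y n - z)) / norm (?y n - z))) \<longlonglongrightarrow> norm h * 0"
    by (intro tendsto_intros 2)
  ultimately have "(\<lambda>n. norm (of_nat (Suc n) * (f (?y n) - f z) - ?D h)) \<longlonglongrightarrow> 0" by simp
  then show ?thesis using LIM_zero_cancel tendsto_norm_zero_iff by blast
qed

text \<open>The derivatives are not assumed continuous. They are measurable as pointwise limits of
  difference quotients of a continuous function, taken along the two independent directions 1 and
  i.\<close>

lemma has_wd_measurable:
  assumes "\<And>z. has_wd f (a z) (b z) z"
  shows "a \<in> borel_measurable borel" "b \<in> borel_measurable borel"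
proof -
  have c: "continuous_on UNIV f"
    using has_wd_isCont[OF assms] by (simp add: continuous_on_eq_continuous_at)
  have m: "(\<lambda>z. a z * h + b z * cnj h) \<in> borel_measurable borel" if "h \<noteq> 0" for h
  proof (rule borel_measurable_LIMSEQ_metric)
    show "(\<lambda>z. of_nat (Suc i) * (f (h / of_nat (Suc i) + z) - f z)) \<in> borel_measurable borel" for i
      by (intro borel_measurable_continuous_onI continuous_intros continuous_on_compose2[OF c]) auto
    show "(\<lambda>i. of_nat (Suc i) * (f (h / of_nat (Suc i) + z) - f z)) \<longlonglongrightarrow> a z * h + b z * cnj h" for z
      by (rule has_wd_quotient_LIMSEQ[OF assms that])
  qed
  have 1: "(\<lambda>z. a z + b z) \<in> borel_measurable borel" using m[of 1] by simp
  have 2: "(\<lambda>z. a z * \<i> + b z * (- \<i>)) \<in> borel_measurable borel" using m[of \<i>] by simp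
  have "(\<lambda>z. ((a z + b z) - \<i> * (a z * \<i> + b z * (- \<i>))) / 2) \<in> borel_measurable borel"
    using 1 2 by measurable
  then show "a \<in> borel_measurable borel" by (simp add: algebra_simps)
  have "(\<lambda>z. ((a z + b z) + \<i> * (a z * \<i> + b z * (- \<i>))) / 2) \<in> borel_measurable borel"
    using 1 2 by measurable
  then show "b \<in> borel_measurable borel" by (simp add: algebra_simps)
qed

lemma integrable_bounded_support:
  fixes f :: "complex \<Rightarrow> complex"
  assumes "f \<in> borel_measurable borel" "\<And>z. cmod (f z) \<le> L" "\<And>z. R < cmod z \<Longrightarrow> f z = 0"
  shows "integrable lborel f"
proof -
  have "integrable lborel (\<lambda>z. indicator (cball 0 R) z *\<^sub>R complex_of_real L)"
    by (intro borel_integrable_compact) auto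
  then show ?thesis
    by (rule Bochner_Integration.integrable_bound)
      (use assms in \<open>auto simp: indicator_def not_le intro!: AE_I2 order_trans[OF assms(2) abs_ge_self]\<close>)
qed

lemma integral_translate:
  fixes f :: "complex \<Rightarrow> complex"
  assumes "f \<in> borel_measurable borel"
  shows "integral\<^sup>L lborel (\<lambda>z. f (c + z)) = integral\<^sup>L lborel f"
proof -
  have "integral\<^sup>L lborel f = integral\<^sup>L (distr lborel borel ((+) c)) f" by (simp add: lborel_distr_plus)
  also have "\<dots> = integral\<^sup>L lborel (\<lambda>z. f (c + z))" using assms by (subst integral_distr) auto
  finally show ?thesis by simp
qed

lemma has_wd_Lipschitz:
  assumes "\<And>z. has_wd g (gz z) (gb z) z" "\<And>z. cmod (gz z) \<le> L" "\<And>z. cmod (gb z) \<le> L"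
  shows "cmod (g x - g y) \<le> 2 * L * cmod (x - y)"
proof (rule differentiable_bound[OF convex_UNIV])
  show "(g has_derivative (\<lambda>h. gz z * h + gb z * cnj h)) (at z within UNIV)" for z
    using assms(1)[of z] by (simp add: has_wd_def)
  show "onorm (\<lambda>h. gz z * h + gb z * cnj h) \<le> 2 * L" for z
  proof (rule onorm_le)
    fix h
    have "cmod (gz z * h + gb z * cnj h) \<le> cmod (gz z) * cmod h + cmod (gb z) * cmod h"
      by (metis complex_mod_cnj norm_mult norm_triangle_ineq)
    also have "\<dots> \<le> L * cmod h + L * cmod h"
      by (intro add_mono mult_right_mono assms) auto
    finally show "cmod (gz z * h + gb z * cnj h) \<le> 2 * L * cmod h" by simp
  qed
qed auto

text \<open>By translation invariance every difference quotient of \<open>g\<close> has integral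
  zero, and on a fixed disc the quotients are dominated by a Lipschitz constant. The limits along 1
  and i give two linear relations that force both integrals to vanish. This is Stokes' formula for
  derivatives that are merely bounded.\<close>

lemma integral_dbar_zero:
  assumes d: "\<And>z. has_wd g (gz z) (gb z) z" and L: "\<And>z. cmod (gz z) \<le> L" "\<And>z. cmod (gb z) \<le> L"
    and R: "\<And>z. R < cmod z \<Longrightarrow> g z = 0"
  shows "integral\<^sup>L lborel gb = 0"
proof -
  have gzero: "gz z = 0 \<and> gb z = 0" if "R < cmod z" for z
  proof -
    have "open {z. R < cmod z}" by (intro open_Collect_less continuous_intros)
    then have "\<forall>\<^sub>F x in nhds z. R < cmod x" using that eventually_nhds_in_open[of "{z. R < cmod z}" z] by simp
    then have "\<forall>\<^sub>F x in nhds z. g x = 0" by eventually_elim (use R in auto)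
    then have "has_wd (\<lambda>_. 0) (gz z) (gb z) z" by (rule has_wd_transform[OF d])
    then show ?thesis using has_wd_unique[OF _ has_wd_const] by blast
  qed
  have meas: "gz \<in> borel_measurable borel" "gb \<in> borel_measurable borel"
    using has_wd_measurable[OF d] by auto
  have int: "integrable lborel gz" "integrable lborel gb"
    using integrable_bounded_support[OF meas(1) L(1), of R] gzero
      integrable_bounded_support[OF meas(2) L(2), of R] by auto
  have cont: "continuous_on UNIV g"
    using has_wd_isCont[OF d] by (simp add: continuous_on_eq_continuous_at)
  have gm: "g \<in> borel_measurable borel" by (rule borel_measurable_continuous_onI[OF cont])
  have "integrable lborel (\<lambda>z. indicator (cball 0 R) z *\<^sub>R g z)"
    by (rule borel_integrable_compact) (use cont continuous_on_subset in auto)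
  moreover have "(\<lambda>z. indicator (cball 0 R) z *\<^sub>R g z) = g"
    using R by (auto simp: indicator_def fun_eq_iff not_le)
  ultimately have gi: "integrable lborel g" by simp
  have gti: "integrable lborel (\<lambda>z. g (c + z))" for c
  proof -
    have "integrable (distr lborel borel ((+) c)) g" by (simp add: lborel_distr_plus gi)
    then show ?thesis by (rule integrable_distr[rotated]) simp
  qed
  have dir: "integral\<^sup>L lborel (\<lambda>z. gz z * h + gb z * cnj h) = 0" if h: "cmod h = 1" for h
  proof -
    let ?q = "\<lambda>n z. of_nat (Suc n) * (g (h / of_nat (Suc n) + z) - g z)"
    \<comment> \<open>The radius R + 1 of the dominating indicator leaves room for the shifts h / (n
      + 1), whose length is at most 1.\<close>
    have "(\<lambda>n. integral\<^sup>L lborel (?q n)) \<longlonglongrightarrow> integral\<^sup>L lborel (\<lambda>z. gz z * h + gb z * cnj h)"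
    proof (rule integral_dominated_convergence[where w="\<lambda>z. indicator (cball 0 (R+1)) z *\<^sub>R (2*L)"])
      show "integrable lborel (\<lambda>z::complex. indicator (cball 0 (R+1)) z *\<^sub>R (2*L))"
        by (intro borel_integrable_compact) auto
      show "AE z in lborel. (\<lambda>i. ?q i z) \<longlonglongrightarrow> gz z * h + gb z * cnj h"
        using h by (intro AE_I2 has_wd_quotient_LIMSEQ[OF d]) auto
      show "(\<lambda>z. gz z * h + gb z * cnj h) \<in> borel_measurable lborel"
        using meas by measurable
      show "?q i \<in> borel_measurable lborel" for i
        using gm by measurable
      show "AE z in lborel. norm (?q n z) \<le> indicator (cball 0 (R+1)) z *\<^sub>R (2*L)" for n
      proof (intro AE_I2)
        fix z :: complex
        show "norm (?q n z) \<le> indicator (cball 0 (R+1)) z *\<^sub>R (2*L)"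
        proof (cases "cmod z \<le> R + 1")
          case True
          have "cmod (g (h / of_nat (Suc n) + z) - g z) \<le> 2 * L * cmod (h / of_nat (Suc n))"
            using has_wd_Lipschitz[OF d L, of "h / of_nat (Suc n) + z" z] by simp
          then have "norm (?q n z) \<le> of_nat (Suc n) * (2 * L * cmod (h / of_nat (Suc n)))"
            unfolding norm_mult norm_of_nat by (intro mult_left_mono) auto
          also have "\<dots> = 2 * L" using h by (simp add: norm_divide del: of_nat_Suc)
          finally show ?thesis using True by simp
        next
          case False
          have "cmod (h / of_nat (Suc n)) \<le> 1" using h by (simp add: norm_divide del: of_nat_Suc)
          moreover have "cmod z \<le> cmod (h / of_nat (Suc n) + z) + cmod (h / of_nat (Suc n))"
            by (metis add_diff_cancel_left' norm_triangle_ineq4)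
          ultimately have "R < cmod (h / of_nat (Suc n) + z)" using False by linarith
          then show ?thesis using False R by simp
        qed
      qed
    qed
    moreover have "integral\<^sup>L lborel (?q n) = 0" for n
      using integral_translate[OF gm, of "h / of_nat (Suc n)"] gi gti
      by (simp del: of_nat_Suc)
    ultimately show ?thesis by (simp only: LIMSEQ_const_iff)
  qed
  have "integral\<^sup>L lborel gz + integral\<^sup>L lborel gb = 0" using dir[of 1] int by simp
  moreover have "integral\<^sup>L lborel gz * \<i> - integral\<^sup>L lborel gb * \<i> = 0" using dir[of \<i>] int by simp
  ultimately show ?thesis by (auto simp: complex_eq_iff)
qed

section \<open>The Cauchy kernel and the Pompeiu formula\<close>

text \<open>Each point of \<open>S\<close> lies in a shell between the radii R q^k / 2 and R q^k.
  There |z|^a is at most max 1 (2^(-a)) times its value at the outer radius, whatever the sign of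
  \<open>a\<close>, and the area is bounded by that of the full disc. The shells contribute a
  geometric series of ratio q^(a+2). The values q = 1/2 and q = 2 yield the integrals over a disc
  and over the complement of one.\<close>

lemma nn_integral_powr_dyadic:
  fixes a q R :: real
  assumes R: "0 < R" and q: "0 < q" "q powr (a + 2) < 1"
    and S: "\<And>z. z \<in> S \<Longrightarrow> \<exists>k::nat. R * q ^ k / 2 < cmod z \<and> cmod z \<le> R * q ^ k"
    and "S \<in> sets borel"
  shows "(\<integral>\<^sup>+ z. indicator S z * ennreal (cmod z powr a) \<partial>lborel)
      \<le> ennreal (max 1 (2 powr - a) * unit_ball_vol 2 / (1 - q powr (a + 2)) * R powr (a + 2))"
proof -
  define M where "M = max 1 (2 powr - a)"
  have M: "M \<ge> 0" by (simp add: M_def)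
  let ?x = "\<lambda>k::nat. R * q ^ k"
  let ?f = "\<lambda>k (z::complex). indicator (cball 0 (?x k)) z * ennreal (M * ?x k powr a)"
  have pt: "indicator S z * ennreal (cmod z powr a) \<le> (\<Sum>k. ?f k z)" for z
  proof (cases "z \<in> S")
    case True
    then obtain k where k: "?x k / 2 < cmod z" "cmod z \<le> ?x k" using S by blast
    have xk: "0 < ?x k" using R q by simp
    have "cmod z powr a \<le> M * ?x k powr a"
    proof (cases "a \<ge> 0")
      case True
      then have "cmod z powr a \<le> ?x k powr a" using k by (intro powr_mono2) auto
      also have "\<dots> = 1 * ?x k powr a" by simp
      also have "\<dots> \<le> M * ?x k powr a" by (rule mult_right_mono) (simp_all add: M_def)
      finally show ?thesis .
    next
      case False
      have "cmod z powr a \<le> (?x k / 2) powr a" using k xk False by (intro powr_mono2') auto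
      also have "\<dots> = 2 powr - a * ?x k powr a"
        using powr_divide[of "?x k" 2 a] xk by (simp only: powr_minus divide_inverse) (simp add: mult.commute)
      also have "\<dots> \<le> M * ?x k powr a" by (intro mult_right_mono) (auto simp: M_def)
      finally show ?thesis .
    qed
    then have "indicator S z * ennreal (cmod z powr a) \<le> ?f k z"
      using k True by (simp add: ennreal_leI)
    also have "\<dots> = (\<Sum>j\<in>{k}. ?f j z)"
      by (simp only: sum.insert_if finite.emptyI empty_iff if_False sum.empty add_0_right)
    also have "\<dots> \<le> (\<Sum>k. ?f k z)" by (intro sum_le_suminf) auto
    finally show ?thesis .
  qed simp
  have "term": "(\<integral>\<^sup>+ z. ?f k z \<partial>lborel) = ennreal (M * unit_ball_vol 2 * R powr (a + 2) * (q powr (a + 2)) ^ k)" for k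
  proof -
    have xk: "0 < ?x k" using R q by simp
    have "(\<integral>\<^sup>+ z. ?f k z \<partial>lborel) = (\<integral>\<^sup>+ z. ennreal (M * ?x k powr a) * indicator (cball 0 (?x k)) (z::complex) \<partial>lborel)"
      by (rule nn_integral_cong) (rule mult.commute)
    also have "\<dots> = ennreal (M * ?x k powr a) * emeasure lborel (cball (0::complex) (?x k))"
      by (rule nn_integral_cmult_indicator) simp
    also have "\<dots> = ennreal (M * ?x k powr a) * ennreal (unit_ball_vol 2 * ?x k ^ 2)"
      using xk by (simp add: emeasure_cball)
    also have "\<dots> = ennreal (M * ?x k powr a * (unit_ball_vol 2 * ?x k ^ 2))"
      using M by (intro ennreal_mult[symmetric]) auto
    also have "M * ?x k powr a * (unit_ball_vol 2 * ?x k ^ 2) = M * unit_ball_vol 2 * (?x k powr (a + 2))"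
      using powr_numeral[OF less_imp_le[OF xk], of "num.Bit0 num.One"] powr_add[of "?x k" a 2] by (simp only: mult_ac)
    also have "?x k powr (a + 2) = R powr (a + 2) * (q powr (a + 2)) ^ k"
    proof -
      have "(q ^ k) powr (a + 2) = q powr (real k * (a + 2))"
        unfolding powr_realpow[OF q(1), symmetric] by (rule powr_powr)
      also have "\<dots> = (q powr (a + 2)) powr real k" by (simp only: powr_powr mult.commute)
      also have "\<dots> = (q powr (a + 2)) ^ k" using q by (intro powr_realpow) simp
      finally show ?thesis using R q by (simp add: powr_mult)
    qed
    finally show ?thesis by (simp add: mult.assoc)
  qed
  have "(\<integral>\<^sup>+ z. indicator S z * ennreal (cmod z powr a) \<partial>lborel) \<le> (\<integral>\<^sup>+ z. (\<Sum>k. ?f k z) \<partial>lborel)"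
    by (intro nn_integral_mono pt)
  also have "\<dots> = (\<Sum>k. \<integral>\<^sup>+ z. ?f k z \<partial>lborel)"
    by (rule nn_integral_suminf)
      (intro borel_measurable_times_ennreal borel_measurable_indicator borel_measurable_const, simp)
  also have "\<dots> = (\<Sum>k. ennreal (M * unit_ball_vol 2 * R powr (a + 2) * (q powr (a + 2)) ^ k))"
    by (simp only: "term")
  also have "\<dots> = ennreal (\<Sum>k. M * unit_ball_vol 2 * R powr (a + 2) * (q powr (a + 2)) ^ k)"
    using M q by (intro suminf_ennreal2 summable_mult summable_geometric) auto
  also have "(\<Sum>k. M * unit_ball_vol 2 * R powr (a + 2) * (q powr (a + 2)) ^ k)
     = M * unit_ball_vol 2 * R powr (a + 2) * (1 / (1 - q powr (a + 2)))"
    using q by (subst suminf_mult) (auto simp: suminf_geometric intro: summable_geometric)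
  also have "M * unit_ball_vol 2 * R powr (a + 2) * (1 / (1 - q powr (a + 2)))
     = M * unit_ball_vol 2 / (1 - q powr (a + 2)) * R powr (a + 2)" by simp
  finally show ?thesis unfolding M_def .
qed

lemma nn_integral_powr_inside:
  assumes "- 2 < a"
  obtains C where "\<And>R. 0 < R \<Longrightarrow>
    (\<integral>\<^sup>+ z. indicator (cball 0 R) z * ennreal (cmod z powr a) \<partial>lborel) \<le> ennreal (C * R powr (a + 2))"
proof -
  have q: "(1/2::real) powr (a + 2) < 1" using assms powr_less_mono2[of "a + 2" "1/2" 1] by simp
  have "(\<integral>\<^sup>+ z. indicator (cball 0 R) z * ennreal (cmod z powr a) \<partial>lborel)
      \<le> ennreal (max 1 (2 powr - a) * unit_ball_vol 2 / (1 - (1/2) powr (a + 2)) * R powr (a + 2))"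
    if R: "0 < R" for R
  proof -
    have "(\<integral>\<^sup>+ z. indicator (cball 0 R) z * ennreal (cmod z powr a) \<partial>lborel)
       = (\<integral>\<^sup>+ z. indicator (cball 0 R - {0}) z * ennreal (cmod z powr a) \<partial>lborel)"
      by (intro nn_integral_cong) (auto simp: indicator_def)
    also have "\<dots> \<le> ennreal (max 1 (2 powr - a) * unit_ball_vol 2 / (1 - (1/2) powr (a + 2)) * R powr (a + 2))"
    proof (rule nn_integral_powr_dyadic[OF R _ q])
      fix z :: complex assume "z \<in> cball 0 R - {0}"
      then have z: "0 < cmod z" "cmod z \<le> R" by auto
      obtain k0 where "(1/2) ^ k0 < cmod z / R"
        using real_arch_pow_inv[of "cmod z / R" "1/2"] z R by auto
      then have "\<exists>k. R * (1/2) ^ k < cmod z"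
        using R by (intro exI[of _ k0]) (simp add: less_divide_eq mult.commute)
      \<comment> \<open>The first power for which the radius drops below |z|. It is not the zeroth
        one because |z| \<le> R, and its predecessor indexes the shell of \<open>z\<close>.\<close>
      define m where "m = (LEAST k. R * (1/2) ^ k < cmod z)"
      have m: "R * (1/2) ^ m < cmod z" unfolding m_def using \<open>\<exists>k. _\<close> by (rule LeastI_ex)
      then have "m \<noteq> 0" using z by (cases m) auto
      then obtain k where k: "m = Suc k" by (cases m) auto
      then have "\<not> R * (1/2) ^ k < cmod z" using not_less_Least[of k "\<lambda>k. R * (1/2) ^ k < cmod z"] m_def by auto
      then show "\<exists>k. R * (1/2) ^ k / 2 < cmod z \<and> cmod z \<le> R * (1/2) ^ k" using m k by (intro exI[of _ k]) auto
    qed auto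
    finally show ?thesis .
  qed
  then show thesis using that by blast
qed

lemma nn_integral_powr_outside:
  assumes "a < - 2"
  obtains C where "\<And>R. 0 < R \<Longrightarrow>
    (\<integral>\<^sup>+ z. indicator (- ball 0 R) z * ennreal (cmod z powr a) \<partial>lborel) \<le> ennreal (C * R powr (a + 2))"
proof -
  have q: "(2::real) powr (a + 2) < 1" using assms powr_less_mono[of "a + 2" 0 2] by simp
  have "(\<integral>\<^sup>+ z. indicator (- ball 0 R) z * ennreal (cmod z powr a) \<partial>lborel)
      \<le> ennreal (max 1 (2 powr - a) * unit_ball_vol 2 / (1 - 2 powr (a + 2)) * R powr (a + 2))"
    if R: "0 < R" for R
  proof (rule nn_integral_powr_dyadic[OF R _ q])
    fix z :: complex assume "z \<in> - ball 0 R"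
    then have z: "R \<le> cmod z" by auto
    have "\<exists>k. cmod z / R < 2 ^ k" by (rule real_arch_pow) simp
    then have ex: "\<exists>k. cmod z \<le> R * 2 ^ k" using R by (auto simp: field_simps intro: less_imp_le)
    define m where "m = (LEAST k. cmod z \<le> R * 2 ^ k)"
    have m: "cmod z \<le> R * 2 ^ m" unfolding m_def using ex by (rule LeastI_ex)
    have "R * 2 ^ m / 2 < cmod z"
    proof (cases m)
      case 0 then show ?thesis using z R by simp
    next
      case (Suc k)
      then have "\<not> cmod z \<le> R * 2 ^ k" using not_less_Least[of k "\<lambda>k. cmod z \<le> R * 2 ^ k"] m_def by auto
      then show ?thesis using Suc by simp
    qed
    then show "\<exists>k. R * 2 ^ k / 2 < cmod z \<and> cmod z \<le> R * 2 ^ k" using m by blast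
  qed auto
  then show thesis using that by blast
qed

lemma nn_integral_translate:
  fixes c :: complex
  assumes "f \<in> borel_measurable borel"
  shows "(\<integral>\<^sup>+ z. f (z - c) \<partial>lborel) = (\<integral>\<^sup>+ z. f z \<partial>lborel)"
proof -
  have "(\<integral>\<^sup>+ z. f z \<partial>lborel) = (\<integral>\<^sup>+ z. f z \<partial>distr lborel borel ((+) (- c)))" by (simp add: lborel_distr_plus)
  also have "\<dots> = (\<integral>\<^sup>+ z. f (z - c) \<partial>lborel)" using assms by (subst nn_integral_distr) auto
  finally show ?thesis by simp
qed

lemma ennreal_sum3:
  assumes "0 \<le> a1" "0 \<le> b1" "0 \<le> a2" "0 \<le> b2" "0 \<le> a3" "0 \<le> (b3::real)"
  shows "ennreal a1 * ennreal b1 + (ennreal a2 * ennreal b2 + ennreal a3 * ennreal b3)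
    = ennreal (a1 * b1 + (a2 * b2 + a3 * b3))"
  using assms by (simp add: ennreal_mult)

text \<open>The plane is split at the scale r = |z| / 2 into a disc around 0, a disc around
  \<open>z\<close> and the rest. The condition a > -2 gives convergence at 0, a < -1 gives
  convergence at infinity, and each of the three pieces scales like |z|^(a+1).\<close>

lemma nn_integral_cauchy_kernel:
  assumes a: "- 2 < a" "a < - 1"
  obtains C where "\<And>z. z \<noteq> 0 \<Longrightarrow>
    (\<integral>\<^sup>+ w. ennreal (cmod w powr a / cmod (w - z)) \<partial>lborel) \<le> ennreal (C * cmod z powr (a + 1))"
proof -
  obtain C1 where C1: "\<And>R. 0 < R \<Longrightarrow>
    (\<integral>\<^sup>+ z. indicator (cball 0 R) z * ennreal (cmod z powr a) \<partial>lborel) \<le> ennreal (C1 * R powr (a + 2))"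
    using nn_integral_powr_inside[OF a(1)] by blast
  obtain C2 where C2: "\<And>R. 0 < R \<Longrightarrow>
    (\<integral>\<^sup>+ z. indicator (cball 0 R) z * ennreal (cmod z powr (- 1)) \<partial>lborel) \<le> ennreal (C2 * R powr (- 1 + 2))"
    using nn_integral_powr_inside[of "- 1"] by auto
  obtain C3 where C3: "\<And>R. 0 < R \<Longrightarrow>
    (\<integral>\<^sup>+ z. indicator (- ball 0 R) z * ennreal (cmod z powr (a - 1)) \<partial>lborel) \<le> ennreal (C3 * R powr (a - 1 + 2))"
    using nn_integral_powr_outside[of "a - 1"] a by auto
  define K where "K = 2 * \<bar>C1\<bar> * (1/2) powr (a + 2) + \<bar>C2\<bar> * (1/2) powr (a+1) + 3 * \<bar>C3\<bar> * (1/2) powr (a + 1)"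
  have "(\<integral>\<^sup>+ w. ennreal (cmod w powr a / cmod (w - z)) \<partial>lborel) \<le> ennreal (K * cmod z powr (a + 1))"
    if z: "z \<noteq> 0" for z
  proof -
    define r where "r = cmod z / 2"
    have r: "0 < r" using z by (simp add: r_def)
    have pt: "ennreal (cmod w powr a / cmod (w - z)) \<le>
        ennreal (1 / r) * (indicator (cball 0 r) w * ennreal (cmod w powr a))
      + (ennreal (r powr a) * (indicator (cball 0 r) (w - z) * ennreal (cmod (w - z) powr (-1)))
      + ennreal 3 * (indicator (- ball 0 r) w * ennreal (cmod w powr (a - 1))))" (is "_ \<le> ?A + (?B + ?D)") for w
    proof -
      have tri: "cmod z \<le> cmod w + cmod (w - z)" "cmod w \<le> cmod z + cmod (w - z)"
        using norm_triangle_ineq4[of w "w - z"] norm_triangle_ineq[of z "w - z"] by (auto simp: norm_minus_commute)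
      consider "cmod w \<le> r" | "cmod (w - z) \<le> r" "r < cmod w" | "r < cmod w" "r < cmod (w - z)" by linarith
      then show ?thesis
      proof cases
        case 1
        then have "r \<le> cmod (w - z)" using tri by (simp add: r_def)
        then have "cmod w powr a / cmod (w - z) \<le> cmod w powr a / r"
          using r by (intro divide_left_mono mult_pos_pos) auto
        also have "\<dots> = 1 / r * cmod w powr a" by simp
        finally have "ennreal (cmod w powr a / cmod (w - z)) \<le> ennreal (1 / r * cmod w powr a)" by (rule ennreal_leI)
        also have "\<dots> = ?A" using 1 r by (simp add: ennreal_mult' del: times_divide_eq_left)
        finally show ?thesis by (rule order_trans) simp
      next
        case 2
        have "cmod w powr a \<le> r powr a" using 2 r a by (intro powr_mono2') auto
        then have "cmod w powr a / cmod (w - z) \<le> r powr a / cmod (w - z)" by (rule divide_right_mono) simp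
        also have "\<dots> = r powr a * cmod (w - z) powr (-1)" by (cases "w = z") (simp_all add: powr_minus divide_inverse)
        finally have "ennreal (cmod w powr a / cmod (w - z)) \<le> ennreal (r powr a * cmod (w - z) powr (-1))"
          by (rule ennreal_leI)
        also have "\<dots> = ennreal (r powr a) * ennreal (cmod (w - z) powr (-1))" by (rule ennreal_mult) auto
        also have "\<dots> = ?B" using 2 by simp
        finally show ?thesis by (rule order_trans) (simp add: add_increasing)
      next
        case 3
        have w: "0 < cmod w" "0 < cmod (w - z)" using 3 r by linarith+
        \<comment> \<open>Outside both discs |w| \<le> 2 r + |w - z| and r < |w - z|.\<close>
        have "cmod w \<le> 3 * cmod (w - z)" using tri 3 by (simp add: r_def)
        then have "1 / cmod (w - z) \<le> 3 / cmod w" using w by (simp add: field_simps)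
        then have "cmod w powr a * (1 / cmod (w - z)) \<le> cmod w powr a * (3 / cmod w)" by (intro mult_left_mono) auto
        also have "\<dots> = 3 * cmod w powr (a - 1)" using w by (simp add: powr_diff)
        finally have "ennreal (cmod w powr a / cmod (w - z)) \<le> ennreal (3 * cmod w powr (a - 1))"
          by (intro ennreal_leI) simp
        also have "\<dots> = ?D" using 3 by (simp add: ennreal_mult)
        finally show ?thesis by (rule order_trans) (simp add: add_increasing)
      qed
    qed
    have "(\<integral>\<^sup>+ w. ennreal (cmod w powr a / cmod (w - z)) \<partial>lborel) \<le>
        (\<integral>\<^sup>+ w. ennreal (1 / r) * (indicator (cball 0 r) w * ennreal (cmod w powr a))
      + (ennreal (r powr a) * (indicator (cball 0 r) (w - z) * ennreal (cmod (w - z) powr (-1)))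
      + ennreal 3 * (indicator (- ball 0 r) w * ennreal (cmod w powr (a - 1)))) \<partial>lborel)"
      by (intro nn_integral_mono pt)
    also have "\<dots> = ennreal (1 / r) * (\<integral>\<^sup>+ w. indicator (cball 0 r) w * ennreal (cmod w powr a) \<partial>lborel)
      + (ennreal (r powr a) * (\<integral>\<^sup>+ w. indicator (cball 0 r) (w - z) * ennreal (cmod (w - z) powr (-1)) \<partial>lborel)
      + ennreal 3 * (\<integral>\<^sup>+ w. indicator (- ball 0 r) w * ennreal (cmod w powr (a - 1)) \<partial>lborel))"
    proof -
      have [measurable]: "cball (0::complex) r \<in> sets borel" "- ball (0::complex) r \<in> sets borel" by auto
      have [measurable]: "(\<lambda>w. indicator (cball 0 r) w * ennreal (cmod w powr a)) \<in> borel_measurable borel"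
         "(\<lambda>w. indicator (- ball 0 r) w * ennreal (cmod w powr (a - 1))) \<in> borel_measurable borel"
        by measurable
      have "(\<lambda>w. indicator (cball 0 r) w * ennreal (cmod w powr (-1))) \<in> borel_measurable borel"
        by measurable
      then have [measurable]: "(\<lambda>w. indicator (cball 0 r) (w - z) * ennreal (cmod (w - z) powr (-1))) \<in> borel_measurable borel"
        by (rule measurable_compose[rotated]) measurable
      show ?thesis by (simp add: nn_integral_add nn_integral_cmult)
    qed
    also have "(\<integral>\<^sup>+ w. indicator (cball 0 r) (w - z) * ennreal (cmod (w - z) powr (-1)) \<partial>lborel)
        = (\<integral>\<^sup>+ w. indicator (cball 0 r) w * ennreal (cmod w powr (-1)) \<partial>lborel)"
    proof (rule nn_integral_translate[where f="\<lambda>w. indicator (cball 0 r) w * ennreal (cmod w powr (-1))"])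
      have [measurable]: "cball (0::complex) r \<in> sets borel" by auto
      show "(\<lambda>w. indicator (cball 0 r) w * ennreal (cmod w powr (-1))) \<in> borel_measurable borel" by measurable
    qed
    also have "ennreal (1 / r) * (\<integral>\<^sup>+ w. indicator (cball 0 r) w * ennreal (cmod w powr a) \<partial>lborel)
      + (ennreal (r powr a) * (\<integral>\<^sup>+ w. indicator (cball 0 r) w * ennreal (cmod w powr (-1)) \<partial>lborel)
      + ennreal 3 * (\<integral>\<^sup>+ w. indicator (- ball 0 r) w * ennreal (cmod w powr (a - 1)) \<partial>lborel))
      \<le> ennreal (1 / r) * ennreal (\<bar>C1\<bar> * r powr (a + 2))
      + (ennreal (r powr a) * ennreal (\<bar>C2\<bar> * r powr (-1+2))
      + ennreal 3 * ennreal (\<bar>C3\<bar> * r powr (a - 1 + 2)))"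
      using C1[OF r] C2[OF r] C3[OF r]
      by (intro add_mono mult_left_mono)
        (auto elim!: order_trans intro!: ennreal_leI mult_right_mono)
    also have "\<dots> = ennreal (1 / r * (\<bar>C1\<bar> * r powr (a + 2)) + (r powr a * (\<bar>C2\<bar> * r powr (-1+2))
       + 3 * (\<bar>C3\<bar> * r powr (a - 1 + 2))))"
      by (rule ennreal_sum3) (use r in auto)
    also have "1 / r * (\<bar>C1\<bar> * r powr (a + 2)) + (r powr a * (\<bar>C2\<bar> * r powr (-1+2))
       + 3 * (\<bar>C3\<bar> * r powr (a - 1 + 2))) = (\<bar>C1\<bar> + \<bar>C2\<bar> + 3 * \<bar>C3\<bar>) * r powr (a + 1)"
      using r by (simp add: powr_add powr_diff field_simps power2_eq_square)
    also have "r powr (a + 1) = (1/2) powr (a + 1) * cmod z powr (a + 1)"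
      by (simp add: r_def powr_mult[symmetric])
    also have "(\<bar>C1\<bar> + \<bar>C2\<bar> + 3 * \<bar>C3\<bar>) * ((1/2) powr (a + 1) * cmod z powr (a + 1)) = K * cmod z powr (a + 1)"
      by (simp add: K_def powr_add field_simps)
    finally show ?thesis .
  qed
  then show thesis using that by blast
qed

text \<open>The value is \<open>\<pi>\<close>, but only that it is nonzero matters.\<close>

definition pompeiu_const :: complex where
  "pompeiu_const = (LINT w|lborel. 1 / (1 + w * cnj w)^2)"

section \<open>The regularized kernel and the Pompeiu formula for bounded derivatives\<close>

lemma one_plus_norm: "1 + w * cnj w = of_real (1 + cmod w ^ 2)"
  by (simp only: complex_norm_square[symmetric]) simp

lemma one_plus_nz: "1 + w * cnj w \<noteq> 0"
proof -
  have "1 + cmod w ^ 2 > 0" by (simp add: add_pos_nonneg)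
  then show ?thesis unfolding one_plus_norm of_real_eq_0_iff by linarith
qed

lemma norm_one_plus: "cmod (1 + w * cnj w) = 1 + cmod w ^ 2"
  unfolding one_plus_norm norm_of_real by (simp add: add_nonneg_nonneg)

lemma pompeiu_integrable: "integrable lborel (\<lambda>w::complex. 1 / (1 + w * cnj w)^2)"
proof -
  obtain C where C: "\<And>R. 0 < R \<Longrightarrow>
    (\<integral>\<^sup>+ z. indicator (- ball 0 R) z * ennreal (cmod z powr (- 4)) \<partial>lborel) \<le> ennreal (C * R powr (- 4 + 2))"
    using nn_integral_powr_outside[of "- 4"] by auto
  have [measurable]: "(\<lambda>w::complex. 1 / (1 + w * cnj w)^2) \<in> borel_measurable borel"
    by (intro borel_measurable_continuous_onI continuous_intros) (use one_plus_nz in auto)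
  have pt: "ennreal (cmod (1 / (1 + w * cnj w)^2)) \<le> indicator (cball 0 1) w + indicator (- ball 0 1) w * ennreal (cmod w powr (- 4))" for w :: complex
  proof (cases "cmod w \<le> 1")
    case True
    have "1 \<le> (1 + cmod w ^ 2)^2" by (rule one_le_power) simp
    then have "cmod (1 / (1 + w * cnj w)^2) \<le> 1"
      by (simp add: norm_divide norm_power norm_one_plus divide_le_eq)
    then have "ennreal (cmod (1 / (1 + w * cnj w)^2)) \<le> 1" using ennreal_leI by fastforce
    then show ?thesis using True by (simp add: add_increasing2)
  next
    case False
    have "(cmod w ^ 2)^2 \<le> (1 + cmod w ^ 2)^2" by (intro power_mono) auto
    then have "1 / (1 + cmod w ^ 2)^2 \<le> 1 / (cmod w ^ 2)^2" using False
      by (intro divide_left_mono mult_pos_pos zero_less_power) (auto simp: add_pos_nonneg)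
    also have "\<dots> = cmod w powr (-4)" using False
      by (subst powr_minus) (auto simp: powr_numeral divide_inverse simp flip: power_mult)
    finally show ?thesis using False by (auto simp: norm_divide norm_power norm_one_plus indicator_def intro!: ennreal_leI)
  qed
  have "(\<integral>\<^sup>+ w. ennreal (cmod (1 / (1 + w * cnj w)^2)) \<partial>lborel) \<le>
     (\<integral>\<^sup>+ w. indicator (cball 0 1) w + indicator (- ball 0 1) (w::complex) * ennreal (cmod w powr (- 4)) \<partial>lborel)"
    by (intro nn_integral_mono pt)
  also have "\<dots> = emeasure lborel (cball 0 (1::real) :: complex set) + (\<integral>\<^sup>+ w. indicator (- ball 0 1) (w::complex) * ennreal (cmod w powr (- 4)) \<partial>lborel)"
    by (subst nn_integral_add) (auto intro!: borel_measurable_indicator)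
  also have "\<dots> < \<infinity>" using C[of 1] by (auto simp: emeasure_cball intro: le_less_trans)
  finally show ?thesis by (intro integrableI_bounded) auto
qed

lemma pompeiu_const_nz: "pompeiu_const \<noteq> 0"
proof -
  let ?f = "\<lambda>w::complex. 1 / (1 + cmod w ^ 2)^2"
  have e: "1 / (1 + w * cnj w)^2 = complex_of_real (?f w)" for w by (simp add: one_plus_norm)
  have ig: "integrable lborel ?f"
    using pompeiu_integrable unfolding e complex_of_real_integrable_eq .
  have "pompeiu_const = of_real (LINT w|lborel. ?f w)"
    unfolding pompeiu_const_def e by (rule integral_complex_of_real)
  moreover have "(LINT w|lborel. ?f w) \<noteq> 0"
  proof
    assume "(LINT w|lborel. ?f w) = 0"
    then have "AE w::complex in lborel. ?f w = 0"
      using integral_nonneg_eq_0_iff_AE[OF ig] by simp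
    moreover have "?f w \<noteq> 0" for w by (simp add: add_nonneg_eq_0_iff)
    ultimately have "AE w::complex in lborel. False" by simp
    then have "ae_filter (lborel::complex measure) = bot" by (simp only: eventually_False)
    then show False by (simp add: ae_filter_eq_bot_iff emeasure_lborel_UNIV)
  qed
  ultimately show ?thesis by (metis of_real_eq_0_iff)
qed

lemma integral_affine:
  fixes f :: "complex \<Rightarrow> complex"
  assumes [measurable]: "f \<in> borel_measurable borel" and e: "0 < e"
  shows "integral\<^sup>L lborel f = of_real (e^2) * (LINT w|lborel. f (t + e *\<^sub>R w))"
proof -
  have "integral\<^sup>L lborel f = integral\<^sup>L (density (distr lborel borel (\<lambda>x. t + e *\<^sub>R x)) (\<lambda>_. ennreal (\<bar>e\<bar>^DIM(complex)))) f"
    by (subst lborel_affine[of e t]) (use e in auto)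
  also have "\<dots> = integral\<^sup>L (distr lborel borel (\<lambda>x. t + e *\<^sub>R x)) (\<lambda>x. (\<bar>e\<bar>^DIM(complex)) *\<^sub>R f x)"
    by (subst integral_density) auto
  also have "\<dots> = (LINT w|lborel. (\<bar>e\<bar>^DIM(complex)) *\<^sub>R f (t + e *\<^sub>R w))"
    by (subst integral_distr) auto
  also have "\<dots> = of_real (e^2) * (LINT w|lborel. f (t + e *\<^sub>R w))"
    by (simp add: scaleR_conv_of_real)
  finally show ?thesis .
qed

lemma support_has_wd_zero:
  assumes d: "\<And>z. has_wd g (gz z) (gb z) z" and R: "\<And>z. R < cmod z \<Longrightarrow> g z = 0" and z: "R < cmod z"
  shows "gz z = 0 \<and> gb z = 0"
proof -
  have "open {z. R < cmod z}" by (intro open_Collect_less continuous_intros)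
  then have "\<forall>\<^sub>F x in nhds z. R < cmod x" using z eventually_nhds_in_open[of "{z. R < cmod z}" z] by simp
  then have "\<forall>\<^sub>F x in nhds z. g x = 0" by eventually_elim (use R in auto)
  then have "has_wd (\<lambda>_. 0) (gz z) (gb z) z" by (rule has_wd_transform[OF d])
  then show ?thesis using has_wd_unique[OF _ has_wd_const] by blast
qed

text \<open>Instead of excising a disc around \<open>z\<close>, the kernel 1 / (w - z) is replaced
  by cnj (w - z) / (e^2 + |w - z|^2), which has no singularity. The substitution w = z + e v turns
  it into the fixed kernel \<open>k\<close> divided by e. The d-bar derivative of \<open>k\<close>
  is the integrable function \<open>b\<close>, and the d-bar derivative of g(z + e v) k(v) has
  integral zero. As e tends to 0, one part of this identity becomes g(z) times the mass of
  \<open>b\<close> and the other becomes the Cauchy integral.\<close>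

lemma pompeiu_smooth:
  assumes d: "\<And>z. has_wd g (gz z) (gb z) z" and L: "\<And>z. cmod (gz z) \<le> L" "\<And>z. cmod (gb z) \<le> L"
    and R: "\<And>z. R < cmod z \<Longrightarrow> g z = 0"
  shows "pompeiu_const * g z = - (LINT w|lborel. gb w / (w - z))"
proof -
  have [measurable]: "gz \<in> borel_measurable borel" "gb \<in> borel_measurable borel"
    using has_wd_measurable[OF d] by auto
  have cont: "continuous_on UNIV g"
    using has_wd_isCont[OF d] by (simp add: continuous_on_eq_continuous_at)
  then have [measurable]: "g \<in> borel_measurable borel" by (rule borel_measurable_continuous_onI)
  have "compact (g ` cball 0 R)" using cont by (intro compact_continuous_image) (auto intro: continuous_on_subset)
  then obtain M0 where M0: "\<And>z. z \<in> cball 0 R \<Longrightarrow> cmod (g z) \<le> M0"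
    by (meson compact_imp_bounded bounded_iff imageI)
  define M where "M = max M0 0"
  have M: "cmod (g z) \<le> M" for z
    using M0[of z] R[of z] by (cases "cmod z \<le> R") (auto simp: M_def)
  have L0: "0 \<le> L" using L(1)[of 0] norm_ge_zero[of "gz 0"] by linarith
  define k where "k = (\<lambda>w::complex. cnj w / (1 + w * cnj w))"
  define b where "b = (\<lambda>w::complex. 1 / (1 + w * cnj w)^2)"
  have [measurable]: "cnj \<in> borel_measurable borel"
    by (intro borel_measurable_continuous_onI continuous_intros)
  have [measurable]: "k \<in> borel_measurable borel" "b \<in> borel_measurable borel"
    unfolding k_def b_def
    by (intro borel_measurable_continuous_onI continuous_intros; use one_plus_nz in auto)+
  have kb: "cmod (k w) \<le> 1" for w
  proof -
    have "0 \<le> (cmod w - 1)^2" by simp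
    then have "2 * cmod w \<le> 1 + cmod w ^ 2" by (simp add: power2_diff)
    then have "cmod w \<le> 1 + cmod w ^ 2" using norm_ge_zero[of w] by linarith
    moreover have "0 < 1 + cmod w ^ 2" by (simp add: add_pos_nonneg)
    ultimately show ?thesis by (simp add: k_def norm_divide norm_one_plus divide_le_eq)
  qed
  have kd: "has_wd k (- ((k w)^2)) (b w) w" for w
  proof -
    have "has_wd (\<lambda>w. 1 + w * cnj w) (0 + (1 * cnj w + w * cnj 0)) (0 + (0 * cnj w + w * cnj 1)) w"
      by (intro has_wd_add has_wd_mult has_wd_const has_wd_ident has_wd_cnj)
    from has_wd_divide[OF has_wd_cnj[OF has_wd_ident] this one_plus_nz] show ?thesis
      unfolding k_def b_def
      by (rule has_wd_eqI) (use one_plus_nz[of w] in \<open>auto simp: divide_simps power2_eq_square algebra_simps\<close>)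
  qed
  have bb: "cmod (b w) \<le> 1" for w
  proof -
    have "1 \<le> (1 + cmod w ^ 2)^2" by (rule one_le_power) simp
    then show ?thesis by (simp add: b_def norm_divide norm_power norm_one_plus divide_le_eq)
  qed
  have key: "(LINT w|lborel. g (z + e *\<^sub>R w) * b w) = - (LINT w|lborel. gb w * (cnj (w - z) / (of_real (e^2) + (w - z) * cnj (w - z))))"
    if e: "0 < e" for e :: real
  proof -
    let ?G = "\<lambda>w. g (z + e *\<^sub>R w) * k w"
    let ?Gz = "\<lambda>w. gz (z + e *\<^sub>R w) * of_real e * k w + g (z + e *\<^sub>R w) * (- ((k w)^2))"
    let ?Gb = "\<lambda>w. gb (z + e *\<^sub>R w) * of_real e * k w + g (z + e *\<^sub>R w) * b w"
    have Gd: "has_wd ?G (?Gz w) (?Gb w) w" for w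
    proof -
      have "has_wd (\<lambda>w. z + e *\<^sub>R w) (of_real e) 0 w"
        unfolding scaleR_conv_of_real
        by (rule has_wd_eqI[OF has_wd_add[OF has_wd_const has_wd_mult[OF has_wd_const has_wd_ident]]]) auto
      from has_wd_mult[OF has_wd_compose[OF d this] kd] show ?thesis
        by (rule has_wd_eqI) auto
    qed
    have bd: "cmod (x * of_real e * k w) \<le> L * e" if "cmod x \<le> L" for x w
      using mult_mono[OF mult_right_mono[OF that, of e] kb[of w]] e L0 by (simp add: norm_mult)
    have bd2: "cmod (g x * (- ((k w)^2))) \<le> M" "cmod (g x * b w) \<le> M" for x w
    proof -
      have "cmod (g x) * cmod (k w) ^ 2 \<le> M * 1 ^ 2"
        by (intro mult_mono power_mono M kb) (auto simp: M_def)
      then show "cmod (g x * (- ((k w)^2))) \<le> M" by (simp add: norm_mult norm_power)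
      have "cmod (g x) * cmod (b w) \<le> M * 1"
        by (intro mult_mono M bb) (auto simp: M_def)
      then show "cmod (g x * b w) \<le> M" by (simp add: norm_mult)
    qed
    have zero: "integral\<^sup>L lborel ?Gb = 0"
    proof (rule integral_dbar_zero[OF Gd])
      show "cmod (?Gz w) \<le> L * e + M" "cmod (?Gb w) \<le> L * e + M" for w
        using norm_triangle_mono[OF bd bd2(1)] norm_triangle_mono[OF bd bd2(2)] L by blast+
      show "?G w = 0" if "(R + cmod z) / e < cmod w" for w
      proof -
        have "R + cmod z < e * cmod w" using that e by (simp add: divide_less_eq mult.commute)
        also have "e * cmod w = cmod (e *\<^sub>R w)" using e by simp
        also have "\<dots> \<le> cmod (z + e *\<^sub>R w) + cmod z"
          by (metis add.commute add_diff_cancel_left' norm_triangle_ineq4)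
        finally show ?thesis using R by simp
      qed
    qed
    have far: "gb (z + e *\<^sub>R w) = 0 \<and> g (z + e *\<^sub>R w) = 0" if "(R + cmod z) / e < cmod w" for w
    proof -
      have "R + cmod z < e * cmod w" using that e by (simp add: divide_less_eq mult.commute)
      also have "e * cmod w = cmod (e *\<^sub>R w)" using e by simp
      also have "\<dots> \<le> cmod (z + e *\<^sub>R w) + cmod z"
        by (metis add.commute add_diff_cancel_left' norm_triangle_ineq4)
      finally show ?thesis using R support_has_wd_zero[OF d R] by simp
    qed
    have i1: "integrable lborel (\<lambda>w. gb (z + e *\<^sub>R w) * of_real e * k w)"
      by (rule integrable_bounded_support[where L="L * e" and R="(R + cmod z) / e"])
        (use bd L far in auto)
    have i2: "integrable lborel (\<lambda>w. g (z + e *\<^sub>R w) * b w)"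
      by (rule integrable_bounded_support[where L="M" and R="(R + cmod z) / e"])
        (use bd2(2) far in auto)
    have "(LINT w|lborel. gb (z + e *\<^sub>R w) * of_real e * k w) + (LINT w|lborel. g (z + e *\<^sub>R w) * b w) = 0"
      using zero by (subst Bochner_Integration.integral_add[OF i1 i2, symmetric]) auto
    moreover have "(LINT w|lborel. gb w * (cnj (w - z) / (of_real (e^2) + (w - z) * cnj (w - z))))
        = of_real (e^2) * (LINT w|lborel. gb (z + e *\<^sub>R w) * (cnj (z + e *\<^sub>R w - z) / (of_real (e^2) + (z + e *\<^sub>R w - z) * cnj (z + e *\<^sub>R w - z))))"
      by (rule integral_affine[OF _ e]) measurable
    moreover have "of_real (e^2) * (gb (z + e *\<^sub>R w) * (cnj (z + e *\<^sub>R w - z) / (of_real (e^2) + (z + e *\<^sub>R w - z) * cnj (z + e *\<^sub>R w - z))))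
       = gb (z + e *\<^sub>R w) * of_real e * k w" for w
    proof -
      have "of_real (e^2) + (z + e *\<^sub>R w - z) * cnj (z + e *\<^sub>R w - z) = of_real (e^2) * (1 + w * cnj w)"
        by (simp add: scaleR_conv_of_real power2_eq_square algebra_simps)
      then show ?thesis using e one_plus_nz[of w] by (simp add: k_def scaleR_conv_of_real power2_eq_square)
    qed
    ultimately have "(LINT w|lborel. gb w * (cnj (w - z) / (of_real (e^2) + (w - z) * cnj (w - z))))
       + (LINT w|lborel. g (z + e *\<^sub>R w) * b w) = 0"
      by (simp only: integral_mult_right_zero[symmetric])
    then show ?thesis by (simp only: eq_neg_iff_add_eq_0 add.commute)
  qed
  \<comment> \<open>The scale tends to 0 along 1 / (n + 1). Both sides of \<open>key\<close>
    converge by domination: the left with M |b|, the right with L / |w - z| on the support.\<close>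
  let ?e = "\<lambda>n. inverse (real (Suc n))"
  have e0: "?e \<longlonglongrightarrow> 0" using LIMSEQ_inverse_real_of_nat .
  have lhs: "(\<lambda>n. LINT w|lborel. g (z + ?e n *\<^sub>R w) * b w) \<longlonglongrightarrow> (LINT w|lborel. g z * b w)"
  proof (rule integral_dominated_convergence[where w="\<lambda>w. M * cmod (b w)"])
    show "integrable lborel (\<lambda>w. M * cmod (b w))"
      unfolding b_def by (intro integrable_mult_right integrable_norm pompeiu_integrable)
    show "AE w in lborel. (\<lambda>i. g (z + ?e i *\<^sub>R w) * b w) \<longlonglongrightarrow> g z * b w"
    proof (intro AE_I2 tendsto_mult_right)
      fix w
      have "(\<lambda>i. z + ?e i *\<^sub>R w) \<longlonglongrightarrow> z + 0 *\<^sub>R w" by (intro tendsto_intros e0)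
      moreover have "isCont g (z + 0 *\<^sub>R w)" using has_wd_isCont[OF d] .
      ultimately have "(\<lambda>i. g (z + ?e i *\<^sub>R w)) \<longlonglongrightarrow> g (z + 0 *\<^sub>R w)"
        by (rule isCont_tendsto_compose[rotated])
      then show "(\<lambda>i. g (z + ?e i *\<^sub>R w)) \<longlonglongrightarrow> g z" by simp
    qed
    show "AE w in lborel. norm (g (z + ?e n *\<^sub>R w) * b w) \<le> M * cmod (b w)" for n
      by (intro AE_I2) (auto simp: norm_mult intro!: mult_right_mono M simp del: norm_divide)
  qed auto
  have ball: "integrable lborel (\<lambda>w. L * (indicator (cball 0 R) w / cmod (w - z)))"
  proof (intro integrable_mult_right)
    obtain C where C: "\<And>R. 0 < R \<Longrightarrow>
      (\<integral>\<^sup>+ z. indicator (cball 0 R) z * ennreal (cmod z powr (- 1)) \<partial>lborel) \<le> ennreal (C * R powr (- 1 + 2))"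
      using nn_integral_powr_inside[of "- 1"] by auto
    have [measurable]: "cball (0::complex) r \<in> sets borel" for r by auto
    define Q where "Q = \<bar>R\<bar> + cmod z + 1"
    have "(\<integral>\<^sup>+ w. ennreal (norm (indicator (cball 0 R) w / cmod (w - z))) \<partial>lborel)
        \<le> (\<integral>\<^sup>+ w. indicator (cball 0 Q) (w - z) * ennreal (cmod (w - z) powr (- 1)) \<partial>lborel)"
    proof (intro nn_integral_mono)
      fix w
      have "cmod (w - z) \<le> cmod w + cmod z" by (rule norm_triangle_ineq4)
      then show "ennreal (norm (indicator (cball 0 R) w / cmod (w - z))) \<le> indicator (cball 0 Q) (w - z) * ennreal (cmod (w - z) powr (- 1))"
        by (auto simp: indicator_def Q_def powr_minus divide_inverse)
    qed
    also have "\<dots> = (\<integral>\<^sup>+ w. indicator (cball 0 Q) w * ennreal (cmod w powr (- 1)) \<partial>lborel)"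
      by (rule nn_integral_translate[where f="\<lambda>w. indicator (cball 0 Q) w * ennreal (cmod w powr (-1))"]) measurable
    also have "\<dots> \<le> ennreal (C * Q powr (- 1 + 2))"
      by (rule C) (simp add: Q_def add_nonneg_pos)
    also have "\<dots> < \<infinity>" by simp
    finally show "integrable lborel (\<lambda>w. indicator (cball 0 R) w / cmod (w - z))"
      by (intro integrableI_bounded) auto
  qed
  have rhs: "(\<lambda>n. LINT w|lborel. gb w * (cnj (w - z) / (of_real ((?e n)^2) + (w - z) * cnj (w - z))))
     \<longlonglongrightarrow> (LINT w|lborel. gb w / (w - z))"
  proof (rule integral_dominated_convergence[OF _ _ ball])
    have ae: "AE w in lborel. w \<noteq> z"
      using AE_lborel_singleton by blast
    have fact: "cmod (of_real ((?e n)^2) + (w - z) * cnj (w - z)) = (?e n)^2 + cmod (w - z)^2" for n w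
      unfolding complex_norm_square[symmetric] of_real_add[symmetric] norm_of_real by simp
    show "AE w in lborel. (\<lambda>n. gb w * (cnj (w - z) / (of_real ((?e n)^2) + (w - z) * cnj (w - z)))) \<longlonglongrightarrow> gb w / (w - z)"
      using ae
    proof eventually_elim
      case (elim w)
      have "(\<lambda>n. gb w * (cnj (w - z) / (of_real ((?e n)^2) + (w - z) * cnj (w - z)))) \<longlonglongrightarrow>
          gb w * (cnj (w - z) / (of_real (0^2) + (w - z) * cnj (w - z)))"
        by (intro tendsto_intros e0) (use elim in auto)
      then show ?case using elim by simp
    qed
    show "AE w in lborel. norm (gb w * (cnj (w - z) / (of_real ((?e n)^2) + (w - z) * cnj (w - z)))) \<le> L * (indicator (cball 0 R) w / cmod (w - z))" for n
      using ae
    proof eventually_elim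
      case (elim w)
      show ?case
      proof (cases "cmod w \<le> R")
        case True
        have p: "0 < cmod (w - z)" using elim by simp
        have "cmod (w - z) / ((?e n)^2 + cmod (w - z)^2) \<le> cmod (w - z) / (cmod (w - z)^2)"
          using p by (intro divide_left_mono mult_pos_pos add_nonneg_pos) auto
        also have "\<dots> = 1 / cmod (w - z)" using p by (simp add: power2_eq_square)
        finally have "cmod (gb w) * (cmod (w - z) / ((?e n)^2 + cmod (w - z)^2)) \<le> L * (1 / cmod (w - z))"
          using L L0 by (intro mult_mono) auto
        then show ?thesis using True by (simp only: norm_mult norm_divide fact complex_mod_cnj) simp
      next
        case False
        then show ?thesis using support_has_wd_zero[OF d R, where z=w] by simp
      qed
    qed
  qed auto
  have "(LINT w|lborel. g z * b w) = - (LINT w|lborel. gb w / (w - z))"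
  proof (rule LIMSEQ_unique[OF lhs])
    show "(\<lambda>n. LINT w|lborel. g (z + ?e n *\<^sub>R w) * b w) \<longlonglongrightarrow> - (LINT w|lborel. gb w / (w - z))"
      using tendsto_minus[OF rhs] by (subst key) simp_all
  qed
  moreover have "(LINT w|lborel. g z * b w) = g z * pompeiu_const"
    unfolding pompeiu_const_def b_def by (rule integral_mult_right_zero)
  ultimately show ?thesis by (simp add: mult.commute)
qed

section \<open>The Pompeiu formula with a singularity at the origin\<close>

lemma has_wd_quadratic_zero:
  assumes "\<forall>\<^sub>F x in nhds z. cmod (f x) \<le> K * cmod (x - z) ^ 2"
  shows "has_wd f 0 0 z"
proof -
  have f0: "f z = 0" using eventually_nhds_x_imp_x[OF assms] by simp
  have "((\<lambda>y. norm ((f y - f z) - (0 * (y - z) + 0 * cnj (y - z))) / norm (y - z)) \<longlongrightarrow> 0) (at z)"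
  proof (rule Lim_null_comparison[where g="\<lambda>y. K * cmod (y - z)"])
    have "\<forall>\<^sub>F x in at z. cmod (f x) \<le> K * cmod (x - z) ^ 2"
      using assms by (simp add: eventually_at_filter eventually_mono)
    moreover have "\<forall>\<^sub>F x in at z. x \<noteq> z" by (simp add: eventually_at_filter)
    ultimately show "\<forall>\<^sub>F x in at z. norm (norm ((f x - f z) - (0 * (x - z) + 0 * cnj (x - z))) / norm (x - z)) \<le> K * cmod (x - z)"
      by eventually_elim (simp add: f0 divide_le_eq power2_eq_square)
    have "((\<lambda>y. K * cmod (y - z)) \<longlongrightarrow> K * cmod (z - z)) (at z)" by (intro tendsto_intros)
    then show "((\<lambda>y. K * cmod (y - z)) \<longlongrightarrow> 0) (at z)" by simp
  qed
  then show ?thesis unfolding has_wd_def has_derivative_iff_norm by simp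
qed

lemma has_wd_power:
  assumes "has_wd f a b z"
  shows "has_wd (\<lambda>z. f z ^ m) (of_nat m * f z ^ (m - 1) * a) (of_nat m * f z ^ (m - 1) * b) z"
proof -
  have "((\<lambda>x. x ^ m) has_field_derivative of_nat m * f z ^ (m - 1)) (at (f z))"
    by (auto intro!: derivative_eq_intros)
  from has_wd_holo_compose[OF this assms] show ?thesis .
qed

text \<open>\<open>nn_integral_cauchy_kernel\<close> needs an exponent below -1. On a bounded
  support a larger exponent may be lowered to -3/2 at the cost of a power of
  \<open>R\<close>.\<close>

lemma integrable_cauchy_kernel:
  fixes f :: "complex \<Rightarrow> complex"
  assumes a: "- 2 < a" and fm: "f \<in> borel_measurable borel" and z: "z \<noteq> 0"
    and f: "\<And>w. w \<noteq> 0 \<Longrightarrow> cmod (f w) \<le> K * cmod w powr a" "\<And>w. R < cmod w \<Longrightarrow> f w = 0" and R: "0 < R"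
  shows "integrable lborel (\<lambda>w. f w / (w - z))"
proof -
  define a' where "a' = min a (- 3/2)"
  have a': "- 2 < a'" "a' < - 1" "a' \<le> a" using a by (auto simp: a'_def)
  obtain C where C: "\<And>z. z \<noteq> 0 \<Longrightarrow>
    (\<integral>\<^sup>+ w. ennreal (cmod w powr a' / cmod (w - z)) \<partial>lborel) \<le> ennreal (C * cmod z powr (a' + 1))"
    using nn_integral_cauchy_kernel[OF a'(1,2)] by blast
  define K' where "K' = \<bar>K\<bar> * R powr (a - a')"
  have K': "0 \<le> K'" by (simp add: K'_def)
  have bd: "cmod (f w) \<le> K' * cmod w powr a'" if "w \<noteq> 0" for w
  proof (cases "cmod w \<le> R")
    case True
    have "cmod (f w) \<le> \<bar>K\<bar> * cmod w powr a"
      using f(1)[OF that] by (meson abs_ge_self mult_right_mono order_trans powr_ge_zero)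
    also have "cmod w powr a = cmod w powr (a - a') * cmod w powr a'"
      using that by (simp add: powr_add[symmetric])
    also have "\<bar>K\<bar> * (cmod w powr (a - a') * cmod w powr a') \<le> \<bar>K\<bar> * (R powr (a - a') * cmod w powr a')"
      using True a' by (intro mult_left_mono mult_right_mono powr_mono2) auto
    finally show ?thesis by (simp add: K'_def mult.assoc)
  qed (use f(2)[of w] K' in simp)
  have "(\<integral>\<^sup>+ w. ennreal (cmod (f w / (w - z))) \<partial>lborel) \<le> (\<integral>\<^sup>+ w. ennreal K' * ennreal (cmod w powr a' / cmod (w - z)) \<partial>lborel)"
  proof (rule nn_integral_mono_AE)
    show "AE w in lborel. ennreal (cmod (f w / (w - z))) \<le> ennreal K' * ennreal (cmod w powr a' / cmod (w - z))"
      using AE_lborel_singleton[of "0::complex"]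
    proof eventually_elim
      case (elim w)
      have "cmod (f w / (w - z)) \<le> K' * (cmod w powr a' / cmod (w - z))"
        using divide_right_mono[OF bd[OF elim], of "cmod (w - z)"] by (simp add: norm_divide)
      then show ?case using K' by (subst ennreal_mult[symmetric]) (auto intro: ennreal_leI)
    qed
  qed
  also have "\<dots> = ennreal K' * (\<integral>\<^sup>+ w. ennreal (cmod w powr a' / cmod (w - z)) \<partial>lborel)"
    by (rule nn_integral_cmult) measurable
  also have "\<dots> < \<infinity>" using C[OF z] by (auto simp: ennreal_mult_less_top intro: le_less_trans)
  finally show ?thesis using fm by (intro integrableI_bounded) auto
qed

lemma powr_le_powr_add:
  assumes "0 < x" "x \<le> (R::real)" "a \<le> b"
  shows "x powr b \<le> R powr (b - a) * x powr a"
proof -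
  have "x powr b = x powr (b - a) * x powr a" using assms by (simp add: powr_add[symmetric])
  also have "\<dots> \<le> R powr (b - a) * x powr a" using assms by (intro mult_right_mono powr_mono2) auto
  finally show ?thesis .
qed

lemma cutoff_deriv_identity:
  fixes E :: complex
  assumes "E \<noteq> 0" "w \<noteq> 0"
  shows "m * q * (n * c / E^2) = m * (q * (n * (w * c) / E)) / (w * E)"
  using assms by (simp add: field_simps power2_eq_square)

text \<open>The origin is removed by the cutoffs (m |w|^2 / (1 + m |w|^2))^M with m = n + 1. They
  tend to 1 off the origin and vanish there to order 2 M, so their products with \<open>g\<close>
  have bounded derivatives and \<open>pompeiu_smooth\<close> applies. Uniformly in n the d-bar
  derivative of the cutoff is at most M / |w|, which leaves a majorant of order min s (c - 1) > -2.
  Hence the limit exists under the integral and no point mass at the origin survives.\<close>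

lemma pompeiu_singular:
  assumes d: "\<And>z. z \<noteq> 0 \<Longrightarrow> has_wd g (gz z) (gb z) z"
    and C: "\<And>z. z \<noteq> 0 \<Longrightarrow> cmod (g z) \<le> C * cmod z powr c" "- 1 < c"
    and D: "\<And>z. z \<noteq> 0 \<Longrightarrow> cmod (gz z) \<le> D * cmod z powr e"
    and B: "\<And>z. z \<noteq> 0 \<Longrightarrow> cmod (gb z) \<le> B * cmod z powr s" "- 2 < s"
    and R: "0 < R" "\<And>z. R < cmod z \<Longrightarrow> g z = 0"
    and gb0: "gb 0 = 0" and z: "z \<noteq> 0"
  shows "gb \<in> borel_measurable borel" "pompeiu_const * g z = - (LINT w|lborel. gb w / (w - z))"
proof -
  \<comment> \<open>A power that outweighs the growth of \<open>g\<close>, \<open>gz\<close> and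
    \<open>gb\<close> near 0. The additional 3 yields the quadratic vanishing of the product at
    0.\<close>
  define M where "M = nat \<lceil>3 + \<bar>c\<bar> + \<bar>e\<bar> + \<bar>s\<bar>\<rceil>"
  have M: "3 + \<bar>c\<bar> + \<bar>e\<bar> + \<bar>s\<bar> \<le> real M" unfolding M_def by linarith
  define N where "N = (\<lambda>n::nat. of_nat (Suc n) :: complex)"
  define p where "p = (\<lambda>n w. N n * (w * cnj w) / (1 + N n * (w * cnj w)))"
  define x where "x = (\<lambda>n w. p n w ^ M)"
  have Nw: "N n * (w * cnj w) = of_real (real (Suc n) * cmod w ^ 2)" for n w
    by (simp add: N_def del: of_nat_Suc flip: complex_norm_square)
  have den: "1 + N n * (w * cnj w) = of_real (1 + real (Suc n) * cmod w ^ 2)" for n w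
    by (simp add: Nw)
  have pos: "0 < 1 + real (Suc n) * cmod w ^ 2" for n w
    by (intro add_pos_nonneg mult_nonneg_nonneg) auto
  have den0: "1 + N n * (w * cnj w) \<noteq> 0" for n w
    unfolding den of_real_eq_0_iff using pos[of n w] by linarith
  have pe: "p n w = of_real (real (Suc n) * cmod w ^ 2 / (1 + real (Suc n) * cmod w ^ 2))" for n w
    unfolding p_def den by (simp only: Nw of_real_divide)
  have pn: "cmod (p n w) = real (Suc n) * cmod w ^ 2 / (1 + real (Suc n) * cmod w ^ 2)" for n w
    unfolding pe norm_of_real by (rule abs_of_nonneg) (intro divide_nonneg_nonneg add_nonneg_nonneg mult_nonneg_nonneg, auto)
  have p1: "cmod (p n w) \<le> 1" for n w
    unfolding pn using pos[of n w] by (subst divide_le_eq_1_pos) linarith+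
  have p2: "cmod (p n w) \<le> real (Suc n) * cmod w ^ 2" for n w
  proof -
    have "real (Suc n) * cmod w ^ 2 / (1 + real (Suc n) * cmod w ^ 2) \<le> real (Suc n) * cmod w ^ 2 / 1"
      using pos[of n w] by (intro divide_left_mono) (auto intro!: mult_nonneg_nonneg)
    then show ?thesis unfolding pn by simp
  qed
  \<comment> \<open>Both derivatives are expressed through the cutoff itself, divided by w or cnj w.
    In this form the bound M |x| / |w|, uniform in n, is visible.\<close>
  define xz where "xz = (\<lambda>n w. of_nat M * x n w / (w * (1 + N n * (w * cnj w))))"
  define xb where "xb = (\<lambda>n w. of_nat M * x n w / (cnj w * (1 + N n * (w * cnj w))))"
  have xd: "has_wd (x n) (xz n w) (xb n w) w" if w: "w \<noteq> 0" for n w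
  proof -
    have t: "has_wd (\<lambda>w. N n * (w * cnj w)) (N n * cnj w) (N n * w) w"
      by (rule has_wd_eqI[OF has_wd_mult[OF has_wd_const has_wd_mult[OF has_wd_ident has_wd_cnj[OF has_wd_ident]]]]) auto
    have t1: "has_wd (\<lambda>w. 1 + N n * (w * cnj w)) (N n * cnj w) (N n * w) w"
      by (rule has_wd_eqI[OF has_wd_add[OF has_wd_const t]]) auto
    have q: "has_wd (p n) (N n * cnj w / (1 + N n * (w * cnj w))^2) (N n * w / (1 + N n * (w * cnj w))^2) w"
      unfolding p_def
      by (rule has_wd_eqI[OF has_wd_divide[OF t t1 den0]]) (simp_all add: algebra_simps)
    have M1: "M = Suc (M - 1)" using M by linarith
    have pw: "p n w ^ M = p n w ^ (M - 1) * p n w" by (subst M1) (simp only: power_Suc mult.commute)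
    show ?thesis unfolding x_def
    proof (rule has_wd_eqI[OF has_wd_power[OF q]])
      show "of_nat M * p n w ^ (M - 1) * (N n * cnj w / (1 + N n * (w * cnj w))^2) = xz n w"
        unfolding xz_def x_def pw
        using cutoff_deriv_identity[OF den0 w, of "of_nat M" "p n w ^ (M - 1)" "N n" "cnj w" n w]
        by (simp only: p_def)
      show "of_nat M * p n w ^ (M - 1) * (N n * w / (1 + N n * (w * cnj w))^2) = xb n w"
        unfolding xb_def x_def pw
        using cutoff_deriv_identity[OF den0, of "cnj w" "of_nat M" "p n w ^ (M - 1)" "N n" w n w] w
        by (simp only: p_def mult.commute[of "cnj w" w] complex_cnj_zero_iff not_False_eq_True simp_thms)
    qed
  qed
  have x1: "cmod (x n w) \<le> 1" for n w
    unfolding x_def norm_power using p1 by (simp add: power_le_one)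
  have x2: "cmod (x n w) \<le> real (Suc n) ^ M * cmod w powr (2 * real M)" if "w \<noteq> 0" for n w
  proof -
    have "cmod (x n w) \<le> (real (Suc n) * cmod w ^ 2) ^ M"
      unfolding x_def norm_power by (intro power_mono p2) auto
    also have "\<dots> = real (Suc n) ^ M * cmod w powr (2 * real M)"
    proof -
      have "(cmod w ^ 2) ^ M = cmod w powr (2 * real M)"
        using powr_realpow[of "cmod w" "2 * M"] that by (simp add: power_mult)
      then show ?thesis by (simp only: power_mult_distrib)
    qed
    finally show ?thesis .
  qed
  have xbn: "cmod (xb n w) = real M * cmod (x n w) / (cmod w * (1 + real (Suc n) * cmod w ^ 2))" for n w
    unfolding xb_def norm_divide norm_mult den norm_of_real using pos[of n w] by simp
  have xzn: "cmod (xz n w) = cmod (xb n w)" for n w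
    unfolding xz_def xb_def norm_divide norm_mult complex_mod_cnj ..
  have xb1: "cmod (xb n w) \<le> real M * cmod (x n w) / cmod w" if "w \<noteq> 0" for n w
    unfolding xbn using that pos[of n w]
    by (intro divide_left_mono) (auto intro!: mult_nonneg_nonneg)
  define G where "G = (\<lambda>n w. x n w * g w)"
  define Gz where "Gz = (\<lambda>n w. if w = 0 then 0 else xz n w * g w + x n w * gz w)"
  define Gb where "Gb = (\<lambda>n w. if w = 0 then 0 else xb n w * g w + x n w * gb w)"
  have x0: "x n 0 = 0" for n using M by (simp add: x_def p_def)
  have Gd: "has_wd (G n) (Gz n w) (Gb n w) w" for n w
  proof (cases "w = 0")
    case False
    then show ?thesis unfolding G_def Gz_def Gb_def using has_wd_mult[OF xd d] by simp
  next
    case True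
    have "has_wd (G n) 0 0 0"
    proof (rule has_wd_quadratic_zero)
      have "\<forall>\<^sub>F w in nhds 0. w \<in> ball (0::complex) 1" by (rule eventually_nhds_in_open) auto
      then show "\<forall>\<^sub>F w in nhds 0. cmod (G n w) \<le> real (Suc n) ^ M * \<bar>C\<bar> * cmod (w - 0) ^ 2"
      proof eventually_elim
        case (elim w)
        show ?case
        proof (cases "w = 0")
          case False
          have "cmod (G n w) \<le> (real (Suc n) ^ M * cmod w powr (2 * real M)) * (\<bar>C\<bar> * cmod w powr c)"
            unfolding G_def norm_mult
            by (intro mult_mono x2 order_trans[OF C(1)] mult_right_mono) (use False in auto)
          also have "\<dots> = real (Suc n) ^ M * \<bar>C\<bar> * cmod w powr (2 * real M + c)"
            by (simp add: powr_add del: of_nat_Suc)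
          also have "\<dots> \<le> real (Suc n) ^ M * \<bar>C\<bar> * cmod w powr 2"
            using elim M C(2) by (intro mult_left_mono powr_mono') auto
          finally show ?thesis using False by (simp add: powr_numeral)
        qed (simp add: G_def x0)
      qed
    qed
    then show ?thesis using True by (simp add: Gz_def Gb_def)
  qed
  have GR: "G n w = 0" if "R < cmod w" for n w using R(2)[OF that] by (simp add: G_def)
  have gRz: "gz w = 0 \<and> gb w = 0" if "R < cmod w" for w
  proof -
    have "open {z. R < cmod z}" by (intro open_Collect_less continuous_intros)
    then have "\<forall>\<^sub>F x in nhds w. R < cmod x"
      using that eventually_nhds_in_open[of "{z. R < cmod z}" w] by simp
    then have ev: "\<forall>\<^sub>F x in nhds w. g x = 0" by eventually_elim (use R in auto)
    have "w \<noteq> 0" using that R by auto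
    then have "has_wd (\<lambda>_. 0) (gz w) (gb w) w" by (intro has_wd_transform[OF d ev])
    then show ?thesis using has_wd_unique[OF _ has_wd_const] by blast
  qed
  have powb: "cmod w powr t \<le> max 1 R powr t" if "w \<noteq> 0" "cmod w \<le> R" "0 \<le> t" for w t
    using that by (intro powr_mono2) auto
  have bnd: "\<exists>L. (\<forall>w. cmod (Gz n w) \<le> L) \<and> (\<forall>w. cmod (Gb n w) \<le> L)" for n
  proof -
    define Q where "Q = real (Suc n) ^ M"
    have Q: "0 \<le> Q" by (simp add: Q_def)
    define L where "L = (real M * Q * \<bar>C\<bar>) * max 1 R powr (2 * real M - 1 + c) + Q * \<bar>D\<bar> * max 1 R powr (2 * real M + e)
       + Q * \<bar>B\<bar> * max 1 R powr (2 * real M + s)"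
    have L0: "0 \<le> L" unfolding L_def using Q by (intro add_nonneg_nonneg mult_nonneg_nonneg) auto
    have "cmod (Gz n w) \<le> L \<and> cmod (Gb n w) \<le> L" for w
    proof (cases "w = 0 \<or> R < cmod w")
      case True
      then show ?thesis using L0 R(2)[of w] gRz[of w] by (auto simp: Gz_def Gb_def)
    next
      case False
      then have w: "w \<noteq> 0" "cmod w \<le> R" by auto
      have x2': "cmod (x n w) \<le> Q * cmod w powr (2 * real M)" using x2[OF w(1)] by (simp add: Q_def del: of_nat_Suc)
      have 1: "cmod (xb n w * g w) \<le> (real M * Q * \<bar>C\<bar>) * max 1 R powr (2 * real M - 1 + c)"
      proof -
        have "cmod (xb n w) \<le> real M * (Q * cmod w powr (2 * real M)) / cmod w"
          by (intro order_trans[OF xb1[OF w(1)]] divide_right_mono mult_left_mono x2') auto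
        also have "\<dots> = real M * Q * cmod w powr (2 * real M - 1)"
          using w by (simp add: powr_diff)
        finally have "cmod (xb n w * g w) \<le> (real M * Q * cmod w powr (2 * real M - 1)) * (\<bar>C\<bar> * cmod w powr c)"
          unfolding norm_mult
          by (intro mult_mono order_trans[OF C(1)] mult_right_mono) (use w Q in auto)
        also have "\<dots> = (real M * Q * \<bar>C\<bar>) * cmod w powr (2 * real M - 1 + c)" by (simp add: powr_add)
        also have "\<dots> \<le> (real M * Q * \<bar>C\<bar>) * max 1 R powr (2 * real M - 1 + c)"
          using M Q w C(2) by (intro mult_left_mono powb) auto
        finally show ?thesis .
      qed
      have 2: "cmod (x n w * y) \<le> Q * \<bar>D'\<bar> * max 1 R powr (2 * real M + t)"
        if y: "cmod y \<le> D' * cmod w powr t" and t: "\<bar>t\<bar> \<le> real M" for y D' t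
      proof -
        have "cmod (x n w * y) \<le> (Q * cmod w powr (2 * real M)) * (\<bar>D'\<bar> * cmod w powr t)"
          unfolding norm_mult
          by (intro mult_mono x2' order_trans[OF y] mult_right_mono) (use w Q in auto)
        also have "\<dots> = Q * \<bar>D'\<bar> * cmod w powr (2 * real M + t)" by (simp add: powr_add)
        also have "\<dots> \<le> Q * \<bar>D'\<bar> * max 1 R powr (2 * real M + t)"
          using t Q w by (intro mult_left_mono powb) auto
        finally show ?thesis .
      qed
      have 3: "cmod (x n w * gz w) \<le> Q * \<bar>D\<bar> * max 1 R powr (2 * real M + e)"
        using M by (intro 2 D w) auto
      have 4: "cmod (x n w * gb w) \<le> Q * \<bar>B\<bar> * max 1 R powr (2 * real M + s)"
        using M by (intro 2 B w) auto
      have "cmod (xz n w * g w) = cmod (xb n w * g w)" unfolding norm_mult xzn ..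
      moreover have "0 \<le> Q * \<bar>D\<bar> * max 1 R powr (2 * real M + e)" "0 \<le> Q * \<bar>B\<bar> * max 1 R powr (2 * real M + s)"
        using Q by auto
      moreover have "cmod (Gz n w) \<le> cmod (xz n w * g w) + cmod (x n w * gz w)"
        "cmod (Gb n w) \<le> cmod (xb n w * g w) + cmod (x n w * gb w)"
        unfolding Gz_def Gb_def using w(1) norm_triangle_ineq by auto
      ultimately show ?thesis
        using 1 3 4 unfolding L_def by linarith
    qed
    then show ?thesis by blast
  qed
  have Gpomp: "pompeiu_const * G n z = - (LINT w|lborel. Gb n w / (w - z))" for n
  proof -
    obtain L where "\<forall>w. cmod (Gz n w) \<le> L" "\<forall>w. cmod (Gb n w) \<le> L" using bnd by blast
    then show ?thesis by (intro pompeiu_smooth[OF Gd, of n L R]) (auto simp: GR)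
  qed
  have Gbm: "Gb n \<in> borel_measurable borel" for n by (rule has_wd_measurable(2)[OF Gd])
  have qlim: "(\<lambda>n. inverse (1 + real (Suc n) * cmod w ^ 2)) \<longlonglongrightarrow> 0" if "w \<noteq> 0" for w
  proof -
    have "filterlim (\<lambda>n. real (Suc n)) at_top sequentially"
      by (rule filterlim_compose[OF filterlim_real_sequentially filterlim_Suc])
    then have "filterlim (\<lambda>n. real (Suc n) * cmod w ^ 2) at_top sequentially"
      using that unfolding mult.commute[of _ "cmod w ^ 2"]
      by (intro filterlim_tendsto_pos_mult_at_top[OF tendsto_const]) auto
    then have "filterlim (\<lambda>n. 1 + real (Suc n) * cmod w ^ 2) at_top sequentially"
      by (rule filterlim_tendsto_add_at_top[OF tendsto_const])
    then show ?thesis by (rule tendsto_inverse_0_at_top)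
  qed
  have plim: "(\<lambda>n. p n w) \<longlonglongrightarrow> 1" if "w \<noteq> 0" for w
  proof -
    have "p n w = 1 - of_real (inverse (1 + real (Suc n) * cmod w ^ 2))" for n
    proof -
      have "y / (1 + y) = 1 - inverse (1 + y)" if "0 < 1 + y" for y :: real
        using that by (simp add: field_simps)
      from this[OF pos[of n w]] show ?thesis unfolding pe by (simp only: of_real_diff of_real_1)
    qed
    moreover have "(\<lambda>n. 1 - complex_of_real (inverse (1 + real (Suc n) * cmod w ^ 2))) \<longlonglongrightarrow> 1 - of_real 0"
      by (intro tendsto_intros qlim that)
    ultimately show ?thesis by simp
  qed
  have xlim: "(\<lambda>n. x n w) \<longlonglongrightarrow> 1" if "w \<noteq> 0" for w
    using tendsto_power[OF plim[OF that], of M] by (simp add: x_def)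
  have xblim: "(\<lambda>n. xb n w) \<longlonglongrightarrow> 0" if "w \<noteq> 0" for w
  proof (rule Lim_null_comparison)
    show "\<forall>\<^sub>F n in sequentially. norm (xb n w) \<le> real M / cmod w * inverse (1 + real (Suc n) * cmod w ^ 2)"
    proof (intro always_eventually allI)
      fix n
      have "cmod (xb n w) \<le> real M * 1 / (cmod w * (1 + real (Suc n) * cmod w ^ 2))"
        unfolding xbn using pos[of n w] by (intro divide_right_mono mult_left_mono x1) auto
      then show "norm (xb n w) \<le> real M / cmod w * inverse (1 + real (Suc n) * cmod w ^ 2)"
        by (simp add: divide_inverse mult.assoc del: of_nat_Suc)
    qed
    show "(\<lambda>n. real M / cmod w * inverse (1 + real (Suc n) * cmod w ^ 2)) \<longlonglongrightarrow> 0"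
      using tendsto_mult_left[OF qlim[OF that], of "real M / cmod w"] by simp
  qed
  \<comment> \<open>The convergence holds at every point: at 0 both sides are 0 by
    \<open>gb0\<close>. This is what makes \<open>gb\<close> measurable as a limit.\<close>
  have Gblim: "(\<lambda>n. Gb n w) \<longlonglongrightarrow> gb w" for w
  proof (cases "w = 0")
    case False
    have "(\<lambda>n. xb n w * g w + x n w * gb w) \<longlonglongrightarrow> 0 * g w + 1 * gb w"
      by (intro tendsto_intros xlim xblim False)
    then show ?thesis using False by (simp add: Gb_def)
  qed (simp add: Gb_def gb0)
  show gbm: "gb \<in> borel_measurable borel"
    by (rule borel_measurable_LIMSEQ_metric[OF Gbm Gblim])
  define a where "a = min s (c - 1)"
  have a: "- 2 < a" "a \<le> s" "a \<le> c - 1" using B C by (auto simp: a_def)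
  define K where "K = real M * \<bar>C\<bar> * R powr (c - 1 - a) + \<bar>B\<bar> * R powr (s - a)"
  have K0: "0 \<le> K" by (simp add: K_def)
  have Gbb: "cmod (Gb n w) \<le> K * cmod w powr a" if w: "w \<noteq> 0" for n w
  proof (cases "cmod w \<le> R")
    case True
    have "cmod (xb n w * g w) \<le> (real M * 1 / cmod w) * (\<bar>C\<bar> * cmod w powr c)"
      unfolding norm_mult
      by (intro mult_mono order_trans[OF C(1)] mult_right_mono order_trans[OF xb1[OF w]] divide_right_mono mult_left_mono x1) (use w in auto)
    also have "\<dots> = real M * \<bar>C\<bar> * cmod w powr (c - 1)" using w by (simp add: powr_diff)
    also have "\<dots> \<le> real M * \<bar>C\<bar> * (R powr (c - 1 - a) * cmod w powr a)"
      using w True a by (intro mult_left_mono powr_le_powr_add) auto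
    finally have 1: "cmod (xb n w * g w) \<le> real M * \<bar>C\<bar> * R powr (c - 1 - a) * cmod w powr a" by (simp add: mult.assoc)
    have "cmod (x n w * gb w) \<le> 1 * (\<bar>B\<bar> * cmod w powr s)"
      unfolding norm_mult
      by (intro mult_mono order_trans[OF B(1)] mult_right_mono x1) (use w in auto)
    also have "\<dots> = \<bar>B\<bar> * cmod w powr s" by simp
    also have "\<dots> \<le> \<bar>B\<bar> * (R powr (s - a) * cmod w powr a)"
      using w True a by (intro mult_left_mono powr_le_powr_add) auto
    finally have 2: "cmod (x n w * gb w) \<le> \<bar>B\<bar> * R powr (s - a) * cmod w powr a" by (simp add: mult.assoc)
    show ?thesis using norm_triangle_mono[OF 1 2] w by (simp add: Gb_def K_def algebra_simps)
  next
    case False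
    then show ?thesis using K0 R(2)[of w] gRz[of w] by (simp add: Gb_def)
  qed
  have Gb0: "Gb n w = 0" if "R < cmod w" for n w
    using that R(2)[of w] gRz[of w] by (simp add: Gb_def)
  define W where "W = (\<lambda>w::complex. if cmod w \<le> R \<and> w \<noteq> 0 then complex_of_real (K * cmod w powr a) else 0)"
  have Wm: "W \<in> borel_measurable borel" unfolding W_def by measurable
  have "integrable lborel (\<lambda>w. W w / (w - z))"
    by (rule integrable_cauchy_kernel[OF a(1) Wm z _ _ R(1), where K="\<bar>K\<bar>"]) (auto simp: W_def abs_mult norm_mult)
  then have Wi: "integrable lborel (\<lambda>w. cmod (W w / (w - z)))" by (rule integrable_norm)
  have "(\<lambda>n. LINT w|lborel. Gb n w / (w - z)) \<longlonglongrightarrow> (LINT w|lborel. gb w / (w - z))"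
  proof (rule integral_dominated_convergence[OF _ _ Wi])
    show "(\<lambda>w. gb w / (w - z)) \<in> borel_measurable lborel" using gbm by measurable
    show "(\<lambda>w. Gb n w / (w - z)) \<in> borel_measurable lborel" for n using Gbm[of n] by measurable
    show "AE w in lborel. (\<lambda>n. Gb n w / (w - z)) \<longlonglongrightarrow> gb w / (w - z)"
      unfolding divide_inverse by (intro AE_I2 tendsto_mult_right Gblim)
    show "AE w in lborel. norm (Gb n w / (w - z)) \<le> cmod (W w / (w - z))" for n
    proof (intro AE_I2)
      fix w
      have "cmod (Gb n w) \<le> cmod (W w)"
        using Gbb[of w n] Gb0[of w n] K0 by (cases "w = 0") (auto simp: W_def Gb_def not_le abs_mult norm_mult)
      then show "norm (Gb n w / (w - z)) \<le> cmod (W w / (w - z))"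
        unfolding norm_divide by (rule divide_right_mono) simp
    qed
  qed
  from tendsto_minus[OF this]
  have "(\<lambda>n. pompeiu_const * G n z) \<longlonglongrightarrow> - (LINT w|lborel. gb w / (w - z))" by (simp add: Gpomp)
  moreover have "(\<lambda>n. pompeiu_const * G n z) \<longlonglongrightarrow> pompeiu_const * (1 * g z)"
    unfolding G_def by (intro tendsto_intros xlim z)
  ultimately show "pompeiu_const * g z = - (LINT w|lborel. gb w / (w - z))"
    using LIMSEQ_unique by fastforce
qed

section \<open>Orders of growth at the origin\<close>

text \<open>The comparison function is complex valued, exactly as in the theorem, so that the final
  expansions are obtained by unfolding.\<close>

definition Ob :: "real \<Rightarrow> (complex \<Rightarrow> complex) \<Rightarrow> bool" where
  "Ob c f \<longleftrightarrow> f \<in> O[at 0](\<lambda>z. of_real (cmod z powr c))"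

lemma Ob_iff: "Ob c f \<longleftrightarrow> (\<exists>C. \<forall>\<^sub>F z in at 0. cmod (f z) \<le> C * cmod z powr c)"
proof
  assume "Ob c f"
  then show "\<exists>C. \<forall>\<^sub>F z in at 0. cmod (f z) \<le> C * cmod z powr c"
    unfolding Ob_def by (auto elim!: landau_o.bigE)
next
  assume "\<exists>C. \<forall>\<^sub>F z in at 0. cmod (f z) \<le> C * cmod z powr c"
  then obtain C where "\<forall>\<^sub>F z in at 0. cmod (f z) \<le> C * cmod z powr c" by blast
  then show "Ob c f" unfolding Ob_def by (intro bigoI[of _ C]) simp
qed

lemma ObI: "\<forall>\<^sub>F z in at 0. cmod (f z) \<le> C * cmod z powr c \<Longrightarrow> Ob c f"
  unfolding Ob_iff by blast

lemma ObE:
  assumes "Ob c f"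
  obtains C where "0 < C" "\<forall>\<^sub>F z in at 0. cmod (f z) \<le> C * cmod z powr c"
proof -
  obtain C where "\<forall>\<^sub>F z in at 0. cmod (f z) \<le> C * cmod z powr c" using assms Ob_iff by blast
  then have "\<forall>\<^sub>F z in at 0. cmod (f z) \<le> max C 1 * cmod z powr c"
    by eventually_elim (meson max.cobounded1 mult_right_mono order_trans powr_ge_zero)
  then show thesis using that[of "max C 1"] by auto
qed

lemma eventually_at_0_lt: "0 < r \<Longrightarrow> \<forall>\<^sub>F z in at (0::complex). 0 < cmod z \<and> cmod z < r"
  by (auto simp: eventually_at intro!: exI[of _ r])

lemma eventually_at_0_D:
  assumes "\<forall>\<^sub>F z in at (0::complex). P z"
  shows "\<exists>r>0. \<forall>z. z \<noteq> 0 \<longrightarrow> cmod z < r \<longrightarrow> P z"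
  using assms by (auto simp: eventually_at)

lemma Ob_bounded:
  assumes "Ob c f" "\<forall>\<^sub>F z in at 0. cmod (g z) \<le> K * cmod (f z)"
  shows "Ob c g"
proof -
  obtain C where "0 < C" "\<forall>\<^sub>F z in at 0. cmod (f z) \<le> C * cmod z powr c" using ObE[OF assms(1)] .
  from this(2) assms(2) have "\<forall>\<^sub>F z in at 0. cmod (g z) \<le> (\<bar>K\<bar> * C) * cmod z powr c"
  proof eventually_elim
    case (elim z)
    have "cmod (g z) \<le> \<bar>K\<bar> * cmod (f z)" using elim(2) by (meson abs_ge_self mult_right_mono norm_ge_zero order_trans)
    also have "\<dots> \<le> \<bar>K\<bar> * (C * cmod z powr c)" by (intro mult_left_mono elim) auto
    finally show ?case by (simp add: mult.assoc)
  qed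
  then show ?thesis by (rule ObI)
qed

lemma Ob_cong:
  assumes "Ob c f" "\<forall>\<^sub>F z in at 0. f z = g z"
  shows "Ob c g"
  by (rule Ob_bounded[OF assms(1), where K=1]) (use assms(2) in \<open>auto elim: eventually_mono\<close>)

lemma Ob_mult:
  assumes "Ob a f" "Ob b g" shows "Ob (a + b) (\<lambda>z. f z * g z)"
proof -
  obtain C where "0 < C" and f: "\<forall>\<^sub>F z in at 0. cmod (f z) \<le> C * cmod z powr a" using ObE[OF assms(1)] .
  obtain D where "0 < D" and g: "\<forall>\<^sub>F z in at 0. cmod (g z) \<le> D * cmod z powr b" using ObE[OF assms(2)] .
  from f g have "\<forall>\<^sub>F z in at 0. cmod (f z * g z) \<le> (C * D) * cmod z powr (a + b)"
  proof eventually_elim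
    case (elim z)
    have "cmod (f z * g z) \<le> (C * cmod z powr a) * (D * cmod z powr b)"
      unfolding norm_mult using elim \<open>0 < C\<close> by (intro mult_mono) auto
    then show ?case by (simp add: powr_add mult_ac)
  qed
  then show ?thesis by (rule ObI)
qed

lemma Ob_mono:
  assumes "Ob a f" "b \<le> a" shows "Ob b f"
proof -
  obtain C where "0 < C" and f: "\<forall>\<^sub>F z in at 0. cmod (f z) \<le> C * cmod z powr a" using ObE[OF assms(1)] .
  from f eventually_at_0_lt[OF zero_less_one] have "\<forall>\<^sub>F z in at 0. cmod (f z) \<le> C * cmod z powr b"
  proof eventually_elim
    case (elim z)
    have "cmod z powr a \<le> cmod z powr b" using elim assms by (intro powr_mono') auto
    then show ?case using elim \<open>0 < C\<close> by (meson mult_left_mono less_imp_le order_trans)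
  qed
  then show ?thesis by (rule ObI)
qed

lemma Ob_multI: "Ob a f \<Longrightarrow> Ob b g \<Longrightarrow> c \<le> a + b \<Longrightarrow> Ob c (\<lambda>z. f z * g z)"
  using Ob_mono[OF Ob_mult] by blast

lemma Ob_add:
  assumes "Ob c f" "Ob c g" shows "Ob c (\<lambda>z. f z + g z)"
  using assms unfolding Ob_def by (rule sum_in_bigo)

lemma Ob_diff:
  assumes "Ob c f" "Ob c g" shows "Ob c (\<lambda>z. f z - g z)"
  using assms unfolding Ob_def by (rule sum_in_bigo)

lemma Ob_minus: "Ob c f \<Longrightarrow> Ob c (\<lambda>z. - f z)"
  by (erule Ob_bounded[where K=1]) simp

lemma Ob_cnj: "Ob c f \<Longrightarrow> Ob c (\<lambda>z. cnj (f z))"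
  by (erule Ob_bounded[where K=1]) simp

lemma Ob_const: "c \<le> 0 \<Longrightarrow> Ob c (\<lambda>z. k)"
proof -
  assume "c \<le> 0"
  have "Ob 0 (\<lambda>z. k)"
    by (rule ObI[where C="cmod k"]) (auto simp: eventually_at intro!: exI[of _ 1])
  then show "Ob c (\<lambda>z. k)" using Ob_mono \<open>c \<le> 0\<close> by blast
qed

lemma Ob_cmult: "Ob c f \<Longrightarrow> Ob c (\<lambda>z. k * f z)"
  by (erule Ob_bounded[where K="cmod k"]) (simp add: norm_mult)

lemma Ob_powr: "Ob c (\<lambda>z. of_real (cmod z powr c))"
  unfolding Ob_def by simp

lemma Ob_power: "Ob (real n) (\<lambda>z. z ^ n)"
proof (rule ObI[where C=1])
  show "\<forall>\<^sub>F z in at 0. cmod (z ^ n) \<le> 1 * cmod z powr real n"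
    using eventually_at_0_lt[OF zero_less_one] by eventually_elim (simp add: norm_power powr_realpow)
qed

lemma Ob_ident: "Ob 1 (\<lambda>z. z)"
  using Ob_power[of 1] by simp

lemma Ob_inverse_ident: "Ob (-1) (\<lambda>z. 1 / z)"
  by (rule ObI[where C=1]) (simp add: norm_divide powr_minus norm_inverse divide_inverse)

lemma Ob_tendsto_0:
  assumes "Ob c f" "0 < c" shows "(f \<longlongrightarrow> 0) (at 0)"
proof -
  obtain C where "0 < C" and f: "\<forall>\<^sub>F z in at 0. cmod (f z) \<le> C * cmod z powr c" using ObE[OF assms(1)] .
  show ?thesis
  proof (rule Lim_null_comparison[OF f])
    have "((\<lambda>x. C * cmod x powr c) \<longlongrightarrow> C * cmod 0 powr c) (at 0)"
      using assms(2) by (intro tendsto_intros tendsto_powr') auto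
    then show "((\<lambda>x. C * cmod x powr c) \<longlongrightarrow> 0) (at 0)" by simp
  qed
qed

lemma tendsto_Ob_0:
  assumes "(f \<longlongrightarrow> l) (at 0)" shows "Ob 0 f"
proof -
  have "((\<lambda>z. cmod (f z)) \<longlongrightarrow> cmod l) (at 0)" by (intro tendsto_intros assms)
  then have "\<forall>\<^sub>F z in at 0. cmod (f z) < cmod l + 1" by (rule order_tendstoD) simp
  with eventually_at_0_lt[OF zero_less_one]
  have "\<forall>\<^sub>F z in at 0. cmod (f z) \<le> (cmod l + 1) * cmod z powr 0" by eventually_elim simp
  then show ?thesis by (rule ObI)
qed

section \<open>Expansion of solutions of an inhomogeneous \<open>\<partial>\<close>-bar equation\<close>

text \<open>With \<open>z\<close> outside the support, the factor w - z can be inserted and divided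
  out again, which reduces plain integrability to the case of the Cauchy kernel.\<close>

lemma integrable_powr_support:
  fixes f :: "complex \<Rightarrow> complex"
  assumes a: "- 2 < a" and fm: "f \<in> borel_measurable borel"
    and f: "\<And>w. w \<noteq> 0 \<Longrightarrow> cmod (f w) \<le> K * cmod w powr a" "\<And>w. R < cmod w \<Longrightarrow> f w = 0" and R: "0 < R"
  shows "integrable lborel f"
proof -
  define z where "z = complex_of_real (R + 1)"
  have z: "z \<noteq> 0" "R < cmod z" "cmod z = R + 1" using R by (auto simp: z_def simp del: of_real_add)
  have "integrable lborel (\<lambda>w. (f w * (w - z)) / (w - z))"
  proof (rule integrable_cauchy_kernel[OF a _ z(1) _ _ R])
    show "(\<lambda>w. f w * (w - z)) \<in> borel_measurable borel" using fm by measurable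
    show "cmod (f w * (w - z)) \<le> \<bar>K\<bar> * (R + (R + 1)) * cmod w powr a" if w: "w \<noteq> 0" for w
    proof (cases "cmod w \<le> R")
      case True
      have "cmod (w - z) \<le> R + (R + 1)" using norm_triangle_ineq4[of w z] True z by linarith
      then have "cmod (f w * (w - z)) \<le> (\<bar>K\<bar> * cmod w powr a) * (R + (R + 1))"
        unfolding norm_mult by (intro mult_mono order_trans[OF f(1)[OF w]] mult_right_mono) auto
      then show ?thesis by (simp add: mult_ac)
    qed (use f(2)[of w] R in simp)
  qed (use f(2) in auto)
  moreover have "(f w * (w - z)) / (w - z) = f w" for w
    using f(2)[OF z(2)] by (cases "w = z") auto
  ultimately show ?thesis by simp
qed

lemma cauchy_kernel_expand:
  fixes w z :: complex
  assumes "w \<noteq> 0" "w \<noteq> z"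
  shows "1 / (w - z) = (\<Sum>j<k. z ^ j / w ^ Suc j) + (z ^ k / w ^ k) / (w - z)"
proof (induction k)
  case (Suc k)
  have "(z ^ k / w ^ k) / (w - z) = z ^ k / w ^ Suc k + (z ^ Suc k / w ^ Suc k) / (w - z)"
    using assms by (simp add: field_simps)
  then show ?case using Suc by (simp only: sum.lessThan_Suc add.assoc)
qed simp

text \<open>Subtracting from 1 / (w - z) its first \<open>k\<close> terms in powers of z / w leaves
  the kernel times (z / w)^k. The two conditions on s - k place the remaining weight |w|^(s-k) in
  the range of \<open>nn_integral_cauchy_kernel\<close>; they exclude integer \<open>s\<close>,
  where logarithms could appear. The moments of \<open>gb\<close> that form the coefficients
  converge because s - (j + 1) \<ge> s - k > -2 for j < k.\<close>

lemma pompeiu_expansion: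
  assumes d: "\<And>z. z \<noteq> 0 \<Longrightarrow> has_wd g (gz z) (gb z) z"
    and C: "\<And>z. z \<noteq> 0 \<Longrightarrow> cmod (g z) \<le> C * cmod z powr c" "- 1 < c"
    and D: "\<And>z. z \<noteq> 0 \<Longrightarrow> cmod (gz z) \<le> D * cmod z powr e"
    and B: "\<And>z. z \<noteq> 0 \<Longrightarrow> cmod (gb z) \<le> B * cmod z powr s" "- 2 < s - real k" "s - real k < - 1"
    and R: "0 < R" "\<And>z. R < cmod z \<Longrightarrow> g z = 0" "\<And>z. R < cmod z \<Longrightarrow> gb z = 0"
    and gb0: "gb 0 = 0"
  shows "\<exists>a. Ob (s + 1) (\<lambda>z. g z - (\<Sum>j<k. a j * z ^ j))"
proof -
  have s2: "- 2 < s" using B(2) by linarith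
  note P = pompeiu_singular[where g=g and gz=gz and gb=gb, OF d C D B(1) s2 R(1,2) gb0]
  have gm: "gb \<in> borel_measurable borel" using P(1)[of 1] by simp
  have P2: "pompeiu_const * g z = - (LINT w|lborel. gb w / (w - z))" if "z \<noteq> 0" for z
    by (rule P(2)) (use that in auto)
  let ?m = "\<lambda>j. LINT w|lborel. gb w / w ^ Suc j"
  obtain K where K: "\<And>z. z \<noteq> 0 \<Longrightarrow>
    (\<integral>\<^sup>+ w. ennreal (cmod w powr (s - real k) / cmod (w - z)) \<partial>lborel) \<le> ennreal (K * cmod z powr (s - real k + 1))"
    using nn_integral_cauchy_kernel[OF B(2,3)] by blast
  have B0: "cmod (gb w / w ^ j) \<le> \<bar>B\<bar> * cmod w powr (s - real j)" if "w \<noteq> 0" for w j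
  proof -
    have "cmod (gb w / w ^ j) \<le> (\<bar>B\<bar> * cmod w powr s) / cmod w ^ j"
      unfolding norm_divide norm_power
      by (intro divide_right_mono order_trans[OF B(1)[OF that]] mult_right_mono) auto
    then show ?thesis using that by (simp add: powr_diff powr_realpow)
  qed
  have im: "integrable lborel (\<lambda>w. gb w / w ^ Suc j)" if "j < k" for j
  proof (rule integrable_powr_support[where a="s - real (Suc j)" and K="\<bar>B\<bar>" and R=R])
    show "- 2 < s - real (Suc j)" using that B(2) by linarith
    show "(\<lambda>w. gb w / w ^ Suc j) \<in> borel_measurable borel" using gm by measurable
  qed (use R(1) R(3) in \<open>simp_all add: B0 del: power_Suc of_nat_Suc\<close>)
  have ik: "integrable lborel (\<lambda>w. (gb w / w ^ k) / (w - z))" if "z \<noteq> 0" for z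
  proof (rule integrable_cauchy_kernel[OF B(2) _ that, where K="\<bar>B\<bar>" and R=R])
    show "(\<lambda>w. gb w / w ^ k) \<in> borel_measurable borel" using gm by measurable
  qed (use B0 R in auto)
  have kb: "cmod (LINT w|lborel. (gb w / w ^ k) / (w - z)) \<le> \<bar>B\<bar> * \<bar>K\<bar> * cmod z powr (s - real k + 1)" if z: "z \<noteq> 0" for z
  proof -
    have "ennreal (cmod (LINT w|lborel. (gb w / w ^ k) / (w - z))) \<le> (\<integral>\<^sup>+ w. ennreal (cmod ((gb w / w ^ k) / (w - z))) \<partial>lborel)"
      by (rule integral_norm_bound_ennreal[OF ik[OF z]])
    also have "\<dots> \<le> (\<integral>\<^sup>+ w. ennreal \<bar>B\<bar> * ennreal (cmod w powr (s - real k) / cmod (w - z)) \<partial>lborel)"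
    proof (rule nn_integral_mono_AE)
      show "AE w in lborel. ennreal (cmod ((gb w / w ^ k) / (w - z))) \<le> ennreal \<bar>B\<bar> * ennreal (cmod w powr (s - real k) / cmod (w - z))"
        using AE_lborel_singleton[of "0::complex"]
      proof eventually_elim
        case (elim w)
        have "cmod ((gb w / w ^ k) / (w - z)) \<le> \<bar>B\<bar> * (cmod w powr (s - real k) / cmod (w - z))"
          using divide_right_mono[OF B0[OF elim, of k], of "cmod (w - z)"] by (simp add: norm_divide norm_mult)
        then show ?case by (subst ennreal_mult[symmetric]) (auto intro: ennreal_leI)
      qed
    qed
    also have "\<dots> = ennreal \<bar>B\<bar> * (\<integral>\<^sup>+ w. ennreal (cmod w powr (s - real k) / cmod (w - z)) \<partial>lborel)"
      by (rule nn_integral_cmult) measurable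
    also have "\<dots> \<le> ennreal \<bar>B\<bar> * ennreal (\<bar>K\<bar> * cmod z powr (s - real k + 1))"
      by (intro mult_left_mono order_trans[OF K[OF z]] ennreal_leI mult_right_mono) auto
    also have "\<dots> = ennreal (\<bar>B\<bar> * \<bar>K\<bar> * cmod z powr (s - real k + 1))"
      by (simp add: ennreal_mult[symmetric] mult.assoc)
    finally show ?thesis by (subst (asm) ennreal_le_iff) auto
  qed
  let ?a = "\<lambda>j. - ?m j / pompeiu_const"
  have expand: "g z - (\<Sum>j<k. ?a j * z ^ j) = - (z ^ k * (LINT w|lborel. (gb w / w ^ k) / (w - z))) / pompeiu_const" if z: "z \<noteq> 0" for z
  proof -
    have "(LINT w|lborel. gb w / (w - z)) = (LINT w|lborel. (\<Sum>j<k. z ^ j * (gb w / w ^ Suc j)) + z ^ k * ((gb w / w ^ k) / (w - z)))"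
    proof (rule integral_cong_AE)
      show "AE w in lborel. gb w / (w - z) = (\<Sum>j<k. z ^ j * (gb w / w ^ Suc j)) + z ^ k * ((gb w / w ^ k) / (w - z))"
        using AE_lborel_singleton[of "0::complex"] AE_lborel_singleton[of z]
      proof eventually_elim
        case (elim w)
        have "gb w / (w - z) = gb w * (1 / (w - z))" by simp
        also have "\<dots> = gb w * ((\<Sum>j<k. z ^ j / w ^ Suc j) + (z ^ k / w ^ k) / (w - z))"
          by (subst cauchy_kernel_expand[OF elim, of k]) rule
        also have "\<dots> = (\<Sum>j<k. z ^ j * (gb w / w ^ Suc j)) + z ^ k * ((gb w / w ^ k) / (w - z))"
          by (simp add: distrib_left sum_distrib_left mult_ac)
        finally show ?case .
      qed
    qed (use gm in measurable)
    also have "\<dots> = (LINT w|lborel. (\<Sum>j<k. z ^ j * (gb w / w ^ Suc j))) + (LINT w|lborel. z ^ k * ((gb w / w ^ k) / (w - z)))"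
      by (intro Bochner_Integration.integral_add Bochner_Integration.integrable_sum integrable_mult_right im ik z) auto
    also have "(LINT w|lborel. (\<Sum>j<k. z ^ j * (gb w / w ^ Suc j))) = (\<Sum>j<k. z ^ j * ?m j)"
      by (subst Bochner_Integration.integral_sum) (auto intro!: integrable_mult_right im simp del: power_Suc times_divide_eq_right)
    also have "(LINT w|lborel. z ^ k * ((gb w / w ^ k) / (w - z))) = z ^ k * (LINT w|lborel. (gb w / w ^ k) / (w - z))"
      by (rule integral_mult_right_zero)
    finally have "pompeiu_const * g z = - ((\<Sum>j<k. z ^ j * ?m j) + z ^ k * (LINT w|lborel. (gb w / w ^ k) / (w - z)))"
      using P2[OF z] by simp
    then have "g z = - ((\<Sum>j<k. z ^ j * ?m j) + z ^ k * (LINT w|lborel. (gb w / w ^ k) / (w - z))) / pompeiu_const"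
      using pompeiu_const_nz by (metis nonzero_mult_div_cancel_left)
    moreover have "(\<Sum>j<k. ?a j * z ^ j) = - (\<Sum>j<k. z ^ j * ?m j) / pompeiu_const"
      by (simp add: sum_divide_distrib sum_negf[symmetric] mult.commute del: power_Suc)
    ultimately have "g z - (\<Sum>j<k. ?a j * z ^ j) = - ((\<Sum>j<k. z ^ j * ?m j) + z ^ k * (LINT w|lborel. (gb w / w ^ k) / (w - z))) / pompeiu_const
       - (- (\<Sum>j<k. z ^ j * ?m j) / pompeiu_const)" by (simp only:)
    also have "\<dots> = - (z ^ k * (LINT w|lborel. (gb w / w ^ k) / (w - z))) / pompeiu_const"
      by (simp only: diff_divide_distrib[symmetric] minus_add_distrib diff_minus_eq_add) simp
    finally show ?thesis .
  qed
  have "Ob (s + 1) (\<lambda>z. g z - (\<Sum>j<k. ?a j * z ^ j))"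
  proof (rule ObI)
    show "\<forall>\<^sub>F z in at 0. cmod (g z - (\<Sum>j<k. ?a j * z ^ j)) \<le> (\<bar>B\<bar> * \<bar>K\<bar> / cmod pompeiu_const) * cmod z powr (s + 1)"
      using eventually_at_0_lt[OF zero_less_one]
    proof eventually_elim
      case (elim z)
      then have z: "z \<noteq> 0" by auto
      have "cmod (g z - (\<Sum>j<k. ?a j * z ^ j)) = cmod z ^ k * cmod (LINT w|lborel. (gb w / w ^ k) / (w - z)) / cmod pompeiu_const"
        unfolding expand[OF z] by (simp only: norm_mult norm_divide norm_power norm_minus_cancel)
      also have "\<dots> \<le> cmod z ^ k * (\<bar>B\<bar> * \<bar>K\<bar> * cmod z powr (s - real k + 1)) / cmod pompeiu_const"
        by (intro divide_right_mono mult_left_mono kb z) auto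
      also have "\<dots> = (\<bar>B\<bar> * \<bar>K\<bar> / cmod pompeiu_const) * (cmod z powr real k * cmod z powr (s - real k + 1))"
        using z by (simp add: powr_realpow)
      also have "cmod z powr real k * cmod z powr (s - real k + 1) = cmod z powr (s + 1)"
        by (simp add: powr_add[symmetric])
      finally show ?case .
    qed
  qed
  then show ?thesis by (rule exI[of _ ?a])
qed

text \<open>\<open>Y\<close> is cut off by (1 - |z|^2 / R^2)^2 inside the disc of radius
  \<open>R\<close>. The square makes the extension by zero differentiable across the circle. At the
  origin the cutoff is 1 + O(|z|^2), so removing it costs an error of order c + 2, which is at least
  s + 1. Of \<open>Yz\<close> only some polynomial bound is asked.\<close>

theorem dbar_expansion:
  assumes ev: "\<forall>\<^sub>F z in at 0. has_wd Y (Yz z) (F z) z"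
    and Y: "Ob c Y" "- 1 < c" and Yz: "Ob d Yz" and F: "Ob s F"
    and s: "s \<le> c + 1" "- 2 < s - real k" "s - real k < - 1"
  shows "\<exists>a. Ob (s + 1) (\<lambda>z. Y z - (\<Sum>j<k. a j * z ^ j))"
proof -
  obtain C where C: "0 < C" "\<forall>\<^sub>F z in at 0. cmod (Y z) \<le> C * cmod z powr c" using ObE[OF Y(1)] .
  obtain D where D: "0 < D" "\<forall>\<^sub>F z in at 0. cmod (Yz z) \<le> D * cmod z powr d" using ObE[OF Yz] .
  obtain B where B: "0 < B" "\<forall>\<^sub>F z in at 0. cmod (F z) \<le> B * cmod z powr s" using ObE[OF F] .
  have "\<forall>\<^sub>F z in at 0. has_wd Y (Yz z) (F z) z \<and> cmod (Y z) \<le> C * cmod z powr c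
      \<and> cmod (Yz z) \<le> D * cmod z powr d \<and> cmod (F z) \<le> B * cmod z powr s"
    using ev C(2) D(2) B(2) by eventually_elim blast
  from eventually_at_0_D[OF this] obtain r where r: "0 < r" and
    *: "\<And>z. z \<noteq> 0 \<Longrightarrow> cmod z < r \<Longrightarrow> has_wd Y (Yz z) (F z) z \<and> cmod (Y z) \<le> C * cmod z powr c
      \<and> cmod (Yz z) \<le> D * cmod z powr d \<and> cmod (F z) \<le> B * cmod z powr s"
    by blast
  define R where "R = r / 2"
  have R: "0 < R" "R < r" using r by (auto simp: R_def)
  define h where "h = (\<lambda>z. 1 - z * cnj z / of_real (R^2))"
  have hn: "h z = of_real (1 - cmod z ^ 2 / R^2)" for z
    unfolding h_def by (simp flip: complex_norm_square)
  have h1: "cmod (h z) \<le> 1" if "cmod z \<le> R" for z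
  proof -
    have "cmod z ^ 2 \<le> R ^ 2" using that by (intro power_mono) auto
    then have "cmod z ^ 2 / R^2 \<le> 1" using R by simp
    then show ?thesis unfolding hn norm_of_real by simp
  qed
  define hz where "hz = (\<lambda>z. 2 * h z * (- cnj z / of_real (R^2)))"
  define hb where "hb = (\<lambda>z. 2 * h z * (- z / of_real (R^2)))"
  have hd: "has_wd (\<lambda>z. h z ^ 2) (hz z) (hb z) z" for z
  proof -
    have "has_wd h (- cnj z / of_real (R^2)) (- z / of_real (R^2)) z"
      unfolding h_def divide_inverse
      by (rule has_wd_eqI[OF has_wd_diff[OF has_wd_const has_wd_mult[OF has_wd_mult[OF has_wd_ident has_wd_cnj[OF has_wd_ident]] has_wd_const]]]) auto
    from has_wd_power[OF this, of 2] show ?thesis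
      by (rule has_wd_eqI) (simp_all add: hz_def hb_def)
  qed
  have hb1: "cmod (hb z) \<le> 2 / R^2 * cmod z" "cmod (hz z) \<le> 2 / R^2 * cmod z" if "cmod z \<le> R" for z
  proof -
    have "2 * cmod (h z) * (cmod z / R^2) \<le> 2 * 1 * (cmod z / R^2)"
      by (intro mult_right_mono mult_left_mono h1 that) auto
    then show "cmod (hb z) \<le> 2 / R^2 * cmod z" "cmod (hz z) \<le> 2 / R^2 * cmod z"
      unfolding hb_def hz_def by (simp_all add: norm_mult norm_divide norm_power)
  qed
  define P where "P = (\<lambda>z. z \<noteq> 0 \<and> cmod z < R)"
  define g where "g = (\<lambda>z. if P z then h z ^ 2 * Y z else 0)"
  define gz where "gz = (\<lambda>z. if P z then hz z * Y z + h z ^ 2 * Yz z else 0)"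
  define gb where "gb = (\<lambda>z. if P z then hb z * Y z + h z ^ 2 * F z else 0)"
  have opP: "open {z. P z}" unfolding P_def
    by (intro open_Collect_conj open_Collect_less open_Collect_neq continuous_intros)
  have gd: "has_wd g (gz z) (gb z) z" if z: "z \<noteq> 0" for z
  proof -
    consider "cmod z < R" | "R < cmod z" | "cmod z = R" by linarith
    then show ?thesis
    proof cases
      case 1
      then have Pz: "P z" using z by (simp add: P_def)
      have "has_wd (\<lambda>z. h z ^ 2 * Y z) (gz z) (gb z) z"
        by (rule has_wd_eqI[OF has_wd_mult[OF hd]]) (use *[of z] z 1 R Pz in \<open>auto simp: gz_def gb_def\<close>)
      moreover have "\<forall>\<^sub>F x in nhds z. P x" using eventually_nhds_in_open[OF opP, of z] Pz by simp
      then have "\<forall>\<^sub>F x in nhds z. h x ^ 2 * Y x = g x" by eventually_elim (simp add: g_def)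
      ultimately show ?thesis by (rule has_wd_transform)
    next
      case 2
      have "open {z. R < cmod z}" by (intro open_Collect_less continuous_intros)
      then have "\<forall>\<^sub>F x in nhds z. R < cmod x" using 2 eventually_nhds_in_open[of "{z. R < cmod z}" z] by simp
      then have "\<forall>\<^sub>F x in nhds z. 0 = g x" by eventually_elim (simp add: g_def P_def)
      from has_wd_transform[OF has_wd_const this] show ?thesis using 2 by (simp add: gz_def gb_def P_def)
    next
      case 3
      \<comment> \<open>Near a point z of the circle |h(x)| is at most 2 |x - z| / R, so the square
        of \<open>h\<close> vanishes quadratically there.\<close>
      have "has_wd g 0 0 z"
      proof (rule has_wd_quadratic_zero)
        have "\<forall>\<^sub>F x in nhds z. x \<in> ball z (R/2)" using R by (intro eventually_nhds_in_open) auto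
        then show "\<forall>\<^sub>F x in nhds z. cmod (g x) \<le> ((2/R)^2 * (C * max (R powr c) ((R/2) powr c))) * cmod (x - z) ^ 2"
        proof eventually_elim
          case (elim x)
          show ?case
          proof (cases "P x")
            case True
            then have x: "x \<noteq> 0" "cmod x < R" by (auto simp: P_def)
            have dz: "R - cmod x \<le> cmod (x - z)" using norm_triangle_ineq2[of z x] 3 by (simp add: norm_minus_commute)
            have "cmod (x - z) < R / 2" using elim by (simp add: dist_norm norm_minus_commute)
            then have x2: "R / 2 \<le> cmod x" using dz by simp
            have "cmod (h x) = (R - cmod x) * (R + cmod x) / R^2"
            proof -
              have "cmod x ^ 2 \<le> R ^ 2" using x by (intro power_mono) auto
              then have "cmod x ^ 2 / R^2 \<le> 1" using R by simp
              then have "cmod (h x) = 1 - cmod x ^ 2 / R^2" unfolding hn norm_of_real by simp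
              also have "\<dots> = (R - cmod x) * (R + cmod x) / R^2" using R by (simp add: field_simps power2_eq_square)
              finally show ?thesis .
            qed
            also have "\<dots> \<le> cmod (x - z) * (2 * R) / R^2"
              using x dz by (intro divide_right_mono mult_mono) (auto intro: add_nonneg_nonneg less_imp_le[OF R(1)])
            also have "\<dots> = 2 / R * cmod (x - z)" using R by (simp add: power2_eq_square)
            finally have hx: "cmod (h x) \<le> 2 / R * cmod (x - z)" .
            have "cmod x powr c \<le> max (R powr c) ((R/2) powr c)"
            proof (cases "0 \<le> c")
              case True
              then have "cmod x powr c \<le> R powr c" using x by (intro powr_mono2) auto
              then show ?thesis by simp
            next
              case False
              then have "cmod x powr c \<le> (R/2) powr c" using x2 R by (intro powr_mono2') auto
              then show ?thesis by simp
            qed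
            then have "cmod (Y x) \<le> C * max (R powr c) ((R/2) powr c)"
              using *[of x] x R C(1) by (meson less_trans less_imp_le mult_left_mono order_trans)
            then have "cmod (h x) ^ 2 * cmod (Y x) \<le> (2 / R * cmod (x - z)) ^ 2 * (C * max (R powr c) ((R/2) powr c))"
              using hx by (intro mult_mono power_mono) auto
            then show ?thesis using True by (simp add: g_def norm_mult norm_power power_mult_distrib mult_ac power_divide)
          qed (use C(1) in \<open>auto simp: g_def le_max_iff_disj intro!: mult_nonneg_nonneg\<close>)
        qed
      qed
      then show ?thesis using 3 by (simp add: gz_def gb_def P_def)
    qed
  qed
  have h2: "cmod (h z ^ 2) \<le> 1" if "cmod z \<le> R" for z
    using h1[OF that] by (simp add: norm_power power_le_one)
  have 1: "cmod (g z) \<le> C * cmod z powr c" if z: "z \<noteq> 0" for z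
  proof (cases "P z")
    case True
    then have zz: "cmod z < R" by (simp add: P_def)
    have "cmod (h z ^ 2) * cmod (Y z) \<le> 1 * (C * cmod z powr c)"
      using *[of z] z zz R by (intro mult_mono h2) auto
    then show ?thesis using True by (simp add: g_def norm_mult)
  qed (use C(1) in \<open>simp add: g_def\<close>)
  \<comment> \<open>One estimate serves both derivatives: the derivative of the cutoff is O(|z|),
    its product with \<open>Y\<close> has order c + 1, and the two orders are lowered to a common
    \<open>t\<close>.\<close>
  have gen: "cmod (k z * Y z + h z ^ 2 * H) \<le> (2 / R^2 * C * R powr (c + 1 - t) + B' * R powr (t' - t)) * cmod z powr t"
    if "P z" "cmod (k z) \<le> 2 / R^2 * cmod z" "cmod H \<le> B' * cmod z powr t'" "t \<le> c + 1" "t \<le> t'" "0 \<le> B'" for k H B' t t' z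
  proof -
    have zz: "z \<noteq> 0" "cmod z < R" using that by (auto simp: P_def)
    have "cmod (k z * Y z) \<le> (2 / R^2 * cmod z) * (C * cmod z powr c)"
      unfolding norm_mult using *[of z] zz R that by (intro mult_mono) auto
    also have "\<dots> = 2 / R^2 * C * cmod z powr (c + 1)" using zz by (simp add: powr_add)
    also have "\<dots> \<le> 2 / R^2 * C * (R powr (c + 1 - t) * cmod z powr t)"
      using zz C(1) that by (intro mult_left_mono powr_le_powr_add) auto
    finally have i: "cmod (k z * Y z) \<le> 2 / R^2 * C * R powr (c + 1 - t) * cmod z powr t" by (simp add: mult.assoc)
    have "cmod (h z ^ 2 * H) \<le> 1 * (B' * cmod z powr t')"
      unfolding norm_mult[of "h z ^ 2"] using zz that by (intro mult_mono h2) auto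
    also have "\<dots> = B' * cmod z powr t'" by simp
    also have "\<dots> \<le> B' * (R powr (t' - t) * cmod z powr t)"
      using zz that by (intro mult_left_mono powr_le_powr_add) auto
    finally have ii: "cmod (h z ^ 2 * H) \<le> B' * R powr (t' - t) * cmod z powr t" by (simp add: mult.assoc)
    show ?thesis using norm_triangle_mono[OF i ii] by (simp add: algebra_simps)
  qed
  define e where "e = min d (c + 1)"
  have 2: "cmod (gz z) \<le> (2 / R^2 * C * R powr (c + 1 - e) + D * R powr (d - e)) * cmod z powr e" if z: "z \<noteq> 0" for z
  proof (cases "P z")
    case True
    then have zz: "cmod z < R" by (simp add: P_def)
    have "cmod (hz z * Y z + h z ^ 2 * Yz z) \<le> (2 / R^2 * C * R powr (c + 1 - e) + D * R powr (d - e)) * cmod z powr e"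
      by (rule gen[where k=hz and z=z, OF True hb1(2)[where z=z]]) (use *[of z] z zz R D(1) in \<open>auto simp: e_def\<close>)
    then show ?thesis using True by (simp add: gz_def)
  qed (use C(1) D(1) in \<open>simp add: gz_def\<close>)
  have 3: "cmod (gb z) \<le> (2 / R^2 * C * R powr (c + 1 - s) + B * R powr (s - s)) * cmod z powr s" if z: "z \<noteq> 0" for z
  proof (cases "P z")
    case True
    then have zz: "cmod z < R" by (simp add: P_def)
    have "cmod (hb z * Y z + h z ^ 2 * F z) \<le> (2 / R^2 * C * R powr (c + 1 - s) + B * R powr (s - s)) * cmod z powr s"
      by (rule gen[where k=hb and z=z, OF True hb1(1)[where z=z]]) (use *[of z] z zz R B(1) s in auto)
    then show ?thesis using True by (simp add: gb_def)
  qed (use C(1) B(1) in \<open>simp add: gb_def\<close>)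
  obtain a where a: "Ob (s + 1) (\<lambda>z. g z - (\<Sum>j<k. a j * z ^ j))"
    using pompeiu_expansion[OF gd 1 Y(2) 2 3 s(2,3) R(1)] by (auto simp: g_def gb_def P_def)
  have b: "Ob (s + 1) (\<lambda>z. (1 - h z ^ 2) * Y z)"
  proof (rule Ob_multI[OF _ Y(1)])
    show "s + 1 \<le> 2 + c" using s by simp
    show "Ob 2 (\<lambda>z. 1 - h z ^ 2)"
    proof (rule ObI[where C="2 / R^2"])
      show "\<forall>\<^sub>F z in at 0. cmod (1 - h z ^ 2) \<le> 2 / R^2 * cmod z powr 2"
        using eventually_at_0_lt[OF R(1)]
      proof eventually_elim
        case (elim z)
        have "1 - h z ^ 2 = (1 + h z) * (1 - h z)" by (simp add: power2_eq_square algebra_simps)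
        moreover have "cmod (1 + h z) \<le> 2" using h1[of z] elim norm_triangle_ineq[of 1 "h z"] by simp
        moreover have "cmod (1 - h z) = cmod z ^ 2 / R^2" by (simp add: h_def norm_mult norm_divide norm_power power2_eq_square)
        ultimately have "cmod (1 - h z ^ 2) \<le> 2 * (cmod z ^ 2 / R^2)"
          by (simp add: norm_mult mult_right_mono del: times_divide_eq_right)
        then show ?case using elim by (simp add: powr_numeral)
      qed
    qed
  qed
  have "Ob (s + 1) (\<lambda>z. (g z - (\<Sum>j<k. a j * z ^ j)) + (1 - h z ^ 2) * Y z)"
    by (rule Ob_add[OF a b])
  then have "Ob (s + 1) (\<lambda>z. Y z - (\<Sum>j<k. a j * z ^ j))"
  proof (rule Ob_cong)
    show "\<forall>\<^sub>F z in at 0. (g z - (\<Sum>j<k. a j * z ^ j)) + (1 - h z ^ 2) * Y z = Y z - (\<Sum>j<k. a j * z ^ j)"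
      using eventually_at_0_lt[OF R(1)] by eventually_elim (auto simp: g_def P_def algebra_simps)
  qed
  then show ?thesis by blast
qed

section \<open>First order asymptotics\<close>

lemma eventually_compose_at:
  "filterlim U (at 0) (at 0) \<Longrightarrow> \<forall>\<^sub>F w in at 0. P w \<Longrightarrow> \<forall>\<^sub>F z in at 0. P (U z)"
  by (simp add: filterlim_iff)

text \<open>|U| must be comparable to |z| from both sides, since \<open>c\<close> may have either
  sign.\<close>

lemma Ob_compose:
  assumes g: "Ob c g" and U: "filterlim U (at 0) (at 0)"
    and lo: "0 < k" "\<forall>\<^sub>F z in at 0. k * cmod z \<le> cmod (U z)"
    and hi: "\<forall>\<^sub>F z in at 0. cmod (U z) \<le> k' * cmod z"
  shows "Ob c (\<lambda>z. g (U z))"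
proof -
  obtain C where C: "0 < C" "\<forall>\<^sub>F z in at 0. cmod (g z) \<le> C * cmod z powr c" using ObE[OF g] .
  show ?thesis
  proof (rule ObI)
    show "\<forall>\<^sub>F z in at 0. cmod (g (U z)) \<le> (C * max (k powr c) (k' powr c)) * cmod z powr c"
      using eventually_compose_at[OF U C(2)] lo(2) hi eventually_at_0_lt[OF zero_less_one]
    proof eventually_elim
      case (elim z)
      have z: "0 < cmod z" using elim by simp
      have "0 < k * cmod z" using lo(1) z by simp
      also have "k * cmod z \<le> k' * cmod z" using elim by linarith
      finally have k': "0 < k'" using z by (simp add: zero_less_mult_iff)
      have "cmod (U z) powr c \<le> max (k powr c) (k' powr c) * cmod z powr c"
      proof (cases "0 \<le> c")
        case True
        have "cmod (U z) powr c \<le> (k' * cmod z) powr c" using True elim by (intro powr_mono2) auto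
        also have "\<dots> = k' powr c * cmod z powr c" using k' by (simp add: powr_mult)
        also have "\<dots> \<le> max (k powr c) (k' powr c) * cmod z powr c" by (intro mult_right_mono) auto
        finally show ?thesis .
      next
        case False
        have "cmod (U z) powr c \<le> (k * cmod z) powr c" using False elim z lo by (intro powr_mono2') auto
        also have "\<dots> = k powr c * cmod z powr c" using lo by (simp add: powr_mult)
        also have "\<dots> \<le> max (k powr c) (k' powr c) * cmod z powr c" by (intro mult_right_mono) auto
        finally show ?thesis .
      qed
      then have "C * cmod (U z) powr c \<le> C * (max (k powr c) (k' powr c) * cmod z powr c)"
        using C(1) by (intro mult_left_mono) auto
      with elim(1) show ?case by (simp add: mult.assoc)
    qed
  qed
qed

lemma derivative_local_Lipschitz:
  fixes h :: "'a::real_normed_field \<Rightarrow> 'a"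
  assumes "(h has_field_derivative D) (at t)"
  shows "\<forall>\<^sub>F x in nhds t. norm (h x - h t) \<le> (norm D + 1) * norm (x - t)"
proof -
  have "((\<lambda>x. (h x - h t) / (x - t)) \<longlongrightarrow> D) (at t)" using assms by (simp add: has_field_derivative_iff)
  then have "((\<lambda>x. norm ((h x - h t) / (x - t))) \<longlongrightarrow> norm D) (at t)" by (rule tendsto_norm)
  then have "\<forall>\<^sub>F x in at t. norm ((h x - h t) / (x - t)) < norm D + 1" by (rule order_tendstoD) simp
  then have "\<forall>\<^sub>F x in at t. norm (h x - h t) \<le> (norm D + 1) * norm (x - t)"
    unfolding eventually_at_filter
    by eventually_elim (auto simp: norm_divide divide_less_eq)
  then show ?thesis
    unfolding eventually_at_filter by eventually_elim auto
qed

lemma Ob_function: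
  assumes h: "(h has_field_derivative D) (at t)" and f: "Ob c (\<lambda>z. f z - t)" "0 < c"
  shows "Ob c (\<lambda>z. h (f z) - h t)"
proof (rule Ob_bounded[OF f(1)])
  have "((\<lambda>z. f z - t) \<longlongrightarrow> 0) (at 0)" by (rule Ob_tendsto_0[OF f])
  then have "(f \<longlongrightarrow> t) (at 0)" by (rule LIM_zero_cancel)
  from eventually_compose_filterlim[OF derivative_local_Lipschitz[OF h] this]
  show "\<forall>\<^sub>F z in at 0. cmod (h (f z) - h t) \<le> (norm D + 1) * cmod (f z - t)" .
qed

lemma Ob_real_function:
  fixes h :: "real \<Rightarrow> real"
  assumes h: "(h has_field_derivative D) (at t)" and f: "Ob c (\<lambda>z. of_real (f z - t))" "0 < c"
  shows "Ob c (\<lambda>z. of_real (h (f z) - h t))"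
proof (rule Ob_bounded[OF f(1)])
  have "((\<lambda>z. complex_of_real (f z - t)) \<longlongrightarrow> 0) (at 0)" by (rule Ob_tendsto_0[OF f])
  then have "((\<lambda>z. f z - t) \<longlongrightarrow> 0) (at 0)"
    using tendsto_of_real_iff[where c=0] by fastforce
  then have "(f \<longlongrightarrow> t) (at 0)" by (rule LIM_zero_cancel)
  from eventually_compose_filterlim[OF derivative_local_Lipschitz[OF h] this]
  show "\<forall>\<^sub>F z in at 0. cmod (of_real (h (f z) - h t)) \<le> (norm D + 1) * cmod (of_real (f z - t))"
    by (simp only: norm_of_real real_norm_def)
qed

lemma Ob_1_of_approx: "Ob d (\<lambda>z. f z - k) \<Longrightarrow> 0 \<le> d \<Longrightarrow> Ob 0 f"
  using Ob_add[OF Ob_mono[of d "\<lambda>z. f z - k" 0] Ob_const[of 0 k]] by simp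

text \<open>A leading term with relative error of order \<open>d\<close>. The profile
  \<open>h\<close> is kept explicitly because its phase matters: |z|^g / z and |z|^g / cnj z have
  the same size but different d-bar primitives.\<close>

definition lead :: "real \<Rightarrow> real \<Rightarrow> (complex \<Rightarrow> complex) \<Rightarrow> complex \<Rightarrow> (complex \<Rightarrow> complex) \<Rightarrow> bool" where
  "lead d c h k f \<longleftrightarrow> Ob c h \<and> Ob (c + d) (\<lambda>z. f z - k * h z)"

lemma lead_Ob: "lead d c h k f \<Longrightarrow> 0 \<le> d \<Longrightarrow> Ob c f"
proof -
  assume a: "lead d c h k f" "0 \<le> d"
  have "Ob c (\<lambda>z. (f z - k * h z) + k * h z)"
    using a by (intro Ob_add Ob_cmult) (auto simp: lead_def intro: Ob_mono)
  then show ?thesis by simp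
qed

lemma lead_mult:
  assumes "lead d c h k f" "lead d c' h' k' f'" "0 \<le> d"
  shows "lead d (c + c') (\<lambda>z. h z * h' z) (k * k') (\<lambda>z. f z * f' z)"
proof -
  have "Ob (c + c' + d) (\<lambda>z. (f z - k * h z) * f' z + k * (h z * (f' z - k' * h' z)))"
    using assms lead_Ob[OF assms(2,3)] unfolding lead_def
    by (intro Ob_add Ob_cmult) (auto intro: Ob_multI)
  then have "Ob (c + c' + d) (\<lambda>z. f z * f' z - k * k' * (h z * h' z))"
    by (simp add: algebra_simps)
  then show ?thesis using assms unfolding lead_def by (auto intro: Ob_mult)
qed

lemma lead_cnj: "lead d c h k f \<Longrightarrow> lead d c (\<lambda>z. cnj (h z)) (cnj k) (\<lambda>z. cnj (f z))"
  unfolding lead_def using Ob_cnj by fastforce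

lemma lead_cong: "lead d c h k f \<Longrightarrow> \<forall>\<^sub>F z in at 0. f z = g z \<Longrightarrow> lead d c h k g"
  unfolding lead_def by (auto elim!: Ob_cong eventually_mono)

lemma lead_const: "0 \<le> d \<Longrightarrow> Ob d (\<lambda>z. f z - k) \<Longrightarrow> lead d 0 (\<lambda>_. 1) k f"
  unfolding lead_def by (auto intro: Ob_const)

lemma lead_small: "Ob (c + d) f \<Longrightarrow> Ob c h \<Longrightarrow> lead d c h 0 f"
  unfolding lead_def by simp

lemma lead_add: "lead d c h k f \<Longrightarrow> lead d c h k' f' \<Longrightarrow> lead d c h (k + k') (\<lambda>z. f z + f' z)"
  unfolding lead_def by (auto simp: algebra_simps dest!: Ob_add[of "c + d" "\<lambda>z. f z - k * h z"])

lemma lead_cmult: "lead d c h k f \<Longrightarrow> lead d c h (m * k) (\<lambda>z. m * f z)"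
  unfolding lead_def using Ob_cmult[of "c + d" "\<lambda>z. f z - k * h z" m] by (simp add: algebra_simps)

lemma Ob_inverse:
  assumes "Ob d (\<lambda>z. f z - k)" "k \<noteq> 0" "0 < d"
  shows "Ob d (\<lambda>z. inverse (f z) - inverse k)"
  by (rule Ob_function[OF DERIV_inverse[OF assms(2)] assms(1,3)])

section \<open>Isolated singularities of holomorphic germs\<close>

lemma holo_extend0:
  assumes h: "\<forall>\<^sub>F z in at 0. has_wd h (h' z) 0 z" and b: "Ob c h" "- 1 < c"
  obtains h0 where "Ob 1 (\<lambda>z. h z - h0)" "Ob 0 h'"
proof -
  from eventually_at_0_D[OF h] obtain r where r: "0 < r" and d: "\<And>z. z \<noteq> 0 \<Longrightarrow> cmod z < r \<Longrightarrow> has_wd h (h' z) 0 z"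
    by blast
  have hol: "h holomorphic_on ball 0 r - {0}"
    unfolding holomorphic_on_def
  proof
    fix x :: complex assume "x \<in> ball 0 r - {0}"
    then have "(h has_field_derivative h' x) (at x)" using d[of x] by (simp add: has_wd_field)
    then show "h field_differentiable (at x within ball 0 r - {0})"
      unfolding field_differentiable_def using has_field_derivative_at_within by blast
  qed
  have "Ob (1 + c) (\<lambda>z. (z - 0) * h z)" using Ob_mult[OF Ob_ident b(1)] by simp
  then have "((\<lambda>z. (z - 0) * h z) \<longlongrightarrow> 0) (at 0)" by (rule Ob_tendsto_0) (use b in simp)
  then obtain H where H: "H holomorphic_on ball 0 r" "\<And>z. z \<in> ball 0 r - {0} \<Longrightarrow> H z = h z"
    using holomorphic_on_extend_lim[of h "ball 0 r" 0] hol r by auto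
  have evH: "\<forall>\<^sub>F z in at 0. h z = H z \<and> h' z = deriv H z"
    using eventually_at_0_lt[OF r]
  proof eventually_elim
    case (elim z)
    have "(H has_field_derivative deriv H z) (at z)"
      using H(1) elim holomorphic_derivI[of H "ball 0 r" z] by auto
    then have 1: "has_wd H (deriv H z) 0 z" by (simp add: has_wd_field)
    have "\<forall>\<^sub>F x in nhds z. x \<in> ball 0 r - {0}" using elim by (intro eventually_nhds_in_open) auto
    then have "\<forall>\<^sub>F x in nhds z. H x = h x" by eventually_elim (use H in auto)
    from has_wd_transform[OF 1 this] have "has_wd h (deriv H z) 0 z" .
    then show ?case using has_wd_unique[OF d[of z]] elim H(2)[of z] by auto
  qed
  have Hd: "(H has_field_derivative deriv H 0) (at 0)"
    using H(1) r holomorphic_derivI[of H "ball 0 r" 0] by auto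
  have "Ob 1 (\<lambda>z. H z - H 0)"
    by (rule Ob_function[OF Hd]) (use Ob_ident in auto)
  then have 1: "Ob 1 (\<lambda>z. h z - H 0)" by (rule Ob_cong) (use evH in \<open>auto elim: eventually_mono\<close>)
  have "deriv H holomorphic_on ball 0 r" using H(1) by (intro holomorphic_deriv) auto
  then have "isCont (deriv H) 0"
    using r holomorphic_on_imp_continuous_on continuous_on_interior[of "ball 0 r" "deriv H" 0] by auto
  then have "Ob 0 (deriv H)" by (intro tendsto_Ob_0[of _ "deriv H 0"]) (simp add: isCont_def)
  then have 2: "Ob 0 h'" by (rule Ob_cong) (use evH in \<open>auto elim: eventually_mono\<close>)
  show thesis by (rule that[OF 1 2])
qed

text \<open>Multiplication by \<open>z\<close> reduces a simple pole to the removable case, and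
  differentiating the product gives the order of \<open>h'\<close> as well.\<close>

lemma holo_extend1:
  assumes h: "\<forall>\<^sub>F z in at 0. has_wd h (h' z) 0 z" and b: "Ob c h" "- 2 < c"
  obtains h0 where "Ob 0 (\<lambda>z. h z - h0 * (1 / z))" "Ob (- 2) h'"
proof -
  let ?k = "\<lambda>z. z * h z" and ?k' = "\<lambda>z. h z + z * h' z"
  have k: "\<forall>\<^sub>F z in at 0. has_wd ?k (?k' z) 0 z"
    using h by eventually_elim (rule has_wd_eqI[OF has_wd_mult[OF has_wd_ident]], auto)
  have kb: "Ob (1 + c) ?k" by (rule Ob_mult[OF Ob_ident b(1)])
  have c1: "- 1 < 1 + c" using b by simp
  obtain h0 where h0: "Ob 1 (\<lambda>z. ?k z - h0)" "Ob 0 ?k'"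
    by (rule holo_extend0[OF k kb c1])
  have "Ob 0 (\<lambda>z. (1 / z) * (?k z - h0))" by (rule Ob_multI[OF Ob_inverse_ident h0(1)]) simp
  then have 1: "Ob 0 (\<lambda>z. h z - h0 * (1 / z))"
    by (rule Ob_cong) (use eventually_at_0_lt[OF zero_less_one] in \<open>auto elim!: eventually_mono simp: field_simps\<close>)
  have "Ob (- 1) (\<lambda>z. (h z - h0 * (1 / z)) + h0 * (1 / z))"
    by (intro Ob_add Ob_cmult Ob_inverse_ident) (use 1 Ob_mono in force)
  then have hb: "Ob (- 1) h" by simp
  have "Ob (- 2) (\<lambda>z. (1 / z) * (?k' z - h z))"
    by (rule Ob_multI[OF Ob_inverse_ident Ob_diff[OF Ob_mono[OF h0(2)] hb]]) auto
  then have 2: "Ob (- 2) h'"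
  proof (rule Ob_cong)
    show "\<forall>\<^sub>F z in at 0. (1 / z) * (?k' z - h z) = h' z"
      using eventually_at_0_lt[OF zero_less_one] by eventually_elim auto
  qed
  show thesis by (rule that[OF 1 2])
qed

section \<open>Logarithm and powers of the modulus\<close>

lemma Ln_norm_square: "z \<noteq> 0 \<Longrightarrow> Ln (z * cnj z) = of_real (2 * ln (cmod z))"
proof -
  assume z: "z \<noteq> 0"
  have "Ln (z * cnj z) = Ln (of_real (cmod z ^ 2))" by (simp flip: complex_norm_square)
  also have "\<dots> = of_real (ln (cmod z ^ 2))" using z by (intro Ln_of_real) simp
  also have "ln (cmod z ^ 2) = 2 * ln (cmod z)" using z by (simp add: ln_realpow)
  finally show ?thesis .
qed

text \<open>Half of Ln (z cnj z) is used: its argument is a positive real, away from the branch cut,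
  so the holomorphic chain rule applies.\<close>

lemma has_wd_ln_norm:
  assumes "z \<noteq> 0"
  shows "has_wd (\<lambda>z. of_real (ln (cmod z))) (1 / (2 * z)) (1 / (2 * cnj z)) z"
proof -
  have "z * cnj z = of_real (cmod z ^ 2)" by (simp flip: complex_norm_square)
  moreover have "complex_of_real (cmod z ^ 2) \<notin> \<real>\<^sub>\<le>\<^sub>0" using assms
    by (simp only: complex_nonpos_Reals_iff) (simp flip: of_real_power)
  ultimately have "z * cnj z \<notin> \<real>\<^sub>\<le>\<^sub>0" by metis
  from has_wd_holo_compose[OF has_field_derivative_Ln[OF this] has_wd_mult[OF has_wd_ident has_wd_cnj[OF has_wd_ident]]]
  have 1: "has_wd (\<lambda>z. Ln (z * cnj z)) (1 / z) (1 / cnj z) z"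
    by (rule has_wd_eqI) (use assms in \<open>auto simp: divide_simps\<close>)
  have "has_wd (\<lambda>z. (1/2) * Ln (z * cnj z)) (1 / (2 * z)) (1 / (2 * cnj z)) z"
    by (rule has_wd_eqI[OF has_wd_mult[OF has_wd_const 1]]) auto
  moreover have "\<forall>\<^sub>F x in nhds z. x \<in> - {0}" using assms by (intro eventually_nhds_in_open) auto
  then have "\<forall>\<^sub>F x in nhds z. (1/2) * Ln (x * cnj x) = of_real (ln (cmod x))"
    by eventually_elim (simp add: Ln_norm_square)
  ultimately show ?thesis by (rule has_wd_transform)
qed

lemma has_wd_powr_norm:
  assumes "z \<noteq> 0"
  shows "has_wd (\<lambda>z. of_real (cmod z powr c)) (of_real (c / 2) * (of_real (cmod z powr c) / z))
      (of_real (c / 2) * (of_real (cmod z powr c) / cnj z)) z"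
proof -
  have e: "exp (of_real c * of_real (ln (cmod x))) = complex_of_real (cmod x powr c)" if "x \<noteq> 0" for x
    using that by (simp add: powr_def flip: of_real_mult exp_of_real)
  have "has_wd (\<lambda>z. exp (of_real c * of_real (ln (cmod z)))) (of_real (c / 2) * (of_real (cmod z powr c) / z))
      (of_real (c / 2) * (of_real (cmod z powr c) / cnj z)) z"
    by (rule has_wd_eqI[OF has_wd_exp[OF has_wd_mult[OF has_wd_const has_wd_ln_norm[OF assms]]]])
      (simp_all only: e[OF assms], simp_all)
  moreover have "\<forall>\<^sub>F x in nhds z. x \<in> - {0}" using assms by (intro eventually_nhds_in_open) auto
  then have "\<forall>\<^sub>F x in nhds z. exp (of_real c * of_real (ln (cmod x))) = complex_of_real (cmod x powr c)"
    by eventually_elim (simp add: e)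
  ultimately show ?thesis by (rule has_wd_transform)
qed

section \<open>Jacobi fields of a conic harmonic germ\<close>

text \<open>\<open>U\<close> is the map and \<open>P\<close> the Jacobi field in coordinates, \<open>F\<close> the logarithm of the target
  density; the other functions are their Wirtinger derivatives (\<open>M\<close> and \<open>N\<close> the mixed ones, \<open>fw\<close> and
  \<open>fb\<close> those of \<open>f\<close>), with the growth that the weighted Hoelder conditions give. \<open>harm\<close> and
  \<open>jac\<close> are the equations \<open>\<tau> = 0\<close> and \<open>L P = 0\<close>.\<close>

locale jacobi_germ =
  fixes U A B Az M Bz F f fw fb P Pz Pb Pzz N Pbb :: "complex \<Rightarrow> complex"
    and l K :: complex and \<alpha> \<delta> b \<epsilon> :: real
  assumes \<alpha>: "0 < \<alpha>" "\<alpha> < 1" and \<delta>: "0 < \<delta>" "\<delta> < 1" and l: "l \<noteq> 0"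
    and \<epsilon>: "0 < \<epsilon>" and b_def: "b = 1 + \<epsilon> - 2 * \<alpha>"
    and dU: "\<forall>\<^sub>F z in at 0. has_wd U (A z) (B z) z"
    and dA: "\<forall>\<^sub>F z in at 0. has_wd A (Az z) (M z) z"
    and dB: "\<forall>\<^sub>F z in at 0. has_wd B (M z) (Bz z) z"
    and bU: "Ob (1 + \<delta>) (\<lambda>z. U z - l * z)"
    and bA: "Ob \<delta> (\<lambda>z. A z - l)" and bB: "Ob \<delta> B"
    and bAz: "Ob (\<delta> - 1) Az" and bBz: "Ob (\<delta> - 1) Bz"
    and dF: "\<forall>\<^sub>F w in at 0. has_wd F (f w) (cnj (f w)) w"
    and df: "\<forall>\<^sub>F w in at 0. has_wd f (fw w) (fb w) w"
    and fb_real: "\<forall>\<^sub>F w in at 0. cnj (fb w) = fb w"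
    and bF: "Ob \<delta> (\<lambda>w. F w - (of_real ((2 * \<alpha> - 2) * ln (cmod w)) + K))"
    and bf: "Ob (\<delta> - 1) (\<lambda>w. f w - of_real (\<alpha> - 1) / w)"
    and harm: "\<forall>\<^sub>F z in at 0. M z + f (U z) * A z * B z = 0"
    and dP: "\<forall>\<^sub>F z in at 0. has_wd P (Pz z) (Pb z) z"
    and dPz: "\<forall>\<^sub>F z in at 0. has_wd Pz (Pzz z) (N z) z"
    and dPb: "\<forall>\<^sub>F z in at 0. has_wd Pb (N z) (Pbb z) z"
    and bP: "Ob b P" and bPz: "Ob (b - 1) Pz" and bPb: "Ob (b - 1) Pb"
    and jac: "\<forall>\<^sub>F z in at 0. N z + (fw (U z) * P z + fb (U z) * cnj (P z)) * A z * B z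
        + f (U z) * (Pz z * B z + A z * Pb z) = 0"
    and F_real: "\<forall>\<^sub>F w in at 0. cnj (F w) = F w"
begin

text \<open>An exponent, not the metric of the theorem: 1 / \<rho>(U) has order \<open>g\<close> at
  the cone point, and 2\<pi>\<alpha> > \<pi> means g < 1.\<close>

definition g where "g = 2 - 2 * \<alpha>"
lemma g: "0 < g" "g < 2" using \<alpha> by (auto simp: g_def)

section \<open>Asymptotics of the map and of the target density\<close>

lemma Ubounds: "\<forall>\<^sub>F z in at 0. cmod l / 2 * cmod z \<le> cmod (U z)" "\<forall>\<^sub>F z in at 0. cmod (U z) \<le> (2 * cmod l) * cmod z"
  and U_quot: "Ob \<delta> (\<lambda>z. U z / z - l)"
proof -
  have "Ob \<delta> (\<lambda>z. (1 / z) * (U z - l * z))" by (rule Ob_multI[OF Ob_inverse_ident bU]) simp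
  then show q: "Ob \<delta> (\<lambda>z. U z / z - l)"
    by (rule Ob_cong) (use eventually_at_0_lt[OF zero_less_one] in \<open>auto elim!: eventually_mono simp: field_simps\<close>)
  have "((\<lambda>z. U z / z - l) \<longlongrightarrow> 0) (at 0)" by (rule Ob_tendsto_0[OF q \<delta>(1)])
  then have "\<forall>\<^sub>F z in at 0. dist (U z / z - l) 0 < cmod l / 2" by (rule tendstoD) (use l in simp)
  then have *: "\<forall>\<^sub>F z in at 0. cmod l / 2 * cmod z \<le> cmod (U z) \<and> cmod (U z) \<le> (2 * cmod l) * cmod z"
    using eventually_at_0_lt[OF zero_less_one]
  proof eventually_elim
    case (elim z)
    have z: "0 < cmod z" using elim by simp
    have e: "cmod (U z) = cmod (U z / z) * cmod z" using z by (simp add: norm_divide)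
    have "cmod l / 2 \<le> cmod (U z / z)" "cmod (U z / z) \<le> 2 * cmod l"
      using elim(1) norm_triangle_ineq2[of "U z / z" l] norm_triangle_ineq3[of "U z / z" l] norm_ge_zero[of l]
      by (auto simp: dist_norm)
    then show ?case unfolding e using z by (auto intro!: mult_right_mono)
  qed
  show "\<forall>\<^sub>F z in at 0. cmod l / 2 * cmod z \<le> cmod (U z)" "\<forall>\<^sub>F z in at 0. cmod (U z) \<le> (2 * cmod l) * cmod z"
    using * by (auto elim: eventually_mono)
qed

lemma U_nz: "\<forall>\<^sub>F z in at 0. U z \<noteq> 0"
  using Ubounds(1) eventually_at_0_lt[OF zero_less_one] by eventually_elim (use l in \<open>auto simp: not_le mult_le_0_iff\<close>)

lemma U_lim: "filterlim U (at 0) (at 0)"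
proof -
  have "Ob 1 U"
    using Ubounds(2) by (intro ObI[where C="2 * cmod l"]) (use eventually_at_0_lt[OF zero_less_one] in \<open>auto elim: eventually_elim2\<close>)
  then have "(U \<longlongrightarrow> 0) (at 0)" by (rule Ob_tendsto_0) simp
  then show ?thesis using U_nz by (simp add: filterlim_at)
qed

lemmas ev_U = eventually_compose_at[OF U_lim]

lemma Ob_U: "Ob c h \<Longrightarrow> Ob c (\<lambda>z. h (U z))"
  by (rule Ob_compose[OF _ U_lim _ Ubounds(1) Ubounds(2)]) (use l in auto)

text \<open>\<open>F\<close> is the logarithm of \<rho>, so these are the reciprocal of the target
  density along the map and the density itself. The exponential form keeps both nonzero
  everywhere.\<close>

definition ir where "ir z = exp (- F (U z))"
definition rr where "rr z = exp (F (U z))"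

lemma rr_ir: "rr z * ir z = 1" "ir z \<noteq> 0" "rr z \<noteq> 0"
  by (auto simp: ir_def rr_def exp_minus)

lemma ratio_lead:
  obtains k where "k \<noteq> 0" "lead \<delta> c (\<lambda>z. of_real (cmod z powr c)) k (\<lambda>z. of_real (cmod (U z) powr c))"
proof -
  have 1: "Ob \<delta> (\<lambda>z. of_real (cmod (U z / z) - cmod l))"
    by (rule Ob_bounded[OF U_quot, where K=1]) (simp only: norm_of_real norm_triangle_ineq3 mult_1 eventually_True)
  have 2: "((\<lambda>t. t powr c) has_field_derivative c * cmod l powr (c - 1)) (at (cmod l))"
    using l by (auto intro!: derivative_eq_intros)
  have "Ob \<delta> (\<lambda>z. of_real (cmod (U z / z) powr c - cmod l powr c))"
    by (rule Ob_real_function[OF 2 1 \<delta>(1)])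
  then have "Ob \<delta> (\<lambda>z. of_real (cmod (U z / z) powr c) - of_real (cmod l powr c))" by simp
  then have 1: "lead \<delta> 0 (\<lambda>_. 1) (of_real (cmod l powr c)) (\<lambda>z. of_real (cmod (U z / z) powr c))"
    using \<delta> by (intro lead_const) auto
  have 2: "lead \<delta> c (\<lambda>z. of_real (cmod z powr c)) 1 (\<lambda>z. of_real (cmod z powr c))"
    unfolding lead_def using Ob_powr Ob_const[of "c+\<delta>" 0]
    by (auto intro!: ObI[where C=0])
  have "lead \<delta> c (\<lambda>z. of_real (cmod z powr c)) (of_real (cmod l powr c)) (\<lambda>z. of_real (cmod (U z) powr c))"
    using lead_mult[OF 1 2] \<delta> eventually_at_0_lt[OF zero_less_one]
    by (auto elim!: lead_cong eventually_mono simp: norm_divide powr_divide)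
  then show thesis using that[of "of_real (cmod l powr c)"] l by auto
qed

text \<open>The two signs of \<open>s\<close> treat the density and its reciprocal at once. The
  coefficient collects exp (s K) from the constant in \<open>bF\<close> and a power of |l| from
  comparing |U| with |z|.\<close>

lemma exp_F_lead:
  fixes s :: real assumes s: "s = 1 \<or> s = - 1"
  obtains k where "k \<noteq> 0" "lead \<delta> (- s * g) (\<lambda>z. of_real (cmod z powr (- s * g))) k (\<lambda>z. exp (of_real s * F (U z)))"
proof -
  let ?c = "- s * g"
  let ?E = "\<lambda>w. of_real s * (F w - (of_real ((2 * \<alpha> - 2) * ln (cmod w)) + K))"
  have E: "Ob \<delta> (\<lambda>z. ?E (U z))" by (rule Ob_cmult[OF Ob_U[OF bF]])
  have "Ob \<delta> (\<lambda>z. exp (?E (U z)) - exp 0)"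
    by (rule Ob_function[OF DERIV_exp]) (use E \<delta> in auto)
  then have 1: "lead \<delta> 0 (\<lambda>_. 1) 1 (\<lambda>z. exp (?E (U z)))"
    using \<delta> by (intro lead_const) auto
  obtain k where k: "k \<noteq> 0" "lead \<delta> ?c (\<lambda>z. of_real (cmod z powr ?c)) k (\<lambda>z. of_real (cmod (U z) powr ?c))"
    using ratio_lead by blast
  have "lead \<delta> ?c (\<lambda>z. of_real (cmod z powr ?c)) (exp (of_real s * K) * k) (\<lambda>z. exp (of_real s * K) * (of_real (cmod (U z) powr ?c) * exp (?E (U z))))"
    using lead_cmult[OF lead_mult[OF k(2) 1], of "exp (of_real s * K)"] \<delta> by simp
  then have "lead \<delta> ?c (\<lambda>z. of_real (cmod z powr ?c)) (exp (of_real s * K) * k) (\<lambda>z. exp (of_real s * F (U z)))"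
  proof (rule lead_cong)
    show "\<forall>\<^sub>F z in at 0. exp (of_real s * K) * (of_real (cmod (U z) powr ?c) * exp (?E (U z))) = exp (of_real s * F (U z))"
      using U_nz
    proof eventually_elim
      case (elim z)
      have "complex_of_real (cmod (U z) powr ?c) = exp (of_real (?c * ln (cmod (U z))))"
        by (subst exp_of_real) (use elim in \<open>simp add: powr_def\<close>)
      also have "?c * ln (cmod (U z)) = s * ((2 * \<alpha> - 2) * ln (cmod (U z)))" by (simp add: g_def algebra_simps)
      finally have "complex_of_real (cmod (U z) powr ?c) = exp (of_real (s * ((2 * \<alpha> - 2) * ln (cmod (U z)))))" .
      then show ?case by (simp add: exp_add[symmetric] algebra_simps)
    qed
  qed
  then show thesis using that[of "exp (of_real s * K) * k"] k by auto
qed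

lemma ir_lead: obtains k where "k \<noteq> 0" "lead \<delta> g (\<lambda>z. of_real (cmod z powr g)) k ir"
  using exp_F_lead[of "-1"] unfolding ir_def by auto

lemma ir_Ob: "Ob g ir"
  using ir_lead lead_Ob \<delta> by (metis less_imp_le)

lemma rr_Ob: "Ob (- g) rr"
proof -
  obtain k where "lead \<delta> (- g) (\<lambda>z. of_real (cmod z powr (- g))) k rr"
    using exp_F_lead[of 1] unfolding rr_def by auto
  then show ?thesis using lead_Ob \<delta> by (metis less_imp_le)
qed

text \<open>Up to density factors, \<open>S\<close> is the energy density and \<open>J\<close> the
  Jacobian. \<open>Q\<close> and \<open>R\<close> are the two pure second derivatives of
  \<open>U\<close> made covariant for the target connection; \<open>Bz\<close> is the derivative of
  \<open>B\<close> in the conjugate variable. \<open>X\<close> inverts P = A X + B cnj X, and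
  \<open>Hr\<close> is the linearized Hopf differential divided by \<rho>(U).\<close>

definition S where "S z = A z * cnj (A z) + B z * cnj (B z)"
definition J where "J z = A z * cnj (A z) - B z * cnj (B z)"
definition Q where "Q z = Az z + f (U z) * A z ^ 2"
definition R where "R z = Bz z + f (U z) * B z ^ 2"
definition X where "X z = (cnj (A z) * P z - B z * cnj (P z)) / J z"
definition Y where "Y z = (cnj (A z) * P z + B z * cnj (P z)) / S z"
definition \<Phi> where "\<Phi> z = rr z * (A z * cnj (B z))"
definition \<Phi>z where "\<Phi>z z = rr z * (cnj (B z) * Q z + A z * cnj (R z))"
definition Hr where "Hr z = (f (U z) * P z + cnj (f (U z)) * cnj (P z)) * (A z * cnj (B z))
    + Pz z * cnj (B z) + A z * cnj (Pb z)"
definition H where "H z = rr z * Hr z"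

lemma A0: "Ob 0 A" using Ob_1_of_approx[OF bA] \<delta> by auto
lemma B0: "Ob 0 B" using Ob_mono[OF bB] \<delta> by auto
lemma BB: "Ob \<delta> (\<lambda>z. B z * cnj (B z))" by (rule Ob_multI[OF bB Ob_cnj[OF bB]]) (use \<delta> in auto)
lemma A_lead: "lead \<delta> 0 (\<lambda>_. 1) l A" using bA \<delta> by (intro lead_const) auto

lemma AA: "Ob \<delta> (\<lambda>z. A z * cnj (A z) - l * cnj l)"
  using lead_mult[OF A_lead lead_cnj[OF A_lead]] \<delta> unfolding lead_def by simp

lemma S_approx: "Ob \<delta> (\<lambda>z. S z - l * cnj l)"
  using Ob_add[OF AA BB] unfolding S_def by (simp add: algebra_simps)
lemma J_approx: "Ob \<delta> (\<lambda>z. J z - l * cnj l)"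
  using Ob_diff[OF AA BB] unfolding J_def by (simp add: algebra_simps)

lemma nz: "\<forall>\<^sub>F z in at 0. S z \<noteq> 0" "\<forall>\<^sub>F z in at 0. J z \<noteq> 0" "\<forall>\<^sub>F z in at 0. A z \<noteq> 0"
proof -
  have *: "\<forall>\<^sub>F z in at 0. h z \<noteq> 0" if "Ob \<delta> (\<lambda>z. h z - k)" "k \<noteq> 0" for h k
    using tendsto_imp_eventually_ne[OF LIM_zero_cancel[OF Ob_tendsto_0[OF that(1) \<delta>(1)]] that(2)] .
  show "\<forall>\<^sub>F z in at 0. S z \<noteq> 0" "\<forall>\<^sub>F z in at 0. J z \<noteq> 0" "\<forall>\<^sub>F z in at 0. A z \<noteq> 0"
    using *[OF S_approx] *[OF J_approx] *[OF bA] l by auto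
qed

lemma S_inv: "Ob \<delta> (\<lambda>z. inverse (S z) - inverse (l * cnj l))"
  by (rule Ob_inverse[OF S_approx]) (use l \<delta> in auto)
lemma S_inv0: "Ob 0 (\<lambda>z. inverse (S z))" using Ob_1_of_approx[OF S_inv] \<delta> by auto
lemma A_inv: "Ob \<delta> (\<lambda>z. inverse (A z) - inverse l)"
  by (rule Ob_inverse[OF bA]) (use l \<delta> in auto)
lemma A_inv0: "Ob 0 (\<lambda>z. inverse (A z))" using Ob_1_of_approx[OF A_inv] \<delta> by auto
lemma J0: "Ob 0 J" using Ob_1_of_approx[OF J_approx] \<delta> by auto

lemma f_inv: "Ob (- 1) (\<lambda>z. f (U z))"
proof -
  have "Ob (- 1) (\<lambda>w. (f w - of_real (\<alpha> - 1) / w) + of_real (\<alpha> - 1) * (1 / w))"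
    by (intro Ob_add Ob_cmult Ob_inverse_ident) (use bf \<delta> Ob_mono in force)
  then have "Ob (- 1) f" by simp
  then show ?thesis by (rule Ob_U)
qed

lemma Q_Ob: "Ob (- 1) Q"
  unfolding Q_def power2_eq_square
  by (intro Ob_add Ob_multI[OF f_inv Ob_multI[OF A0 A0, of 0]]) (use Ob_mono[OF bAz] \<delta> in auto)
lemma M_Ob: "Ob (- 1) M"
proof -
  have "Ob (- 1) (\<lambda>z. - (f (U z) * (A z * B z)))"
    by (intro Ob_minus Ob_multI[OF f_inv Ob_multI[OF A0 B0, of 0]]) auto
  then show ?thesis
  proof (rule Ob_cong)
    show "\<forall>\<^sub>F z in at 0. - (f (U z) * (A z * B z)) = M z"
      using harm
    proof eventually_elim
      case (elim z)
      then have "M z = - (f (U z) * A z * B z)" by (simp only: eq_neg_iff_add_eq_0)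
      then show ?case by (simp only: mult.assoc)
    qed
  qed
qed

section \<open>Holomorphy of the Hopf differential and of its linearization\<close>

lemma d_rr: "\<forall>\<^sub>F z in at 0. has_wd rr (rr z * (f (U z) * A z + cnj (f (U z)) * cnj (B z)))
    (rr z * (f (U z) * B z + cnj (f (U z)) * cnj (A z))) z"
  using ev_U[OF dF] dU
proof eventually_elim
  case (elim z)
  from has_wd_exp[OF has_wd_compose[OF elim(1,2)]] show ?case unfolding rr_def .
qed

text \<open>The conjugate derivative equals \<rho>(U) times cnj B (M + f A B) + A cnj (M + f A B),
  and by \<open>harm\<close> the bracket is zero.\<close>

lemma \<Phi>_holo: "\<forall>\<^sub>F z in at 0. has_wd \<Phi> (\<Phi>z z) 0 z"
  using d_rr dA dB harm
proof eventually_elim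
  case (elim z)
  note d = has_wd_mult[OF elim(1) has_wd_mult[OF elim(2) has_wd_cnj[OF elim(3)]]]
  have m: "M z = - (f (U z) * A z * B z)" using elim(4) by (simp add: eq_neg_iff_add_eq_0)
  show ?case unfolding \<Phi>_def
    by (rule has_wd_eqI[OF d]) (simp_all add: \<Phi>z_def Q_def R_def m power2_eq_square algebra_simps)
qed

text \<open>This is the first variation of the preceding identity: \<open>M\<close> and
  \<open>N\<close> are eliminated by \<open>harm\<close> and \<open>jac\<close>. The terms with
  \<open>fb\<close>, the mixed derivative of log \<rho>, cancel in pairs because \<open>fb\<close>
  is real.\<close>

lemma H_holo: "\<exists>Hz. \<forall>\<^sub>F z in at 0. has_wd H (Hz z) 0 z"
proof (rule exI)
  show "\<forall>\<^sub>F z in at 0. has_wd H (pd_z H z) 0 z"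
    using d_rr dA dB harm ev_U[OF df] ev_U[OF fb_real] dU dP dPz dPb jac
  proof eventually_elim
    case (elim z)
    note dfU = has_wd_compose[OF elim(5,7)]
    note d = has_wd_mult[OF elim(1) has_wd_add[OF has_wd_add[OF has_wd_mult[OF
      has_wd_add[OF has_wd_mult[OF dfU elim(8)] has_wd_mult[OF has_wd_cnj[OF dfU] has_wd_cnj[OF elim(8)]]]
      has_wd_mult[OF elim(2) has_wd_cnj[OF elim(3)]]] has_wd_mult[OF elim(9) has_wd_cnj[OF elim(3)]]]
      has_wd_mult[OF elim(2) has_wd_cnj[OF elim(10)]]]]
    have m: "M z = - (f (U z) * A z * B z)" using elim(4) by (simp add: eq_neg_iff_add_eq_0)
    have n: "N z = - ((fw (U z) * P z + fb (U z) * cnj (P z)) * A z * B z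
        + f (U z) * (Pz z * B z + A z * Pb z))" using elim(11) by (simp only: eq_neg_iff_add_eq_0 add.assoc)
    have "\<exists>a. has_wd H a 0 z"
      unfolding H_def[abs_def] Hr_def
      by (rule exI, rule has_wd_eqI[OF d]) (rule refl, simp add: m n elim(6) algebra_simps)
    then show ?case using has_wd_pd_z by blast
  qed
qed

text \<open>The weight of the theorem enters here: -g + (b - 1) = -2 + \<epsilon>, which excludes a
  double pole of the holomorphic \<open>H\<close>.\<close>

lemma H_Ob: "Ob (- 2 + \<epsilon>) H"
proof -
  have 1: "Ob (b - 1) (\<lambda>z. f (U z) * P z)" by (rule Ob_multI[OF f_inv bP]) simp
  have "Ob (b - 1) Hr"
    unfolding Hr_def
    by (intro Ob_add Ob_multI[OF Ob_add[OF 1] Ob_multI[OF A0 Ob_cnj[OF B0], of 0]]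
        Ob_multI[OF bPz Ob_cnj[OF B0]] Ob_multI[OF A0 Ob_cnj[OF bPb]])
      (use Ob_cnj[OF 1] in auto)
  then show ?thesis unfolding H_def
    by (rule Ob_multI[OF rr_Ob]) (simp add: b_def g_def)
qed

lemma H_pole: obtains a where "Ob 0 (\<lambda>z. H z - a * (1 / z))"
proof -
  obtain Hz where "\<forall>\<^sub>F z in at 0. has_wd H (Hz z) 0 z" using H_holo by blast
  then show thesis by (rule holo_extend1[OF _ H_Ob]) (use \<epsilon> that in auto)
qed

lemma \<Phi>_Ob: "Ob (\<delta> - g) \<Phi>"
  unfolding \<Phi>_def by (rule Ob_multI[OF rr_Ob Ob_multI[OF A0 Ob_cnj[OF bB], of \<delta>]]) auto

text \<open>The definition of \<Phi> is solved for \<open>B\<close>. A bound on the pole order of a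
  holomorphic function thus becomes a decay rate of \<open>B\<close> that no longer depends on
  \<delta>.\<close>

lemma B_eq: "\<forall>\<^sub>F z in at 0. B z = ir z * (cnj (\<Phi> z) * inverse (cnj (A z)))"
  using nz(3) ev_U[OF F_real]
proof eventually_elim
  case (elim z)
  have "cnj (rr z) = rr z" using elim(2) by (simp add: rr_def exp_cnj)
  then show ?case using elim(1) rr_ir[of z] by (simp add: \<Phi>_def field_simps)
qed

definition D where "D z = cnj (A z) * R z - B z * cnj (Q z)"

text \<open>Estimated directly, \<open>D\<close> would involve \<open>R\<close> and hence a second
  derivative known only to order \<delta> - 1. The derivative of \<Phi> contains the same term cnj A
  R in conjugate form, so \<open>R\<close> is traded for the holomorphic
  \<open>\<Phi>z\<close>.\<close>

lemma D_eq: "\<forall>\<^sub>F z in at 0. D z = ir z * cnj (\<Phi>z z) - 2 * (B z * cnj (Q z))"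
  using ev_U[OF F_real]
proof eventually_elim
  case (elim z)
  have "cnj (rr z) = rr z" using elim by (simp add: rr_def exp_cnj)
  then have "ir z * cnj (\<Phi>z z) = (rr z * ir z) * (B z * cnj (Q z) + cnj (A z) * R z)" by (simp add: \<Phi>z_def)
  then show ?case by (simp add: rr_ir D_def)
qed

section \<open>The d-bar equation for the corrected field\<close>

definition Yz where "Yz z = pd_z Y z"
text \<open>The closed form of the conjugate derivative of \<open>Y\<close>. Derivatives of
  \<open>P\<close> are present only in \<open>Hr\<close>, which is \<open>ir\<close> times the
  holomorphic \<open>H\<close>; \<open>D\<close> measures how the field itself enters.\<close>

definition Yb where "Yb z = cnj (Hr z) * inverse (S z) + D z * (J z * cnj (X z)) * (inverse (S z) * inverse (S z))"

lemma Y_deriv: "\<forall>\<^sub>F z in at 0. has_wd Y (Yz z) (Yb z) z" and Yz_Ob: "Ob (b - 1) Yz"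
proof -
  define n1 where "n1 = (\<lambda>z. (cnj (M z) * P z + cnj (A z) * Pz z) + (M z * cnj (P z) + B z * cnj (Pb z)))"
  define s1 where "s1 = (\<lambda>z. (Az z * cnj (A z) + A z * cnj (M z)) + (M z * cnj (B z) + B z * cnj (Bz z)))"
  have *: "\<forall>\<^sub>F z in at 0. has_wd Y ((n1 z * S z - (cnj (A z) * P z + B z * cnj (P z)) * s1 z) * (inverse (S z) * inverse (S z))) (Yb z) z"
    using dA dB dP harm nz(1) nz(2)
  proof eventually_elim
    case (elim z)
    note dn = has_wd_add[OF has_wd_mult[OF has_wd_cnj[OF elim(1)] elim(3)] has_wd_mult[OF elim(2) has_wd_cnj[OF elim(3)]]]
    have ds: "has_wd S (s1 z) ((M z * cnj (A z) + A z * cnj (Az z)) + (Bz z * cnj (B z) + B z * cnj (M z))) z"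
      unfolding S_def[abs_def] s1_def
      by (rule has_wd_add[OF has_wd_mult[OF elim(1) has_wd_cnj[OF elim(1)]] has_wd_mult[OF elim(2) has_wd_cnj[OF elim(2)]]])
    have m: "M z = - (f (U z) * A z * B z)" using elim(4) by (simp add: eq_neg_iff_add_eq_0)
    have jx: "J z * cnj (X z) = A z * cnj (P z) - cnj (B z) * P z"
    proof -
      have "cnj (J z) = J z" by (simp add: J_def mult.commute)
      then show ?thesis using elim(6) by (simp add: X_def)
    qed
    \<comment> \<open>The derivatives of \<open>P\<close> in cnj Hr are cnj A Pb + B cnj Pz, exactly
      those produced by differentiating the numerator of \<open>Y\<close>. \<open>M\<close> is
      eliminated through \<open>harm\<close>, and what remains is algebraic in \<open>P\<close> and
      \<open>cnj P\<close>.\<close>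
    have key: "((cnj (Az z) * P z + cnj (A z) * Pb z) + (Bz z * cnj (P z) + B z * cnj (Pz z))) * S z
        - (cnj (A z) * P z + B z * cnj (P z)) * ((M z * cnj (A z) + A z * cnj (Az z)) + (Bz z * cnj (B z) + B z * cnj (M z)))
      = cnj (Hr z) * S z + D z * (A z * cnj (P z) - cnj (B z) * P z)"
      unfolding S_def Hr_def D_def Q_def R_def m by (simp add: power2_eq_square algebra_simps)
    show ?case unfolding Y_def[abs_def]
    proof (rule has_wd_eqI[OF has_wd_divide[OF dn ds elim(5)]])
      show "((cnj (M z) * P z + cnj (A z) * Pz z + (M z * cnj (P z) + B z * cnj (Pb z))) * S z
         - (cnj (A z) * P z + B z * cnj (P z)) * s1 z) / (S z)\<^sup>2 =
        (n1 z * S z - (cnj (A z) * P z + B z * cnj (P z)) * s1 z) * (inverse (S z) * inverse (S z))"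
        by (simp add: n1_def power2_eq_square divide_inverse)
      show "((cnj (Az z) * P z + cnj (A z) * Pb z + (Bz z * cnj (P z) + B z * cnj (Pz z))) * S z
         - (cnj (A z) * P z + B z * cnj (P z)) * (M z * cnj (A z) + A z * cnj (Az z) + (Bz z * cnj (B z) + B z * cnj (M z)))) / (S z)\<^sup>2 = Yb z"
        unfolding key Yb_def jx using elim(5) by (simp add: power2_eq_square field_simps)
    qed
  qed
  then have e: "\<forall>\<^sub>F z in at 0. (n1 z * S z - (cnj (A z) * P z + B z * cnj (P z)) * s1 z) * (inverse (S z) * inverse (S z)) = Yz z"
    by eventually_elim (simp add: Yz_def has_wd_pd_z)
  show "\<forall>\<^sub>F z in at 0. has_wd Y (Yz z) (Yb z) z"
    using * e by eventually_elim simp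
  have Az': "Ob (- 1) Az" "Ob (- 1) Bz" using Ob_mono[OF bAz] Ob_mono[OF bBz] \<delta> by auto
  have S0: "Ob 0 S" using Ob_1_of_approx[OF S_approx] \<delta> by auto
  have n1: "Ob (b - 1) n1" unfolding n1_def
    by (intro Ob_add; rule Ob_multI[OF Ob_cnj[OF M_Ob] bP] Ob_multI[OF Ob_cnj[OF A0] bPz]
        Ob_multI[OF M_Ob Ob_cnj[OF bP]] Ob_multI[OF B0 Ob_cnj[OF bPb]]) auto
  have s1: "Ob (- 1) s1" unfolding s1_def
    by (intro Ob_add; rule Ob_multI[OF Az'(1) Ob_cnj[OF A0]] Ob_multI[OF A0 Ob_cnj[OF M_Ob]]
        Ob_multI[OF M_Ob Ob_cnj[OF B0]] Ob_multI[OF B0 Ob_cnj[OF Az'(2)]]) auto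
  have num: "Ob b (\<lambda>z. cnj (A z) * P z + B z * cnj (P z))"
    by (intro Ob_add; rule Ob_multI[OF Ob_cnj[OF A0] bP] Ob_multI[OF B0 Ob_cnj[OF bP]]) auto
  have "Ob (b - 1) (\<lambda>z. (n1 z * S z - (cnj (A z) * P z + B z * cnj (P z)) * s1 z) * (inverse (S z) * inverse (S z)))"
    by (rule Ob_multI[OF Ob_diff[OF Ob_multI[OF n1 S0, of "b - 1"] Ob_multI[OF num s1, of "b - 1"]] Ob_multI[OF S_inv0 S_inv0, of 0]]) auto
  then show "Ob (b - 1) Yz" by (rule Ob_cong[OF _ e])
qed

lemma Y_Ob: "Ob b Y"
  unfolding Y_def divide_inverse
  by (rule Ob_multI[OF Ob_add[OF Ob_multI[OF Ob_cnj[OF A0] bP, of b] Ob_multI[OF B0 Ob_cnj[OF bP], of b]] S_inv0]) auto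

definition \<kappa> where "\<kappa> z = 2 * (cnj (A z) * B z * inverse (S z))"

lemma \<kappa>_Ob: assumes "Ob c B" shows "Ob c \<kappa>"
  unfolding \<kappa>_def by (intro Ob_cmult Ob_multI[OF Ob_multI[OF Ob_cnj[OF A0] assms, of c] S_inv0]) auto

text \<open>Substituting P = A X + B cnj X into the numerator of \<open>Y\<close> gives S Y = S X +
  2 cnj A B cnj X.\<close>

lemma X_Y: "\<forall>\<^sub>F z in at 0. X z = Y z - \<kappa> z * cnj (X z)"
  using nz(1) nz(2)
proof eventually_elim
  case (elim z)
  have cJ: "cnj (J z) = J z" by (simp add: J_def mult.commute)
  have "(Y z - \<kappa> z * cnj (X z)) * (S z * J z) = (cnj (A z) * P z + B z * cnj (P z)) * J z - 2 * (cnj (A z) * B z) * (A z * cnj (P z) - cnj (B z) * P z)"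
    using elim by (simp add: Y_def X_def \<kappa>_def cJ field_simps)
  also have "\<dots> = (cnj (A z) * P z - B z * cnj (P z)) * S z"
    unfolding S_def J_def by (simp add: algebra_simps)
  also have "\<dots> = X z * (S z * J z)" using elim by (simp add: X_def)
  finally show ?case using elim by simp
qed

text \<open>Since \<kappa> tends to 0, the correction \<kappa> cnj X is at most half of X in modulus
  near the origin.\<close>

lemma X_Ob: assumes "Ob e Y" shows "Ob e X"
proof (rule Ob_bounded[OF assms])
  have "((\<lambda>z. \<kappa> z) \<longlongrightarrow> 0) (at 0)" by (rule Ob_tendsto_0[OF \<kappa>_Ob[OF bB] \<delta>(1)])
  then have "\<forall>\<^sub>F z in at 0. dist (\<kappa> z) 0 < 1/2" by (rule tendstoD) simp
  with X_Y show "\<forall>\<^sub>F z in at 0. cmod (X z) \<le> 2 * cmod (Y z)"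
  proof eventually_elim
    case (elim z)
    have "cmod (X z) \<le> cmod (Y z) + cmod (\<kappa> z * cnj (X z))"
      by (subst elim(1)) (rule norm_triangle_ineq4)
    also have "cmod (\<kappa> z * cnj (X z)) \<le> 1/2 * cmod (X z)"
      unfolding norm_mult complex_mod_cnj using elim(2) by (intro mult_right_mono) auto
    finally show ?case by simp
  qed
qed

lemma Hr_eq: "Hr z = ir z * H z"
  using rr_ir(1)[of z] by (simp add: H_def mult.assoc[symmetric] mult.commute[of "ir z"])

lemma H_inverse_Ob: "Ob (- 1) H"
proof -
  obtain a where a: "Ob 0 (\<lambda>z. H z - a * (1 / z))" using H_pole .
  have "Ob (- 1) (\<lambda>z. (H z - a * (1 / z)) + a * (1 / z))"
    by (intro Ob_add Ob_cmult Ob_inverse_ident) (use a Ob_mono in force)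
  then show ?thesis by simp
qed

text \<open>The input to one turn of the bootstrap. The pole of \<open>H\<close> contributes order g
  - 1, and the order \<open>e\<close> of the field enters shifted by the order \<open>d\<close> of
  \<open>D\<close>. In both angle ranges \<open>d\<close> will exceed -1, so that integration
  produces a gain.\<close>

lemma Yb_Ob:
  assumes D: "Ob d D" and Y: "Ob e Y" and s: "s \<le> g - 1" "s \<le> d + e"
  shows "Ob s Yb"
proof -
  have "Ob (g - 1) Hr" unfolding Hr_eq by (rule Ob_multI[OF ir_Ob H_inverse_Ob]) simp
  then have 1: "Ob s (\<lambda>z. cnj (Hr z) * inverse (S z))"
    by (intro Ob_multI[OF Ob_cnj S_inv0]) (use s in auto)
  have 2: "Ob s (\<lambda>z. D z * (J z * cnj (X z)) * (inverse (S z) * inverse (S z)))"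
    by (rule Ob_multI[OF Ob_multI[OF D Ob_multI[OF J0 Ob_cnj[OF X_Ob[OF Y]], of e], of "d + e"] Ob_multI[OF S_inv0 S_inv0, of 0]])
      (use s in auto)
  show ?thesis unfolding Yb_def by (rule Ob_add[OF 1 2])
qed

lemma Y_step:
  assumes "Ob c Y" "Ob s Yb" "- 1 < c" "s \<le> c + 1" "- 2 < s - real k" "s - real k < - 1"
  obtains a where "Ob (s + 1) (\<lambda>z. Y z - (\<Sum>j<k. a j * z ^ j))"
  using dbar_expansion[OF Y_deriv assms(1,3) Yz_Ob assms(2,4-6)] by blast

section \<open>Expansion of the Jacobi field in the two angle ranges\<close>

lemma f_lead: "lead \<delta> (- 1) (\<lambda>z. 1 / z) (of_real (\<alpha> - 1) / l) (\<lambda>z. f (U z))"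
proof -
  have 1: "Ob (\<delta> - 1) (\<lambda>z. f (U z) - of_real (\<alpha> - 1) / U z)" by (rule Ob_U[OF bf])
  have "Ob \<delta> (\<lambda>z. inverse (U z / z) - inverse l)"
    by (rule Ob_inverse[OF U_quot l \<delta>(1)])
  then have "Ob (\<delta> - 1) (\<lambda>z. of_real (\<alpha> - 1) * ((inverse (U z / z) - inverse l) * (1 / z)))"
    by (intro Ob_cmult Ob_multI[OF _ Ob_inverse_ident]) auto
  from Ob_add[OF 1 this] have "Ob (\<delta> - 1) (\<lambda>z. f (U z) - of_real (\<alpha> - 1) / l * (1 / z))"
  proof (rule Ob_cong)
    show "\<forall>\<^sub>F z in at 0. f (U z) - of_real (\<alpha> - 1) / U z + of_real (\<alpha> - 1) * ((inverse (U z / z) - inverse l) * (1 / z))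
        = f (U z) - of_real (\<alpha> - 1) / l * (1 / z)"
      using U_nz eventually_at_0_lt[OF zero_less_one]
      by eventually_elim (use l in \<open>auto simp: divide_simps algebra_simps\<close>)
  qed
  then show ?thesis unfolding lead_def using Ob_inverse_ident by (simp add: add.commute)
qed

lemma Q_lead: "lead \<delta> (- 1) (\<lambda>z. 1 / z) (of_real (\<alpha> - 1) * l) Q"
proof -
  have 1: "lead \<delta> (- 1) (\<lambda>z. 1 / z) 0 Az"
    by (rule lead_small) (use bAz Ob_inverse_ident in \<open>auto simp: add.commute\<close>)
  have "lead \<delta> (- 1 + (0 + 0)) (\<lambda>z. 1 / z * (1 * 1)) (of_real (\<alpha> - 1) / l * (l * l)) (\<lambda>z. f (U z) * (A z * A z))"
    using \<delta> by (intro lead_mult f_lead A_lead) auto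
  then have 2: "lead \<delta> (- 1) (\<lambda>z. 1 / z) (of_real (\<alpha> - 1) * l) (\<lambda>z. f (U z) * (A z * A z))"
    using l by simp
  show ?thesis using lead_add[OF 1 2] unfolding Q_def[abs_def] power2_eq_square by simp
qed

text \<open>For g < 1 the order \<delta> - g already makes the singularity of \<Phi> removable, so
  \<open>B\<close> has order g and \<open>D\<close> order g - 1. The bootstrap leads from the
  possibly negative weight to a bounded \<open>Y\<close>, then to a constant plus O(r^g). At this
  point the leading part of the conjugate derivative is known explicitly; its primitive is
  subtracted and the remainder is expanded once more.\<close>

theorem expansion_large:
  assumes a: "1/2 < \<alpha>" and d: "\<delta> < 2 * \<alpha> - 1" "\<delta> \<le> 2 - 2 * \<alpha>"
  shows "\<exists>w k. Ob (g + \<delta>) (\<lambda>z. X z - (w + k * of_real (cmod z powr g)))"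
proof -
  have g1: "g < 1" using a by (simp add: g_def)
  have gd: "g + \<delta> < 1" "\<delta> \<le> g" using d by (auto simp: g_def)
  have ir: "Ob g ir" by (rule ir_Ob)
  obtain \<Phi>0 where P0: "Ob 1 (\<lambda>z. \<Phi> z - \<Phi>0)" and Pz: "Ob 0 \<Phi>z"
    by (rule holo_extend0[OF \<Phi>_holo \<Phi>_Ob]) (use gd \<delta> g1 in auto)
  have P00: "Ob 0 \<Phi>" using Ob_1_of_approx[OF P0] by simp
  have Ai: "Ob 0 (\<lambda>z. inverse (cnj (A z)))" using Ob_cnj[OF A_inv0] by simp
  have Bg: "Ob g B"
  proof (rule Ob_cong)
    show "Ob g (\<lambda>z. ir z * (cnj (\<Phi> z) * inverse (cnj (A z))))"
      by (rule Ob_multI[OF ir Ob_multI[OF Ob_cnj[OF P00] Ai, of 0]]) auto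
    show "\<forall>\<^sub>F z in at 0. ir z * (cnj (\<Phi> z) * inverse (cnj (A z))) = B z"
      using B_eq by eventually_elim (rule sym)
  qed
  have Dg: "Ob (g - 1) D"
  proof (rule Ob_cong)
    show "Ob (g - 1) (\<lambda>z. ir z * cnj (\<Phi>z z) - 2 * (B z * cnj (Q z)))"
      by (intro Ob_diff Ob_cmult Ob_multI[OF ir Ob_cnj[OF Pz]] Ob_multI[OF Bg Ob_cnj[OF Q_Ob]]) auto
    show "\<forall>\<^sub>F z in at 0. ir z * cnj (\<Phi>z z) - 2 * (B z * cnj (Q z)) = D z"
      using D_eq by eventually_elim simp
  qed
  \<comment> \<open>The orders reached after n turns. Half of the available gain g is used per turn,
    and the cap at -g/2 keeps the order negative, so that s = e - 1 stays in (-2, -1) and no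
    polynomial splits off (k = 0).\<close>
  define e where "e = (\<lambda>n::nat. min (- g / 2) (b + real n * (g / 2)))"
  have b1: "- 1 < b" using \<alpha> \<epsilon> by (simp add: b_def)
  have e_lo: "- 1 < e n" for n
  proof -
    have "0 \<le> real n * (g / 2)" using g by simp
    then have "- 1 < b + real n * (g / 2)" using b1 by linarith
    then show ?thesis unfolding e_def min_less_iff_conj using g g1 by auto
  qed
  have Ye: "Ob (e n) Y" for n
  proof (induction n)
    case 0
    then show ?case using Ob_mono[OF Y_Ob] by (simp add: e_def)
  next
    case (Suc n)
    define t where "t = b + real n * (g / 2)"
    have "e n = min (- g / 2) t" "e (Suc n) = min (- g / 2) (t + g / 2)"
      by (simp_all add: e_def t_def algebra_simps add_divide_distrib)
    then have st: "e (Suc n) \<le> e n + g / 2" "e (Suc n) < 0" using g by (auto simp: min_def)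
    have "Ob (e (Suc n) - 1) Yb"
      by (rule Yb_Ob[OF Dg Suc]) (use st g in auto)
    then obtain aa where "Ob (e (Suc n) - 1 + 1) (\<lambda>z. Y z - (\<Sum>j<(0::nat). aa j * z ^ j))"
      by (rule Y_step[OF Suc, where k=0 and s="e (Suc n) - 1"]) (use e_lo[of "Suc n"] e_lo[of n] st in auto)
    then show ?case by simp
  qed
  obtain n :: nat where n: "(- g / 2 - b) / (g / 2) \<le> real n" using real_arch_simple by blast
  then have "- g / 2 - b \<le> real n * (g / 2)" using g by (simp add: divide_le_eq)
  then have "e n = - g / 2" by (simp add: e_def)
  then have Y1: "Ob (- g / 2) Y" using Ye[of n] by simp
  \<comment> \<open>Starting from order -g/2 the next turn passes 0: the exponent s = g/2 - 1
    belongs to k = 1, and a constant splits off.\<close>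
  have "Ob (g / 2 - 1) Yb" by (rule Yb_Ob[OF Dg Y1]) (use g in auto)
  then obtain aa where "Ob (g / 2 - 1 + 1) (\<lambda>z. Y z - (\<Sum>j<(1::nat). aa j * z ^ j))"
    by (rule Y_step[OF Y1, where k=1 and s="g / 2 - 1"]) (use g g1 in auto)
  then have "Ob (g / 2) (\<lambda>z. Y z - aa 0)" by simp
  then have Y2: "Ob 0 Y" using Ob_1_of_approx g by auto
  have "Ob (g - 1) Yb" by (rule Yb_Ob[OF Dg Y2]) (use g in auto)
  then obtain aa where "Ob (g - 1 + 1) (\<lambda>z. Y z - (\<Sum>j<(1::nat). aa j * z ^ j))"
    by (rule Y_step[OF Y2, where k=1 and s="g - 1"]) (use g g1 in auto)
  then have Y3: "Ob g (\<lambda>z. Y z - aa 0)" by simp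
  define w where "w = aa 0"
  have kg: "Ob g \<kappa>" by (rule \<kappa>_Ob[OF Bg])
  have X0: "Ob 0 X" by (rule X_Ob[OF Y2])
  have "Ob g (\<lambda>z. (Y z - w) - \<kappa> z * cnj (X z))"
    by (rule Ob_diff[OF Y3[folded w_def] Ob_multI[OF kg Ob_cnj[OF X0]]]) simp
  then have X1: "Ob g (\<lambda>z. X z - w)"
    by (rule Ob_cong) (use X_Y in \<open>auto elim!: eventually_mono simp: algebra_simps\<close>)
  have Xl: "lead \<delta> 0 (\<lambda>_. 1) w X"
    using Ob_mono[OF X1 gd(2)] \<delta> by (intro lead_const) auto
  let ?h = "\<lambda>z. complex_of_real (cmod z powr g)"
  obtain k where irl: "lead \<delta> g ?h k ir" using ir_lead by blast
  have Sl: "lead \<delta> 0 (\<lambda>_. 1) (inverse (l * cnj l)) (\<lambda>z. inverse (S z))"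
    using S_inv \<delta> by (intro lead_const) auto
  have Jl: "lead \<delta> 0 (\<lambda>_. 1) (l * cnj l) J" using J_approx \<delta> by (intro lead_const) auto
  have Pl: "lead \<delta> 0 (\<lambda>_. 1) \<Phi>0 \<Phi>" using Ob_mono[OF P0] \<delta> by (intro lead_const) auto
  have Al: "lead \<delta> 0 (\<lambda>_. 1) (inverse l) (\<lambda>z. inverse (A z))" using A_inv \<delta> by (intro lead_const) auto
  have d0: "0 \<le> \<delta>" using \<delta> by simp
  obtain kB where Bl: "lead \<delta> g ?h kB B"
  proof -
    have "lead \<delta> g ?h (k * (cnj \<Phi>0 * cnj (inverse l))) (\<lambda>z. ir z * (cnj (\<Phi> z) * inverse (cnj (A z))))"
      using lead_mult[OF irl lead_mult[OF lead_cnj[OF Pl] lead_cnj[OF Al] d0] d0] by simp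
    then have "lead \<delta> g ?h (k * (cnj \<Phi>0 * cnj (inverse l))) B"
      by (rule lead_cong) (use B_eq in \<open>auto elim: eventually_mono\<close>)
    then show thesis by (rule that)
  qed
  \<comment> \<open>The common profile |z|^g / cnj z: both the pole of \<open>H\<close> and the term
    with \<open>D\<close> contribute a multiple of it, the latter through B cnj Q, since the part
    with \<open>\<Phi>z\<close> has the better order g.\<close>
  let ?m = "\<lambda>z. ?h z * cnj (1 / z)"
  have mOb: "Ob (g - 1) ?m" using Ob_mult[OF Ob_powr Ob_cnj[OF Ob_inverse_ident], of g] by simp
  obtain kD where Dl: "lead \<delta> (g - 1) ?m kD D"
  proof -
    have 1: "lead \<delta> (g - 1) ?m 0 (\<lambda>z. ir z * cnj (\<Phi>z z))"
      by (rule lead_small[OF _ mOb]) (intro Ob_multI[OF ir Ob_cnj[OF Pz]], use \<delta> in simp)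
    have 2: "lead \<delta> (g - 1) ?m (- 2 * (kB * cnj (of_real (\<alpha> - 1) * l))) (\<lambda>z. - 2 * (B z * cnj (Q z)))"
      using lead_cmult[OF lead_mult[OF Bl lead_cnj[OF Q_lead] d0], of "- 2"] by simp
    have "lead \<delta> (g - 1) ?m (0 + - 2 * (kB * cnj (of_real (\<alpha> - 1) * l))) D"
      by (rule lead_cong[OF lead_add[OF 1 2]]) (use D_eq in \<open>auto elim!: eventually_mono\<close>)
    then show thesis by (rule that)
  qed
  obtain a where Ha: "Ob 0 (\<lambda>z. H z - a * (1 / z))" using H_pole .
  have Hl: "lead \<delta> (- 1) (\<lambda>z. 1 / z) a H"
    unfolding lead_def using Ob_mono[OF Ha] \<delta> Ob_inverse_ident by auto
  obtain c where Ybl: "lead \<delta> (g - 1) ?m c Yb"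
  proof -
    have irr: "\<forall>\<^sub>F z in at 0. cnj (ir z) = ir z"
      using ev_U[OF F_real] by eventually_elim (simp add: ir_def exp_cnj)
    have "lead \<delta> (g - 1) ?m (k * cnj a * inverse (l * cnj l)) (\<lambda>z. ir z * cnj (H z) * inverse (S z))"
      using lead_mult[OF lead_mult[OF irl lead_cnj[OF Hl] d0] Sl d0] by simp
    then have 1: "lead \<delta> (g - 1) ?m (k * cnj a * inverse (l * cnj l)) (\<lambda>z. cnj (Hr z) * inverse (S z))"
      by (rule lead_cong) (use irr in \<open>auto elim!: eventually_mono simp: Hr_eq\<close>)
    have 2: "lead \<delta> (g - 1) ?m (kD * (l * cnj l * cnj w) * (inverse (l * cnj l) * inverse (l * cnj l)))
        (\<lambda>z. D z * (J z * cnj (X z)) * (inverse (S z) * inverse (S z)))"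
      using lead_mult[OF lead_mult[OF Dl lead_mult[OF Jl lead_cnj[OF Xl] d0] d0] lead_mult[OF Sl Sl d0] d0] by simp
    show thesis by (rule that) (use lead_add[OF 1 2] in \<open>simp add: Yb_def[abs_def]\<close>)
  qed
  \<comment> \<open>The conjugate derivative of |z|^g is (g/2) |z|^g / cnj z, so this multiple of
    |z|^g is a primitive of the leading term.\<close>
  let ?c = "c / of_real (g / 2)"
  have c: "?c * of_real (g / 2) = c" using g by simp
  have dW: "\<forall>\<^sub>F z in at 0. has_wd (\<lambda>z. Y z - ?c * ?h z) (Yz z - ?c * (of_real (g / 2) * (?h z / z))) (Yb z - c * ?m z) z"
    using Y_deriv eventually_at_0_lt[OF zero_less_one]
  proof eventually_elim
    case (elim z)
    then have z: "z \<noteq> 0" by auto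
    show ?case
      by (rule has_wd_eqI[OF has_wd_diff[OF elim(1) has_wd_mult[OF has_wd_const has_wd_powr_norm[OF z]]]])
        (simp_all only: mult_zero_left add_0 mult.assoc[symmetric] c, simp add: mult.assoc)
  qed
  \<comment> \<open>The remaining source has order g - 1 + \<delta>. The condition g + \<delta> < 1
    keeps it in the range k = 1, so only a constant is added.\<close>
  have "\<exists>a. Ob (g - 1 + \<delta> + 1) (\<lambda>z. (Y z - ?c * ?h z) - (\<Sum>j<(1::nat). a j * z ^ j))"
  proof (rule dbar_expansion[OF dW])
    show "Ob 0 (\<lambda>z. Y z - ?c * ?h z)"
      by (intro Ob_diff Y2 Ob_cmult Ob_mono[OF Ob_powr]) (use g in auto)
    show "Ob (g - 1 + \<delta>) (\<lambda>z. Yb z - c * ?m z)" using Ybl by (simp add: lead_def)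
    have "Ob (g - 1) (\<lambda>z. ?h z * (1 / z))" by (rule Ob_multI[OF Ob_powr Ob_inverse_ident]) simp
    then have "Ob (min (b - 1) (g - 1)) (\<lambda>z. Yz z - ?c * (of_real (g / 2) * (?h z * (1 / z))))"
      by (intro Ob_diff Ob_cmult) (auto intro: Ob_mono[OF Yz_Ob] Ob_mono)
    then show "Ob (min (b - 1) (g - 1)) (\<lambda>z. Yz z - ?c * (of_real (g / 2) * (?h z / z)))" by simp
  qed (use g gd \<delta> in auto)
  then obtain w' where w': "Ob (g + \<delta>) (\<lambda>z. Y z - ?c * ?h z - w')" by (auto simp: algebra_simps)
  obtain kk where kl: "lead \<delta> g ?h kk \<kappa>"
  proof -
    have "lead \<delta> g ?h (2 * (cnj l * kB * inverse (l * cnj l))) \<kappa>"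
      using lead_cmult[OF lead_mult[OF lead_mult[OF lead_cnj[OF A_lead] Bl d0] Sl d0], of 2] by (simp add: \<kappa>_def[abs_def])
    then show thesis by (rule that)
  qed
  have kX: "lead \<delta> g ?h (kk * cnj w) (\<lambda>z. \<kappa> z * cnj (X z))"
    using lead_mult[OF kl lead_cnj[OF Xl] d0] by simp
  \<comment> \<open>The passage from \<open>Y\<close> to \<open>X\<close> adds one more multiple of
    |z|^g, because \<kappa> has this profile and \<open>X\<close> tends to \<open>w\<close>.\<close>
  have "Ob (g + \<delta>) (\<lambda>z. (Y z - ?c * ?h z - w') - (\<kappa> z * cnj (X z) - (kk * cnj w) * ?h z))"
    by (rule Ob_diff[OF w']) (use kX in \<open>simp add: lead_def\<close>)
  then have "Ob (g + \<delta>) (\<lambda>z. X z - (w' + (?c - kk * cnj w) * ?h z))"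
    by (rule Ob_cong) (use X_Y in \<open>auto elim!: eventually_mono simp: algebra_simps\<close>)
  then show ?thesis by blast
qed

text \<open>Now g = 1 + h with h = 1 - 2\<alpha> > 0, and \<Phi> may keep a simple pole. This costs
  one order: \<open>B\<close> has order h and \<open>D\<close> order h - 1. The weight b is
  positive, which makes all constant terms vanish. The conjugate derivative of \<open>Y\<close> is
  finally of order h/2 > 0, so \<open>Y\<close> is linear up to O(r^(1+h/2)), and \<kappa> cnj X is
  of that order too.\<close>

theorem expansion_small:
  assumes a: "\<alpha> < 1/2"
  shows "\<exists>\<mu>. Ob (1 + (1 - 2 * \<alpha>) / 2) (\<lambda>z. X z - \<mu> * z)"
proof -
  define h where "h = 1 - 2 * \<alpha>"
  have h: "0 < h" "h < 1" "g = h + 1" using a \<alpha> by (auto simp: h_def g_def)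
  have ir: "Ob g ir" by (rule ir_Ob)
  obtain \<Phi>0 where P0: "Ob 0 (\<lambda>z. \<Phi> z - \<Phi>0 * (1 / z))" and Pz: "Ob (- 2) \<Phi>z"
    by (rule holo_extend1[OF \<Phi>_holo \<Phi>_Ob]) (use \<delta> h in auto)
  have "Ob (- 1) (\<lambda>z. (\<Phi> z - \<Phi>0 * (1 / z)) + \<Phi>0 * (1 / z))"
    by (intro Ob_add Ob_cmult Ob_inverse_ident) (use P0 Ob_mono in force)
  then have P1: "Ob (- 1) \<Phi>" by simp
  have Ai: "Ob 0 (\<lambda>z. inverse (cnj (A z)))" using Ob_cnj[OF A_inv0] by simp
  have Bh: "Ob h B"
  proof (rule Ob_cong)
    show "Ob h (\<lambda>z. ir z * (cnj (\<Phi> z) * inverse (cnj (A z))))"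
      by (rule Ob_multI[OF ir Ob_multI[OF Ob_cnj[OF P1] Ai, of "- 1"]]) (use h in auto)
    show "\<forall>\<^sub>F z in at 0. ir z * (cnj (\<Phi> z) * inverse (cnj (A z))) = B z"
      using B_eq by eventually_elim (rule sym)
  qed
  have Dh: "Ob (h - 1) D"
  proof (rule Ob_cong)
    show "Ob (h - 1) (\<lambda>z. ir z * cnj (\<Phi>z z) - 2 * (B z * cnj (Q z)))"
      by (intro Ob_diff Ob_cmult Ob_multI[OF ir Ob_cnj[OF Pz]] Ob_multI[OF Bh Ob_cnj[OF Q_Ob]]) (use h in auto)
    show "\<forall>\<^sub>F z in at 0. ir z * cnj (\<Phi>z z) - 2 * (B z * cnj (Q z)) = D z"
      using D_eq by eventually_elim simp
  qed
  \<comment> \<open>Half of the gain h is used per turn. The cap at 1 - h/2 keeps s = e - 1 in (-1,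
    0), where k = 1 and only a constant can split off.\<close>
  define e where "e = (\<lambda>n::nat. min (1 - h / 2) (b + real n * (h / 2)))"
  have b0: "0 < b" using h \<epsilon> by (simp add: b_def h_def)
  have e_lo: "0 < e n" for n
  proof -
    have "0 \<le> real n * (h / 2)" using h by simp
    then have "0 < b + real n * (h / 2)" using b0 by linarith
    then show ?thesis unfolding e_def min_less_iff_conj using h by auto
  qed
  \<comment> \<open>Both \<open>Y\<close> and the remainder tend to 0, hence so does the polynomial.
    The range Suc k guarantees that the polynomial has a constant term.\<close>
  have a0: "aa (0::nat) = 0" if "Ob c Y" "0 < c" "Ob c' (\<lambda>z. Y z - (\<Sum>j<Suc k. aa j * z ^ j))" "0 < c'" for c c' k and aa :: "nat \<Rightarrow> complex"
  proof -
    have "((\<lambda>z. Y z - (Y z - (\<Sum>j<Suc k. aa j * z ^ j))) \<longlongrightarrow> 0 - 0) (at 0)"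
      by (rule tendsto_diff[OF Ob_tendsto_0[OF that(1,2)] Ob_tendsto_0[OF that(3,4)]])
    then have "((\<lambda>z. \<Sum>j<Suc k. aa j * z ^ j) \<longlongrightarrow> 0) (at 0)" by simp
    moreover have "((\<lambda>z::complex. \<Sum>j<Suc k. aa j * z ^ j) \<longlongrightarrow> (\<Sum>j<Suc k. aa j * 0 ^ j)) (at 0)"
      by (intro tendsto_intros)
    ultimately have "0 = (\<Sum>j<Suc k. aa j * (0::complex) ^ j)"
      by (rule tendsto_unique[rotated]) auto
    then show ?thesis by (simp add: sum.lessThan_Suc_shift del: sum.lessThan_Suc)
  qed
  have Ye: "Ob (e n) Y" for n
  proof (induction n)
    case 0
    then show ?case using Ob_mono[OF Y_Ob] by (simp add: e_def)
  next
    case (Suc n)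
    define t where "t = b + real n * (h / 2)"
    have "e n = min (1 - h / 2) t" "e (Suc n) = min (1 - h / 2) (t + h / 2)"
      by (simp_all add: e_def t_def algebra_simps add_divide_distrib)
    then have st: "e (Suc n) \<le> e n + h / 2" "e (Suc n) \<le> 1 - h / 2" using h by (auto simp: min_def)
    have "Ob (e (Suc n) - 1) Yb"
      by (rule Yb_Ob[OF Dh Suc]) (use st h in auto)
    then obtain aa where aa: "Ob (e (Suc n) - 1 + 1) (\<lambda>z. Y z - (\<Sum>j<(1::nat). aa j * z ^ j))"
      by (rule Y_step[OF Suc, where k=1 and s="e (Suc n) - 1"]) (use e_lo[of "Suc n"] e_lo[of n] st h in auto)
    have "aa 0 = 0"
      by (rule a0[OF Suc e_lo, where k=0 and c'="e (Suc n)"]) (use aa e_lo in auto)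
    then show ?case using aa by simp
  qed
  obtain n :: nat where n: "(1 - h / 2 - b) / (h / 2) \<le> real n" using real_arch_simple by blast
  then have "1 - h / 2 - b \<le> real n * (h / 2)" using h by (simp add: divide_le_eq)
  then have "e n = 1 - h / 2" by (simp add: e_def)
  then have Y1: "Ob (1 - h / 2) Y" using Ye[of n] by simp
  \<comment> \<open>The last turn: s = h/2 belongs to k = 2, so the linear term splits off.\<close>
  have "Ob (h / 2) Yb" by (rule Yb_Ob[OF Dh Y1]) (use h in auto)
  then obtain aa where aa: "Ob (h / 2 + 1) (\<lambda>z. Y z - (\<Sum>j<(2::nat). aa j * z ^ j))"
    by (rule Y_step[OF Y1, where k=2 and s="h / 2"]) (use h in auto)
  have "aa 0 = 0"
    by (rule a0[OF Y1, where k=1 and c'="h / 2 + 1"]) (use aa h in \<open>auto simp: numeral_2_eq_2\<close>)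
  then have Y2: "Ob (h / 2 + 1) (\<lambda>z. Y z - aa 1 * z)" using aa by (simp add: numeral_2_eq_2)
  have "Ob 1 (\<lambda>z. (Y z - aa 1 * z) + aa 1 * z)"
    by (intro Ob_add Ob_cmult Ob_ident Ob_mono[OF Y2]) (use h in auto)
  then have "Ob 1 Y" by simp
  then have X1: "Ob 1 X" by (rule X_Ob)
  have "Ob (h / 2 + 1) (\<lambda>z. (Y z - aa 1 * z) - \<kappa> z * cnj (X z))"
    by (rule Ob_diff[OF Y2 Ob_multI[OF \<kappa>_Ob[OF Bh] Ob_cnj[OF X1]]]) (use h in auto)
  then have "Ob (h / 2 + 1) (\<lambda>z. X z - aa 1 * z)"
    by (rule Ob_cong) (use X_Y in \<open>auto elim!: eventually_mono simp: algebra_simps\<close>)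
  then show ?thesis unfolding h_def by (auto simp: add.commute)
qed

end

section \<open>Weighted Hoelder germs\<close>

text \<open>Young's argument for second derivatives, in which x -> D x a need only be differentiable
  at the single point \<open>z\<close>. Along the first increment, the difference in direction
  \<open>b\<close> minus its model s t L b has a derivative of size o(t). The mean value inequality
  then gives o(t^2).\<close>

lemma second_difference:
  fixes f :: "'a::real_normed_vector \<Rightarrow> 'b::real_normed_vector"
  assumes D: "\<forall>\<^sub>F x in nhds z. (f has_derivative D x) (at x)"
    and L: "((\<lambda>x. D x a) has_derivative L) (at z)"
  shows "((\<lambda>t. (f (z + t *\<^sub>R a + t *\<^sub>R b) - f (z + t *\<^sub>R a) - f (z + t *\<^sub>R b) + f z) /\<^sub>R t^2) \<longlongrightarrow> L b) (at_right 0)"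
proof (rule tendstoI)
  fix e :: real assume e: "0 < e"
  define N where "N = norm a + norm b + 1"
  have N: "0 < N" by (simp add: N_def add_nonneg_pos)
  define e' where "e' = e / (4 * N)"
  have e': "0 < e'" using e N by (simp add: e'_def)
  obtain d1 where d1: "0 < d1" "\<And>x. dist x z < d1 \<Longrightarrow> (f has_derivative D x) (at x)"
    using D unfolding eventually_nhds_metric by blast
  obtain d2 where d2: "0 < d2" "\<And>x. norm (x - z) < d2 \<Longrightarrow> norm (D x a - D z a - L (x - z)) \<le> e' * norm (x - z)"
    using L e' unfolding has_derivative_at_alt by blast
  have Ll: "linear L" using L has_derivative_linear by blast
  define r where "r = min d1 d2 / N"
  have r: "0 < r" using d1 d2 N by (simp add: r_def)
  have main: "dist ((f (z + t *\<^sub>R a + t *\<^sub>R b) - f (z + t *\<^sub>R a) - f (z + t *\<^sub>R b) + f z) /\<^sub>R t^2) (L b) < e"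
    if t: "0 < t" "t < r" for t
  proof -
    have tN: "t * N < d1" "t * N < d2" using t N by (auto simp: r_def less_divide_eq)
    have small: "norm (s *\<^sub>R a + u *\<^sub>R b) \<le> t * N" if "0 \<le> s" "s \<le> t" "0 \<le> u" "u \<le> t" for s u
    proof -
      have "norm (s *\<^sub>R a + u *\<^sub>R b) \<le> s * norm a + u * norm b"
        using norm_triangle_ineq[of "s *\<^sub>R a" "u *\<^sub>R b"] that by simp
      also have "\<dots> \<le> t * norm a + t * norm b" using that by (intro add_mono mult_right_mono) auto
      also have "\<dots> \<le> t * N" using t by (simp add: N_def algebra_simps)
      finally show ?thesis .
    qed
    define \<phi> where "\<phi> = (\<lambda>s. f (z + (s *\<^sub>R a + t *\<^sub>R b)) - f (z + (s *\<^sub>R a + 0 *\<^sub>R b)) - (s * t) *\<^sub>R L b)"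
    define \<phi>' where "\<phi>' = (\<lambda>s h::real. h *\<^sub>R (D (z + (s *\<^sub>R a + t *\<^sub>R b)) a - D (z + (s *\<^sub>R a + 0 *\<^sub>R b)) a - t *\<^sub>R L b))"
    have der: "((\<lambda>s. f (z + (s *\<^sub>R a + u *\<^sub>R b))) has_derivative (\<lambda>h. h *\<^sub>R D (z + (s *\<^sub>R a + u *\<^sub>R b)) a)) (at s within {0..t})"
      if "0 \<le> s" "s \<le> t" "0 \<le> u" "u \<le> t" for s u
    proof -
      have fd: "(f has_derivative D (z + (s *\<^sub>R a + u *\<^sub>R b))) (at (z + (s *\<^sub>R a + u *\<^sub>R b)))"
        using small[OF that] tN by (intro d1(2)) (simp add: dist_norm)
      have "((\<lambda>s. z + (s *\<^sub>R a + u *\<^sub>R b)) has_derivative (\<lambda>h. h *\<^sub>R a)) (at s within {0..t})"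
        by (auto intro!: derivative_eq_intros)
      from has_derivative_compose[OF this fd] show ?thesis
        using has_derivative_linear[OF fd] by (simp add: linear_scale)
    qed
    have "norm (\<phi> t - \<phi> 0) \<le> (2 * (e' * (t * N))) * norm (t - 0)"
    proof (rule differentiable_bound)
      show "convex {0..t}" by simp
      fix s assume s: "s \<in> {0..t}"
      show "(\<phi> has_derivative \<phi>' s) (at s within {0..t})"
        unfolding \<phi>_def \<phi>'_def scaleR_diff_right
        using s t by (intro has_derivative_diff der) (auto intro!: derivative_eq_intros)
      show "onorm (\<phi>' s) \<le> 2 * (e' * (t * N))"
      proof (rule onorm_le)
        fix h
        let ?v = "s *\<^sub>R a + t *\<^sub>R b" and ?w = "s *\<^sub>R a + 0 *\<^sub>R b"
        have v: "norm ?v \<le> t * N" by (rule small) (use s t in auto)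
        have w: "norm ?w \<le> t * N" by (rule small) (use s t in auto)
        have "L ?v - L ?w = t *\<^sub>R L b" by (simp add: linear_add[OF Ll] linear_scale[OF Ll])
        then have "D (z + ?v) a - D (z + ?w) a - t *\<^sub>R L b
            = (D (z + ?v) a - D z a - L ((z + ?v) - z)) - (D (z + ?w) a - D z a - L ((z + ?w) - z))"
          by (simp add: algebra_simps)
        also have "norm \<dots> \<le> e' * (t * N) + e' * (t * N)"
        proof (rule order_trans[OF norm_triangle_ineq4], rule add_mono)
          show "norm (D (z + ?v) a - D z a - L ((z + ?v) - z)) \<le> e' * (t * N)"
            by (rule order_trans[OF d2(2)]) (use v tN e' in auto)
          show "norm (D (z + ?w) a - D z a - L ((z + ?w) - z)) \<le> e' * (t * N)"
            by (rule order_trans[OF d2(2)]) (use w tN e' in auto)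
        qed
        finally have "norm (D (z + ?v) a - D (z + ?w) a - t *\<^sub>R L b) \<le> 2 * (e' * (t * N))" by (simp add: mult_ac)
        then show "norm (\<phi>' s h) \<le> 2 * (e' * (t * N)) * norm h"
          unfolding \<phi>'_def norm_scaleR real_norm_def by (subst mult.commute) (rule mult_right_mono, auto)
      qed
    qed (use t in auto)
    then have bd: "norm (\<phi> t - \<phi> 0) \<le> 2 * e' * N * t^2" using t by (simp add: power2_eq_square mult_ac)
    let ?\<Delta> = "f (z + t *\<^sub>R a + t *\<^sub>R b) - f (z + t *\<^sub>R a) - f (z + t *\<^sub>R b) + f z"
    have "\<phi> t - \<phi> 0 = ?\<Delta> - (t^2) *\<^sub>R L b" by (simp add: \<phi>_def power2_eq_square algebra_simps)
    moreover have "?\<Delta> /\<^sub>R t^2 - L b = (?\<Delta> - (t^2) *\<^sub>R L b) /\<^sub>R t^2" using t by (simp add: scaleR_diff_right)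
    ultimately have "norm (?\<Delta> /\<^sub>R t^2 - L b) = norm (\<phi> t - \<phi> 0) / t^2" using t by (simp add: divide_inverse)
    also have "\<dots> \<le> 2 * e' * N" using bd t by (simp add: divide_le_eq)
    also have "\<dots> < e" using e N by (simp add: e'_def)
    finally show ?thesis by (simp add: dist_norm)
  qed
  show "\<forall>\<^sub>F t in at_right 0. dist ((f (z + t *\<^sub>R a + t *\<^sub>R b) - f (z + t *\<^sub>R a) - f (z + t *\<^sub>R b) + f z) /\<^sub>R t^2) (L b) < e"
    unfolding eventually_at_right_field using r main by auto
qed

text \<open>The second difference is symmetric in the directions 1 and i. Its two limits differ by a
  nonzero multiple of a2 - b1.\<close>

lemma has_wd_mixed:
  assumes f: "\<forall>\<^sub>F x in nhds z. has_wd f (a x) (b x) x" and a: "has_wd a a1 a2 z" and b: "has_wd b b1 b2 z"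
  shows "a2 = b1"
proof -
  let ?D = "\<lambda>x h. a x * h + b x * cnj h"
  have D: "\<forall>\<^sub>F x in nhds z. (f has_derivative ?D x) (at x)" using f by (simp add: has_wd_def)
  have L: "((\<lambda>x. ?D x k) has_derivative (\<lambda>h. (a1 * h + a2 * cnj h) * k + (b1 * h + b2 * cnj h) * cnj k)) (at z)" for k
    using a b unfolding has_wd_def by (intro has_derivative_add has_derivative_mult_left) auto
  have 1: "((\<lambda>t. (f (z + t *\<^sub>R 1 + t *\<^sub>R \<i>) - f (z + t *\<^sub>R 1) - f (z + t *\<^sub>R \<i>) + f z) /\<^sub>R t^2) \<longlongrightarrow>
     (a1 * \<i> + a2 * cnj \<i>) * 1 + (b1 * \<i> + b2 * cnj \<i>) * cnj 1) (at_right 0)"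
    by (rule second_difference[OF D L])
  have 2: "((\<lambda>t. (f (z + t *\<^sub>R \<i> + t *\<^sub>R 1) - f (z + t *\<^sub>R \<i>) - f (z + t *\<^sub>R 1) + f z) /\<^sub>R t^2) \<longlongrightarrow>
     (a1 * 1 + a2 * cnj 1) * \<i> + (b1 * 1 + b2 * cnj 1) * cnj \<i>) (at_right 0)"
    by (rule second_difference[OF D L])
  have "(\<lambda>t. (f (z + t *\<^sub>R \<i> + t *\<^sub>R 1) - f (z + t *\<^sub>R \<i>) - f (z + t *\<^sub>R 1) + f z) /\<^sub>R t^2)
    = (\<lambda>t. (f (z + t *\<^sub>R 1 + t *\<^sub>R \<i>) - f (z + t *\<^sub>R 1) - f (z + t *\<^sub>R \<i>) + f z) /\<^sub>R t^2)"
    by (simp add: algebra_simps)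
  from tendsto_unique[OF _ 1 2[unfolded this]]
  have "(a1 * \<i> + a2 * cnj \<i>) * 1 + (b1 * \<i> + b2 * cnj \<i>) * cnj 1 = (a1 * 1 + a2 * cnj 1) * \<i> + (b1 * 1 + b2 * cnj 1) * cnj \<i>"
    by simp
  then show ?thesis by (auto simp: complex_eq_iff)
qed

section \<open>Germs with growth conditions on derivatives\<close>

lemma eventually_at_0_nhds:
  assumes "\<forall>\<^sub>F z in at (0::complex). P z"
  shows "\<forall>\<^sub>F z in at 0. \<forall>\<^sub>F x in nhds z. P x"
proof -
  obtain r where r: "0 < r" "\<And>z. z \<noteq> 0 \<Longrightarrow> cmod z < r \<Longrightarrow> P z" using eventually_at_0_D[OF assms] by blast
  from eventually_at_0_lt[OF r(1)] show ?thesis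
  proof eventually_elim
    case (elim z)
    have "\<forall>\<^sub>F x in nhds z. x \<in> ball 0 r - {0}" using elim by (intro eventually_nhds_in_open) auto
    then show ?case by eventually_elim (use r in auto)
  qed
qed

lemma ev_has_wd_cong:
  assumes "\<forall>\<^sub>F z in at 0. has_wd f (a z) (b z) z" "\<forall>\<^sub>F z in at 0. f z = g z"
  shows "\<forall>\<^sub>F z in at 0. has_wd g (a z) (b z) z"
  using assms(1) eventually_at_0_nhds[OF assms(2)] by eventually_elim (rule has_wd_transform)

text \<open>The value has order \<open>c\<close>, the first derivatives have order c - 1, and second
  derivatives exist without a bound. \<open>S3\<close> adds the order c - 2 of the second
  derivatives and a common mixed derivative. The weaker class is what a Jacobi field has to satisfy
  and it survives changes of both coordinates; the stronger one is used for the map itself.\<close>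

definition S2 :: "real \<Rightarrow> (complex \<Rightarrow> complex) \<Rightarrow> bool" where
  "S2 c f \<longleftrightarrow> (\<exists>a b a1 a2 b1 b2. (\<forall>\<^sub>F z in at 0. has_wd f (a z) (b z) z) \<and>
     (\<forall>\<^sub>F z in at 0. has_wd a (a1 z) (a2 z) z) \<and> (\<forall>\<^sub>F z in at 0. has_wd b (b1 z) (b2 z) z) \<and>
     Ob c f \<and> Ob (c - 1) a \<and> Ob (c - 1) b)"

definition S3 :: "real \<Rightarrow> (complex \<Rightarrow> complex) \<Rightarrow> bool" where
  "S3 c f \<longleftrightarrow> (\<exists>a b a1 m b2. (\<forall>\<^sub>F z in at 0. has_wd f (a z) (b z) z) \<and>
     (\<forall>\<^sub>F z in at 0. has_wd a (a1 z) (m z) z) \<and> (\<forall>\<^sub>F z in at 0. has_wd b (m z) (b2 z) z) \<and>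
     Ob c f \<and> Ob (c - 1) a \<and> Ob (c - 1) b \<and> Ob (c - 2) a1 \<and> Ob (c - 2) m \<and> Ob (c - 2) b2)"

lemma S2_E:
  assumes "S2 c f"
  obtains a b a1 m b2 where "\<forall>\<^sub>F z in at 0. has_wd f (a z) (b z) z"
     "\<forall>\<^sub>F z in at 0. has_wd a (a1 z) (m z) z" "\<forall>\<^sub>F z in at 0. has_wd b (m z) (b2 z) z"
     "Ob c f" "Ob (c - 1) a" "Ob (c - 1) b"
proof -
  from assms obtain a b a1 a2 b1 b2 where *: "\<forall>\<^sub>F z in at 0. has_wd f (a z) (b z) z"
     "\<forall>\<^sub>F z in at 0. has_wd a (a1 z) (a2 z) z" "\<forall>\<^sub>F z in at 0. has_wd b (b1 z) (b2 z) z"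
     "Ob c f" "Ob (c - 1) a" "Ob (c - 1) b" unfolding S2_def by blast
  have "\<forall>\<^sub>F z in at 0. has_wd b (a2 z) (b2 z) z"
    using eventually_at_0_nhds[OF *(1)] *(2,3)
  proof eventually_elim
    case (elim z)
    have "a2 z = b1 z" by (rule has_wd_mixed[OF elim])
    then show ?case using elim(3) by simp
  qed
  from that[OF *(1,2) this *(4,5,6)] show thesis .
qed

lemma S2_I:
  assumes "\<forall>\<^sub>F z in at 0. has_wd f (a z) (b z) z"
     "\<forall>\<^sub>F z in at 0. has_wd a (a1 z) (a2 z) z" "\<forall>\<^sub>F z in at 0. has_wd b (b1 z) (b2 z) z"
     "Ob c f" "Ob (c - 1) a" "Ob (c - 1) b"
  shows "S2 c f"
  unfolding S2_def by (intro exI conjI) (rule assms)+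

lemma S3_I:
  assumes "\<forall>\<^sub>F z in at 0. has_wd f (a z) (b z) z"
     "\<forall>\<^sub>F z in at 0. has_wd a (a1 z) (m z) z" "\<forall>\<^sub>F z in at 0. has_wd b (m z) (b2 z) z"
     "Ob c f" "Ob (c - 1) a" "Ob (c - 1) b" "Ob (c - 2) a1" "Ob (c - 2) m" "Ob (c - 2) b2"
  shows "S3 c f"
  unfolding S3_def by (intro exI conjI) (rule assms)+

lemma S2_Ob: "S2 c f \<Longrightarrow> Ob c f" unfolding S2_def by blast

lemma S2_cong:
  assumes "S2 c f" "\<forall>\<^sub>F z in at 0. f z = g z"
  shows "S2 c g"
proof -
  obtain a b a1 a2 b1 b2 where *: "\<forall>\<^sub>F z in at 0. has_wd f (a z) (b z) z"
     "\<forall>\<^sub>F z in at 0. has_wd a (a1 z) (a2 z) z" "\<forall>\<^sub>F z in at 0. has_wd b (b1 z) (b2 z) z"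
     "Ob c f" "Ob (c - 1) a" "Ob (c - 1) b" using assms(1) unfolding S2_def by blast
  show ?thesis
    by (rule S2_I[OF ev_has_wd_cong[OF *(1) assms(2)] *(2,3) Ob_cong[OF *(4) assms(2)] *(5,6)])
qed

lemma S3_cong:
  assumes "S3 c f" "\<forall>\<^sub>F z in at 0. f z = g z"
  shows "S3 c g"
proof -
  obtain a b a1 m b2 where *: "\<forall>\<^sub>F z in at 0. has_wd f (a z) (b z) z"
     "\<forall>\<^sub>F z in at 0. has_wd a (a1 z) (m z) z" "\<forall>\<^sub>F z in at 0. has_wd b (m z) (b2 z) z"
     "Ob c f" "Ob (c - 1) a" "Ob (c - 1) b" "Ob (c - 2) a1" "Ob (c - 2) m" "Ob (c - 2) b2"
    using assms(1) unfolding S3_def by blast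
  show ?thesis
    by (rule S3_I[OF ev_has_wd_cong[OF *(1) assms(2)] *(2,3) Ob_cong[OF *(4) assms(2)] *(5-9)])
qed

lemma S2_mult:
  assumes "S2 c f" "S2 d g"
  shows "S2 (c + d) (\<lambda>z. f z * g z)"
proof -
  obtain a b a1 a2 b1 b2 where f: "\<forall>\<^sub>F z in at 0. has_wd f (a z) (b z) z"
     "\<forall>\<^sub>F z in at 0. has_wd a (a1 z) (a2 z) z" "\<forall>\<^sub>F z in at 0. has_wd b (b1 z) (b2 z) z"
     "Ob c f" "Ob (c - 1) a" "Ob (c - 1) b" using assms(1) unfolding S2_def by blast
  obtain a' b' a1' a2' b1' b2' where g: "\<forall>\<^sub>F z in at 0. has_wd g (a' z) (b' z) z"
     "\<forall>\<^sub>F z in at 0. has_wd a' (a1' z) (a2' z) z" "\<forall>\<^sub>F z in at 0. has_wd b' (b1' z) (b2' z) z"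
     "Ob d g" "Ob (d - 1) a'" "Ob (d - 1) b'" using assms(2) unfolding S2_def by blast
  show ?thesis
  proof (rule S2_I)
    show "\<forall>\<^sub>F z in at 0. has_wd (\<lambda>z. f z * g z) (a z * g z + f z * a' z) (b z * g z + f z * b' z) z"
      using f(1) g(1) by eventually_elim (rule has_wd_mult)
    show "\<forall>\<^sub>F z in at 0. has_wd (\<lambda>z. a z * g z + f z * a' z)
        ((a1 z * g z + a z * a' z) + (a z * a' z + f z * a1' z)) ((a2 z * g z + a z * b' z) + (b z * a' z + f z * a2' z)) z"
      using f(1,2) g(1,2) by eventually_elim (intro has_wd_add has_wd_mult)
    show "\<forall>\<^sub>F z in at 0. has_wd (\<lambda>z. b z * g z + f z * b' z)
        ((b1 z * g z + b z * a' z) + (a z * b' z + f z * b1' z)) ((b2 z * g z + b z * b' z) + (b z * b' z + f z * b2' z)) z"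
      using f(1,3) g(1,3) by eventually_elim (intro has_wd_add has_wd_mult)
    show "Ob (c + d) (\<lambda>z. f z * g z)" by (rule Ob_mult[OF f(4) g(4)])
    show "Ob (c + d - 1) (\<lambda>z. a z * g z + f z * a' z)"
      by (intro Ob_add Ob_multI[OF f(5) g(4)] Ob_multI[OF f(4) g(5)]) auto
    show "Ob (c + d - 1) (\<lambda>z. b z * g z + f z * b' z)"
      by (intro Ob_add Ob_multI[OF f(6) g(4)] Ob_multI[OF f(4) g(6)]) auto
  qed
qed

lemma S3_mult:
  assumes "S3 c f" "S3 d g"
  shows "S3 (c + d) (\<lambda>z. f z * g z)"
proof -
  obtain a b a1 m b2 where f: "\<forall>\<^sub>F z in at 0. has_wd f (a z) (b z) z"
     "\<forall>\<^sub>F z in at 0. has_wd a (a1 z) (m z) z" "\<forall>\<^sub>F z in at 0. has_wd b (m z) (b2 z) z"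
     "Ob c f" "Ob (c - 1) a" "Ob (c - 1) b" "Ob (c - 2) a1" "Ob (c - 2) m" "Ob (c - 2) b2"
    using assms(1) unfolding S3_def by blast
  obtain a' b' a1' m' b2' where g: "\<forall>\<^sub>F z in at 0. has_wd g (a' z) (b' z) z"
     "\<forall>\<^sub>F z in at 0. has_wd a' (a1' z) (m' z) z" "\<forall>\<^sub>F z in at 0. has_wd b' (m' z) (b2' z) z"
     "Ob d g" "Ob (d - 1) a'" "Ob (d - 1) b'" "Ob (d - 2) a1'" "Ob (d - 2) m'" "Ob (d - 2) b2'"
    using assms(2) unfolding S3_def by blast
  show ?thesis
  proof (rule S3_I)
    show "\<forall>\<^sub>F z in at 0. has_wd (\<lambda>z. f z * g z) (a z * g z + f z * a' z) (b z * g z + f z * b' z) z"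
      using f(1) g(1) by eventually_elim (rule has_wd_mult)
    show "\<forall>\<^sub>F z in at 0. has_wd (\<lambda>z. a z * g z + f z * a' z)
        ((a1 z * g z + a z * a' z) + (a z * a' z + f z * a1' z)) ((m z * g z + a z * b' z) + (b z * a' z + f z * m' z)) z"
      using f(1,2) g(1,2) by eventually_elim (intro has_wd_add has_wd_mult)
    show "\<forall>\<^sub>F z in at 0. has_wd (\<lambda>z. b z * g z + f z * b' z)
        ((m z * g z + a z * b' z) + (b z * a' z + f z * m' z)) ((b2 z * g z + b z * b' z) + (b z * b' z + f z * b2' z)) z"
      using f(1,3) g(1,3)
    proof eventually_elim
      case (elim z)
      from has_wd_add[OF has_wd_mult[OF elim(2,3)] has_wd_mult[OF elim(1,4)]] show ?case
        by (rule has_wd_eqI) (simp_all add: algebra_simps)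
    qed
    show "Ob (c + d) (\<lambda>z. f z * g z)" by (rule Ob_mult[OF f(4) g(4)])
    show "Ob (c + d - 1) (\<lambda>z. a z * g z + f z * a' z)"
      by (intro Ob_add Ob_multI[OF f(5) g(4)] Ob_multI[OF f(4) g(5)]) auto
    show "Ob (c + d - 1) (\<lambda>z. b z * g z + f z * b' z)"
      by (intro Ob_add Ob_multI[OF f(6) g(4)] Ob_multI[OF f(4) g(6)]) auto
    show "Ob (c + d - 2) (\<lambda>z. (a1 z * g z + a z * a' z) + (a z * a' z + f z * a1' z))"
      by (intro Ob_add Ob_multI[OF f(7) g(4)] Ob_multI[OF f(5) g(5)] Ob_multI[OF f(4) g(7)]) auto
    show "Ob (c + d - 2) (\<lambda>z. (m z * g z + a z * b' z) + (b z * a' z + f z * m' z))"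
      by (intro Ob_add Ob_multI[OF f(8) g(4)] Ob_multI[OF f(5) g(6)] Ob_multI[OF f(6) g(5)] Ob_multI[OF f(4) g(8)]) auto
    show "Ob (c + d - 2) (\<lambda>z. (b2 z * g z + b z * b' z) + (b z * b' z + f z * b2' z))"
      by (intro Ob_add Ob_multI[OF f(9) g(4)] Ob_multI[OF f(6) g(6)] Ob_multI[OF f(4) g(9)]) auto
  qed
qed

lemma S3_imp_S2: "S3 c f \<Longrightarrow> S2 c f"
  unfolding S3_def S2_def by blast

lemma S2_cnj: "S2 c f \<Longrightarrow> S2 c (\<lambda>z. cnj (f z))"
proof -
  assume "S2 c f"
  then obtain a b a1 a2 b1 b2 where f: "\<forall>\<^sub>F z in at 0. has_wd f (a z) (b z) z"
     "\<forall>\<^sub>F z in at 0. has_wd a (a1 z) (a2 z) z" "\<forall>\<^sub>F z in at 0. has_wd b (b1 z) (b2 z) z"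
     "Ob c f" "Ob (c - 1) a" "Ob (c - 1) b" unfolding S2_def by blast
  show "S2 c (\<lambda>z. cnj (f z))"
  proof (rule S2_I)
    show "\<forall>\<^sub>F z in at 0. has_wd (\<lambda>z. cnj (f z)) (cnj (b z)) (cnj (a z)) z"
      using f(1) by eventually_elim (rule has_wd_cnj)
    show "\<forall>\<^sub>F z in at 0. has_wd (\<lambda>z. cnj (b z)) (cnj (b2 z)) (cnj (b1 z)) z"
      using f(3) by eventually_elim (rule has_wd_cnj)
    show "\<forall>\<^sub>F z in at 0. has_wd (\<lambda>z. cnj (a z)) (cnj (a2 z)) (cnj (a1 z)) z"
      using f(2) by eventually_elim (rule has_wd_cnj)
  qed (intro Ob_cnj f)+
qed

text \<open>The lower bound keeps |g| comparable to |z|, since the orders may be negative. Second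
  derivatives have only to exist, so those of the composition are named by \<open>pd_z\<close> and
  \<open>pd_zbar\<close> instead of being expanded.\<close>

lemma S2_compose:
  assumes f: "S2 c f" and g: "S2 1 g" and lo: "0 < k" "\<forall>\<^sub>F z in at 0. k * cmod z \<le> cmod (g z)"
  shows "S2 c (\<lambda>z. f (g z))"
proof -
  obtain a b a1 a2 b1 b2 where f: "\<forall>\<^sub>F z in at 0. has_wd f (a z) (b z) z"
     "\<forall>\<^sub>F z in at 0. has_wd a (a1 z) (a2 z) z" "\<forall>\<^sub>F z in at 0. has_wd b (b1 z) (b2 z) z"
     "Ob c f" "Ob (c - 1) a" "Ob (c - 1) b" using f unfolding S2_def by blast
  obtain a' b' a1' a2' b1' b2' where g: "\<forall>\<^sub>F z in at 0. has_wd g (a' z) (b' z) z"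
     "\<forall>\<^sub>F z in at 0. has_wd a' (a1' z) (a2' z) z" "\<forall>\<^sub>F z in at 0. has_wd b' (b1' z) (b2' z) z"
     "Ob 1 g" "Ob 0 a'" "Ob 0 b'" using g unfolding S2_def by auto
  obtain C where hi: "\<forall>\<^sub>F z in at 0. cmod (g z) \<le> C * cmod z"
  proof -
    obtain C where "\<forall>\<^sub>F z in at 0. cmod (g z) \<le> C * cmod z powr 1" using ObE[OF g(4)] .
    with eventually_at_0_lt[OF zero_less_one] have "\<forall>\<^sub>F z in at 0. cmod (g z) \<le> C * cmod z"
      by eventually_elim simp
    then show thesis by (rule that)
  qed
  have "\<forall>\<^sub>F z in at 0. g z \<noteq> 0"
    using lo(2) eventually_at_0_lt[OF zero_less_one] by eventually_elim (use lo(1) in \<open>auto simp: mult_le_0_iff\<close>)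
  then have lim: "filterlim g (at 0) (at 0)" using Ob_tendsto_0[OF g(4)] by (simp add: filterlim_at)
  note ev = eventually_compose_at[OF lim]
  note O = Ob_compose[OF _ lim lo hi]
  show ?thesis
  proof (rule S2_I)
    show "\<forall>\<^sub>F z in at 0. has_wd (\<lambda>z. f (g z)) (a (g z) * a' z + b (g z) * cnj (b' z)) (a (g z) * b' z + b (g z) * cnj (a' z)) z"
      using ev[OF f(1)] g(1) by eventually_elim (rule has_wd_compose)
    show "\<forall>\<^sub>F z in at 0. has_wd (\<lambda>z. a (g z) * a' z + b (g z) * cnj (b' z))
       (pd_z (\<lambda>z. a (g z) * a' z + b (g z) * cnj (b' z)) z) (pd_zbar (\<lambda>z. a (g z) * a' z + b (g z) * cnj (b' z)) z) z"
      using ev[OF f(2)] ev[OF f(3)] g(1) g(2) g(3)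
    proof eventually_elim
      case (elim z)
      from has_wd_add[OF has_wd_mult[OF has_wd_compose[OF elim(1,3)] elim(4)] has_wd_mult[OF has_wd_compose[OF elim(2,3)] has_wd_cnj[OF elim(5)]]]
      show ?case by (intro differentiable_has_wd has_wd_differentiable)
    qed
    show "\<forall>\<^sub>F z in at 0. has_wd (\<lambda>z. a (g z) * b' z + b (g z) * cnj (a' z))
       (pd_z (\<lambda>z. a (g z) * b' z + b (g z) * cnj (a' z)) z) (pd_zbar (\<lambda>z. a (g z) * b' z + b (g z) * cnj (a' z)) z) z"
      using ev[OF f(2)] ev[OF f(3)] g(1) g(2) g(3)
    proof eventually_elim
      case (elim z)
      from has_wd_add[OF has_wd_mult[OF has_wd_compose[OF elim(1,3)] elim(5)] has_wd_mult[OF has_wd_compose[OF elim(2,3)] has_wd_cnj[OF elim(4)]]]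
      show ?case by (intro differentiable_has_wd has_wd_differentiable)
    qed
    show "Ob c (\<lambda>z. f (g z))" by (rule O[OF f(4)])
    show "Ob (c - 1) (\<lambda>z. a (g z) * a' z + b (g z) * cnj (b' z))"
      by (intro Ob_add Ob_multI[OF O[OF f(5)] g(5)] Ob_multI[OF O[OF f(6)] Ob_cnj[OF g(6)]]) auto
    show "Ob (c - 1) (\<lambda>z. a (g z) * b' z + b (g z) * cnj (a' z))"
      by (intro Ob_add Ob_multI[OF O[OF f(5)] g(6)] Ob_multI[OF O[OF f(6)] Ob_cnj[OF g(5)]]) auto
  qed
qed

lemma S3_powr: "S3 c (\<lambda>z. of_real (cmod z powr c))"
proof -
  let ?h = "\<lambda>z. complex_of_real (cmod z powr c)" and ?k = "complex_of_real (c / 2)"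
  have h: "Ob c ?h" by (rule Ob_powr)
  have i: "Ob (- 1) (\<lambda>z. 1 / cnj z)" using Ob_cnj[OF Ob_inverse_ident] by simp
  have nz: "\<forall>\<^sub>F z in at (0::complex). z \<noteq> 0" using eventually_at_0_lt[OF zero_less_one] by eventually_elim auto
  have i2: "Ob (- 1) (\<lambda>z. inverse z)" "Ob (- 1) (\<lambda>z. inverse (cnj z))"
    using i Ob_inverse_ident by (auto simp: inverse_eq_divide)
  show ?thesis
  proof (rule S3_I)
    show "\<forall>\<^sub>F z in at 0. has_wd ?h (?k * (?h z / z)) (?k * (?h z / cnj z)) z"
      using nz by eventually_elim (rule has_wd_powr_norm)
    show "\<forall>\<^sub>F z in at 0. has_wd (\<lambda>z. ?k * (?h z / z)) (?k * ((?k - 1) * (?h z * (inverse z * inverse z)))) (?k * (?k * (?h z * (inverse z * inverse (cnj z))))) z"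
      using nz
    proof eventually_elim
      case (elim z)
      show ?case
        by (rule has_wd_eqI[OF has_wd_mult[OF has_wd_const has_wd_divide[OF has_wd_powr_norm[OF elim] has_wd_ident elim]]])
          (use elim in \<open>simp_all add: field_simps power2_eq_square\<close>)
    qed
    show "\<forall>\<^sub>F z in at 0. has_wd (\<lambda>z. ?k * (?h z / cnj z)) (?k * (?k * (?h z * (inverse z * inverse (cnj z))))) (?k * ((?k - 1) * (?h z * (inverse (cnj z) * inverse (cnj z))))) z"
      using nz
    proof eventually_elim
      case (elim z)
      then have "cnj z \<noteq> 0" by simp
      show ?case
        by (rule has_wd_eqI[OF has_wd_mult[OF has_wd_const has_wd_divide[OF has_wd_powr_norm[OF elim] has_wd_cnj[OF has_wd_ident] \<open>cnj z \<noteq> 0\<close>]]])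
          (use elim in \<open>simp_all add: field_simps power2_eq_square\<close>)
    qed
    show "Ob c ?h" by (rule h)
    show "Ob (c - 1) (\<lambda>z. ?k * (?h z / z))" "Ob (c - 1) (\<lambda>z. ?k * (?h z / cnj z))"
      unfolding divide_inverse by (intro Ob_cmult Ob_multI[OF h i2(1)] Ob_multI[OF h i2(2)], simp)+
    have "Ob (- 2) (\<lambda>z. inverse z * inverse z)" by (rule Ob_multI[OF i2(1) i2(1)]) simp
    then show "Ob (c - 2) (\<lambda>z. ?k * ((?k - 1) * (?h z * (inverse z * inverse z))))"
      by (intro Ob_cmult) (rule Ob_multI[OF h], assumption, linarith)
    have "Ob (- 2) (\<lambda>z. inverse z * inverse (cnj z))" by (rule Ob_multI[OF i2(1) i2(2)]) simp
    then show "Ob (c - 2) (\<lambda>z. ?k * (?k * (?h z * (inverse z * inverse (cnj z)))))"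
      by (intro Ob_cmult) (rule Ob_multI[OF h], assumption, linarith)
    have "Ob (- 2) (\<lambda>z. inverse (cnj z) * inverse (cnj z))" by (rule Ob_multI[OF i2(2) i2(2)]) simp
    then show "Ob (c - 2) (\<lambda>z. ?k * ((?k - 1) * (?h z * (inverse (cnj z) * inverse (cnj z)))))"
      by (intro Ob_cmult) (rule Ob_multI[OF h], assumption, linarith)
  qed
qed

text \<open>\<open>E\<close> and \<open>F\<close> are z and cnj z times the Wirtinger derivatives,
  the quantities that the polar derivatives control.\<close>

lemma S2_polar:
  assumes g: "\<And>z. z \<in> ball 0 s - {0} \<Longrightarrow> has_wd g (E z / z) (F z / cnj z) z" and s: "0 < s"
    and E: "\<And>z. z \<in> ball 0 s - {0} \<Longrightarrow> E differentiable (at z) \<and> cmod (E z) \<le> C"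
    and F: "\<And>z. z \<in> ball 0 s - {0} \<Longrightarrow> F differentiable (at z) \<and> cmod (F z) \<le> C"
    and b: "\<And>z. z \<in> ball 0 s - {0} \<Longrightarrow> cmod (g z) \<le> C"
  shows "S2 0 g"
proof -
  have ev: "\<forall>\<^sub>F z in at (0::complex). z \<in> ball 0 s - {0}"
    using eventually_at_0_lt[OF s] by eventually_elim auto
  have i: "Ob (- 1) (\<lambda>z. inverse z)" "Ob (- 1) (\<lambda>z. inverse (cnj z))"
    using Ob_inverse_ident Ob_cnj[OF Ob_inverse_ident] by (auto simp: inverse_eq_divide)
  have bd: "Ob 0 h" if "\<And>z. z \<in> ball 0 s - {0} \<Longrightarrow> cmod (h z) \<le> C" for h
  proof (rule ObI[where C=C])
    show "\<forall>\<^sub>F z in at 0. cmod (h z) \<le> C * cmod z powr 0"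
      using ev by eventually_elim (use that in auto)
  qed
  show ?thesis
  proof (rule S2_I)
    show "\<forall>\<^sub>F z in at 0. has_wd g (E z / z) (F z / cnj z) z" using ev by eventually_elim (rule g)
    show "\<forall>\<^sub>F z in at 0. has_wd (\<lambda>z. E z / z) (pd_z (\<lambda>z. E z / z) z) (pd_zbar (\<lambda>z. E z / z) z) z"
      using ev
    proof eventually_elim
      case (elim z)
      then have "z \<noteq> 0" by simp
      from has_wd_divide[OF differentiable_has_wd[OF conjunct1[OF E[OF elim]]] has_wd_ident this]
      show ?case by (intro differentiable_has_wd has_wd_differentiable)
    qed
    show "\<forall>\<^sub>F z in at 0. has_wd (\<lambda>z. F z / cnj z) (pd_z (\<lambda>z. F z / cnj z) z) (pd_zbar (\<lambda>z. F z / cnj z) z) z"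
      using ev
    proof eventually_elim
      case (elim z)
      then have "cnj z \<noteq> 0" by simp
      from has_wd_divide[OF differentiable_has_wd[OF conjunct1[OF F[OF elim]]] has_wd_cnj[OF has_wd_ident] this]
      show ?case by (intro differentiable_has_wd has_wd_differentiable)
    qed
    show "Ob 0 g" by (rule bd[OF b])
    have "Ob 0 E" "Ob 0 F" by (rule bd, use E F in blast)+
    then show "Ob (0 - 1) (\<lambda>z. E z / z)" "Ob (0 - 1) (\<lambda>z. F z / cnj z)"
      unfolding divide_inverse by (auto intro!: Ob_multI[OF _ i(1), of 0] Ob_multI[OF _ i(2), of 0])
  qed
qed

section \<open>From polar derivatives to Wirtinger derivatives\<close>

lemma frechet_eq:
  assumes "(f has_derivative D) (at z)" shows "frechet_derivative f (at z) = D"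
  using frechet_derivative_at[OF assms] by simp

text \<open>Inverts the relations r d_r = z d_z + cnj z d_z' and d_theta = i (z d_z - cnj z
  d_z').\<close>

lemma has_wd_polar:
  assumes d: "f differentiable (at z)" and z: "z \<noteq> 0"
  shows "has_wd f ((r_dr f z - \<i> * d_theta f z) / 2 / z) ((r_dr f z + \<i> * d_theta f z) / 2 / cnj z) z"
  by (rule has_wd_eqI[OF differentiable_has_wd[OF d]])
    (use z in \<open>auto simp: r_dr_def d_theta_def frechet_pd[OF d] field_simps\<close>)

definition polar_bounded :: "(complex \<Rightarrow> 'b::real_normed_vector) \<Rightarrow> real \<Rightarrow> complex \<Rightarrow> bool" where
  "polar_bounded f C z \<longleftrightarrow> f differentiable (at z) \<and> r_dr f differentiable (at z) \<and> d_theta f differentiable (at z)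
     \<and> norm (f z) \<le> C \<and> norm (r_dr f z) \<le> C \<and> norm (d_theta f z) \<le> C \<and> norm (r_dr (r_dr f) z) \<le> C
     \<and> norm (r_dr (d_theta f) z) \<le> C \<and> norm (d_theta (d_theta f) z) \<le> C"

lemma Cb_2_D:
  assumes "Cb 2 \<gamma> s f"
  shows "\<exists>C. \<forall>z\<in>ball 0 s - {0}. polar_bounded f C z"
proof -
  have dif: "\<And>i j. i + j < 2 \<Longrightarrow> (\<forall>z\<in>ball 0 s - {0}. ((r_dr ^^ i) ((d_theta ^^ j) f)) differentiable (at z))"
    and bd: "\<And>i j. i + j \<le> 2 \<Longrightarrow> \<exists>B. \<forall>z\<in>ball 0 s - {0}. norm ((r_dr ^^ i) ((d_theta ^^ j) f) z) \<le> B"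
    using assms unfolding Cb_def Cb0_def by blast+
  obtain B where B: "\<And>i j. i + j \<le> 2 \<Longrightarrow> \<forall>z\<in>ball 0 s - {0}. norm ((r_dr ^^ i) ((d_theta ^^ j) f) z) \<le> B i j"
    using bd by metis
  define C where "C = max (B 0 0) (max (B 1 0) (max (B 0 1) (max (B 2 0) (max (B 1 1) (B 0 2)))))"
  have le: "B 0 0 \<le> C" "B 1 0 \<le> C" "B 0 1 \<le> C" "B 2 0 \<le> C" "B 1 1 \<le> C" "B 0 2 \<le> C"
    unfolding C_def by auto
  show ?thesis
  proof (intro exI[of _ C] ballI)
    fix z :: complex assume z: "z \<in> ball 0 s - {0}"
    note D = dif[THEN bspec, OF _ z] and N = B[THEN bspec, OF _ z]
    show "polar_bounded f C z" unfolding polar_bounded_def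
      using D[of 0 0] D[of 1 0] D[of 0 1] order_trans[OF N[of 0 0] le(1)] order_trans[OF N[of 1 0] le(2)]
       order_trans[OF N[of 0 1] le(3)] order_trans[OF N[of 2 0] le(4)] order_trans[OF N[of 1 1] le(5)] order_trans[OF N[of 0 2] le(6)]
      by (simp add: numeral_2_eq_2)
  qed
qed

text \<open>The linear map \<open>J\<close> lets one argument cover complex sections and the real
  exponent of a conic metric.\<close>

lemma weighted_Cb_S2:
  fixes J :: "'b::real_normed_vector \<Rightarrow> complex"
  assumes J: "bounded_linear J" and f: "weighted_Cb c 2 \<gamma> s f" and s: "0 < s"
  shows "S2 c (\<lambda>z. J (f z))"
proof -
  define f0 where "f0 = (\<lambda>z. (cmod z powr (- c)) *\<^sub>R f z)"
  have "Cb 2 \<gamma> s f0" using f by (simp add: weighted_Cb_def f0_def)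
  from Cb_2_D[OF this] obtain C where C': "\<forall>z\<in>ball 0 s - {0}. polar_bounded f0 C z" by blast
  note C = bspec[OF C', unfolded polar_bounded_def]
  obtain K where K: "0 < K" "\<And>x. norm (J x) \<le> norm x * K" using bounded_linear.pos_bounded[OF J] by blast
  have JC: "cmod (J x) \<le> C * K" if "norm x \<le> C" for x
    using order_trans[OF K(2) mult_right_mono[OF that less_imp_le[OF K(1)]]] .
  let ?g = "\<lambda>z. J (f0 z)"
  have Jd: "(\<lambda>z. J (h z)) differentiable (at z)" if "h differentiable (at z)" for h and z :: complex
    using that bounded_linear.has_derivative[OF J] unfolding differentiable_def by blast
  have gder: "frechet_derivative ?g (at z) = (\<lambda>h. J (frechet_derivative f0 (at z) h))" if "f0 differentiable (at z)" for z :: complex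
    using that by (intro frechet_eq bounded_linear.has_derivative[OF J]) (simp add: frechet_derivative_works)
  have "S2 0 ?g"
  proof (rule S2_polar[where s=s and C="C * K"])
    fix z :: complex assume z: "z \<in> ball 0 s - {0}"
    have fd: "f0 differentiable (at z)" using C[OF z] by blast
    have R: "r_dr ?g z = J (r_dr f0 z)" "d_theta ?g z = J (d_theta f0 z)"
      by (simp_all add: r_dr_def d_theta_def gder[OF fd])
    show "has_wd ?g ((J (r_dr f0 z) - \<i> * J (d_theta f0 z)) / 2 / z) ((J (r_dr f0 z) + \<i> * J (d_theta f0 z)) / 2 / cnj z) z"
      using has_wd_polar[OF Jd[OF fd]] z unfolding R by simp
    have JJ: "cmod (J (r_dr f0 z)) \<le> C * K" "cmod (J (d_theta f0 z)) \<le> C * K" using C[OF z] by (auto intro: JC)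
    have diff: "(\<lambda>z. J (r_dr f0 z)) differentiable (at z)" "(\<lambda>z. J (d_theta f0 z)) differentiable (at z)"
      using C[OF z] by (auto intro: Jd)
    show "(\<lambda>z. (J (r_dr f0 z) - \<i> * J (d_theta f0 z)) / 2) differentiable (at z) \<and> cmod ((J (r_dr f0 z) - \<i> * J (d_theta f0 z)) / 2) \<le> C * K"
    proof
      show "(\<lambda>z. (J (r_dr f0 z) - \<i> * J (d_theta f0 z)) / 2) differentiable (at z)"
        using diff by (auto intro!: derivative_intros)
      show "cmod ((J (r_dr f0 z) - \<i> * J (d_theta f0 z)) / 2) \<le> C * K"
        using norm_triangle_ineq4[of "J (r_dr f0 z)" "\<i> * J (d_theta f0 z)"] JJ by (simp add: norm_divide norm_mult)
    qed
    show "(\<lambda>z. (J (r_dr f0 z) + \<i> * J (d_theta f0 z)) / 2) differentiable (at z) \<and> cmod ((J (r_dr f0 z) + \<i> * J (d_theta f0 z)) / 2) \<le> C * K"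
    proof
      show "(\<lambda>z. (J (r_dr f0 z) + \<i> * J (d_theta f0 z)) / 2) differentiable (at z)"
        using diff by (auto intro!: derivative_intros)
      show "cmod ((J (r_dr f0 z) + \<i> * J (d_theta f0 z)) / 2) \<le> C * K"
        using norm_triangle_ineq[of "J (r_dr f0 z)" "\<i> * J (d_theta f0 z)"] JJ by (simp add: norm_divide norm_mult)
    qed
    show "cmod (?g z) \<le> C * K" using C[OF z] by (auto intro: JC)
  qed (rule s)
  from S2_mult[OF S3_imp_S2[OF S3_powr[of c]] this]
  have "S2 c (\<lambda>z. of_real (cmod z powr c) * ?g z)" by simp
  then show ?thesis
  proof (rule S2_cong)
    show "\<forall>\<^sub>F z in at 0. of_real (cmod z powr c) * ?g z = J (f z)"
      using eventually_at_0_lt[OF zero_less_one]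
    proof eventually_elim
      case (elim z)
      have "of_real (cmod z powr c) * ?g z = J ((cmod z powr c) *\<^sub>R f0 z)"
        by (simp add: linear_scale[OF bounded_linear.linear[OF J]] scaleR_conv_of_real)
      also have "(cmod z powr c) *\<^sub>R f0 z = f z"
        using elim by (simp add: f0_def powr_add[symmetric])
      finally show ?case .
    qed
  qed
qed

lemma weighted_Cb_S3:
  fixes f :: "complex \<Rightarrow> complex"
  assumes f: "weighted_Cb c 2 \<gamma> s f" and s: "0 < s"
  shows "S3 c f"
proof -
  define f0 where "f0 = (\<lambda>z. (cmod z powr (- c)) *\<^sub>R f z)"
  have Cb: "Cb 2 \<gamma> s f0" using f by (simp add: weighted_Cb_def f0_def)
  from Cb_2_D[OF this] obtain C where C': "\<forall>z\<in>ball 0 s - {0}. polar_bounded f0 C z" by blast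
  note C = bspec[OF C', unfolded polar_bounded_def]
  have nz: "z \<noteq> 0" if "z \<in> ball 0 s - {0}" for z using that by simp
  define a where "a = (\<lambda>z. (r_dr f0 z - \<i> * d_theta f0 z) / 2 / z)"
  define b where "b = (\<lambda>z. (r_dr f0 z + \<i> * d_theta f0 z) / 2 / cnj z)"
  have fd: "has_wd f0 (a z) (b z) z" if "z \<in> ball 0 s - {0}" for z
    unfolding a_def b_def using has_wd_polar[of f0 z] C[OF that] nz[OF that] by blast
  have ad: "a differentiable (at z)" and bd: "b differentiable (at z)" if z: "z \<in> ball 0 s - {0}" for z
  proof -
    have R: "has_wd (r_dr f0) (pd_z (r_dr f0) z) (pd_zbar (r_dr f0) z) z"
      and T: "has_wd (d_theta f0) (pd_z (d_theta f0) z) (pd_zbar (d_theta f0) z) z"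
      using C[OF z] differentiable_has_wd by blast+
    have n: "(2::complex) \<noteq> 0" "cnj z \<noteq> 0" using nz[OF z] by auto
    show "a differentiable (at z)" unfolding a_def
      by (rule has_wd_differentiable[OF has_wd_divide[OF has_wd_divide[OF has_wd_diff[OF R has_wd_mult[OF has_wd_const T]] has_wd_const n(1)] has_wd_ident nz[OF z]]])
    show "b differentiable (at z)" unfolding b_def
      by (rule has_wd_differentiable[OF has_wd_divide[OF has_wd_divide[OF has_wd_add[OF R has_wd_mult[OF has_wd_const T]] has_wd_const n(1)] has_wd_cnj[OF has_wd_ident] n(2)]])
  qed
  have nh: "\<forall>\<^sub>F x in nhds z. x \<in> ball 0 s - {0}" if "z \<in> ball 0 s - {0}" for z
    using that by (intro eventually_nhds_in_open) auto
  define m where "m = pd_zbar a"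
  have adw: "has_wd a (pd_z a z) (m z) z" if "z \<in> ball 0 s - {0}" for z
    unfolding m_def by (rule differentiable_has_wd[OF ad[OF that]])
  have bdw: "has_wd b (m z) (pd_zbar b z) z" if z: "z \<in> ball 0 s - {0}" for z
  proof -
    have "\<forall>\<^sub>F x in nhds z. has_wd f0 (a x) (b x) x" using nh[OF z] by eventually_elim (rule fd)
    from has_wd_mixed[OF this adw[OF z] differentiable_has_wd[OF bd[OF z]]] differentiable_has_wd[OF bd[OF z]]
    show ?thesis by simp
  qed
  have RT: "r_dr f0 z = z * a z + cnj z * b z" "d_theta f0 z = \<i> * (z * a z - cnj z * b z)" if "z \<in> ball 0 s - {0}" for z
    using nz[OF that] by (auto simp: a_def b_def field_simps)
  have bounds: "cmod (z * a z) \<le> C \<and> cmod (cnj z * b z) \<le> C \<and> cmod (z^2 * pd_z a z) \<le> 2 * C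
      \<and> cmod (z * cnj z * m z) \<le> 2 * C \<and> cmod (cnj z ^ 2 * pd_zbar b z) \<le> 2 * C" if z: "z \<in> ball 0 s - {0}" for z
  proof -
    note za = has_wd_mult[OF has_wd_ident adw[OF z]] and zb = has_wd_mult[OF has_wd_cnj[OF has_wd_ident] bdw[OF z]]
    have R: "has_wd (r_dr f0) (1 * a z + z * pd_z a z + (cnj 0 * b z + cnj z * m z)) (0 * a z + z * m z + (cnj 1 * b z + cnj z * pd_zbar b z)) z"
    proof (rule has_wd_transform[OF has_wd_add[OF za zb]])
      show "\<forall>\<^sub>F x in nhds z. x * a x + cnj x * b x = r_dr f0 x" using nh[OF z] by eventually_elim (simp add: RT)
    qed
    have T: "has_wd (d_theta f0) (0 * (z * a z - cnj z * b z) + \<i> * (1 * a z + z * pd_z a z - (cnj 0 * b z + cnj z * m z)))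
       (0 * (z * a z - cnj z * b z) + \<i> * (0 * a z + z * m z - (cnj 1 * b z + cnj z * pd_zbar b z))) z"
    proof (rule has_wd_transform[OF has_wd_mult[OF has_wd_const has_wd_diff[OF za zb]]])
      show "\<forall>\<^sub>F x in nhds z. \<i> * (x * a x - cnj x * b x) = d_theta f0 x" using nh[OF z] by eventually_elim (simp add: RT)
    qed
    define q1 where "q1 = r_dr (r_dr f0) z"
    define q2 where "q2 = r_dr (d_theta f0) z"
    define q3 where "q3 = d_theta (d_theta f0) z"
    have q: "cmod q1 \<le> C" "cmod q2 \<le> C" "cmod q3 \<le> C" using C[OF z] by (auto simp: q1_def q2_def q3_def)
    have e1: "q1 = (a z + z * pd_z a z + cnj z * m z) * z + (z * m z + (b z + cnj z * pd_zbar b z)) * cnj z"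
      unfolding q1_def r_dr_def[of "r_dr f0"] has_wd_frechet[OF R] by simp
    have e2: "q2 = (\<i> * (a z + z * pd_z a z - cnj z * m z)) * z + (\<i> * (z * m z - (b z + cnj z * pd_zbar b z))) * cnj z"
      unfolding q2_def r_dr_def[of "d_theta f0"] has_wd_frechet[OF T] by simp
    have e3: "q3 = (\<i> * (a z + z * pd_z a z - cnj z * m z)) * (\<i> * z) + (\<i> * (z * m z - (b z + cnj z * pd_zbar b z))) * cnj (\<i> * z)"
      unfolding q3_def d_theta_def[of "d_theta f0"] has_wd_frechet[OF T] by simp
    have az: "cmod (z * a z) \<le> C" "cmod (cnj z * b z) \<le> C"
    proof -
      have "z * a z = (r_dr f0 z - \<i> * d_theta f0 z) / 2" "cnj z * b z = (r_dr f0 z + \<i> * d_theta f0 z) / 2"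
        using nz[OF z] by (simp_all add: a_def b_def)
      moreover have "cmod (r_dr f0 z) \<le> C" "cmod (\<i> * d_theta f0 z) \<le> C" using C[OF z] by (auto simp: norm_mult)
      then have "cmod ((r_dr f0 z - \<i> * d_theta f0 z) / 2) \<le> C" "cmod ((r_dr f0 z + \<i> * d_theta f0 z) / 2) \<le> C"
        using norm_triangle_ineq4[of "r_dr f0 z" "\<i> * d_theta f0 z"] norm_triangle_ineq[of "r_dr f0 z" "\<i> * d_theta f0 z"]
        by (auto simp: norm_divide)
      ultimately show "cmod (z * a z) \<le> C" "cmod (cnj z * b z) \<le> C" by (simp_all only:)
    qed
    \<comment> \<open>The first identity is (r d_r)^2 + d_theta^2 = 4 z cnj z d_z d_z'. The other
      two combinations of q1, q2 and q3 isolate the pure second derivatives up to first order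
      terms.\<close>
    have 1: "z * cnj z * m z = (q1 + q3) / 4" unfolding e1 e3 by (simp add: algebra_simps)
    have 2: "z^2 * pd_z a z = (q1 - q3) / 4 - \<i> * q2 / 2 - z * a z"
      unfolding e1 e2 e3 by (simp add: algebra_simps power2_eq_square add_divide_distrib diff_divide_distrib)
    have 3: "cnj z ^ 2 * pd_zbar b z = (q1 - q3) / 4 + \<i> * q2 / 2 - cnj z * b z"
      unfolding e1 e2 e3 by (simp add: algebra_simps power2_eq_square add_divide_distrib diff_divide_distrib)
    have n1: "cmod ((q1 - q3) / 4) \<le> C / 2" "cmod ((q1 + q3) / 4) \<le> C / 2" "cmod (\<i> * q2 / 2) \<le> C / 2"
      using q norm_triangle_ineq4[of q1 q3] norm_triangle_ineq[of q1 q3] by (auto simp: norm_divide norm_mult)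
    have C0: "0 \<le> C" using q(1) norm_ge_zero[of q1] by linarith
    have "cmod (z * cnj z * m z) \<le> 2 * C" unfolding 1 using n1(2) C0 by linarith
    moreover have "cmod (z^2 * pd_z a z) \<le> C / 2 + C / 2 + C"
      unfolding 2 by (intro order_trans[OF norm_triangle_ineq4] add_mono n1 az)
    moreover have "cmod (cnj z ^ 2 * pd_zbar b z) \<le> C / 2 + C / 2 + C"
      unfolding 3 by (intro order_trans[OF norm_triangle_ineq4] order_trans[OF norm_triangle_ineq] add_mono n1 az)
    ultimately show ?thesis using az by simp
  qed
  have ev: "\<forall>\<^sub>F z in at (0::complex). z \<in> ball 0 s - {0}"
    using eventually_at_0_lt[OF s] by eventually_elim auto
  have bdO: "Ob (- real n) h" if "\<And>z. z \<in> ball 0 s - {0} \<Longrightarrow> cmod z ^ n * cmod (h z) \<le> K" for h n K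
  proof (rule ObI[where C=K])
    show "\<forall>\<^sub>F z in at 0. cmod (h z) \<le> K * cmod z powr (- real n)"
      using ev
    proof eventually_elim
      case (elim z)
      then show ?case using that[OF elim] by (simp add: powr_minus powr_realpow field_simps)
    qed
  qed
  have "S3 0 f0"
  proof (rule S3_I)
    show "\<forall>\<^sub>F z in at 0. has_wd f0 (a z) (b z) z" using ev by eventually_elim (rule fd)
    show "\<forall>\<^sub>F z in at 0. has_wd a (pd_z a z) (m z) z" using ev by eventually_elim (rule adw)
    show "\<forall>\<^sub>F z in at 0. has_wd b (m z) (pd_zbar b z) z" using ev by eventually_elim (rule bdw)
    show "Ob 0 f0" using bdO[of 0 f0 C] C by auto
    show "Ob (0 - 1) a" using bdO[of 1 a C] bounds by (auto simp: norm_mult)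
    show "Ob (0 - 1) b" using bdO[of 1 b C] bounds by (auto simp: norm_mult)
    show "Ob (0 - 2) (pd_z a)" using bdO[of 2 "pd_z a" "2 * C"] bounds by (auto simp: norm_mult norm_power)
    show "Ob (0 - 2) m" using bdO[of 2 m "2 * C"] bounds by (auto simp: norm_mult power2_eq_square)
    show "Ob (0 - 2) (pd_zbar b)" using bdO[of 2 "pd_zbar b" "2 * C"] bounds by (auto simp: norm_mult norm_power)
  qed
  from S3_mult[OF S3_powr[of c] this]
  have "S3 c (\<lambda>z. of_real (cmod z powr c) * f0 z)" by simp
  then show ?thesis
  proof (rule S3_cong)
    show "\<forall>\<^sub>F z in at 0. of_real (cmod z powr c) * f0 z = f z"
      using eventually_at_0_lt[OF zero_less_one]
      by eventually_elim (simp add: f0_def scaleR_conv_of_real powr_add[symmetric] mult.assoc[symmetric] flip: of_real_mult)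
  qed
qed

section \<open>Charts and conformal coordinates\<close>

lemma chart_D:
  assumes "is_chart c"
  shows "open (fst c)" "open (snd c ` fst c)"
    "x \<in> fst c \<Longrightarrow> point_of c (snd c x) = x"
    "z \<in> snd c ` fst c \<Longrightarrow> snd c (point_of c z) = z"
    "z \<in> snd c ` fst c \<Longrightarrow> point_of c z \<in> fst c"
    "continuous_on (snd c ` fst c) (point_of c)" "continuous_on (fst c) (snd c)"
  using assms unfolding is_chart_def homeomorphism_def point_of_def[abs_def] by auto

text \<open>Coordinate identities are needed on whole neighbourhoods, since they are going to be
  differentiated.\<close>

lemma ev_point_of:
  assumes c: "is_chart c" "x \<in> fst c" and V: "open V" "x \<in> V"
  shows "\<forall>\<^sub>F z in nhds (snd c x). z \<in> snd c ` fst c \<and> point_of c z \<in> V \<and> point_of c z \<in> fst c \<and> snd c (point_of c z) = z"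
proof -
  note D = chart_D[OF c(1)]
  have "open (snd c ` fst c \<inter> point_of c -` V)"
    by (rule continuous_open_preimage[OF D(6) D(2) V(1)])
  moreover have "snd c x \<in> snd c ` fst c \<inter> point_of c -` V" using c V D(3) by auto
  ultimately have "\<forall>\<^sub>F z in nhds (snd c x). z \<in> snd c ` fst c \<inter> point_of c -` V" by (rule eventually_nhds_in_open)
  then show ?thesis by eventually_elim (use D(4,5) in auto)
qed

lemma open_chart_image:
  assumes c: "is_chart c" and V: "open V"
  shows "open (snd c ` (fst c \<inter> V))"
proof -
  note D = chart_D[OF c]
  have "snd c ` (fst c \<inter> V) = snd c ` fst c \<inter> point_of c -` V"
    using D(3) by force
  then show ?thesis using continuous_open_preimage[OF D(6) D(2) V] by simp
qed

lemma transition_compose: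
  assumes c: "is_chart c" "x \<in> fst c" and a: "is_chart a" "x \<in> fst a"
  shows "\<forall>\<^sub>F z in nhds (snd c x). transition c d z = transition a d (transition c a z)"
  using ev_point_of[OF c chart_D(1)[OF a(1)] a(2)]
  by eventually_elim (use chart_D(3)[OF a(1)] in \<open>simp add: local_rep_def\<close>)

lemma local_rep_compose:
  assumes c: "is_chart c" "x \<in> fst c" and a: "is_chart a" "x \<in> fst a"
    and b: "is_chart b" "u x \<in> fst b" and u: "continuous_on UNIV u"
  shows "\<forall>\<^sub>F z in nhds (snd c x). local_rep c u d z = transition b d (local_rep a u b (transition c a z))"
proof -
  have "open (fst a \<inter> u -` fst b)"
    using u chart_D(1)[OF a(1)] chart_D(1)[OF b(1)] by (intro open_Int open_vimage) auto
  from ev_point_of[OF c this] a(2) b(2) show ?thesis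
    by (auto elim!: eventually_mono simp: local_rep_def chart_D(3)[OF a(1)] chart_D(3)[OF b(1)])
qed

lemma transition_at: "is_chart c \<Longrightarrow> x \<in> fst c \<Longrightarrow> transition c d (snd c x) = snd d x"
  by (simp add: local_rep_def chart_D(3))

lemma local_rep_at: "is_chart c \<Longrightarrow> x \<in> fst c \<Longrightarrow> local_rep c u d (snd c x) = snd d (u x)"
  by (simp add: local_rep_def chart_D(3))

lemma frechet_compose:
  fixes f g h :: "complex \<Rightarrow> complex"
  assumes f: "f differentiable (at (g z))" and g: "g differentiable (at z)" and e: "\<forall>\<^sub>F x in nhds z. h x = f (g x)"
  shows "h differentiable (at z)"
    "frechet_derivative h (at z) v = frechet_derivative f (at (g z)) (frechet_derivative g (at z) v)"
    "pd_z h z = pd_z f (g z) * pd_z g z + pd_zbar f (g z) * cnj (pd_zbar g z)"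
    "pd_zbar h z = pd_z f (g z) * pd_zbar g z + pd_zbar f (g z) * cnj (pd_z g z)"
proof -
  have e': "\<forall>\<^sub>F x in nhds z. f (g x) = h x" using e by eventually_elim simp
  note w = has_wd_transform[OF has_wd_compose[OF differentiable_has_wd[OF f] differentiable_has_wd[OF g]] e']
  show "h differentiable (at z)" by (rule has_wd_differentiable[OF w])
  show "frechet_derivative h (at z) v = frechet_derivative f (at (g z)) (frechet_derivative g (at z) v)"
    unfolding has_wd_frechet[OF w] frechet_pd[OF f] frechet_pd[OF g] by (simp add: algebra_simps)
  show "pd_z h z = pd_z f (g z) * pd_z g z + pd_zbar f (g z) * cnj (pd_zbar g z)"
    "pd_zbar h z = pd_z f (g z) * pd_zbar g z + pd_zbar f (g z) * cnj (pd_z g z)"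
    using has_wd_pd_z[OF w] has_wd_pd_zbar[OF w] by auto
qed

section \<open>Tangent vectors in compatible charts\<close>

lemma atlas_D:
  assumes "smooth_atlas A"
  shows "a \<in> A \<Longrightarrow> is_chart a" "\<exists>a\<in>A. x \<in> fst a"
    "a \<in> A \<Longrightarrow> x \<in> fst a \<Longrightarrow> a \<in> charts_at A x"
proof -
  show "a \<in> A \<Longrightarrow> is_chart a" "\<exists>a\<in>A. x \<in> fst a" using assms unfolding smooth_atlas_def by auto
  have sm: "transition a b differentiable (at (snd a x))" if "a \<in> A" "b \<in> A" "x \<in> fst a" "x \<in> fst b" for a b
  proof -
    have "smooth_on (snd a ` (fst a \<inter> fst b)) (transition a b)" using assms that unfolding smooth_atlas_def by auto
    then have "holder_loc (Suc 0) 1 (snd a ` (fst a \<inter> fst b)) (transition a b)" unfolding smooth_on_def by blast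
    then have "\<forall>z\<in>snd a ` (fst a \<inter> fst b). transition a b differentiable (at z)" by simp
    then show ?thesis using that by blast
  qed
  show "a \<in> A \<Longrightarrow> x \<in> fst a \<Longrightarrow> a \<in> charts_at A x"
    using assms sm unfolding charts_at_def smooth_atlas_def by auto
qed

lemma charts_at_D: "c \<in> charts_at A x \<Longrightarrow> is_chart c" "c \<in> charts_at A x \<Longrightarrow> x \<in> fst c"
  by (auto simp: charts_at_def)

lemma charts_at_transition:
  assumes A: "smooth_atlas A" and c: "c \<in> charts_at A x" and d: "d \<in> charts_at A x"
  shows "transition c d differentiable (at (snd c x))"
proof -
  obtain a where a: "a \<in> A" "x \<in> fst a" using atlas_D(2)[OF A] by blast
  have 1: "transition c a differentiable (at (snd c x))" using c a by (simp add: charts_at_def)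
  have 2: "transition a d differentiable (at (transition c a (snd c x)))"
    using d a transition_at[OF charts_at_D[OF c], of a] by (simp add: charts_at_def)
  show ?thesis
    by (rule frechet_compose(1)[where f="transition a d" and g="transition c a",
        OF 2 1 transition_compose[OF charts_at_D[OF c] atlas_D(1)[OF A a(1)] a(2)]])
qed

lemma charts_at_chain:
  assumes A: "smooth_atlas A" and c: "c \<in> charts_at A x" and d: "d \<in> charts_at A x" and e: "e \<in> charts_at A x"
  shows "frechet_derivative (transition c e) (at (snd c x)) v
    = frechet_derivative (transition d e) (at (snd d x)) (frechet_derivative (transition c d) (at (snd c x)) v)"
proof -
  have "transition d e differentiable (at (transition c d (snd c x)))"
    using charts_at_transition[OF A d e] transition_at[OF charts_at_D[OF c]] by simp
  from frechet_compose(2)[where f="transition d e" and g="transition c d" and h="transition c e", OF this charts_at_transition[OF A c d] transition_compose[OF charts_at_D[OF c] charts_at_D[OF d]]]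
  show ?thesis using transition_at[OF charts_at_D[OF c]] by simp
qed

lemma transition_self:
  assumes "is_chart c" "x \<in> fst c"
  shows "frechet_derivative (transition c c) (at (snd c x)) v = v"
proof -
  have "\<forall>\<^sub>F z in nhds (snd c x). z = transition c c z"
    using ev_point_of[OF assms open_UNIV UNIV_I] by eventually_elim (simp add: local_rep_def)
  from has_wd_frechet[OF has_wd_transform[OF has_wd_ident this]] show ?thesis by simp
qed

lemma tangent_vec_in:
  assumes A: "smooth_atlas A" and c: "c \<in> charts_at A x"
  shows "tangent_vec A c x v \<in> tangent_space A x" "tangent_vec A c x v c = v"
proof -
  show "tangent_vec A c x v \<in> tangent_space A x"
    unfolding tangent_space_def
  proof (intro CollectI conjI ballI allI impI)
    fix d e assume d: "d \<in> charts_at A x" and e: "e \<in> charts_at A x"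
    show "tangent_vec A c x v e = frechet_derivative (transition d e) (at (snd d x)) (tangent_vec A c x v d)"
      unfolding tangent_vec_def if_P[OF d] if_P[OF e] by (rule charts_at_chain[OF A c d e])
  qed (simp add: tangent_vec_def)
  show "tangent_vec A c x v c = v"
    using c transition_self[OF charts_at_D[OF c]] by (simp add: tangent_vec_def)
qed

lemma tangent_space_D:
  assumes "X \<in> tangent_space A x" "c \<in> charts_at A x"
  shows "d \<in> charts_at A x \<Longrightarrow> X d = frechet_derivative (transition c d) (at (snd c x)) (X c)"
    "d \<notin> charts_at A x \<Longrightarrow> X d = 0"
proof -
  have *: "\<And>c d. c \<in> charts_at A x \<Longrightarrow> d \<in> charts_at A x \<Longrightarrow> X d = frechet_derivative (transition c d) (at (snd c x)) (X c)"
    "\<And>d. d \<notin> charts_at A x \<Longrightarrow> X d = 0"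
    using assms(1) unfolding tangent_space_def by blast+
  show "d \<in> charts_at A x \<Longrightarrow> X d = frechet_derivative (transition c d) (at (snd c x)) (X c)"
    by (rule *(1)[OF assms(2)])
  show "d \<notin> charts_at A x \<Longrightarrow> X d = 0" by (rule *(2))
qed

lemma tangent_space_eqI:
  assumes "X \<in> tangent_space A x" "X' \<in> tangent_space A x" "c \<in> charts_at A x" "X c = X' c"
  shows "X = X'"
proof
  fix d
  show "X d = X' d"
  proof (cases "d \<in> charts_at A x")
    case True
    then show ?thesis
      by (simp only: tangent_space_D(1)[OF assms(1,3) True] tangent_space_D(1)[OF assms(2,3) True] assms(4))
  next
    case False
    then show ?thesis
      by (simp only: tangent_space_D(2)[OF assms(1,3) False] tangent_space_D(2)[OF assms(2,3) False])
  qed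
qed

section \<open>Conformal charts and their transitions\<close>

lemma conformal_charts_at:
  assumes "conformal_chart \<gamma> A g p c \<rho>" "x \<in> fst c" "x \<noteq> p"
  shows "c \<in> charts_at A x"
proof -
  have "\<forall>a\<in>A. x \<in> fst a \<longrightarrow> transition a c differentiable (at (snd a x)) \<and> transition c a differentiable (at (snd c x))"
    using assms unfolding conformal_chart_def by (auto simp: numeral_3_eq_3)
  then show ?thesis using assms by (auto simp: charts_at_def conformal_chart_def)
qed

lemma conformal_pos:
  assumes A: "smooth_atlas A" and g: "metric_off \<gamma> A p g" and c: "conformal_chart \<gamma> A g p c \<rho>" and x: "x \<in> fst c" "x \<noteq> p"
  shows "0 < \<rho> (snd c x)"
proof -
  obtain a where a: "a \<in> A" "x \<in> fst a" using atlas_D(2)[OF A] by blast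
  let ?X = "tangent_vec A a x 1"
  have "?X \<in> tangent_space A x" by (rule tangent_vec_in(1)[OF A atlas_D(3)[OF A a]])
  then have "g x ?X ?X = \<rho> (snd c x) * (?X c \<bullet> ?X c)" using c x unfolding conformal_chart_def by blast
  moreover have "0 < g x ?X ?X" using g a x unfolding metric_off_def by auto
  moreover have "0 \<le> ?X c \<bullet> ?X c" by simp
  ultimately have "0 < \<rho> (snd c x) * (?X c \<bullet> ?X c)" "0 \<le> ?X c \<bullet> ?X c" by (simp_all only:)
  then show ?thesis unfolding zero_less_mult_iff by linarith
qed

text \<open>Testing v = 1, i and 1 + i yields |a + b| = |a - b| = |a - i b|, hence a cnj b = 0: a
  real linear map that scales all lengths equally is complex linear or antilinear.\<close>

lemma conformal_linear:
  fixes a b :: complex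
  assumes "\<And>v. s * (cmod (a * v + b * cnj v))^2 = t * (cmod v)^2" and s: "0 < s" and t: "0 < t"
  shows "(a = 0 \<or> b = 0) \<and> \<not> (a = 0 \<and> b = 0) \<and> t = s * ((cmod a)^2 + (cmod b)^2)"
proof -
  have 1: "s * (cmod (a + b))^2 = t" using assms(1)[of 1] by simp
  have "cmod (a * \<i> + b * cnj \<i>) = cmod (a - b)"
  proof -
    have "a * \<i> + b * cnj \<i> = \<i> * (a - b)" by (simp add: algebra_simps)
    then show ?thesis by (simp only: norm_mult) simp
  qed
  then have 2: "s * (cmod (a - b))^2 = t" using assms(1)[of \<i>] by simp
  have e3: "a * (1 + \<i>) + b * cnj (1 + \<i>) = (1 + \<i>) * (a - \<i> * b)" by (simp add: algebra_simps)
  have n: "(cmod (1 + \<i>))^2 = 2" by (simp add: cmod_power2)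
  have "s * (2 * (cmod (a - \<i> * b))^2) = t * 2"
    using assms(1)[of "1 + \<i>"] unfolding e3 norm_mult power_mult_distrib n .
  then have 3: "s * (cmod (a - \<i> * b))^2 = t" by simp
  have q: "(cmod (a + b))^2 = (cmod (a - b))^2" "(cmod (a + b))^2 = (cmod (a - \<i> * b))^2"
  proof -
    have "s * (cmod (a + b))^2 = s * (cmod (a - b))^2" "s * (cmod (a + b))^2 = s * (cmod (a - \<i> * b))^2"
      using 1 2 3 by (simp_all only:)
    then show "(cmod (a + b))^2 = (cmod (a - b))^2" "(cmod (a + b))^2 = (cmod (a - \<i> * b))^2"
      unfolding mult_cancel_left using s by auto
  qed
  have R: "Re a * Re b + Im a * Im b = 0"
    using q(1) unfolding cmod_power2 by (simp add: power2_eq_square algebra_simps)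
  have "Im a * Re b - Re a * Im b = 0"
    using q(2) R unfolding cmod_power2 by (simp add: power2_eq_square algebra_simps)
  with R have "a * cnj b = 0" by (simp add: complex_eq_iff algebra_simps)
  then have ab: "a = 0 \<or> b = 0" by simp
  moreover have "(cmod (a + b))^2 = (cmod a)^2 + (cmod b)^2" using ab by auto
  ultimately show ?thesis using 1 t by auto
qed

lemma conformal_transition:
  assumes A: "smooth_atlas A" and g: "metric_off \<gamma> A p g" and c: "conformal_chart \<gamma> A g p c \<rho>" and c': "conformal_chart \<gamma> A g p c' \<rho>'"
    and x: "x \<in> fst c" "x \<in> fst c'" "x \<noteq> p"
  defines "a \<equiv> pd_z (transition c c') (snd c x)" and "b \<equiv> pd_zbar (transition c c') (snd c x)"
  shows "(a = 0 \<or> b = 0) \<and> \<not> (a = 0 \<and> b = 0) \<and> \<rho> (snd c x) = \<rho>' (snd c' x) * ((cmod a)^2 + (cmod b)^2)"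
proof (rule conformal_linear)
  note cx = conformal_charts_at[OF c x(1,3)] and cx' = conformal_charts_at[OF c' x(2,3)]
  show "0 < \<rho>' (snd c' x)" "0 < \<rho> (snd c x)" using conformal_pos[OF A g] c c' x by auto
  fix v
  let ?X = "tangent_vec A c x v"
  have X: "?X \<in> tangent_space A x" "?X c = v" using tangent_vec_in[OF A cx] by auto
  have "?X c' = a * v + b * cnj v"
    using tangent_space_D(1)[OF X(1) cx cx'] X(2) frechet_pd[OF charts_at_transition[OF A cx cx']] by (simp add: a_def b_def)
  moreover have "g x ?X ?X = \<rho> (snd c x) * (?X c \<bullet> ?X c)" "g x ?X ?X = \<rho>' (snd c' x) * (?X c' \<bullet> ?X c')"
    using c c' x X unfolding conformal_chart_def by blast+
  ultimately show "\<rho>' (snd c' x) * (cmod (a * v + b * cnj v))^2 = \<rho> (snd c x) * (cmod v)^2"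
    by (simp add: power2_norm_eq_inner X(2))
qed

lemma differentiable_pd:
  assumes "(\<lambda>z. frechet_derivative f (at z) 1) differentiable (at z)" "(\<lambda>z. frechet_derivative f (at z) \<i>) differentiable (at z)"
  shows "pd_z f differentiable (at z)" "pd_zbar f differentiable (at z)"
proof -
  note w = differentiable_has_wd[OF assms(1)] differentiable_has_wd[OF assms(2)]
  have n: "(2::complex) \<noteq> 0" by simp
  show "pd_z f differentiable (at z)" unfolding pd_z_def[abs_def]
    by (rule has_wd_differentiable[OF has_wd_divide[OF has_wd_diff[OF w(1) has_wd_mult[OF has_wd_const w(2)]] has_wd_const n]])
  show "pd_zbar f differentiable (at z)" unfolding pd_zbar_def[abs_def]
    by (rule has_wd_differentiable[OF has_wd_divide[OF has_wd_add[OF w(1) has_wd_mult[OF has_wd_const w(2)]] has_wd_const n]])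
qed

text \<open>Off the cone point both charts are of class C^3 against the atlas, and the transition
  factors through an atlas chart. The continuity obtained here serves the connectedness argument in
  \<open>conformal_germ\<close>.\<close>

lemma conformal_transition_C1:
  fixes A :: "('a::t2_space) chart set"
  assumes A: "smooth_atlas A" and c: "conformal_chart \<gamma> A g p c \<rho>" and c': "conformal_chart \<gamma> A g p c' \<rho>'"
    and x: "x \<in> fst c" "x \<in> fst c'" "x \<noteq> p"
  shows "isCont (pd_z (transition c c')) (snd c x)" "isCont (pd_zbar (transition c c')) (snd c x)"
proof -
  obtain a where a: "a \<in> A" "x \<in> fst a" using atlas_D(2)[OF A] by blast
  have ia: "is_chart a" by (rule atlas_D(1)[OF A a(1)])
  have ic: "is_chart c" "is_chart c'" using c c' by (auto simp: conformal_chart_def)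
  let ?T = "transition c c'" and ?R = "transition c a" and ?S = "transition a c'"
  have hR: "holder_loc 3 \<gamma> (snd c ` (fst a \<inter> fst c - {p})) ?R" using c a unfolding conformal_chart_def by blast
  have hS: "holder_loc 3 \<gamma> (snd a ` (fst a \<inter> fst c' - {p})) ?S" using c' a unfolding conformal_chart_def by blast
  have R1: "?R differentiable (at (snd c y))" "pd_z ?R differentiable (at (snd c y))" "pd_zbar ?R differentiable (at (snd c y))"
    if "y \<in> fst a" "y \<in> fst c" "y \<noteq> p" for y
  proof -
    have "snd c y \<in> snd c ` (fst a \<inter> fst c - {p})" using that by auto
    with hR show "?R differentiable (at (snd c y))" "pd_z ?R differentiable (at (snd c y))" "pd_zbar ?R differentiable (at (snd c y))"
      by (auto simp: numeral_3_eq_3 intro!: differentiable_pd)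
  qed
  have S1: "?S differentiable (at (snd a y))" "pd_z ?S differentiable (at (snd a y))" "pd_zbar ?S differentiable (at (snd a y))"
    if "y \<in> fst a" "y \<in> fst c'" "y \<noteq> p" for y
  proof -
    have "snd a y \<in> snd a ` (fst a \<inter> fst c' - {p})" using that by auto
    with hS show "?S differentiable (at (snd a y))" "pd_z ?S differentiable (at (snd a y))" "pd_zbar ?S differentiable (at (snd a y))"
      by (auto simp: numeral_3_eq_3 intro!: differentiable_pd)
  qed
  have "\<forall>\<^sub>F z in nhds (snd c x). z \<in> snd c ` fst c \<and> point_of c z \<in> fst a \<inter> fst c' \<inter> - {p} \<and> point_of c z \<in> fst c \<and> snd c (point_of c z) = z"
    by (rule ev_point_of[OF ic(1) x(1)])
      (use a x chart_D(1)[OF ia] chart_D(1)[OF ic(2)] in \<open>auto intro!: open_Int\<close>)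
  then have ev: "\<forall>\<^sub>F z in nhds (snd c x). pd_z ?T z = pd_z ?S (?R z) * pd_z ?R z + pd_zbar ?S (?R z) * cnj (pd_zbar ?R z)
      \<and> pd_zbar ?T z = pd_z ?S (?R z) * pd_zbar ?R z + pd_zbar ?S (?R z) * cnj (pd_z ?R z)"
  proof eventually_elim
    case (elim z)
    define y where "y = point_of c z"
    have y: "y \<in> fst a" "y \<in> fst c'" "y \<noteq> p" "y \<in> fst c" "snd c y = z" using elim by (auto simp: y_def)
    have Rz: "?R z = snd a y" using transition_at[OF ic(1) y(4)] y(5) by simp
    have d: "?S differentiable (at (?R z))" "?R differentiable (at z)"
      using S1(1)[OF y(1-3)] R1(1)[OF y(1,4,3)] Rz y(5) by auto
    have e: "\<forall>\<^sub>F w in nhds z. ?T w = ?S (?R w)"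
      using transition_compose[OF ic(1) y(4) ia y(1)] y(5) by simp
    show ?case
      by (rule conjI; rule frechet_compose(3)[where f="?S" and g="?R", OF d e] frechet_compose(4)[where f="?S" and g="?R", OF d e])
  qed
  have Rx: "?R (snd c x) = snd a x" by (rule transition_at[OF ic(1) x(1)])
  have cR: "isCont ?R (snd c x)" "isCont (pd_z ?R) (snd c x)" "isCont (pd_zbar ?R) (snd c x)"
    using R1[OF a(2) x(1,3)] by (auto intro: differentiable_imp_continuous_within)
  have cS: "isCont (pd_z ?S) (?R (snd c x))" "isCont (pd_zbar ?S) (?R (snd c x))"
    using S1[OF a(2) x(2,3)] Rx by (auto intro: differentiable_imp_continuous_within)
  have e1: "\<forall>\<^sub>F z in nhds (snd c x). pd_z ?T z = pd_z ?S (?R z) * pd_z ?R z + pd_zbar ?S (?R z) * cnj (pd_zbar ?R z)"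
    and e2: "\<forall>\<^sub>F z in nhds (snd c x). pd_zbar ?T z = pd_z ?S (?R z) * pd_zbar ?R z + pd_zbar ?S (?R z) * cnj (pd_z ?R z)"
    using ev by (auto elim: eventually_mono)
  show "isCont (pd_z ?T) (snd c x)" unfolding isCont_cong[OF e1]
    by (intro continuous_intros isCont_o2[OF cR(1) cS(1)] isCont_o2[OF cR(1) cS(2)] cR)
  show "isCont (pd_zbar ?T) (snd c x)" unfolding isCont_cong[OF e2]
    by (intro continuous_intros isCont_o2[OF cR(1) cS(1)] isCont_o2[OF cR(1) cS(2)] cR)
qed

section \<open>Holomorphic germs and the density factors they produce\<close>

lemma S2_add: "S2 c f \<Longrightarrow> S2 c g \<Longrightarrow> S2 c (\<lambda>z. f z + g z)"
proof -
  assume "S2 c f" "S2 c g"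
  then obtain a b a1 a2 b1 b2 a' b' a1' a2' b1' b2' where f: "\<forall>\<^sub>F z in at 0. has_wd f (a z) (b z) z"
     "\<forall>\<^sub>F z in at 0. has_wd a (a1 z) (a2 z) z" "\<forall>\<^sub>F z in at 0. has_wd b (b1 z) (b2 z) z"
     "Ob c f" "Ob (c - 1) a" "Ob (c - 1) b"
    and g: "\<forall>\<^sub>F z in at 0. has_wd g (a' z) (b' z) z"
     "\<forall>\<^sub>F z in at 0. has_wd a' (a1' z) (a2' z) z" "\<forall>\<^sub>F z in at 0. has_wd b' (b1' z) (b2' z) z"
     "Ob c g" "Ob (c - 1) a'" "Ob (c - 1) b'" unfolding S2_def by blast
  show ?thesis
  proof (rule S2_I)
    show "\<forall>\<^sub>F z in at 0. has_wd (\<lambda>z. f z + g z) (a z + a' z) (b z + b' z) z"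
      using f(1) g(1) by eventually_elim (rule has_wd_add)
    show "\<forall>\<^sub>F z in at 0. has_wd (\<lambda>z. a z + a' z) (a1 z + a1' z) (a2 z + a2' z) z"
      using f(2) g(2) by eventually_elim (rule has_wd_add)
    show "\<forall>\<^sub>F z in at 0. has_wd (\<lambda>z. b z + b' z) (b1 z + b1' z) (b2 z + b2' z) z"
      using f(3) g(3) by eventually_elim (rule has_wd_add)
  qed (intro Ob_add f g)+
qed

lemma S2_cmult: "S2 c f \<Longrightarrow> S2 c (\<lambda>z. k * f z)"
proof -
  assume "S2 c f"
  then obtain a b a1 a2 b1 b2 where f: "\<forall>\<^sub>F z in at 0. has_wd f (a z) (b z) z"
     "\<forall>\<^sub>F z in at 0. has_wd a (a1 z) (a2 z) z" "\<forall>\<^sub>F z in at 0. has_wd b (b1 z) (b2 z) z"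
     "Ob c f" "Ob (c - 1) a" "Ob (c - 1) b" unfolding S2_def by blast
  have m: "has_wd (\<lambda>z. k * h z) (k * p) (k * q) z" if "has_wd h p q z" for h p q z
    by (rule has_wd_eqI[OF has_wd_mult[OF has_wd_const that]]) auto
  show ?thesis
  proof (rule S2_I)
    show "\<forall>\<^sub>F z in at 0. has_wd (\<lambda>z. k * f z) (k * a z) (k * b z) z"
      using f(1) by eventually_elim (rule m)
    show "\<forall>\<^sub>F z in at 0. has_wd (\<lambda>z. k * a z) (k * a1 z) (k * a2 z) z"
      using f(2) by eventually_elim (rule m)
    show "\<forall>\<^sub>F z in at 0. has_wd (\<lambda>z. k * b z) (k * b1 z) (k * b2 z) z"
      using f(3) by eventually_elim (rule m)
  qed (intro Ob_cmult f)+
qed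

lemma S2_mono: "S2 c f \<Longrightarrow> d \<le> c \<Longrightarrow> S2 d f"
proof -
  assume "S2 c f" "d \<le> c"
  then show ?thesis unfolding S2_def by (elim exE conjE, intro exI conjI) (assumption | erule Ob_mono, simp)+
qed

lemma holo_Ob_0:
  assumes "h holomorphic_on ball 0 r" "0 < r"
  shows "Ob 0 h"
proof -
  have "isCont h 0"
    using assms holomorphic_on_imp_continuous_on continuous_on_interior[of "ball 0 r" h 0] by auto
  then show ?thesis by (intro tendsto_Ob_0[of _ "h 0"]) (simp add: isCont_def)
qed

lemma holo_has_wd:
  assumes "h holomorphic_on ball 0 r" "0 < r"
  shows "\<forall>\<^sub>F z in at 0. has_wd h (deriv h z) 0 z"
  using eventually_at_0_lt[OF assms(2)]
  by eventually_elim (use holomorphic_derivI[OF assms(1)] in \<open>auto simp: has_wd_field[symmetric]\<close>)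

lemma S2_holo:
  assumes h: "h holomorphic_on ball 0 r" and r: "0 < r" and c: "c \<le> 0 \<or> c \<le> 1 \<and> h 0 = 0"
  shows "S2 c h"
proof (rule S2_I)
  have h': "deriv h holomorphic_on ball 0 r" using h by (intro holomorphic_deriv) auto
  show "\<forall>\<^sub>F z in at 0. has_wd h (deriv h z) 0 z" by (rule holo_has_wd[OF h r])
  show "\<forall>\<^sub>F z in at 0. has_wd (deriv h) (deriv (deriv h) z) 0 z" by (rule holo_has_wd[OF h' r])
  show "\<forall>\<^sub>F z in at 0. has_wd (\<lambda>_. 0) 0 0 z" using has_wd_const by simp
  show "Ob (c - 1) (deriv h)" using Ob_mono[OF holo_Ob_0[OF h' r]] c by auto
  show "Ob (c - 1) (\<lambda>_. 0)" by (rule ObI[where C=0]) simp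
  show "Ob c h"
  proof (cases "c \<le> 0")
    case True then show ?thesis using Ob_mono[OF holo_Ob_0[OF h r]] by auto
  next
    case False
    then have h0: "h 0 = 0" "c \<le> 1" using c by auto
    have "(h has_field_derivative deriv h 0) (at 0)" using holomorphic_derivI[OF h, of 0] r by auto
    from Ob_function[OF this, of 1 "\<lambda>z. z"] have "Ob 1 (\<lambda>z. h z - h 0)" using Ob_ident by simp
    then show ?thesis using Ob_mono h0 by simp
  qed
qed

text \<open>The difference is the real part of Ln (q / q 0), whose argument stays in the right half
  plane near 0. Such terms arise in log \<rho> when the conformal coordinate is changed.\<close>

lemma S2_ln_norm:
  assumes q: "q holomorphic_on ball 0 r" and r: "0 < r" and q0: "q 0 \<noteq> 0"
  shows "S2 1 (\<lambda>z. of_real (ln (cmod (q z)) - ln (cmod (q 0))))"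
proof -
  have "isCont q 0"
    using q r holomorphic_on_imp_continuous_on continuous_on_interior[of "ball 0 r" q 0] by auto
  then have "(q \<longlongrightarrow> q 0) (nhds 0)" by (simp add: continuous_at_imp_continuous_at_within isCont_def tendsto_nhds_iff)
  then have "((\<lambda>z. q z / q 0) \<longlongrightarrow> q 0 / q 0) (nhds 0)" by (intro tendsto_intros q0)
  then have "((\<lambda>z. q z / q 0) \<longlongrightarrow> 1) (nhds 0)" using q0 by simp
  from tendstoD[OF this, of 1] obtain d where d: "0 < d" "\<And>z. cmod z < d \<Longrightarrow> cmod (q z / q 0 - 1) < 1"
    by (auto simp: eventually_nhds_metric dist_norm)
  define s where "s = min d r"
  have s: "0 < s" using d r by (simp add: s_def)
  have re: "0 < Re (q z / q 0)" if "z \<in> ball 0 s" for z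
  proof -
    have "cmod (q z / q 0 - 1) < 1" using that d by (simp add: s_def)
    then have "\<bar>Re (q z / q 0 - 1)\<bar> < 1" by (meson abs_Re_le_cmod le_less_trans)
    then show ?thesis by simp
  qed
  define g where "g = (\<lambda>z. Ln (q z / q 0))"
  have gh: "g holomorphic_on ball 0 s" unfolding g_def
  proof (intro holomorphic_intros)
    show "q holomorphic_on ball 0 s" by (rule holomorphic_on_subset[OF q]) (auto simp: s_def)
    show "q z / q 0 \<notin> \<real>\<^sub>\<le>\<^sub>0" if "z \<in> ball 0 s" for z using re[OF that] by (auto simp: complex_nonpos_Reals_iff)
  qed (use q0 in auto)
  have "S2 1 g" by (rule S2_holo[OF gh s]) (simp add: g_def q0)
  then have "S2 1 (\<lambda>z. (1/2) * (g z + cnj (g z)))" by (intro S2_cmult S2_add S2_cnj)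
  then show ?thesis
  proof (rule S2_cong)
    show "\<forall>\<^sub>F z in at 0. (1/2) * (g z + cnj (g z)) = of_real (ln (cmod (q z)) - ln (cmod (q 0)))"
      using eventually_at_0_lt[OF s]
    proof eventually_elim
      case (elim z)
      then have "0 < Re (q z / q 0)" by (intro re) auto
      then have n: "q z / q 0 \<noteq> 0" "q z \<noteq> 0" by auto
      have "g z + cnj (g z) = of_real (2 * Re (g z))" by (simp add: complex_add_cnj)
      also have "Re (g z) = ln (cmod (q z / q 0))" using n by (simp add: g_def)
      also have "\<dots> = ln (cmod (q z)) - ln (cmod (q 0))" using n q0 by (simp add: norm_divide ln_div)
      finally show ?case by simp
    qed
  qed
qed

lemma holo_quotient:
  assumes h: "h holomorphic_on ball 0 r" "h 0 = 0"
  shows "\<exists>q. q holomorphic_on ball 0 r \<and> q 0 = deriv h 0 \<and> (\<forall>z. z \<noteq> 0 \<longrightarrow> h z = z * q z)"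
proof (intro exI conjI)
  \<comment> \<open>The subtracted pole h 0 / z is zero; it is written out in the form that
    \<open>pole_theorem_open\<close> expects.\<close>
  let ?q = "\<lambda>z. if z = 0 then deriv h 0 else h z / z - h 0 / (z - 0)"
  show "?q holomorphic_on ball 0 r"
    by (rule pole_theorem_open[OF h(1)]) auto
qed (use h in auto)

lemma holo_lower_bound:
  assumes h: "h holomorphic_on ball 0 r" "h 0 = 0" and r: "0 < r" and d: "deriv h 0 \<noteq> 0"
  obtains k where "0 < k" "\<forall>\<^sub>F z in at 0. k * cmod z \<le> cmod (h z)"
proof -
  obtain q where q: "q holomorphic_on ball 0 r" "q 0 = deriv h 0" "\<forall>z. z \<noteq> 0 \<longrightarrow> h z = z * q z"
    using holo_quotient[OF h] by blast
  have "isCont q 0"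
    using q(1) r holomorphic_on_imp_continuous_on continuous_on_interior[of "ball 0 r" q 0] by auto
  then have "((\<lambda>z. cmod (q z)) \<longlongrightarrow> cmod (q 0)) (at 0)" by (intro tendsto_norm) (simp add: isCont_def)
  then have "\<forall>\<^sub>F z in at 0. cmod (q 0) / 2 < cmod (q z)" by (rule order_tendstoD) (use d q in simp)
  then have "\<forall>\<^sub>F z in at 0. cmod (q 0) / 2 * cmod z \<le> cmod (h z)"
    using eventually_at_0_lt[OF zero_less_one]
  proof eventually_elim
    case (elim z)
    then have "h z = z * q z" using q(3) by auto
    then show ?case using elim by (simp add: norm_mult mult.commute mult_left_mono)
  qed
  then show thesis by (rule that[rotated]) (use d q in simp)
qed

text \<open>At its centre a conformal chart is only a topological coordinate, so holomorphy is known
  just off 0. Continuity removes the singularity, and injectivity then makes the derivative nonzero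
  at 0 as well.\<close>

lemma inj_holo_germ:
  assumes r: "0 < r" and cont: "continuous_on (ball 0 r) F" and inj: "inj_on F (ball 0 r)"
    and d: "\<And>z. z \<in> ball 0 r - {0} \<Longrightarrow> has_wd F (d z) 0 z"
  shows "F holomorphic_on ball 0 r" "\<And>z. z \<in> ball 0 r \<Longrightarrow> deriv F z \<noteq> 0"
    "\<And>z. z \<in> ball 0 r - {0} \<Longrightarrow> deriv F z = d z"
proof -
  have "F holomorphic_on ball 0 r - {0}" unfolding holomorphic_on_def
  proof
    fix x :: complex assume "x \<in> ball 0 r - {0}"
    then have "(F has_field_derivative d x) (at x)" using d[of x] by (simp add: has_wd_field)
    then show "F field_differentiable (at x within ball 0 r - {0})"
      unfolding field_differentiable_def using has_field_derivative_at_within by blast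
  qed
  then show h: "F holomorphic_on ball 0 r"
    by (intro no_isolated_singularity[OF cont]) auto
  show "deriv F z \<noteq> 0" if "z \<in> ball 0 r" for z
    by (rule holomorphic_injective_imp_regular[OF h open_ball inj that])
  show "deriv F z = d z" if "z \<in> ball 0 r - {0}" for z
    using d[OF that] by (simp add: has_wd_field[symmetric] DERIV_imp_deriv)
qed

text \<open>At each point of the punctured disc exactly one Wirtinger derivative of the transition
  vanishes. The two zero sets are closed, disjoint and cover the punctured disc, which is connected;
  so one and the same derivative vanishes throughout. In the antiholomorphic case the conjugate of
  the transition is the germ.\<close>

lemma conformal_germ:
  fixes A :: "('a::t2_space) chart set"
  assumes A: "smooth_atlas A" and g: "metric_off \<gamma> A p g" and c: "conformal_chart \<gamma> A g p c \<rho>" "centered_at c p"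
    and c': "conformal_chart \<gamma> A g p c' \<rho>'" "centered_at c' p"
  shows "\<exists>r h. 0 < r \<and> h holomorphic_on ball 0 r \<and> h 0 = 0 \<and> (\<forall>z\<in>ball 0 r. deriv h z \<noteq> 0) \<and>
    ball 0 r \<subseteq> snd c ` (fst c \<inter> fst c') \<and>
    ((\<forall>z\<in>ball 0 r. transition c c' z = h z) \<or> (\<forall>z\<in>ball 0 r. transition c c' z = cnj (h z))) \<and>
    (\<forall>z\<in>ball 0 r - {0}. \<rho> z = \<rho>' (transition c c' z) * (cmod (deriv h z))^2)"
proof -
  have ic: "is_chart c" "is_chart c'" using c c' by (auto simp: conformal_chart_def)
  note D = chart_D[OF ic(1)] and D' = chart_D[OF ic(2)]
  let ?T = "transition c c'"
  have op: "open (snd c ` (fst c \<inter> fst c'))" by (rule open_chart_image[OF ic(1) D'(1)])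
  have "0 \<in> snd c ` (fst c \<inter> fst c')" using c(2) c'(2) unfolding centered_at_def by force
  then obtain r where r: "0 < r" "ball 0 r \<subseteq> snd c ` (fst c \<inter> fst c')"
    using op open_contains_ball by blast
  define x where "x = point_of c"
  have x: "x z \<in> fst c" "x z \<in> fst c'" "snd c (x z) = z" if "z \<in> ball 0 r" for z
  proof -
    have "z \<in> snd c ` (fst c \<inter> fst c')" using r(2) that by blast
    then obtain y where y: "y \<in> fst c" "y \<in> fst c'" "z = snd c y" by blast
    then show "x z \<in> fst c" "x z \<in> fst c'" "snd c (x z) = z" by (simp_all add: x_def D(3))
  qed
  have xp: "x z \<noteq> p" if "z \<in> ball 0 r - {0}" for z
    using x(3)[of z] that c(2) by (auto simp: centered_at_def)
  have T: "?T z = snd c' (x z)" for z by (simp add: local_rep_def x_def)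
  have T0: "?T 0 = 0" using transition_at[OF ic(1), of p c'] c(2) c'(2) by (simp add: centered_at_def)
  have sub: "ball 0 r \<subseteq> snd c ` fst c" using r(2) by auto
  have cont: "continuous_on (ball 0 r) ?T"
    unfolding local_rep_def
    by (rule continuous_on_compose2[OF D'(7) continuous_on_subset[OF D(6) sub]]) (use x in \<open>auto simp: x_def\<close>)
  have inj: "inj_on ?T (ball 0 r)"
  proof (rule inj_onI)
    fix z w assume zw: "z \<in> ball 0 r" "w \<in> ball 0 r" "?T z = ?T w"
    then have "point_of c' (snd c' (x z)) = point_of c' (snd c' (x w))" by (simp add: T)
    then have "x z = x w" using D'(3) x zw by simp
    then show "z = w" using x(3) zw by metis
  qed
  let ?a = "pd_z ?T" and ?b = "pd_zbar ?T"
  have wd: "has_wd ?T (?a z) (?b z) z" if z: "z \<in> ball 0 r - {0}" for z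
  proof -
    have zb: "z \<in> ball 0 r" using z by blast
    have "?T differentiable (at (snd c (x z)))"
      by (rule charts_at_transition[OF A conformal_charts_at[OF c(1) x(1)[OF zb] xp[OF z]] conformal_charts_at[OF c'(1) x(2)[OF zb] xp[OF z]]])
    then show ?thesis using differentiable_has_wd x(3)[OF zb] by simp
  qed
  have cf: "(?a z = 0 \<or> ?b z = 0) \<and> \<not> (?a z = 0 \<and> ?b z = 0) \<and> \<rho> z = \<rho>' (?T z) * ((cmod (?a z))^2 + (cmod (?b z))^2)"
    if z: "z \<in> ball 0 r - {0}" for z
  proof -
    have zb: "z \<in> ball 0 r" using z by blast
    show ?thesis
      using conformal_transition[OF A g c(1) c'(1) x(1)[OF zb] x(2)[OF zb] xp[OF z]] x(3)[OF zb] T by simp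
  qed
  have cab: "continuous_on (ball 0 r - {0}) ?a" "continuous_on (ball 0 r - {0}) ?b"
  proof -
    have "isCont ?a z \<and> isCont ?b z" if z: "z \<in> ball 0 r - {0}" for z
    proof -
      have zb: "z \<in> ball 0 r" using z by blast
      show ?thesis
        using conformal_transition_C1[OF A c(1) c'(1) x(1)[OF zb] x(2)[OF zb] xp[OF z]] x(3)[OF zb] by simp
    qed
    then show "continuous_on (ball 0 r - {0}) ?a" "continuous_on (ball 0 r - {0}) ?b"
      by (simp_all add: continuous_at_imp_continuous_on)
  qed
  have conn: "connected (ball (0::complex) r - {0})"
    by (rule connected_open_delete) auto
  have dich: "(\<forall>z\<in>ball 0 r - {0}. ?b z = 0) \<or> (\<forall>z\<in>ball 0 r - {0}. ?a z = 0)"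
  proof (rule ccontr)
    assume n: "\<not> ?thesis"
    let ?D = "ball (0::complex) r - {0}"
    let ?E1 = "{z \<in> ?D. ?a z = 0}" and ?E2 = "{z \<in> ?D. ?b z = 0}"
    have "closedin (top_of_set ?D) ?E1" "closedin (top_of_set ?D) ?E2"
      by (rule continuous_closedin_preimage_constant[OF cab(1)], rule continuous_closedin_preimage_constant[OF cab(2)])
    moreover have "?D \<subseteq> ?E1 \<union> ?E2" using cf by blast
    moreover have "?E1 \<inter> ?E2 = {}" using cf by blast
    moreover have "?E1 \<noteq> {}" "?E2 \<noteq> {}" using n cf by blast+
    ultimately show False using conn unfolding connected_closedin by blast
  qed
  then show ?thesis
  proof
    assume b0: "\<forall>z\<in>ball 0 r - {0}. ?b z = 0"
    have "has_wd ?T (?a z) 0 z" if "z \<in> ball 0 r - {0}" for z using wd[OF that] b0 that by simp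
    note H = inj_holo_germ[OF r(1) cont inj this]
    show ?thesis
    proof (intro exI[of _ r] exI[of _ ?T] conjI ballI)
      fix z :: complex assume z: "z \<in> ball 0 r - {0}"
      show "\<rho> z = \<rho>' (?T z) * (cmod (deriv ?T z))^2" using cf[OF z] b0 z H(3)[OF _ z] by simp
    qed (use r H T0 in auto)
  next
    assume a0: "\<forall>z\<in>ball 0 r - {0}. ?a z = 0"
    let ?h = "\<lambda>z. cnj (?T z)"
    have d: "has_wd ?h (cnj (?b z)) 0 z" if z: "z \<in> ball 0 r - {0}" for z
      using has_wd_cnj[OF wd[OF z]] a0 z by simp
    have ch: "continuous_on (ball 0 r) ?h" using cont by (intro continuous_intros)
    have ih: "inj_on ?h (ball 0 r)" using inj by (simp add: inj_on_def)
    note H = inj_holo_germ[OF r(1) ch ih d]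
    show ?thesis
    proof (intro exI[of _ r] exI[of _ ?h] conjI ballI)
      fix z :: complex assume z: "z \<in> ball 0 r - {0}"
      show "\<rho> z = \<rho>' (?T z) * (cmod (deriv ?h z))^2" using cf[OF z] a0 z H(3)[OF _ z] by simp
    qed (use r H T0 in auto)
  qed
qed

section \<open>The pulled back field in coordinates\<close>

lemma wirtinger_solve:
  fixes a b P v :: complex
  assumes "a * cnj a - b * cnj b \<noteq> 0"
  shows "a * v + b * cnj v = P \<longleftrightarrow> v = (cnj a * P - b * cnj P) / (a * cnj a - b * cnj b)"
proof
  assume "a * v + b * cnj v = P"
  then have "cnj a * P - b * cnj P = v * (a * cnj a - b * cnj b)" by (auto simp: algebra_simps)
  then show "v = (cnj a * P - b * cnj P) / (a * cnj a - b * cnj b)" using assms by simp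
next
  let ?J = "a * cnj a - b * cnj b"
  have cJ: "cnj ?J = ?J" by (simp add: mult.commute)
  assume v: "v = (cnj a * P - b * cnj P) / ?J"
  then have "cnj v = (a * cnj P - cnj b * P) / ?J" using cJ by simp
  then have "a * v + b * cnj v = (a * (cnj a * P - b * cnj P) + b * (a * cnj P - cnj b * P)) / ?J"
    using v by (simp add: add_divide_distrib)
  also have "a * (cnj a * P - b * cnj P) + b * (a * cnj P - cnj b * P) = P * ?J" by (simp add: algebra_simps)
  finally show "a * v + b * cnj v = P" using assms by simp
qed

text \<open>\<open>differential\<close> refers to a chart picked by \<open>SOME\<close>, and the
  chain rule moves its value to the chart \<open>c\<close>. There it acts as v -> a v + b cnj v,
  which is injective because the Jacobian is nonzero, and \<open>wirtinger_solve\<close> inverts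
  it.\<close>

lemma pullback_component:
  assumes A: "smooth_atlas A" and u: "continuous_on UNIV u" and c: "c \<in> charts_at A x" and d: "d \<in> charts_at A (u x)"
    and U: "has_wd (local_rep c u d) a b (snd c x)" and J: "a * cnj a - b * cnj b \<noteq> 0"
    and \<psi>: "\<psi> x \<in> tangent_space A (u x)"
  shows "pullback_field A u \<psi> x \<in> tangent_space A x"
    "pullback_field A u \<psi> x c = (cnj a * \<psi> x d - b * cnj (\<psi> x d)) / (a * cnj a - b * cnj b)"
proof -
  define c0 where "c0 = (SOME c. c \<in> A \<and> x \<in> fst c)"
  have c0: "c0 \<in> A" "x \<in> fst c0"
    using someI_ex[of "\<lambda>c. c \<in> A \<and> x \<in> fst c"] atlas_D(2)[OF A, of x] unfolding c0_def by blast+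
  have c0x: "c0 \<in> charts_at A x" by (rule atlas_D(3)[OF A c0])
  note ic = charts_at_D[OF c] and ic0 = charts_at_D[OF c0x] and id = charts_at_D[OF d]
  have key: "frechet_derivative (local_rep c0 u d') (at (snd c0 x)) (X c0)
      = frechet_derivative (transition d d') (at (snd d (u x))) (a * X c + b * cnj (X c))"
    if d': "d' \<in> charts_at A (u x)" and X: "X \<in> tangent_space A x" for d' X
  proof -
    let ?R = "transition c0 c" and ?U = "local_rep c u d"
    have Rx: "?R (snd c0 x) = snd c x" by (rule transition_at[OF ic0])
    have R: "?R differentiable (at (snd c0 x))" by (rule charts_at_transition[OF A c0x c])
    have Ud: "?U differentiable (at (?R (snd c0 x)))" unfolding Rx by (rule has_wd_differentiable[OF U])
    note UR = frechet_compose[where f="?U" and g="?R" and h="\<lambda>z. ?U (?R z)", OF Ud R always_eventually[OF allI[OF refl]]]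
    have Ux: "?U (?R (snd c0 x)) = snd d (u x)" unfolding Rx by (rule local_rep_at[OF ic])
    have V: "transition d d' differentiable (at (?U (?R (snd c0 x))))"
      unfolding Ux by (rule charts_at_transition[OF A d d'])
    have "frechet_derivative (local_rep c0 u d') (at (snd c0 x)) (X c0)
      = frechet_derivative (transition d d') (at (?U (?R (snd c0 x)))) (frechet_derivative (\<lambda>z. ?U (?R z)) (at (snd c0 x)) (X c0))"
      by (rule frechet_compose(2)[where f="transition d d'" and g="\<lambda>z. ?U (?R z)", OF V UR(1) local_rep_compose[OF ic0 ic id u]])
    also have "frechet_derivative (\<lambda>z. ?U (?R z)) (at (snd c0 x)) (X c0) = frechet_derivative ?U (at (snd c x)) (frechet_derivative ?R (at (snd c0 x)) (X c0))"
      unfolding UR(2) Rx ..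
    also have "frechet_derivative ?R (at (snd c0 x)) (X c0) = X c"
      by (rule tangent_space_D(1)[OF X c0x c, symmetric])
    also have "frechet_derivative ?U (at (snd c x)) (X c) = a * X c + b * cnj (X c)"
      unfolding has_wd_frechet[OF U] ..
    finally show ?thesis unfolding Ux .
  qed
  have dif: "differential A u x X d' = (if d' \<in> charts_at A (u x) then frechet_derivative (transition d d') (at (snd d (u x))) (a * X c + b * cnj (X c)) else 0)"
    if X: "X \<in> tangent_space A x" for X d'
    unfolding differential_def Let_def c0_def[symmetric] using key[OF _ X] by simp
  have inj: "inj_on (differential A u x) (tangent_space A x)"
  proof (rule inj_onI)
    fix X X' assume X: "X \<in> tangent_space A x" and X': "X' \<in> tangent_space A x" and e: "differential A u x X = differential A u x X'"
    have "differential A u x X d = differential A u x X' d" by (simp only: e)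
    then have "a * X c + b * cnj (X c) = a * X' c + b * cnj (X' c)"
      unfolding dif[OF X] dif[OF X'] using d transition_self[OF id] by simp
    then have "X c = X' c" using wirtinger_solve[OF J] by metis
    then show "X = X'" by (rule tangent_space_eqI[OF X X' c])
  qed
  define v where "v = (cnj a * \<psi> x d - b * cnj (\<psi> x d)) / (a * cnj a - b * cnj b)"
  define X where "X = tangent_vec A c x v"
  have X: "X \<in> tangent_space A x" "X c = v" unfolding X_def using tangent_vec_in[OF A c] by auto
  have v: "a * v + b * cnj v = \<psi> x d" using wirtinger_solve[OF J] v_def by metis
  have dX: "differential A u x X = \<psi> x"
  proof
    fix d'
    show "differential A u x X d' = \<psi> x d'"
    proof (cases "d' \<in> charts_at A (u x)")
      case True
      then show ?thesis unfolding dif[OF X(1)] X(2) v by (simp only: if_True tangent_space_D(1)[OF \<psi> d True])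
    next
      case False
      then show ?thesis unfolding dif[OF X(1)] using tangent_space_D(2)[OF \<psi> d False] by simp
    qed
  qed
  have "pullback_field A u \<psi> x = X"
    unfolding pullback_field_def by (rule the_inv_into_f_eq[OF inj dX X(1)])
  then show "pullback_field A u \<psi> x \<in> tangent_space A x"
    "pullback_field A u \<psi> x c = (cnj a * \<psi> x d - b * cnj (\<psi> x d)) / (a * cnj a - b * cnj b)"
    using X v_def by auto
qed

section \<open>Expansions under a holomorphic change of coordinate\<close>

lemma holo_approx:
  assumes h: "h holomorphic_on ball 0 r" and r: "0 < r"
  shows "Ob 1 (\<lambda>z. h z - h 0)"
proof -
  have "(h has_field_derivative deriv h 0) (at 0)" using holomorphic_derivI[OF h, of 0] r by auto
  from Ob_function[OF this, of 1 "\<lambda>z. z"] show ?thesis using Ob_ident by simp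
qed

lemma holo_filterlim:
  assumes h: "h holomorphic_on ball 0 r" "h 0 = 0" and r: "0 < r" and d: "deriv h 0 \<noteq> 0"
  shows "filterlim h (at 0) (at 0)"
proof -
  obtain k where k: "0 < k" "\<forall>\<^sub>F z in at 0. k * cmod z \<le> cmod (h z)" using holo_lower_bound[OF h r d] .
  have "\<forall>\<^sub>F z in at 0. h z \<noteq> 0"
    using k(2) eventually_at_0_lt[OF zero_less_one] by eventually_elim (use k(1) in \<open>auto simp: mult_le_0_iff\<close>)
  moreover have "Ob 1 h" using holo_approx[OF h(1) r] h(2) by simp
  then have "(h \<longlongrightarrow> 0) (at 0)" by (rule Ob_tendsto_0) simp
  ultimately show ?thesis by (simp add: filterlim_at)
qed

lemma Ob_holo_compose:
  assumes X: "Ob c X" and h: "h holomorphic_on ball 0 r" "h 0 = 0" and r: "0 < r" and d: "deriv h 0 \<noteq> 0"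
  shows "Ob c (\<lambda>z. X (h z))"
proof -
  obtain k where k: "0 < k" "\<forall>\<^sub>F z in at 0. k * cmod z \<le> cmod (h z)" using holo_lower_bound[OF h r d] .
  have "Ob 1 h" using holo_approx[OF h(1) r] h(2) by simp
  then obtain C where "0 < C" "\<forall>\<^sub>F z in at 0. cmod (h z) \<le> C * cmod z powr 1" by (rule ObE)
  from this(2) eventually_at_0_lt[OF zero_less_one] have "\<forall>\<^sub>F z in at 0. cmod (h z) \<le> C * cmod z"
    by eventually_elim simp
  then show ?thesis by (rule Ob_compose[OF X holo_filterlim[OF h r d] k])
qed

lemma deriv_inverse_approx:
  assumes h: "h holomorphic_on ball 0 r" and r: "0 < r" and d: "deriv h 0 \<noteq> 0"
  shows "Ob 1 (\<lambda>z. inverse (deriv h z) - inverse (deriv h 0))"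
proof -
  have "deriv h holomorphic_on ball 0 r" using h by (intro holomorphic_deriv) auto
  then have "Ob 1 (\<lambda>z. deriv h z - deriv h 0)" by (rule holo_approx[OF _ r])
  then show ?thesis by (rule Ob_inverse[OF _ d]) simp
qed

text \<open>A vector field component changes by the factor 1 / h'. This factor is constant up to
  O(r), and so is |h(z)|^g / |z|^g. Since g + \<delta> \<le> 1, both errors disappear in the
  remainder.\<close>

lemma transfer_large:
  assumes X: "Ob (g + \<delta>) (\<lambda>z. X z - (w + k * of_real (cmod z powr g)))" and g: "0 < g" "0 < \<delta>" "g + \<delta> \<le> 1"
    and h: "h holomorphic_on ball 0 r" "h 0 = 0" and r: "0 < r" and d: "deriv h 0 \<noteq> 0"
  shows "\<exists>w k. Ob (g + \<delta>) (\<lambda>z. X (h z) / deriv h z - (w + k * of_real (cmod z powr g)))"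
proof -
  let ?i = "inverse (deriv h 0)" and ?p = "\<lambda>z. complex_of_real (cmod z powr g)"
  obtain q where q: "q holomorphic_on ball 0 r" "q 0 = deriv h 0" "\<forall>z. z \<noteq> 0 \<longrightarrow> h z = z * q z"
    using holo_quotient[OF h] by blast
  have q1: "Ob 1 (\<lambda>z. q z - q 0)" by (rule holo_approx[OF q(1) r])
  have nq: "Ob 1 (\<lambda>z. of_real (cmod (q z) - cmod (q 0)))"
    by (rule Ob_bounded[OF q1, where K=1]) (simp only: norm_of_real norm_triangle_ineq3 mult_1 eventually_True)
  have dq: "((\<lambda>t. t powr g) has_field_derivative g * cmod (q 0) powr (g - 1)) (at (cmod (q 0)))"
    using d q(2) by (auto intro!: derivative_eq_intros)
  have "Ob 1 (\<lambda>z. of_real (cmod (q z) powr g - cmod (q 0) powr g))"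
    by (rule Ob_real_function[OF dq nq]) simp
  then have "Ob (g + 1) (\<lambda>z. ?p z * of_real (cmod (q z) powr g - cmod (q 0) powr g))"
    by (rule Ob_multI[OF Ob_powr]) simp
  then have hp: "Ob (g + \<delta>) (\<lambda>z. ?p (h z) - of_real (cmod (q 0) powr g) * ?p z)"
  proof (rule Ob_cong[OF Ob_mono])
    show "\<forall>\<^sub>F z in at 0. ?p z * of_real (cmod (q z) powr g - cmod (q 0) powr g) = ?p (h z) - of_real (cmod (q 0) powr g) * ?p z"
      using eventually_at_0_lt[OF zero_less_one]
    proof eventually_elim
      case (elim z)
      then have "h z = z * q z" using q(3) by auto
      then show ?case by (simp add: norm_mult powr_mult algebra_simps)
    qed
  qed (use g in simp)
  let ?k = "k * of_real (cmod (q 0) powr g)"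
  have Xh: "Ob (g + \<delta>) (\<lambda>z. X (h z) - (w + ?k * ?p z))"
  proof -
    have "Ob (g + \<delta>) (\<lambda>z. (X (h z) - (w + k * ?p (h z))) + k * (?p (h z) - of_real (cmod (q 0) powr g) * ?p z))"
      by (intro Ob_add Ob_cmult hp Ob_holo_compose[OF X h r d])
    then show ?thesis by (simp add: algebra_simps)
  qed
  have i1: "Ob 1 (\<lambda>z. inverse (deriv h z) - ?i)" by (rule deriv_inverse_approx[OF h(1) r d])
  have i0: "Ob 0 (\<lambda>z. inverse (deriv h z))" by (rule Ob_1_of_approx[OF i1]) simp
  have w0: "Ob 0 (\<lambda>z. w + ?k * ?p z)" by (intro Ob_add Ob_const Ob_cmult Ob_mono[OF Ob_powr]) (use g in auto)
  have "Ob (g + \<delta>) (\<lambda>z. (X (h z) - (w + ?k * ?p z)) * inverse (deriv h z) + (w + ?k * ?p z) * (inverse (deriv h z) - ?i))"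
    by (rule Ob_add[OF Ob_multI[OF Xh i0] Ob_multI[OF w0 i1]]) (use g in auto)
  then have "Ob (g + \<delta>) (\<lambda>z. X (h z) / deriv h z - (w * ?i + (?k * ?i) * ?p z))"
    by (simp add: algebra_simps divide_inverse)
  then show ?thesis by blast
qed

text \<open>The linear part of a vector field at its zero is independent of the coordinate: h(z) /
  h'(z) = z + O(z^2), so \<mu> is unchanged.\<close>

lemma transfer_small:
  assumes X: "Ob (1 + \<delta>) (\<lambda>z. X z - \<mu> * z)" and g: "0 < \<delta>" "\<delta> \<le> 1"
    and h: "h holomorphic_on ball 0 r" "h 0 = 0" and r: "0 < r" and d: "deriv h 0 \<noteq> 0"
  shows "Ob (1 + \<delta>) (\<lambda>z. X (h z) / deriv h z - \<mu> * z)"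
proof -
  let ?i = "inverse (deriv h 0)"
  obtain q where q: "q holomorphic_on ball 0 r" "q 0 = deriv h 0" "\<forall>z. z \<noteq> 0 \<longrightarrow> h z = z * q z"
    using holo_quotient[OF h] by blast
  have i1: "Ob 1 (\<lambda>z. inverse (deriv h z) - ?i)" by (rule deriv_inverse_approx[OF h(1) r d])
  have i0: "Ob 0 (\<lambda>z. inverse (deriv h z))" by (rule Ob_1_of_approx[OF i1]) simp
  have q1: "Ob 1 (\<lambda>z. q z - q 0)" by (rule holo_approx[OF q(1) r])
  have h1: "Ob 1 h" using holo_approx[OF h(1) r] h(2) by simp
  have 1: "Ob (1 + \<delta>) (\<lambda>z. (X (h z) - \<mu> * h z) * inverse (deriv h z))"
    by (rule Ob_multI[OF Ob_holo_compose[OF X h r d] i0]) simp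
  \<comment> \<open>The difference h / h' - z is split into the error of 1 / h' and that of the
    quotient q = h / z.\<close>
  have 2: "Ob (1 + \<delta>) (\<lambda>z. \<mu> * (h z * (inverse (deriv h z) - ?i) + z * (q z - q 0) * ?i))"
    by (intro Ob_cmult Ob_add Ob_multI[OF h1 i1] Ob_multI[OF Ob_multI[OF Ob_ident q1, of 2] Ob_const, of 0]) (use g in auto)
  from Ob_add[OF 1 2] show ?thesis
  proof (rule Ob_cong)
    show "\<forall>\<^sub>F z in at 0. (X (h z) - \<mu> * h z) * inverse (deriv h z) + \<mu> * (h z * (inverse (deriv h z) - ?i) + z * (q z - q 0) * ?i)
        = X (h z) / deriv h z - \<mu> * z"
      using eventually_at_0_lt[OF zero_less_one]
    proof eventually_elim
      case (elim z)
      then have e: "h z = z * q z" using q(3) by auto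
      have qi: "q 0 * ?i = 1" using d q(2) by simp
      have "(X (h z) - \<mu> * h z) * inverse (deriv h z) + \<mu> * (h z * (inverse (deriv h z) - ?i) + z * (q z - q 0) * ?i)
        = X (h z) * inverse (deriv h z) - \<mu> * z * (q 0 * ?i)" by (simp add: e algebra_simps)
      then show ?case by (simp only: qi) (simp add: divide_inverse)
    qed
  qed
qed

section \<open>The tension field in coordinates\<close>

lemma tension_eval:
  assumes U: "\<forall>\<^sub>F x in nhds z. has_wd U (A x) (B x) x" and B: "has_wd B M Bz z"
  shows "tension \<sigma> \<rho> U z = of_real (4 / \<sigma> z) * (M + pd_z (\<lambda>w. of_real (ln (\<rho> w))) (U z) * A z * B z)"
proof -
  have "\<forall>\<^sub>F x in nhds z. B x = pd_zbar U x" using U by eventually_elim (simp add: has_wd_pd_zbar)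
  from has_wd_transform[OF B this] have "pd_z (pd_zbar U) z = M" by (rule has_wd_pd_z)
  moreover have "has_wd U (A z) (B z) z" using U by (rule eventually_nhds_x_imp_x)
  ultimately show ?thesis by (simp add: tension_def has_wd_pd_z has_wd_pd_zbar)
qed

text \<open>Along U + t P the tension at \<open>z\<close> has a closed form in t as long as U z + t
  P z stays in the region where \<open>f\<close> is the derivative of log \<rho>, that is, for small
  t. The product rule at t = 0 then gives the linear operator.\<close>

lemma lin_tension_eval:
  assumes U: "\<forall>\<^sub>F x in nhds z. has_wd U (A x) (B x) x" and B: "has_wd B M Bz z"
    and P: "\<forall>\<^sub>F x in nhds z. has_wd P (Pz x) (Pb x) x" and Pb: "has_wd Pb N Pbb z"
    and F: "\<forall>\<^sub>F w in nhds (U z). has_wd (\<lambda>w. of_real (ln (\<rho> w))) (f w) (f' w) w" and f: "has_wd f fw fb (U z)"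
  shows "lin_tension \<sigma> \<rho> U P z = of_real (4 / \<sigma> z) * (N + (fw * P z + fb * cnj (P z)) * A z * B z
     + f (U z) * (Pz z * B z + A z * Pb z))"
proof -
  let ?F = "\<lambda>w. complex_of_real (ln (\<rho> w))"
  let ?Ut = "\<lambda>t x. U x + of_real t * P x"
  have t1: "tension \<sigma> \<rho> (?Ut t) z = of_real (4 / \<sigma> z) * ((M + of_real t * N) + pd_z ?F (?Ut t z) * (A z + of_real t * Pz z) * (B z + of_real t * Pb z))" for t :: real
  proof (rule tension_eval)
    show "\<forall>\<^sub>F x in nhds z. has_wd (?Ut t) (A x + of_real t * Pz x) (B x + of_real t * Pb x) x"
      using U P
    proof eventually_elim
      case (elim x)
      show ?case by (rule has_wd_eqI[OF has_wd_add[OF elim(1) has_wd_mult[OF has_wd_const elim(2)]]]) auto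
    qed
    show "has_wd (\<lambda>x. B x + of_real t * Pb x) (M + of_real t * N) (Bz + of_real t * Pbb) z"
      by (rule has_wd_eqI[OF has_wd_add[OF B has_wd_mult[OF has_wd_const Pb]]]) auto
  qed
  have line: "((\<lambda>t. U z + of_real t * P z) has_vector_derivative P z) (at 0)"
    by (auto intro!: derivative_eq_intros simp: has_vector_derivative_def scaleR_conv_of_real)
  have "((\<lambda>t::real. f (U z + of_real t * P z)) has_derivative (\<lambda>h. fw * (h *\<^sub>R P z) + fb * cnj (h *\<^sub>R P z))) (at 0)"
    using has_derivative_compose[OF line[unfolded has_vector_derivative_def], of f "\<lambda>h. fw * h + fb * cnj h"] f
    by (simp add: has_wd_def)
  moreover have "(\<lambda>h. fw * (h *\<^sub>R P z) + fb * cnj (h *\<^sub>R P z)) = (\<lambda>h::real. h *\<^sub>R (fw * P z + fb * cnj (P z)))"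
    by (simp add: fun_eq_iff scaleR_conv_of_real algebra_simps)
  ultimately have fd: "((\<lambda>t. f (U z + of_real t * P z)) has_vector_derivative (fw * P z + fb * cnj (P z))) (at 0)"
    by (simp add: has_vector_derivative_def)
  have aff: "((\<lambda>t. c + of_real t * d) has_vector_derivative d) (at 0)" for c d :: complex
    by (auto intro!: derivative_eq_intros simp: has_vector_derivative_def scaleR_conv_of_real)
  let ?\<phi> = "\<lambda>t. of_real (4 / \<sigma> z) * ((M + of_real t * N) + f (?Ut t z) * (A z + of_real t * Pz z) * (B z + of_real t * Pb z))"
  have d\<phi>: "(?\<phi> has_vector_derivative of_real (4 / \<sigma> z) * (N + (f (?Ut 0 z) * (A z + of_real 0 * Pz z) * Pb z
      + (f (?Ut 0 z) * Pz z + (fw * P z + fb * cnj (P z)) * (A z + of_real 0 * Pz z)) * (B z + of_real 0 * Pb z)))) (at 0)"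
    by (intro has_vector_derivative_mult_right has_vector_derivative_add has_vector_derivative_mult fd aff)
  have e\<phi>: "\<forall>\<^sub>F t in nhds 0. ?\<phi> t = tension \<sigma> \<rho> (?Ut t) z"
  proof -
    have "((\<lambda>t. ?Ut t z) \<longlongrightarrow> ?Ut 0 z) (nhds 0)"
      by (intro tendsto_intros filterlim_ident)
    then have "((\<lambda>t. ?Ut t z) \<longlongrightarrow> U z) (nhds 0)" by simp
    from eventually_compose_filterlim[OF F this] show ?thesis
      by eventually_elim (simp add: t1 has_wd_pd_z)
  qed
  then have "\<forall>\<^sub>F t in at 0. ?\<phi> t = tension \<sigma> \<rho> (?Ut t) z" by (simp add: eventually_at_filter eventually_mono)
  from has_derivative_transform_eventually[OF d\<phi>[unfolded has_vector_derivative_def] this eventually_nhds_x_imp_x[OF e\<phi>] UNIV_I]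
  have "((\<lambda>t. tension \<sigma> \<rho> (?Ut t) z) has_vector_derivative of_real (4 / \<sigma> z) * (N + (f (?Ut 0 z) * (A z + of_real 0 * Pz z) * Pb z
      + (f (?Ut 0 z) * Pz z + (fw * P z + fb * cnj (P z)) * (A z + of_real 0 * Pz z)) * (B z + of_real 0 * Pb z)))) (at 0)"
    unfolding has_vector_derivative_def .
  then show ?thesis unfolding lin_tension_def
    by (subst vector_derivative_at, assumption) (simp add: algebra_simps)
qed

text \<open>The chart \<open>d\<close> may differ from the one in which the metric has its conic
  normal form, by a germ h or its conjugate. Then log \<rho> is ln k plus 2 \<open>lam\<close> along
  the transition, (2\<alpha> - 2) ln |h| and 2 ln |h'|. With h = z q, all but (2\<alpha> - 2) ln |z|
  and a constant has order \<delta>, which is limited by the order \<nu> of \<open>lam\<close> and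
  the order 1 of the holomorphic corrections.\<close>

lemma log_density_germ:
  fixes A :: "('a::t2_space) chart set"
  assumes A: "smooth_atlas A" and G: "conic_metric \<alpha> \<nu> \<gamma> A G p" and d: "conformal_chart \<gamma> A G p d \<rho>" "centered_at d p"
    and \<delta>: "0 < \<delta>" "\<delta> \<le> 1" "\<delta> \<le> \<nu>"
  shows "\<exists>K f fw fb. (\<forall>\<^sub>F w in at 0. has_wd (\<lambda>w. of_real (ln (\<rho> w))) (f w) (cnj (f w)) w) \<and>
    (\<forall>\<^sub>F w in at 0. has_wd f (fw w) (fb w) w) \<and> (\<forall>\<^sub>F w in at 0. cnj (fb w) = fb w) \<and>
    Ob \<delta> (\<lambda>w. of_real (ln (\<rho> w)) - (of_real ((2 * \<alpha> - 2) * ln (cmod w)) + K)) \<and>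
    Ob (\<delta> - 1) (\<lambda>w. f w - of_real (\<alpha> - 1) / w)"
proof -
  have m: "metric_off \<gamma> A p G" using G by (simp add: conic_metric_def)
  obtain d0 \<rho>0 s k lam where d0: "conformal_chart \<gamma> A G p d0 \<rho>0" "centered_at d0 p" and s: "0 < s" and k: "0 < k"
    and lam: "weighted_Cb \<nu> 2 \<gamma> s (lam :: complex \<Rightarrow> real)"
    and \<rho>0: "\<forall>\<zeta>\<in>ball 0 s - {0}. \<rho>0 \<zeta> = k * exp (2 * lam \<zeta>) * cmod \<zeta> powr (2 * (\<alpha> - 1))"
    using G unfolding conic_metric_def by blast
  let ?T = "transition d d0"
  obtain r h where r: "0 < r" and h: "h holomorphic_on ball 0 r" "h 0 = 0" "\<forall>z\<in>ball 0 r. deriv h z \<noteq> 0"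
    and Th: "(\<forall>z\<in>ball 0 r. ?T z = h z) \<or> (\<forall>z\<in>ball 0 r. ?T z = cnj (h z))"
    and \<rho>: "\<forall>z\<in>ball 0 r - {0}. \<rho> z = \<rho>0 (?T z) * (cmod (deriv h z))^2"
    using conformal_germ[OF A m d d0] by blast
  have d0': "deriv h 0 \<noteq> 0" using h(3) r by auto
  obtain q where q: "q holomorphic_on ball 0 r" "q 0 = deriv h 0" "\<forall>z. z \<noteq> 0 \<longrightarrow> h z = z * q z"
    using holo_quotient[OF h(1,2)] by blast
  have ev: "\<forall>\<^sub>F w in at (0::complex). w \<in> ball 0 r - {0}"
    using eventually_at_0_lt[OF r] by eventually_elim auto
  obtain c where c: "0 < c" "\<forall>\<^sub>F z in at 0. c * cmod z \<le> cmod (h z)" using holo_lower_bound[OF h(1,2) r d0'] .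
  have h1: "S2 1 h" by (rule S2_holo[OF h(1) r]) (use h in auto)
  have "bounded_linear complex_of_real" by (rule bounded_linear_of_real)
  from weighted_Cb_S2[OF this lam s] have L: "S2 \<nu> (\<lambda>z. of_real (lam z))" .
  have LT: "S2 \<nu> (\<lambda>w. of_real (lam (?T w)))"
    using Th
  proof
    assume t: "\<forall>z\<in>ball 0 r. ?T z = h z"
    show ?thesis
      by (rule S2_cong[OF S2_compose[OF L h1 c]]) (use ev t in \<open>auto elim!: eventually_mono\<close>)
  next
    assume t: "\<forall>z\<in>ball 0 r. ?T z = cnj (h z)"
    show ?thesis
    proof (rule S2_cong[OF S2_compose[OF L S2_cnj[OF h1] c(1)]])
      show "\<forall>\<^sub>F z in at 0. c * cmod z \<le> cmod (cnj (h z))" using c(2) by simp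
      show "\<forall>\<^sub>F z in at 0. complex_of_real (lam (cnj (h z))) = of_real (lam (?T z))"
        using ev by eventually_elim (use t in auto)
    qed
  qed
  have h': "deriv h holomorphic_on ball 0 r" using h by (intro holomorphic_deriv) auto
  have lq: "S2 1 (\<lambda>w. of_real (ln (cmod (q w)) - ln (cmod (q 0))))" by (rule S2_ln_norm[OF q(1) r]) (use q d0' in simp)
  have lh: "S2 1 (\<lambda>w. of_real (ln (cmod (deriv h w)) - ln (cmod (deriv h 0))))" by (rule S2_ln_norm[OF h' r d0'])
  \<comment> \<open>The part of log \<rho> that tends to 0; the values at 0 of the holomorphic
    corrections go into \<open>K\<close>.\<close>
  define F2 where "F2 = (\<lambda>w. 2 * of_real (lam (?T w)) + of_real (2 * \<alpha> - 2) * of_real (ln (cmod (q w)) - ln (cmod (q 0)))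
     + 2 * of_real (ln (cmod (deriv h w)) - ln (cmod (deriv h 0))) :: complex)"
  have F2: "S2 \<delta> F2" unfolding F2_def
    by (intro S2_add S2_cmult S2_mono[OF LT] S2_mono[OF lq] S2_mono[OF lh]) (use \<delta> in auto)
  define K where "K = complex_of_real (ln k + (2 * \<alpha> - 2) * ln (cmod (q 0)) + 2 * ln (cmod (deriv h 0)))"
  let ?F = "\<lambda>w. complex_of_real (ln (\<rho> w))"
  have "\<forall>\<^sub>F w in at 0. h w \<in> ball 0 s - {0}"
  proof -
    have "\<forall>\<^sub>F w in at (0::complex). w \<in> ball 0 s - {0}"
      using eventually_at_0_lt[OF s] by eventually_elim auto
    then show ?thesis by (rule eventually_compose_at[OF holo_filterlim[OF h(1,2) r d0']])
  qed
  then have FF: "\<forall>\<^sub>F w in at 0. of_real ((2 * \<alpha> - 2) * ln (cmod w)) + K + F2 w = ?F w"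
    using ev
  proof eventually_elim
    case (elim w)
    then have w: "w \<noteq> 0" "w \<in> ball 0 r" "h w \<noteq> 0" "cmod (h w) < s" by auto
    have Tn: "cmod (?T w) = cmod (h w)" using Th w(2) by auto
    then have "?T w \<in> ball 0 s - {0}" using w by auto
    then have "\<rho> w = k * exp (2 * lam (?T w)) * cmod (h w) powr (2 * (\<alpha> - 1)) * (cmod (deriv h w))^2"
      using \<rho> \<rho>0 elim(2) Tn by simp
    moreover have "deriv h w \<noteq> 0" using h(3) w by blast
    ultimately have "ln (\<rho> w) = ln k + 2 * lam (?T w) + (2 * (\<alpha> - 1)) * ln (cmod (h w)) + 2 * ln (cmod (deriv h w))"
      using k w by (simp add: ln_mult ln_powr ln_realpow)
    moreover have "q w \<noteq> 0" "cmod (h w) = cmod w * cmod (q w)" using q(3)[rule_format, OF w(1)] w(3) by (auto simp: norm_mult)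
    then have "ln (cmod (h w)) = ln (cmod w) + ln (cmod (q w))" using w(1) by (simp add: ln_mult)
    ultimately have "ln (\<rho> w) = (2 * \<alpha> - 2) * ln (cmod w) + (ln k + (2 * \<alpha> - 2) * ln (cmod (q 0)) + 2 * ln (cmod (deriv h 0)))
      + (2 * lam (?T w) + (2 * \<alpha> - 2) * (ln (cmod (q w)) - ln (cmod (q 0))) + 2 * (ln (cmod (deriv h w)) - ln (cmod (deriv h 0))))"
      by (simp add: algebra_simps)
    then show ?case by (simp add: F2_def K_def)
  qed
  obtain a b a1 m b2 where F2d: "\<forall>\<^sub>F z in at 0. has_wd F2 (a z) (b z) z"
     "\<forall>\<^sub>F z in at 0. has_wd a (a1 z) (m z) z" "\<forall>\<^sub>F z in at 0. has_wd b (m z) (b2 z) z"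
     "Ob \<delta> F2" "Ob (\<delta> - 1) a" "Ob (\<delta> - 1) b" by (rule S2_E[OF F2])
  have ba: "\<forall>\<^sub>F z in at 0. cnj (a z) = b z"
    using F2d(1)
  proof eventually_elim
    case (elim z)
    have "\<forall>\<^sub>F x in nhds z. cnj (F2 x) = F2 x" by (rule always_eventually) (simp add: F2_def)
    from has_wd_real_valued[OF elim this] show ?case by simp
  qed
  \<comment> \<open>\<open>F2\<close> is real, so \<open>b\<close> is the conjugate of
    \<open>a\<close>; comparing the derivatives of both shows that the mixed derivative
    \<open>m\<close> equals its conjugate.\<close>
  have mr: "\<forall>\<^sub>F z in at 0. cnj (m z) = m z"
  proof -
    have "\<forall>\<^sub>F z in at 0. has_wd (\<lambda>z. cnj (a z)) (cnj (m z)) (cnj (a1 z)) z"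
      using F2d(2) by eventually_elim (rule has_wd_cnj)
    from ev_has_wd_cong[OF this ba] F2d(3) show ?thesis
    proof eventually_elim
      case (elim z)
      from has_wd_unique[OF this] show ?case by simp
    qed
  qed
  let ?f = "\<lambda>w. of_real (\<alpha> - 1) / w + a w"
  have Fd: "\<forall>\<^sub>F w in at 0. has_wd ?F (?f w) (cnj (?f w)) w"
  proof (rule ev_has_wd_cong[OF _ FF])
    show "\<forall>\<^sub>F w in at 0. has_wd (\<lambda>w. of_real ((2 * \<alpha> - 2) * ln (cmod w)) + K + F2 w) (?f w) (cnj (?f w)) w"
      using F2d(1) ba ev
    proof eventually_elim
      case (elim w)
      then have w: "w \<noteq> 0" by auto
      have "has_wd (\<lambda>w. of_real (2 * \<alpha> - 2) * of_real (ln (cmod w)) + K + F2 w) (?f w) (cnj (?f w)) w"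
        by (rule has_wd_eqI[OF has_wd_add[OF has_wd_add[OF has_wd_mult[OF has_wd_const has_wd_ln_norm[OF w]] has_wd_const] elim(1)]])
          (use w elim(2) in \<open>auto simp: field_simps\<close>)
      then show ?case by simp
    qed
  qed
  have fd: "\<forall>\<^sub>F w in at 0. has_wd ?f (- of_real (\<alpha> - 1) / w^2 + a1 w) (m w) w"
    using F2d(2) ev
  proof eventually_elim
    case (elim w)
    then have w: "w \<noteq> 0" by auto
    show ?case
      by (rule has_wd_eqI[OF has_wd_add[OF has_wd_divide[OF has_wd_const has_wd_ident w] elim(1)]]) auto
  qed
  have o1: "Ob \<delta> (\<lambda>w. ?F w - (of_real ((2 * \<alpha> - 2) * ln (cmod w)) + K))"
    by (rule Ob_cong[OF F2d(4)]) (use FF in \<open>auto elim!: eventually_mono simp: algebra_simps\<close>)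
  have o2: "Ob (\<delta> - 1) (\<lambda>w. ?f w - of_real (\<alpha> - 1) / w)" using F2d(5) by simp
  show ?thesis
    by (rule exI[of _ K], rule exI[of _ ?f], rule exI[of _ "\<lambda>w. - of_real (\<alpha> - 1) / w^2 + a1 w"], rule exI[of _ m])
      (intro conjI Fd fd mr o1 o2)
qed

section \<open>Transfer to the charts of the map and assembly\<close>

lemma S2_filterlim:
  assumes "S2 1 g" "0 < k" "\<forall>\<^sub>F z in at 0. k * cmod z \<le> cmod (g z)"
  shows "filterlim g (at 0) (at 0)"
proof -
  have "\<forall>\<^sub>F z in at 0. g z \<noteq> 0"
    using assms(3) eventually_at_0_lt[OF zero_less_one] by eventually_elim (use assms(2) in \<open>auto simp: mult_le_0_iff\<close>)
  then show ?thesis using Ob_tendsto_0[OF S2_Ob[OF assms(1)]] by (simp add: filterlim_at)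
qed

text \<open>Only \<open>q\<close> is mapped to \<open>p\<close>, so at nearby points other than
  \<open>q\<close> neither cone point is met and the conformal charts represent tangent
  vectors.\<close>

lemma ev_source:
  assumes c: "is_chart c" "centered_at c q" and s: "0 < s" "ball 0 s \<subseteq> snd c ` (fst c \<inter> u -` fst d)"
    and u: "u -` {p} = {q}"
  shows "\<forall>\<^sub>F z in at 0. point_of c z \<in> fst c \<and> point_of c z \<noteq> q \<and> snd c (point_of c z) = z
     \<and> u (point_of c z) \<in> fst d \<and> u (point_of c z) \<noteq> p"
  using eventually_at_0_lt[OF s(1)]
proof eventually_elim
  case (elim z)
  then have "z \<in> ball 0 s" by simp
  then obtain y where y: "y \<in> fst c" "u y \<in> fst d" "z = snd c y" using s(2) by blast
  have py: "point_of c z = y" unfolding y(3) by (rule chart_D(3)[OF c(1) y(1)])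
  have yq: "y \<noteq> q" using c(2) elim y(3) by (auto simp: centered_at_def)
  then have "u y \<noteq> p" using u by auto
  then show ?case using py y yq by simp
qed

lemma germ_has_wd:
  assumes k: "k holomorphic_on ball 0 r" and z: "z \<in> ball 0 r"
  shows "(\<forall>w\<in>ball 0 r. V w = k w) \<Longrightarrow> has_wd V (deriv k z) 0 z"
    "(\<forall>w\<in>ball 0 r. V w = cnj (k w)) \<Longrightarrow> has_wd V 0 (cnj (deriv k z)) z"
proof -
  have w: "has_wd k (deriv k z) 0 z" by (rule has_wd_field[THEN iffD1, OF holomorphic_derivI[OF k open_ball z]])
  have n: "\<forall>\<^sub>F w in nhds z. w \<in> ball 0 r" using z by (intro eventually_nhds_in_open) auto
  have w': "has_wd (\<lambda>w. cnj (k w)) 0 (cnj (deriv k z)) z" using has_wd_cnj[OF w] by simp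
  show "has_wd V (deriv k z) 0 z" if V: "\<forall>w\<in>ball 0 r. V w = k w"
  proof (rule has_wd_transform[OF w])
    show "\<forall>\<^sub>F w in nhds z. k w = V w" using n by eventually_elim (simp add: V)
  qed
  show "has_wd V 0 (cnj (deriv k z)) z" if V: "\<forall>w\<in>ball 0 r. V w = cnj (k w)"
  proof (rule has_wd_transform[OF w'])
    show "\<forall>\<^sub>F w in nhds z. cnj (k w) = V w" using n by eventually_elim (simp add: V)
  qed
qed

lemma ball_chart_mem:
  assumes c: "is_chart c" and r: "ball 0 r \<subseteq> snd c ` (fst c \<inter> fst c')" and x: "x \<in> fst c" "snd c x \<in> ball 0 r"
  shows "x \<in> fst c'"
proof -
  from subsetD[OF r x(2)] obtain y where y: "snd c x = snd c y" "y \<in> fst c \<inter> fst c'" by (rule imageE)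
  have "x = y" using chart_D(3)[OF c x(1)] chart_D(3)[OF c, of y] y by simp
  then show ?thesis using y by simp
qed

text \<open>The weight of a section and Form 1 of the map each come with their own pair of charts.
  In the charts of the map the component is the given one, composed with the source transition and
  divided by the derivative of the target transition along the map, with a conjugation if the target
  transition reverses orientation. The class \<open>S2\<close> is closed under these
  operations.\<close>

lemma section_germ:
  fixes A :: "('a::t2_space) chart set"
  assumes A: "smooth_atlas A" and mg: "metric_off \<gamma> A q g" and mG: "metric_off \<gamma> A p G"
    and c1: "conformal_chart \<gamma> A g q c1 \<sigma>1" "centered_at c1 q" and d1: "conformal_chart \<gamma> A G p d1 \<rho>1" "centered_at d1 p"
    and c2: "conformal_chart \<gamma> A g q c2 \<sigma>2" "centered_at c2 q" and d2: "conformal_chart \<gamma> A G p d2 \<rho>2" "centered_at d2 p"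
    and s: "0 < s" "ball 0 s \<subseteq> snd c1 ` (fst c1 \<inter> u -` fst d1)" and u: "u -` {p} = {q}"
    and \<psi>: "\<And>x. x \<noteq> q \<Longrightarrow> \<psi> x \<in> tangent_space A (u x)"
    and w: "weighted_Cb b 2 \<gamma> s2 (section_rep c2 \<psi> d2)" "0 < s2"
    and U: "S2 1 (local_rep c1 u d1)" "0 < kU" "\<forall>\<^sub>F z in at 0. kU * cmod z \<le> cmod (local_rep c1 u d1 z)"
  shows "S2 b (section_rep c1 \<psi> d1)"
proof -
  let ?Tc = "transition c1 c2" and ?V = "transition d1 d2" and ?P = "section_rep c1 \<psi> d1" and ?P2 = "section_rep c2 \<psi> d2"
  let ?U = "local_rep c1 u d1"
  have ic: "is_chart c1" "is_chart d1" "is_chart c2" using c1 d1 c2 by (auto simp: conformal_chart_def)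
  obtain r h where r: "0 < r" and h: "h holomorphic_on ball 0 r" "h 0 = 0" "\<forall>z\<in>ball 0 r. deriv h z \<noteq> 0"
    and rs: "ball 0 r \<subseteq> snd c1 ` (fst c1 \<inter> fst c2)"
    and Th: "(\<forall>z\<in>ball 0 r. ?Tc z = h z) \<or> (\<forall>z\<in>ball 0 r. ?Tc z = cnj (h z))"
    using conformal_germ[OF A mg c1 c2] by blast
  obtain r' k where r': "0 < r'" and k: "k holomorphic_on ball 0 r'" "\<forall>z\<in>ball 0 r'. deriv k z \<noteq> 0"
    and rs': "ball 0 r' \<subseteq> snd d1 ` (fst d1 \<inter> fst d2)"
    and Vk: "(\<forall>z\<in>ball 0 r'. ?V z = k z) \<or> (\<forall>z\<in>ball 0 r'. ?V z = cnj (k z))"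
    using conformal_germ[OF A mG d1 d2] by blast
  have h0: "deriv h 0 \<noteq> 0" using h r by auto
  obtain kh where kh: "0 < kh" "\<forall>\<^sub>F z in at 0. kh * cmod z \<le> cmod (h z)" using holo_lower_bound[OF h(1,2) r h0] .
  have h1: "S2 1 h" by (rule S2_holo[OF h(1) r]) (use h in auto)
  have P2: "S2 b ?P2" by (rule weighted_Cb_S2[OF bounded_linear_ident w])
  have evr: "\<forall>\<^sub>F z in at (0::complex). z \<in> ball 0 r" using eventually_at_0_lt[OF r] by eventually_elim auto
  have Pc: "S2 b (\<lambda>z. ?P2 (?Tc z))"
    using Th
  proof
    assume t: "\<forall>z\<in>ball 0 r. ?Tc z = h z"
    show ?thesis
    proof (rule S2_cong[OF S2_compose[OF P2 h1 kh]])
      show "\<forall>\<^sub>F z in at 0. ?P2 (h z) = ?P2 (?Tc z)" using evr by eventually_elim (use t in auto)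
    qed
  next
    assume t: "\<forall>z\<in>ball 0 r. ?Tc z = cnj (h z)"
    show ?thesis
    proof (rule S2_cong[OF S2_compose[OF P2 S2_cnj[OF h1] kh(1)]])
      show "\<forall>\<^sub>F z in at 0. kh * cmod z \<le> cmod (cnj (h z))" using kh(2) by simp
      show "\<forall>\<^sub>F z in at 0. ?P2 (cnj (h z)) = ?P2 (?Tc z)" using evr by eventually_elim (use t in auto)
    qed
  qed
  have "deriv k holomorphic_on ball 0 r'" using k by (intro holomorphic_deriv) auto
  then have "(\<lambda>w. inverse (deriv k w)) holomorphic_on ball 0 r'" by (rule holomorphic_on_inverse) (use k(2) in auto)
  then have "S2 0 (\<lambda>w. inverse (deriv k w))" by (rule S2_holo[OF _ r']) simp
  then have Wk: "S2 0 (\<lambda>z. inverse (deriv k (?U z)))" by (rule S2_compose[OF _ U])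
  have evU: "\<forall>\<^sub>F z in at 0. ?U z \<in> ball 0 r'"
  proof (rule eventually_compose_at[OF S2_filterlim[OF U]])
    show "\<forall>\<^sub>F w in at (0::complex). w \<in> ball 0 r'" using eventually_at_0_lt[OF r'] by eventually_elim auto
  qed
  have pt: "\<forall>\<^sub>F z in at 0. ?U z \<in> ball 0 r' \<and> ?P2 (?Tc z) = frechet_derivative ?V (at (?U z)) (?P z)"
    using ev_source[OF ic(1) c1(2) s u] evr evU
  proof eventually_elim
    case (elim z)
    define x where "x = point_of c1 z"
    have x: "x \<in> fst c1" "x \<noteq> q" "snd c1 x = z" "u x \<in> fst d1" "u x \<noteq> p" using elim(1) by (auto simp: x_def)
    have x2: "x \<in> fst c2" by (rule ball_chart_mem[OF ic(1) rs x(1)]) (use x elim in simp)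
    have Ux: "?U z = snd d1 (u x)" by (simp add: local_rep_def x_def)
    have ux2: "u x \<in> fst d2" by (rule ball_chart_mem[OF ic(2) rs' x(4)]) (use Ux elim in simp)
    have "?Tc z = snd c2 x" by (simp add: local_rep_def x_def)
    then have "?P2 (?Tc z) = \<psi> x d2" by (simp add: section_rep_def chart_D(3)[OF ic(3) x2])
    also have "\<dots> = frechet_derivative ?V (at (snd d1 (u x))) (\<psi> x d1)"
      by (rule tangent_space_D(1)[OF \<psi>[OF x(2)] conformal_charts_at[OF d1(1) x(4,5)] conformal_charts_at[OF d2(1) ux2 x(5)]])
    finally have f: "?P2 (?Tc z) = frechet_derivative ?V (at (snd d1 (u x))) (\<psi> x d1)" .
    have e: "?P z = \<psi> x d1" by (simp add: section_rep_def x_def)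
    show ?case by (rule conjI[OF elim(3)]) (simp only: f e Ux)
  qed
  show ?thesis
    using Vk
  proof
    assume v: "\<forall>z\<in>ball 0 r'. ?V z = k z"
    have "S2 (b + 0) (\<lambda>z. ?P2 (?Tc z) * inverse (deriv k (?U z)))" by (rule S2_mult[OF Pc Wk])
    then have "S2 b (\<lambda>z. ?P2 (?Tc z) * inverse (deriv k (?U z)))" by simp
    then show ?thesis
    proof (rule S2_cong)
      show "\<forall>\<^sub>F z in at 0. ?P2 (?Tc z) * inverse (deriv k (?U z)) = ?P z"
        using pt
      proof eventually_elim
        case (elim z)
        then have Uz: "?U z \<in> ball 0 r'" by blast
        have "?P2 (?Tc z) = deriv k (?U z) * ?P z"
          unfolding conjunct2[OF elim] has_wd_frechet[OF germ_has_wd(1)[OF k(1) Uz v]] by simp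
        then show ?case using bspec[OF k(2) Uz] by simp
      qed
    qed
  next
    assume v: "\<forall>z\<in>ball 0 r'. ?V z = cnj (k z)"
    have "S2 (b + 0) (\<lambda>z. cnj (?P2 (?Tc z)) * inverse (deriv k (?U z)))" by (rule S2_mult[OF S2_cnj[OF Pc] Wk])
    then have "S2 b (\<lambda>z. cnj (?P2 (?Tc z)) * inverse (deriv k (?U z)))" by simp
    then show ?thesis
    proof (rule S2_cong)
      show "\<forall>\<^sub>F z in at 0. cnj (?P2 (?Tc z)) * inverse (deriv k (?U z)) = ?P z"
        using pt
      proof eventually_elim
        case (elim z)
        then have Uz: "?U z \<in> ball 0 r'" by blast
        have "?P2 (?Tc z) = cnj (deriv k (?U z)) * cnj (?P z)"
          unfolding conjunct2[OF elim] has_wd_frechet[OF germ_has_wd(2)[OF k(1) Uz v]] by simp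
        then show ?case using bspec[OF k(2) Uz] by simp
      qed
    qed
  qed
qed

text \<open>In the charts of Form 1 the germs of the map, of the field and of log \<rho> form an
  instance of \<open>jacobi_germ\<close>. The expansion refers to that one chart at
  \<open>q\<close>; tangency of the pulled back field is recorded so that its component can be moved
  to any other chart.\<close>

lemma field_expansion:
  fixes A :: "('a::t2_space) chart set"
  assumes A: "smooth_atlas A" and \<alpha>: "0 < \<alpha>" "\<alpha> < 1" and \<nu>: "2 * \<alpha> < \<nu>"
    and G: "conic_metric \<alpha> \<nu> \<gamma> A G p" and g: "conic_metric \<alpha> \<nu> \<gamma> A g q" and form: "form1 \<gamma> A g q G p u"
    and u: "u -` {p} = {q}" and tz: "tension_zero_off \<gamma> A g q G p u" and \<epsilon>: "0 < \<epsilon>"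
    and \<psi>: "\<psi> \<in> kernel_L (1 + \<epsilon> - 2 * \<alpha>) \<gamma> A g q G p u"
  shows "\<exists>c1 \<sigma>1 X. conformal_chart \<gamma> A g q c1 \<sigma>1 \<and> centered_at c1 q \<and>
    (\<forall>\<^sub>F z in at 0. pullback_field A u \<psi> (point_of c1 z) \<in> tangent_space A (point_of c1 z)
        \<and> section_rep c1 (pullback_field A u \<psi>) c1 z = X z) \<and>
    (1/2 < \<alpha> \<longrightarrow> (\<exists>\<delta> w k. 0 < \<delta> \<and> 2 * (1 - \<alpha>) + \<delta> \<le> 1 \<and>
        Ob (2 * (1 - \<alpha>) + \<delta>) (\<lambda>z. X z - (w + k * of_real (cmod z powr (2 * (1 - \<alpha>))))))) \<and>
    (\<alpha> < 1/2 \<longrightarrow> (\<exists>\<mu>. Ob (1 + (1 - 2 * \<alpha>) / 2) (\<lambda>z. X z - \<mu> * z)))"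
proof -
  have mG: "metric_off \<gamma> A p G" and mg: "metric_off \<gamma> A q g" using G g by (auto simp: conic_metric_def)
  have cu: "continuous_on UNIV u" using form by (auto simp: form1_def homeomorphism_def)
  obtain c1 \<sigma>1 d1 \<rho>1 s l e1 where c1: "conformal_chart \<gamma> A g q c1 \<sigma>1" "centered_at c1 q"
    and d1: "conformal_chart \<gamma> A G p d1 \<rho>1" "centered_at d1 p"
    and s: "0 < s" "ball 0 s \<subseteq> snd c1 ` (fst c1 \<inter> u -` fst d1)" and l: "l \<noteq> 0" and e1: "0 < e1"
    and v: "weighted_Cb (1 + e1) 2 \<gamma> s (\<lambda>\<zeta>. local_rep c1 u d1 \<zeta> - l * \<zeta>)"
    using form unfolding form1_def by blast
  have \<psi>T: "\<And>x. x \<noteq> q \<Longrightarrow> \<psi> x \<in> tangent_space A (u x)" using \<psi> by (auto simp: kernel_L_def weighted_sections_def)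
  define b where "b = 1 + \<epsilon> - 2 * \<alpha>"
  obtain c2 \<sigma>2 d2 \<rho>2 s2 where c2: "conformal_chart \<gamma> A g q c2 \<sigma>2" "centered_at c2 q"
    and d2: "conformal_chart \<gamma> A G p d2 \<rho>2" "centered_at d2 p" and s2: "0 < s2"
    and w2: "weighted_Cb b 2 \<gamma> s2 (section_rep c2 \<psi> d2)"
    using \<psi> unfolding kernel_L_def weighted_sections_def b_def by blast
  have ic: "is_chart c1" "is_chart d1" using c1 d1 by (auto simp: conformal_chart_def)
  \<comment> \<open>At most the given orders e1 and \<nu>, below 1, and for \<alpha> > 1/2 within
    the limits of \<open>expansion_large\<close>, which read g + \<delta> < 1 and \<delta> \<le>
    g.\<close>
  define \<delta> where "\<delta> = min (min e1 \<nu>) (min (1/2) (if 1/2 < \<alpha> then min ((2 * \<alpha> - 1) / 2) (2 - 2 * \<alpha>) else 1/2))"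
  have \<delta>: "0 < \<delta>" "\<delta> < 1" "\<delta> \<le> e1" "\<delta> \<le> \<nu>" "1/2 < \<alpha> \<Longrightarrow> \<delta> < 2 * \<alpha> - 1 \<and> \<delta> \<le> 2 - 2 * \<alpha>"
    using e1 \<nu> \<alpha> by (auto simp: \<delta>_def min_def)
  let ?U = "local_rep c1 u d1" and ?P = "section_rep c1 \<psi> d1" and ?F = "\<lambda>w. complex_of_real (ln (\<rho>1 w))"
  obtain a B Az M Bz where V: "\<forall>\<^sub>F z in at 0. has_wd (\<lambda>\<zeta>. ?U \<zeta> - l * \<zeta>) (a z) (B z) z"
     "\<forall>\<^sub>F z in at 0. has_wd a (Az z) (M z) z" "\<forall>\<^sub>F z in at 0. has_wd B (M z) (Bz z) z"
     "Ob (1 + e1) (\<lambda>\<zeta>. ?U \<zeta> - l * \<zeta>)" "Ob (1 + e1 - 1) a" "Ob (1 + e1 - 1) B" "Ob (1 + e1 - 2) Az" "Ob (1 + e1 - 2) M" "Ob (1 + e1 - 2) Bz"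
    using weighted_Cb_S3[OF v s(1)] unfolding S3_def by blast
  define AA where "AA = (\<lambda>z. l + a z)"
  have dU: "\<forall>\<^sub>F z in at 0. has_wd ?U (AA z) (B z) z"
    using V(1)
  proof eventually_elim
    case (elim z)
    have "has_wd (\<lambda>\<zeta>. l * \<zeta> + (?U \<zeta> - l * \<zeta>)) (AA z) (B z) z"
      by (rule has_wd_eqI[OF has_wd_add[OF has_wd_mult[OF has_wd_const has_wd_ident] elim]]) (auto simp: AA_def)
    then show ?case by simp
  qed
  have dA: "\<forall>\<^sub>F z in at 0. has_wd AA (Az z) (M z) z"
    using V(2) unfolding AA_def by eventually_elim (rule has_wd_eqI[OF has_wd_add[OF has_wd_const]], auto)
  have bU: "Ob (1 + \<delta>) (\<lambda>z. ?U z - l * z)" using Ob_mono[OF V(4)] \<delta>(3) by auto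
  have bA: "Ob \<delta> (\<lambda>z. AA z - l)" using Ob_mono[OF V(5), of \<delta>] \<delta>(3) by (simp add: AA_def)
  have bB: "Ob \<delta> B" using Ob_mono[OF V(6), of \<delta>] \<delta>(3) by simp
  have bAz: "Ob (\<delta> - 1) Az" using Ob_mono[OF V(7), of "\<delta> - 1"] \<delta>(3) by simp
  have bBz: "Ob (\<delta> - 1) Bz" using Ob_mono[OF V(9), of "\<delta> - 1"] \<delta>(3) by simp
  have "S2 1 (\<lambda>z. ?U z - l * z)" by (rule S2_mono[OF S3_imp_S2[OF weighted_Cb_S3[OF v s(1)]]]) (use e1 in simp)
  moreover have "S2 1 (\<lambda>z. z)" by (rule S2_holo[where r=1]) auto
  ultimately have "S2 1 (\<lambda>z. (?U z - l * z) + l * z)" by (intro S2_add S2_cmult)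
  then have U2: "S2 1 ?U" by simp
  have Ulow: "\<forall>\<^sub>F z in at 0. cmod l / 2 * cmod z \<le> cmod (?U z)"
  proof -
    have "Ob \<delta> (\<lambda>z. (1 / z) * (?U z - l * z))" by (rule Ob_multI[OF Ob_inverse_ident bU]) simp
    from tendstoD[OF Ob_tendsto_0[OF this \<delta>(1)], of "cmod l / 2"] l
    have "\<forall>\<^sub>F z in at 0. cmod ((1 / z) * (?U z - l * z)) < cmod l / 2" by simp
    with eventually_at_0_lt[OF zero_less_one] show ?thesis
    proof eventually_elim
      case (elim z)
      then have "cmod (?U z - l * z) \<le> cmod l / 2 * cmod z" by (simp add: norm_mult norm_divide divide_less_eq)
      moreover have "cmod (l * z) \<le> cmod (?U z) + cmod (?U z - l * z)"
        using norm_triangle_ineq4[of "?U z" "?U z - l * z"] by simp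
      ultimately show ?case by (simp add: norm_mult)
    qed
  qed
  have kl: "0 < cmod l / 2" using l by simp
  have limU: "filterlim ?U (at 0) (at 0)" by (rule S2_filterlim[OF U2 kl Ulow])
  obtain K f fw fb where F: "\<forall>\<^sub>F w in at 0. has_wd ?F (f w) (cnj (f w)) w"
    "\<forall>\<^sub>F w in at 0. has_wd f (fw w) (fb w) w" "\<forall>\<^sub>F w in at 0. cnj (fb w) = fb w"
    "Ob \<delta> (\<lambda>w. ?F w - (of_real ((2 * \<alpha> - 2) * ln (cmod w)) + K))"
    "Ob (\<delta> - 1) (\<lambda>w. f w - of_real (\<alpha> - 1) / w)"
    using log_density_germ[OF A G d1 \<delta>(1) less_imp_le[OF \<delta>(2)] \<delta>(4)] by blast
  have "S2 b ?P"
    by (rule section_germ[OF A mg mG c1 d1 c2 d2 s u \<psi>T w2 s2 U2 kl Ulow])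
  then obtain Pz Pb Pzz N Pbb where P: "\<forall>\<^sub>F z in at 0. has_wd ?P (Pz z) (Pb z) z"
     "\<forall>\<^sub>F z in at 0. has_wd Pz (Pzz z) (N z) z" "\<forall>\<^sub>F z in at 0. has_wd Pb (N z) (Pbb z) z"
     "Ob b ?P" "Ob (b - 1) Pz" "Ob (b - 1) Pb"
    by (rule S2_E)
  note src = ev_source[OF ic(1) c1(2) s u]
  have pos: "\<forall>\<^sub>F z in at 0. \<sigma>1 z \<noteq> 0"
    using src
  proof eventually_elim
    case (elim z)
    then show ?case using conformal_pos[OF A mg c1(1), of "point_of c1 z"] by auto
  qed
  have harm: "\<forall>\<^sub>F z in at 0. M z + f (?U z) * AA z * B z = 0"
    using src pos eventually_at_0_nhds[OF dU] V(3) eventually_compose_at[OF limU F(1)]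
  proof eventually_elim
    case (elim z)
    have "tension \<sigma>1 \<rho>1 ?U (snd c1 (point_of c1 z)) = 0"
      using tz c1(1) d1(1) elim(1) unfolding tension_zero_off_def by blast
    then have "of_real (4 / \<sigma>1 z) * (M z + f (?U z) * AA z * B z) = 0"
      using tension_eval[OF elim(3,4), of \<sigma>1 \<rho>1] elim(1) has_wd_pd_z[OF elim(5)] by simp
    moreover have "complex_of_real (4 / \<sigma>1 z) \<noteq> 0" using elim(2) by simp
    ultimately show ?case unfolding mult_eq_0_iff by blast
  qed
  have jac: "\<forall>\<^sub>F z in at 0. N z + (fw (?U z) * ?P z + fb (?U z) * cnj (?P z)) * AA z * B z
        + f (?U z) * (Pz z * B z + AA z * Pb z) = 0"
    using src pos eventually_at_0_nhds[OF dU] V(3) eventually_at_0_nhds[OF P(1)] P(3)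
      eventually_compose_at[OF limU eventually_at_0_nhds[OF F(1)]] eventually_compose_at[OF limU F(2)]
  proof eventually_elim
    case (elim z)
    have "lin_tension \<sigma>1 \<rho>1 ?U ?P (snd c1 (point_of c1 z)) = 0"
      using \<psi> c1(1) d1(1) elim(1) unfolding kernel_L_def by blast
    then have "of_real (4 / \<sigma>1 z) * (N z + (fw (?U z) * ?P z + fb (?U z) * cnj (?P z)) * AA z * B z
        + f (?U z) * (Pz z * B z + AA z * Pb z)) = 0"
      using lin_tension_eval[OF elim(3-8), of \<sigma>1] elim(1) by simp
    moreover have "complex_of_real (4 / \<sigma>1 z) \<noteq> 0" using elim(2) by simp
    ultimately show ?case unfolding mult_eq_0_iff by blast
  qed
  have Fr: "\<forall>\<^sub>F w in at 0. cnj (?F w) = ?F w" by simp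
  have J: "jacobi_germ ?U AA B Az M Bz ?F f fw fb ?P Pz Pb Pzz N Pbb l K \<alpha> \<delta> b \<epsilon>"
    by (rule jacobi_germ.intro; fact)
  define X where "X = jacobi_germ.X AA B ?P"
  have Xeq: "\<forall>\<^sub>F z in at 0. pullback_field A u \<psi> (point_of c1 z) \<in> tangent_space A (point_of c1 z)
        \<and> section_rep c1 (pullback_field A u \<psi>) c1 z = X z"
    using src dU jacobi_germ.nz(2)[OF J]
  proof eventually_elim
    case (elim z)
    define x where "x = point_of c1 z"
    have x: "x \<in> fst c1" "x \<noteq> q" "snd c1 x = z" "u x \<in> fst d1" "u x \<noteq> p" using elim(1) by (auto simp: x_def)
    have Jz: "AA z * cnj (AA z) - B z * cnj (B z) \<noteq> 0" using elim(3) by (simp add: jacobi_germ.J_def[OF J])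
    have Ux: "has_wd ?U (AA z) (B z) (snd c1 x)" using elim(2) x(3) by simp
    note pb = pullback_component[where \<psi>=\<psi> and x=x and u=u, OF A cu conformal_charts_at[OF c1(1) x(1,2)] conformal_charts_at[OF d1(1) x(4,5)] Ux Jz \<psi>T[OF x(2)]]
    have "X z = (cnj (AA z) * \<psi> x d1 - B z * cnj (\<psi> x d1)) / (AA z * cnj (AA z) - B z * cnj (B z))"
      unfolding X_def jacobi_germ.X_def[OF J] jacobi_germ.J_def[OF J] by (simp add: section_rep_def x_def)
    then show ?case using pb by (simp add: section_rep_def x_def)
  qed
  have gg: "jacobi_germ.g \<alpha> = 2 * (1 - \<alpha>)" by (simp add: jacobi_germ.g_def[OF J])
  have large: "\<exists>\<delta> w k. 0 < \<delta> \<and> 2 * (1 - \<alpha>) + \<delta> \<le> 1 \<and>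
        Ob (2 * (1 - \<alpha>) + \<delta>) (\<lambda>z. X z - (w + k * of_real (cmod z powr (2 * (1 - \<alpha>)))))" if a: "1/2 < \<alpha>"
  proof -
    have "\<exists>w k. Ob (2 * (1 - \<alpha>) + \<delta>) (\<lambda>z. X z - (w + k * of_real (cmod z powr (2 * (1 - \<alpha>)))))"
      using jacobi_germ.expansion_large[OF J a] \<delta>(5)[OF a] unfolding gg X_def by blast
    moreover have "2 * (1 - \<alpha>) + \<delta> \<le> 1" using \<delta>(5)[OF a] by simp
    ultimately show ?thesis using \<delta>(1) by blast
  qed
  have small: "\<exists>\<mu>. Ob (1 + (1 - 2 * \<alpha>) / 2) (\<lambda>z. X z - \<mu> * z)" if a: "\<alpha> < 1/2"
    using jacobi_germ.expansion_small[OF J a] unfolding X_def .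
  show ?thesis
    by (rule exI[of _ c1], rule exI[of _ \<sigma>1], rule exI[of _ X]) (intro conjI impI c1 Xeq large small)
qed

lemma Ob_conjugate: "Ob c f \<Longrightarrow> Ob c (\<lambda>z. f (cnj z))"
proof -
  assume f: "Ob c f"
  have "filterlim cnj (at 0) (at 0)"
    unfolding filterlim_at by (auto simp: eventually_at_filter intro!: tendsto_eq_intros)
  then show ?thesis by (rule Ob_compose[OF f, where k=1 and k'=1]) auto
qed

theorem lemma1p1:
  fixes A :: "('a::t2_space) chart set"
    and p q :: 'a
    and \<alpha> \<nu> \<gamma> :: real
    and g G :: "'a metric_tensor"
    and u :: "'a \<Rightarrow> 'a"
  assumes "closed_surface A" and "orientable A"
    and "0 < \<gamma>" and "\<gamma> < 1"
    and "0 < \<alpha>" and "\<alpha> < 1"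
    and "2 * \<alpha> < \<nu>"
    and "conic_metric \<alpha> \<nu> \<gamma> A G p"
    and "conic_metric \<alpha> \<nu> \<gamma> A g q"
    and "form1 \<gamma> A g q G p u"
    and "u -` {p} = {q}"
    and "tension_zero_off \<gamma> A g q G p u"
  shows "\<exists>\<epsilon>0>0. \<forall>\<epsilon>. 0 < \<epsilon> \<and> \<epsilon> < \<epsilon>0 \<longrightarrow>
    (\<forall>\<psi> \<in> kernel_L (1 + \<epsilon> - 2 * \<alpha>) \<gamma> A g q G p u.
     \<forall>c \<sigma>. conformal_chart \<gamma> A g q c \<sigma> \<and> centered_at c q \<longrightarrow>
       (2 * pi * \<alpha> > pi \<longrightarrow>
          (\<exists>w a :: complex. \<exists>\<delta>>0.
             (\<lambda>z. section_rep c (pullback_field A u \<psi>) c z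
                  - (w + cnj a / of_real (1 - \<alpha>) * of_real (cmod z powr (2 * (1 - \<alpha>)))))
             \<in> O[at 0](\<lambda>z. of_real (cmod z powr (2 * (1 - \<alpha>) + \<delta>))))) \<and>
       (2 * pi * \<alpha> < pi \<longrightarrow>
          (\<exists>\<mu> :: complex. \<exists>\<delta>>0.
             (\<lambda>z. section_rep c (pullback_field A u \<psi>) c z - \<mu> * z)
             \<in> O[at 0](\<lambda>z. of_real (cmod z powr (1 + \<delta>))))))"
proof (rule exI[of _ 1], intro conjI allI impI ballI)
  \<comment> \<open>The threshold 1 is a choice: \<open>field_expansion\<close> holds for every
    positive \<epsilon>.\<close>
  fix \<epsilon> \<psi> c \<sigma>
  assume \<epsilon>: "0 < \<epsilon> \<and> \<epsilon> < 1" and \<psi>: "\<psi> \<in> kernel_L (1 + \<epsilon> - 2 * \<alpha>) \<gamma> A g q G p u"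
    and c: "conformal_chart \<gamma> A g q c \<sigma> \<and> centered_at c q"
  have A: "smooth_atlas A" using assms(1) by (simp add: closed_surface_def)
  have mg: "metric_off \<gamma> A q g" using assms(9) by (simp add: conic_metric_def)
  obtain c1 \<sigma>1 X where c1: "conformal_chart \<gamma> A g q c1 \<sigma>1" "centered_at c1 q"
    and X: "\<forall>\<^sub>F z in at 0. pullback_field A u \<psi> (point_of c1 z) \<in> tangent_space A (point_of c1 z)
        \<and> section_rep c1 (pullback_field A u \<psi>) c1 z = X z"
    and large: "1/2 < \<alpha> \<longrightarrow> (\<exists>\<delta> w k. 0 < \<delta> \<and> 2 * (1 - \<alpha>) + \<delta> \<le> 1 \<and>
        Ob (2 * (1 - \<alpha>) + \<delta>) (\<lambda>z. X z - (w + k * of_real (cmod z powr (2 * (1 - \<alpha>))))))"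
    and small: "\<alpha> < 1/2 \<longrightarrow> (\<exists>\<mu>. Ob (1 + (1 - 2 * \<alpha>) / 2) (\<lambda>z. X z - \<mu> * z))"
    using field_expansion[OF A assms(5-12) conjunct1[OF \<epsilon>] \<psi>] by blast
  have ic: "is_chart c" "is_chart c1" using c c1 by (auto simp: conformal_chart_def)
  obtain r h where r: "0 < r" and h: "h holomorphic_on ball 0 r" "h 0 = 0" "\<forall>z\<in>ball 0 r. deriv h z \<noteq> 0"
    and rs: "ball 0 r \<subseteq> snd c ` (fst c \<inter> fst c1)"
    and Th: "(\<forall>z\<in>ball 0 r. transition c c1 z = h z) \<or> (\<forall>z\<in>ball 0 r. transition c c1 z = cnj (h z))"
    using conformal_germ[OF A mg conjunct1[OF c] conjunct2[OF c] c1] by blast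
  have h0: "deriv h 0 \<noteq> 0" using h(3) r by auto
  have limh: "filterlim h (at 0) (at 0)" by (rule holo_filterlim[OF h(1,2) r h0])
  let ?T = "transition c c1" and ?\<Xi> = "section_rep c (pullback_field A u \<psi>) c"
  have evr: "\<forall>\<^sub>F z in at (0::complex). z \<in> ball 0 r - {0}" using eventually_at_0_lt[OF r] by eventually_elim auto
  have limT: "filterlim ?T (at 0) (at 0)"
    using Th
  proof
    assume t: "\<forall>z\<in>ball 0 r. ?T z = h z"
    have "\<forall>\<^sub>F z in at 0. h z = ?T z" using evr by eventually_elim (simp add: t)
    then show ?thesis using limh filterlim_cong[OF refl refl, of h ?T "at 0"] by blast
  next
    assume t: "\<forall>z\<in>ball 0 r. ?T z = cnj (h z)"
    have "\<forall>\<^sub>F z in at 0. cnj (h z) = ?T z" using evr by eventually_elim (simp add: t)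
    moreover have "filterlim (\<lambda>z. cnj (h z)) (at 0) (at 0)"
      using limh unfolding filterlim_at by (auto intro!: tendsto_eq_intros)
    ultimately show ?thesis using filterlim_cong[OF refl refl, of "\<lambda>z. cnj (h z)" ?T "at 0"] by blast
  qed
  \<comment> \<open>The expansion is known in \<open>c1\<close>, the component is wanted in
    \<open>c\<close>; tangency relates the two by the derivative of the transition.\<close>
  have pt: "\<forall>\<^sub>F z in at 0. z \<in> ball 0 r \<and> X (?T z) = frechet_derivative ?T (at z) (?\<Xi> z)"
    using evr eventually_compose_at[OF limT X]
  proof eventually_elim
    case (elim z)
    have zr: "z \<in> ball 0 r" using elim(1) by blast
    from subsetD[OF rs zr] obtain x where zx: "z = snd c x" and "x \<in> fst c \<inter> fst c1" by (rule imageE)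
    then have x: "x \<in> fst c" "x \<in> fst c1" by auto
    have xq: "x \<noteq> q" using elim(1) zx c by (auto simp: centered_at_def)
    have pz: "point_of c z = x" unfolding zx by (rule chart_D(3)[OF ic(1) x(1)])
    have Tz: "?T z = snd c1 x" unfolding zx by (rule transition_at[OF ic(1) x(1)])
    have pT: "point_of c1 (?T z) = x" unfolding Tz by (rule chart_D(3)[OF ic(2) x(2)])
    have Xx: "pullback_field A u \<psi> x \<in> tangent_space A x" using conjunct1[OF elim(2)] unfolding pT .
    have "X (?T z) = pullback_field A u \<psi> x c1" using conjunct2[OF elim(2)] unfolding section_rep_def pT by (rule sym)
    also have "\<dots> = frechet_derivative ?T (at (snd c x)) (pullback_field A u \<psi> x c)"
      by (rule tangent_space_D(1)[OF Xx conformal_charts_at[OF conjunct1[OF c] x(1) xq] conformal_charts_at[OF c1(1) x(2) xq]])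
    finally have "X (?T z) = frechet_derivative ?T (at z) (?\<Xi> z)"
      unfolding section_rep_def pz zx[symmetric] .
    then show ?case by (rule conjI[OF zr])
  qed
  \<comment> \<open>In the antiholomorphic case \<open>Y\<close> is the component in the coordinate
    conjugate to that of \<open>c1\<close>. In both cases the transition is then the holomorphic
    germ \<open>h\<close>, and the transfer lemmas apply.\<close>
  obtain Y where Y: "Y = X \<or> Y = (\<lambda>z. cnj (X (cnj z)))" and \<Xi>: "\<forall>\<^sub>F z in at 0. Y (h z) / deriv h z = ?\<Xi> z"
    using Th
  proof
    assume t: "\<forall>z\<in>ball 0 r. ?T z = h z"
    have "\<forall>\<^sub>F z in at 0. X (h z) / deriv h z = ?\<Xi> z"
      using pt
    proof eventually_elim
      case (elim z)
      have "X (h z) = deriv h z * ?\<Xi> z"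
        using conjunct2[OF elim] unfolding has_wd_frechet[OF germ_has_wd(1)[OF h(1) conjunct1[OF elim] t]]
          bspec[OF t conjunct1[OF elim]] by simp
      then show ?case using bspec[OF h(3) conjunct1[OF elim]] by simp
    qed
    then show thesis by (rule that[of X, OF disjI1[OF refl]])
  next
    assume t: "\<forall>z\<in>ball 0 r. ?T z = cnj (h z)"
    have "\<forall>\<^sub>F z in at 0. cnj (X (cnj (h z))) / deriv h z = ?\<Xi> z"
      using pt
    proof eventually_elim
      case (elim z)
      have "X (cnj (h z)) = cnj (deriv h z) * cnj (?\<Xi> z)"
        using conjunct2[OF elim] unfolding has_wd_frechet[OF germ_has_wd(2)[OF h(1) conjunct1[OF elim] t]]
          bspec[OF t conjunct1[OF elim]] by simp
      then show ?case using bspec[OF h(3) conjunct1[OF elim]] by simp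
    qed
    then show thesis by (rule that[of "\<lambda>z. cnj (X (cnj z))", OF disjI2[OF refl]])
  qed
  show "\<exists>w a :: complex. \<exists>\<delta>>0. (\<lambda>z. ?\<Xi> z - (w + cnj a / of_real (1 - \<alpha>) * of_real (cmod z powr (2 * (1 - \<alpha>)))))
             \<in> O[at 0](\<lambda>z. of_real (cmod z powr (2 * (1 - \<alpha>) + \<delta>)))" if "2 * pi * \<alpha> > pi"
  proof -
    have a: "1/2 < \<alpha>" using that by simp
    let ?g = "2 * (1 - \<alpha>)"
    obtain \<delta> w k where \<delta>: "0 < \<delta>" "?g + \<delta> \<le> 1" and wk: "Ob (?g + \<delta>) (\<lambda>z. X z - (w + k * of_real (cmod z powr ?g)))"
      using large a by blast
    have "\<exists>w k. Ob (?g + \<delta>) (\<lambda>z. Y z - (w + k * of_real (cmod z powr ?g)))"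
      using Y
    proof
      assume "Y = X"
      then show ?thesis using wk by blast
    next
      assume y: "Y = (\<lambda>z. cnj (X (cnj z)))"
      have "Ob (?g + \<delta>) (\<lambda>z. Y z - (cnj w + cnj k * of_real (cmod z powr ?g)))"
        using Ob_cnj[OF Ob_conjugate[OF wk]] by (simp add: y)
      then show ?thesis by blast
    qed
    then obtain w1 k1 where "Ob (?g + \<delta>) (\<lambda>z. Y z - (w1 + k1 * of_real (cmod z powr ?g)))" by blast
    from transfer_large[OF this _ \<delta> h(1,2) r h0] assms(6)
    obtain w2 k2 where "Ob (?g + \<delta>) (\<lambda>z. Y (h z) / deriv h z - (w2 + k2 * of_real (cmod z powr ?g)))" by auto
    then have "Ob (?g + \<delta>) (\<lambda>z. ?\<Xi> z - (w2 + k2 * of_real (cmod z powr ?g)))"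
      by (rule Ob_cong) (use \<Xi> in eventually_elim, simp)
    \<comment> \<open>The witness for \<open>a\<close> is fitted to the coefficient k2 that was
      found: a = cnj (k2 (1 - \<alpha>)).\<close>
    moreover have "k2 = cnj (cnj (k2 * of_real (1 - \<alpha>))) / of_real (1 - \<alpha>)" using assms(6) by simp
    ultimately have "(\<lambda>z. ?\<Xi> z - (w2 + cnj (cnj (k2 * of_real (1 - \<alpha>))) / of_real (1 - \<alpha>) * of_real (cmod z powr ?g)))
             \<in> O[at 0](\<lambda>z. of_real (cmod z powr (?g + \<delta>)))" unfolding Ob_def by (simp only:)
    then show ?thesis using \<delta>(1) by blast
  qed
  show "\<exists>\<mu> :: complex. \<exists>\<delta>>0. (\<lambda>z. ?\<Xi> z - \<mu> * z) \<in> O[at 0](\<lambda>z. of_real (cmod z powr (1 + \<delta>)))" if "2 * pi * \<alpha> < pi"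
  proof -
    have a: "\<alpha> < 1/2" using that by simp
    let ?d = "(1 - 2 * \<alpha>) / 2"
    have d: "0 < ?d" "?d \<le> 1" using a assms(5) by auto
    obtain \<mu> where \<mu>: "Ob (1 + ?d) (\<lambda>z. X z - \<mu> * z)" using small a by blast
    have "\<exists>\<mu>. Ob (1 + ?d) (\<lambda>z. Y z - \<mu> * z)"
      using Y
    proof
      assume "Y = X"
      then show ?thesis using \<mu> by blast
    next
      assume y: "Y = (\<lambda>z. cnj (X (cnj z)))"
      have "Ob (1 + ?d) (\<lambda>z. Y z - cnj \<mu> * z)"
        using Ob_cnj[OF Ob_conjugate[OF \<mu>]] by (simp add: y)
      then show ?thesis by blast
    qed
    then obtain \<mu>1 where "Ob (1 + ?d) (\<lambda>z. Y z - \<mu>1 * z)" by blast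
    from transfer_small[OF this d h(1,2) r h0]
    have "Ob (1 + ?d) (\<lambda>z. ?\<Xi> z - \<mu>1 * z)"
      by (rule Ob_cong) (use \<Xi> in eventually_elim, simp)
    then show ?thesis unfolding Ob_def using d(1) by blast
  qed
qed simp

end
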